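(* For every integer $g>0$ there exists a constant $C_g>0$, depending only on $g$, such that for every integer $n>2g$ and every $\varepsilon\in(0,1)$, the mixing time of the fixed genus chord swap chain on $\mathcal{X}_{n,g}$ satisfies $$t_{\mathrm{mix}}(\varepsilon)\ \le\ C_g\, n^{1488g-615}\left(\log n+\log\frac1\varepsilon\right).$$
   Context: Chord diagrams. Let $P$ be a regular polygon with $2n$ vertices, labelled clockwise $1,\dots,2n$ (indices modulo $2n$), and hence $2n$ sides $\{x,x+1\}$. A chord is an unordered pair of distinct sides. A chord diagram $X$ is a set of $n$ chords forming a perfect matching of the $2n$ sides of $P$. Genus. The genus of a chord diagram is the genus of the closed orientable surface obtained by gluing the sides of $P$ in pairs according to the chords, compatibly with orientation (a chord $\{\{x,x+1\},\{y,y+1\}\}$ identifies vertex $x$ with $y+1$ and vertex $y$ with $x+1$). Equivalently, if $V$ is the number of classes of vertices of $P$ after these identifications, the genus is $g=(n+1-V)/2$. $\mathcal{X}_{n,g}$ is the set of all chord diagrams with $n$ chords and genus $g$. Chord swap. $Y$ is a chord swap of $X$ if there are two distinct chords $\{A,B\},\{C,D\}\in X$ such that $Y=(X\setminus\{\{A,B\},\{C,D\}\})\cup\{\{A,C\},\{B,D\}\}$ or $Y=(X\setminus\{\{A,B\},\{C,D\}\})\cup\{\{A,D\},\{B,C\}\}$. The chain. The fixed genus chord swap chain on $\mathcal{X}_{n,g}$ is the Markov chain with transition kernel $P(X,Y)=\frac{1}{4\binom n2}$ if $Y$ is a chord swap of $X$ (with $X,Y\in\mathcal{X}_{n,g}$),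 $P(X,Y)=0$ for other $Y\ne X$, and $P(X,X)=1-\sum_{Z\in\mathcal{X}_{n,g}\setminus\{X\}}P(X,Z)$. Its stationary distribution $\pi$ is uniform on $\mathcal{X}_{n,g}$. Mixing time. $t_{\mathrm{mix}}(\varepsilon)$ is the smallest integer $t\ge 0$ such that $\max_{X}\|P^t(X,\cdot)-\pi\|_{TV}\le\varepsilon$, where $\|\cdot\|_{TV}$ is total variation distance. *)

theory Defs
  imports Complex_Main "HOL-Library.Extended_Real"
begin

section \<open>Chord diagrams and their genus\<close>

definition vertices :: "nat \<Rightarrow> nat set" where
  "vertices n = {1..2 * n}"

text \<open>The successor in clockwise order; the vertex after \<open>2 * n\<close> is \<open>1\<close>.\<close>

definition next_vertex :: "nat \<Rightarrow> nat \<Rightarrow> nat" where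
  "next_vertex n x = x mod (2 * n) + 1"

text \<open>The side \<open>{x, x + 1}\<close> of the polygon is represented by its first endpoint \<open>x\<close> in
  clockwise order, so that sides, like vertices, are the numbers \<open>1, \<dots>, 2 * n\<close>.\<close>

definition sides :: "nat \<Rightarrow> nat set" where
  "sides n = {1..2 * n}"

definition chords :: "nat \<Rightarrow> nat set set" where
  "chords n = {c. c \<subseteq> sides n \<and> card c = 2}"

definition chord_diagrams :: "nat \<Rightarrow> nat set set set" where
  "chord_diagrams n = {X. X \<subseteq> chords n \<and> card X = n \<and> (\<forall>s\<in>sides n. \<exists>!c. c \<in> X \<and> s \<in> c)}"

text \<open>A chord \<open>{x, y}\<close> identifies \<open>x\<close> with \<open>y + 1\<close> and \<open>y\<close> with \<open>x + 1\<close>; the second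
  identification is covered by exchanging \<open>x\<close> and \<open>y\<close>.\<close>

definition identified :: "nat \<Rightarrow> nat set set \<Rightarrow> (nat \<times> nat) set" where
  "identified n X = {(x, next_vertex n y) | x y. {x, y} \<in> X \<and> x \<noteq> y}"

definition vertex_classes :: "nat \<Rightarrow> nat set set \<Rightarrow> nat set set" where
  "vertex_classes n X = vertices n // (identified n X \<union> (identified n X)\<inverse>)\<^sup>*"

text \<open>The glued surface has a cell structure with \<open>card (vertex_classes n X)\<close> vertices, \<open>n\<close> edges
  and one face, so its Euler characteristic \<open>2 - 2 * genus\<close> is
  \<open>card (vertex_classes n X) - n + 1\<close>.\<close>

definition genus :: "nat \<Rightarrow> nat set set \<Rightarrow> real" where
  "genus n X = (real n + 1 - real (card (vertex_classes n X))) / 2"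

definition genus_diagrams :: "nat \<Rightarrow> nat \<Rightarrow> nat set set set" where
  "genus_diagrams n g = {X \<in> chord_diagrams n. genus n X = real g}"


section \<open>The fixed genus chord swap chain\<close>

definition chord_swap :: "nat set set \<Rightarrow> nat set set \<Rightarrow> bool" where
  "chord_swap X Y \<longleftrightarrow>
     (\<exists>A B C D. {A, B} \<in> X \<and> {C, D} \<in> X \<and> {A, B} \<noteq> {C, D} \<and>
        (Y = (X - {{A, B}, {C, D}}) \<union> {{A, C}, {B, D}} \<or>
         Y = (X - {{A, B}, {C, D}}) \<union> {{A, D}, {B, C}}))"

definition swap_prob :: "nat \<Rightarrow> nat set set \<Rightarrow> nat set set \<Rightarrow> real" where
  "swap_prob n X Y = (if chord_swap X Y then 1 / (4 * real (n choose 2)) else 0)"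

text \<open>The kernel is meaningful for arguments in \<^term>\<open>genus_diagrams n g\<close>.\<close>

definition swap_kernel :: "nat \<Rightarrow> nat \<Rightarrow> nat set set \<Rightarrow> nat set set \<Rightarrow> real" where
  "swap_kernel n g X Y =
     (if X = Y then 1 - (\<Sum>Z\<in>genus_diagrams n g - {X}. swap_prob n X Z) else swap_prob n X Y)"


section \<open>Mixing time of a chain on a finite state space\<close>

text \<open>In this section \<open>S\<close> is the finite state space and \<open>P\<close> a transition kernel on it.\<close>

fun kernel_power :: "'a set \<Rightarrow> ('a \<Rightarrow> 'a \<Rightarrow> real) \<Rightarrow> nat \<Rightarrow> 'a \<Rightarrow> 'a \<Rightarrow> real" where
  "kernel_power S P 0 x y = (if x = y then 1 else 0)"
| "kernel_power S P (Suc t) x y = (\<Sum>z\<in>S. kernel_power S P t x z * P z y)"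

definition tv_dist :: "'a set \<Rightarrow> ('a \<Rightarrow> real) \<Rightarrow> ('a \<Rightarrow> real) \<Rightarrow> real" where
  "tv_dist S \<mu> \<nu> = Max ((\<lambda>A. \<bar>sum \<mu> A - sum \<nu> A\<bar>) ` Pow S)"

text \<open>The value is \<open>\<infinity>\<close> if no \<open>t\<close> has the required property.\<close>

definition mixing_time ::
    "'a set \<Rightarrow> ('a \<Rightarrow> 'a \<Rightarrow> real) \<Rightarrow> ('a \<Rightarrow> real) \<Rightarrow> real \<Rightarrow> enat" where
  "mixing_time S P \<pi> \<epsilon> =
     (INF t\<in>{t. Max ((\<lambda>x. tv_dist S (kernel_power S P t x) \<pi>) ` S) \<le> \<epsilon>}. enat t)"

definition uniform :: "'a set \<Rightarrow> 'a \<Rightarrow> real" where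
  "uniform S x = (if x \<in> S then 1 / real (card S) else 0)"

definition swap_mixing_time :: "nat \<Rightarrow> nat \<Rightarrow> real \<Rightarrow> enat" where
  "swap_mixing_time n g =
     mixing_time (genus_diagrams n g) (swap_kernel n g) (uniform (genus_diagrams n g))"

end

theory Submission
  imports Defs "HOL-Combinatorics.Orbits" "HOL-Analysis.Convex"
begin

text \<open>Describe a chord diagram by the involution \<open>\<alpha>\<close> that exchanges the two sides of each chord. Its
  vertices are the cycles of \<open>\<alpha>\<close> followed by the rotation of the polygon, and a chord swap
  multiplies this permutation by two transpositions. So a swap preserves the genus when one of these
  merges two cycles and the other splits one.

  The spectral gap is estimated by induction on the genus. For positive genus there is a simple
  cycle of chords; exchanging the chords pairwise from its middle outwards folds the cycle together,
  and after a few such foldings the diagram has a leaf (a chord joining two consecutive sides) and a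
  loop (a chord with both ends at one vertex). One exchange makes them into a handle, two crossing
  chords, which is moved to the first four sides. Diagrams with a handle there are the diagrams with
  two chords less and genus smaller by one. The congestion of these routes is polynomial: a folding
  can be undone if one knows two simple paths in its result, and a simple path is determined, up to
  its ends, by a set of chords with prescribed boundary modulo 2, for which there are at most
  \<open>2 ^ (2 * g)\<close> possibilities.

  In genus zero the diagrams are the noncrossing ones, that is, balanced ballot sequences. There
  path coupling for adjacent transpositions, with the strictly concave weight \<open>b * (2 * n - b)\<close>, gives
  a polynomial gap. The gap and the laziness of the chain bound the \<open>L\<^sup>2\<close> distance to uniformity.\<close>

section \<open>Permutations multiplied by transpositions\<close>

text \<open>Whether an exchange is legal depends on which sides lie at a common vertex, a global
  datum. Folding a cycle supplies legal exchanges at every stage: the outer ends of the two arcs lie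
  at different vertices and get merged, the inner ends already share a vertex and get separated.
  These exchanges depend on the diagram itself, so a route cannot be reversed from its end alone.
  The missing data are paths in the current diagram: with n chords and n + 1 - 2g vertices, the
  fibres of the boundary map modulo 2 have size at most 2 ^ (2g), a constant for fixed genus. The
  inequalities speak of squared differences over all pairs of states, without means, so that they
  pass to subsets and along maps. Route bounds are powers of n * 4 ^ (g + 1). The stages leading to
  a handle stay below exponent 74 and the comparison squares their bound, so each unit of genus
  costs n ^ 148 up to constants. With n ^ 4 in genus zero, n ^ 2 from the transition probability and
  n from the number of diagrams (together with log n), this gives n ^ (148 g + 7).\<close>

context
  fixes p :: "'a \<Rightarrow> 'a" and S :: "'a set"
  assumes p: "p permutes S" and S: "finite S"
begin

lemma orbit_refl: "x \<in> orbit p x"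
  using p S by (intro permutation_self_in_orbit) (auto simp: permutation_permutes)

lemma orbit_sym: "y \<in> orbit p x \<Longrightarrow> x \<in> orbit p y"
  by (rule orbit_swap[OF orbit_refl])

lemma orbit_eq_iff: "orbit p x = orbit p y \<longleftrightarrow> x \<in> orbit p y"
proof
  assume "orbit p x = orbit p y"
  then show "x \<in> orbit p y" using orbit_refl[of x] by simp
next
  assume "x \<in> orbit p y"
  then show "orbit p x = orbit p y"
    by (blast intro: orbit_trans orbit_sym)
qed

end

text \<open>A change of \<open>p\<close> away from the arc from \<open>a\<close> to \<open>b\<close>
  is invisible until \<open>b\<close> is reached: \<open>q\<close> enters the arc at
  \<open>c\<close> instead of \<open>a\<close> and then repeats the steps of \<open>p\<close>. This
  is how membership in a changed cycle is proved later without describing the whole cycle.\<close>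

lemma orbit_arc:
  assumes b: "b \<in> orbit p a" and c: "q c = p a"
    and q: "\<And>x. x \<in> orbit p a \<Longrightarrow> x \<noteq> a \<Longrightarrow> x \<noteq> b \<Longrightarrow> q x = p x"
  shows "b \<in> orbit q c"
proof -
  define k where "k = funpow_dist1 p a b"
  have k: "(p ^^ k) a = b" "k > 0"
    using funpow_dist1_prop[OF b] by (simp_all add: k_def)
  have nb: "(p ^^ j) a \<noteq> b" if "0 < j" "j < k" for j
    using funpow_dist1_least[of j p a b] that by (simp add: k_def)
  \<comment> \<open>An earlier return to \<open>a\<close> would shorten the way to
    \<open>b\<close>.\<close>
  have na: "(p ^^ j) a \<noteq> a" if "0 < j" "j < k" for j
  proof
    assume "(p ^^ j) a = a"
    then have "(p ^^ (k - j)) a = b"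
      using k that by (metis funpow_add comp_apply le_add_diff_inverse2 less_imp_le)
    then show False using nb[of "k - j"] that by simp
  qed
  have "(q ^^ j) c = (p ^^ j) a" if "0 < j" "j \<le> k" for j
    using that
  proof (induction j)
    case (Suc j)
    show ?case
    proof (cases "j = 0")
      case False
      have "(p ^^ j) a \<in> orbit p a"
        using False by (auto simp: orbit_altdef)
      then have "q ((p ^^ j) a) = p ((p ^^ j) a)"
        using na[of j] nb[of j] False Suc.prems by (intro q) auto
      with Suc False show ?thesis by simp
    qed (simp add: c)
  qed simp
  from this[of k] k show ?thesis
    by (auto simp: orbit_altdef)
qed

definition cycles :: "('a \<Rightarrow> 'a) \<Rightarrow> 'a set \<Rightarrow> 'a set set" where
  "cycles p S = orbit p ` S"

context
  fixes p :: "'a \<Rightarrow> 'a" and S :: "'a set" and a b :: 'a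
  assumes p: "p permutes S" and S: "finite S" and a: "a \<in> S" and b: "b \<in> S"
begin

lemma exchange_permutes: "p \<circ> transpose a b permutes S"
  using p a b by (intro permutes_compose) (auto intro: permutes_swap_id)

text \<open>Composing with \<open>transpose a b\<close> on the right makes \<open>a\<close> continue
  as \<open>b\<close> did and conversely. Two disjoint cycles are thus cut open at \<open>a\<close>
  and \<open>b\<close> and joined crosswise into one.\<close>

lemma exchange_merge_orbit:
  assumes ab: "a \<notin> orbit p b"
  shows "orbit (p \<circ> transpose a b) a = orbit p a \<union> orbit p b"
    and "orbit (p \<circ> transpose a b) b = orbit p a \<union> orbit p b"
    and "x \<notin> orbit p a \<union> orbit p b \<Longrightarrow> orbit (p \<circ> transpose a b) x = orbit p x"
proof -
  define q where "q = p \<circ> transpose a b"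
  note qp = exchange_permutes[folded q_def]
  note rp = orbit_refl[OF p S] and rq = orbit_refl[OF qp S]
  have ba: "b \<notin> orbit p a"
    using ab orbit_sym[OF p S] by blast
  have q: "q x = p x" if "x \<noteq> a" "x \<noteq> b" for x
    using that by (simp add: q_def)
  have 1: "orbit p a \<subseteq> orbit q b"
    by (rule subsetI, rule orbit_arc[where p = p and a = a]) (use ba in \<open>auto simp: q_def transpose_def\<close>)
  have 2: "orbit p b \<subseteq> orbit q a"
    by (rule subsetI, rule orbit_arc[where p = p and a = b]) (use ab in \<open>auto simp: q_def transpose_def\<close>)
  have 3: "orbit q a = orbit q b"
    using 2 rp[of b] orbit_eq_iff[OF qp S] by blast
  have 4: "orbit q a \<subseteq> orbit p a \<union> orbit p b"
  proof
    fix x assume "x \<in> orbit q a"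
    then show "x \<in> orbit p a \<union> orbit p b"
    proof induction
      case base
      show ?case by (simp add: q_def orbit.base)
    next
      case (step x)
      show ?case
      proof (cases "x = a \<or> x = b")
        case True
        then show ?thesis by (auto simp: q_def orbit.base)
      next
        case False
        then show ?thesis using step q by (auto intro: orbit.step)
      qed
    qed
  qed
  show "orbit (p \<circ> transpose a b) a = orbit p a \<union> orbit p b"
      "orbit (p \<circ> transpose a b) b = orbit p a \<union> orbit p b"
    using 1 2 3 4 by (auto simp: q_def)
  assume x: "x \<notin> orbit p a \<union> orbit p b"
  have "orbit q x = orbit p x"
  proof (rule orbit_cong0[OF rp, symmetric])
    show "p \<in> orbit p x \<rightarrow> orbit p x" by (auto intro: orbit.step)
    fix y assume y: "y \<in> orbit p x"
    have "y \<noteq> a" "y \<noteq> b"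
      using x y orbit_sym[OF p S] by blast+
    then show "p y = q y" by (simp add: q)
  qed
  then show "orbit (p \<circ> transpose a b) x = orbit p x" by (simp add: q_def)
qed

lemma exchange_merge:
  assumes ab: "a \<notin> orbit p b"
  shows "y \<in> orbit (p \<circ> transpose a b) x \<longleftrightarrow>
      y \<in> orbit p x \<or> x \<in> orbit p a \<union> orbit p b \<and> y \<in> orbit p a \<union> orbit p b"
    and "card (cycles p S) = Suc (card (cycles (p \<circ> transpose a b) S))"
proof -
  define q where "q = p \<circ> transpose a b"
  note qp = exchange_permutes[folded q_def]
  note m = exchange_merge_orbit[OF ab, folded q_def]
  note ep = orbit_eq_iff[OF p S] and eq = orbit_eq_iff[OF qp S]
  have on: "orbit q x = orbit p a \<union> orbit p b" if "x \<in> orbit p a \<union> orbit p b" for x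
    using that m(1) eq by (metis)
  have "y \<in> orbit q x \<longleftrightarrow>
      y \<in> orbit p x \<or> x \<in> orbit p a \<union> orbit p b \<and> y \<in> orbit p a \<union> orbit p b"
  proof (cases "x \<in> orbit p a \<union> orbit p b")
    case True
    then have "y \<in> orbit p a \<union> orbit p b" if "y \<in> orbit p x"
      using that by (auto intro: orbit_trans)
    with True on[OF True] show ?thesis by blast
  next
    case False
    with m(3)[OF this] show ?thesis by simp
  qed
  then show "y \<in> orbit (p \<circ> transpose a b) x \<longleftrightarrow>
      y \<in> orbit p x \<or> x \<in> orbit p a \<union> orbit p b \<and> y \<in> orbit p a \<union> orbit p b"
    by (simp add: q_def)
  let ?u = "orbit p a \<union> orbit p b"
  let ?R = "cycles p S - {orbit p a, orbit p b}"
  have fin: "finite (cycles p S)" using S by (simp add: cycles_def)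
  have "cycles q S = insert ?u ?R"
  proof (intro equalityI subsetI)
    fix C assume "C \<in> cycles q S"
    then obtain x where x: "x \<in> S" "C = orbit q x" by (auto simp: cycles_def)
    show "C \<in> insert ?u ?R"
    proof (cases "x \<in> ?u")
      case False
      then show ?thesis using x m(3)[of x] ep[of x] by (auto simp: cycles_def)
    qed (use on x in auto)
  next
    fix C assume C: "C \<in> insert ?u ?R"
    show "C \<in> cycles q S"
    proof (cases "C = ?u")
      case True
      then show ?thesis using m(1) a by (auto simp: cycles_def)
    next
      case False
      then obtain x where x: "x \<in> S" "C = orbit p x" "orbit p x \<noteq> orbit p a" "orbit p x \<noteq> orbit p b"
        using C by (auto simp: cycles_def)
      then have "orbit q x = orbit p x" using m(3)[of x] ep by auto
      then show ?thesis using x by (auto simp: cycles_def)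
    qed
  qed
  moreover have "?u \<notin> ?R"
  proof
    assume "?u \<in> ?R"
    then obtain x where "?u = orbit p x" "orbit p x \<noteq> orbit p a" by (auto simp: cycles_def)
    then show False using ep orbit_refl[OF p S] by (metis Un_iff)
  qed
  moreover have "orbit p a \<noteq> orbit p b" using ab ep by blast
  moreover have "card ?R + 2 = card (cycles p S)"
  proof -
    have "{orbit p a, orbit p b} \<subseteq> cycles p S" using a b by (auto simp: cycles_def)
    moreover have "card {orbit p a, orbit p b} = 2" using \<open>orbit p a \<noteq> orbit p b\<close> by simp
    ultimately show ?thesis
      using fin by (metis card_Diff_subset card_mono finite.emptyI finite.insertI le_add_diff_inverse2)
  qed
  ultimately have "card (cycles q S) = Suc (card ?R)" "card ?R + 2 = card (cycles p S)"
    using fin by auto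
  then show "card (cycles p S) = Suc (card (cycles (p \<circ> transpose a b) S))"
    by (simp add: q_def)
qed

text \<open>The part of the cycle after \<open>a\<close> up to \<open>b\<close> is closed under the
  new permutation, since \<open>b\<close> now jumps back to the successor of \<open>a\<close>; this
  part does not contain \<open>a\<close>.\<close>

lemma exchange_split:
  assumes ab: "a \<in> orbit p b" and "a \<noteq> b"
  shows "a \<notin> orbit (p \<circ> transpose a b) b"
proof -
  define q where "q = p \<circ> transpose a b"
  define k where "k = funpow_dist1 p a b"
  have b': "b \<in> orbit p a" by (rule orbit_sym[OF p S ab])
  have k: "(p ^^ k) a = b" "k > 0"
    using funpow_dist1_prop[OF b'] by (simp_all add: k_def)
  have nb: "(p ^^ j) a \<noteq> b" if "0 < j" "j < k" for j
    using funpow_dist1_least[of j p a b] that by (simp add: k_def)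
  have na: "(p ^^ j) a \<noteq> a" if "0 < j" "j \<le> k" for j
  proof
    assume *: "(p ^^ j) a = a"
    then have "j < k" using k that \<open>a \<noteq> b\<close> by (cases "j = k") auto
    then have "(p ^^ (k - j)) a = b"
      using k * by (metis funpow_add comp_apply le_add_diff_inverse2 less_imp_le)
    then show False using nb[of "k - j"] that \<open>j < k\<close> by simp
  qed
  have "x \<in> {(p ^^ j) a | j. 0 < j \<and> j \<le> k}" if "x \<in> orbit q b" for x
    using that
  proof induction
    case base
    show ?case using k by (auto simp: q_def intro!: exI[of _ 1])
  next
    case (step x)
    then obtain j where j: "x = (p ^^ j) a" "0 < j" "j \<le> k" by auto
    show ?case
    proof (cases "j = k")
      case True
      then show ?thesis using j k by (auto simp: q_def intro!: exI[of _ 1])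
    next
      case False
      then have "q x = (p ^^ (Suc j)) a" using na[of j] nb[of j] j by (simp add: q_def)
      then show ?thesis using j False by (intro CollectI exI[of _ "Suc j"]) auto
    qed
  qed
  note in_arc = this
  show ?thesis
  proof
    assume "a \<in> orbit (p \<circ> transpose a b) b"
    then have "a \<in> orbit q b" by (simp add: q_def)
    from in_arc[OF this] obtain j where "0 < j" "j \<le> k" "(p ^^ j) a = a" by auto
    with na show False by blast
  qed
qed

end

context
  fixes p :: "'a \<Rightarrow> 'a" and S :: "'a set" and a b :: 'a
  assumes p: "p permutes S" and S: "finite S" and a: "a \<in> S" and b: "b \<in> S"
    and ab: "a \<in> orbit p b" "a \<noteq> b"
begin

text \<open>Splitting is merging read backwards: the same transposition, applied to the new
  permutation in which \<open>a\<close> and \<open>b\<close> are separated, gives \<open>p\<close>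
  back.\<close>

lemma exchange_split_orbit:
  "y \<in> orbit p x \<longleftrightarrow> y \<in> orbit (p \<circ> transpose a b) x \<or>
    x \<in> orbit (p \<circ> transpose a b) a \<union> orbit (p \<circ> transpose a b) b \<and>
    y \<in> orbit (p \<circ> transpose a b) a \<union> orbit (p \<circ> transpose a b) b"
  and exchange_split_card: "card (cycles (p \<circ> transpose a b) S) = Suc (card (cycles p S))"
proof -
  note * = exchange_merge[OF exchange_permutes[OF p S a b] S a b exchange_split[OF p S a b ab]]
  have "p \<circ> transpose a b \<circ> transpose a b = p"
    by (simp add: comp_assoc)
  then show "y \<in> orbit p x \<longleftrightarrow> y \<in> orbit (p \<circ> transpose a b) x \<or>
    x \<in> orbit (p \<circ> transpose a b) a \<union> orbit (p \<circ> transpose a b) b \<and>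
    y \<in> orbit (p \<circ> transpose a b) a \<union> orbit (p \<circ> transpose a b) b"
    "card (cycles (p \<circ> transpose a b) S) = Suc (card (cycles p S))"
    using *(1)[of y x] *(2) by simp_all
qed

end

section \<open>Two exchanges that together keep the number of cycles\<close>

context
  fixes p :: "'a \<Rightarrow> 'a" and S :: "'a set" and a b c d :: 'a
  assumes p: "p permutes S" and S: "finite S"
    and in_S: "a \<in> S" "b \<in> S" "c \<in> S" "d \<in> S" and ne: "a \<noteq> c" "b \<noteq> d"
begin

text \<open>One exchange merges and the other splits: \<open>b\<close> and \<open>d\<close> share a
  cycle before the first exchange if and only if \<open>a\<close> and \<open>c\<close> do not share
  one before the second.\<close>

lemma double_exchange_card:
  assumes "b \<in> orbit p d \<longleftrightarrow> a \<notin> orbit (p \<circ> transpose b d) c"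
  shows "card (cycles (p \<circ> transpose b d \<circ> transpose a c) S) = card (cycles p S)"
proof (cases "b \<in> orbit p d")
  case True
  then show ?thesis
    using exchange_split_card[OF p S in_S(2,4) True ne(2)] assms
      exchange_merge(2)[OF exchange_permutes[OF p S in_S(2,4)] S in_S(1,3)] by simp
next
  case False
  then show ?thesis
    using exchange_merge(2)[OF p S in_S(2,4) False] assms
      exchange_split_card[OF exchange_permutes[OF p S in_S(2,4)] S in_S(1,3) _ ne(1)] by simp
qed

text \<open>The first exchange merges. For the second to split, \<open>a\<close> and
  \<open>c\<close> must be together by then: they were together already, or the merged cycle is the
  union of their two cycles.\<close>

lemma double_exchange_fold:
  assumes "b \<notin> orbit p d" and "a \<in> orbit p c \<or> a \<in> orbit p b \<and> c \<in> orbit p d \<or> a \<in> orbit p d \<and> c \<in> orbit p b"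
  shows "card (cycles (p \<circ> transpose b d \<circ> transpose a c) S) = card (cycles p S)"
  using assms exchange_merge(1)[OF p S in_S(2,4)] by (intro double_exchange_card) auto

text \<open>Here two arcs in the intermediate permutation \<open>q\<close> replace knowledge of the
  cycles of \<open>p\<close>. They tie \<open>a\<close> and \<open>c\<close> to \<open>b\<close> and
  \<open>d\<close>, so \<open>a\<close> and \<open>c\<close> are together in \<open>q\<close> if and
  only if \<open>b\<close> and \<open>d\<close> are, and the first exchange has reversed that
  relation.\<close>

lemma double_exchange_cross:
  fixes q assumes q: "q = p \<circ> transpose b d"
    and *: "a \<in> orbit q b \<and> c \<in> orbit q d \<or> a \<in> orbit q d \<and> c \<in> orbit q b"
  shows "card (cycles (p \<circ> transpose b d \<circ> transpose a c) S) = card (cycles p S)"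
proof (rule double_exchange_card)
  have qp: "q permutes S" unfolding q by (rule exchange_permutes[OF p S in_S(2,4)])
  have "a \<in> orbit q c \<longleftrightarrow> b \<in> orbit q d"
    using * orbit_eq_iff[OF qp S] by metis
  also have "\<dots> \<longleftrightarrow> b \<notin> orbit p d"
    using exchange_split[OF p S in_S(2,4)] exchange_merge_orbit[OF p S in_S(2,4)]
      orbit_refl[OF p S] ne by (auto simp: q)
  finally show "b \<in> orbit p d \<longleftrightarrow> a \<notin> orbit (p \<circ> transpose b d) c"
    by (auto simp: q)
qed

end

section \<open>Diagrams as involutions\<close>

text \<open>As a permutation of all numbers a pairing fixes everything that is not a side.\<close>

definition pairings :: "nat \<Rightarrow> (nat \<Rightarrow> nat) set" where
  "pairings n = {\<alpha>. \<alpha> permutes {1..2 * n} \<and> (\<forall>x. \<alpha> (\<alpha> x) = x) \<and> (\<forall>x\<in>{1..2 * n}. \<alpha> x \<noteq> x)}"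

definition cyc :: "nat \<Rightarrow> nat \<Rightarrow> nat" where
  "cyc n x = (if x \<in> {1..2 * n} then next_vertex n x else x)"

text \<open>Gluing identifies the first endpoint of side \<open>x\<close> with the second endpoint
  of its partner, so the vertex classes are the cycles of this permutation, and a vertex is
  represented by the sides that start at it.\<close>

definition vertex :: "nat \<Rightarrow> (nat \<Rightarrow> nat) \<Rightarrow> nat \<Rightarrow> nat set" where
  "vertex n \<alpha> = orbit (cyc n \<circ> \<alpha>)"

definition states :: "nat \<Rightarrow> nat \<Rightarrow> (nat \<Rightarrow> nat) set" where
  "states n g = {\<alpha> \<in> pairings n. card (cycles (cyc n \<circ> \<alpha>) {1..2 * n}) + 2 * g = n + 1}"

text \<open>Conjugation: the sides \<open>b\<close> and \<open>d\<close> exchange their partners.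
  Applying it twice with the same sides restores the pairing, hence a prescribed sequence of
  exchanges is reversible.\<close>

definition sw :: "(nat \<Rightarrow> nat) \<Rightarrow> nat \<Rightarrow> nat \<Rightarrow> nat \<Rightarrow> nat" where
  "sw \<alpha> b d = transpose b d \<circ> \<alpha> \<circ> transpose b d"

definition adj :: "nat \<Rightarrow> (nat \<Rightarrow> nat) \<Rightarrow> (nat \<Rightarrow> nat) \<Rightarrow> bool" where
  "adj n \<alpha> \<beta> \<longleftrightarrow> (\<exists>b\<in>{1..2 * n}. \<exists>d\<in>{1..2 * n}. b \<noteq> d \<and> d \<noteq> \<alpha> b \<and> \<beta> = sw \<alpha> b d)"

lemma cyc_less: "1 \<le> x \<Longrightarrow> x < 2 * n \<Longrightarrow> cyc n x = Suc x"
  by (simp add: cyc_def next_vertex_def)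

lemma cyc_last: "1 \<le> n \<Longrightarrow> cyc n (2 * n) = 1"
  by (simp add: cyc_def next_vertex_def)

lemma cyc_in: "x \<in> {1..2 * n} \<Longrightarrow> cyc n x \<in> {1..2 * n}"
  by (cases "x = 2 * n") (auto simp: cyc_less cyc_last)

lemma cyc_permutes: "cyc n permutes {1..2 * n}"
proof (rule bij_imp_permutes)
  have "y \<in> cyc n ` {1..2 * n}" if "y \<in> {1..2 * n}" for y
  proof (cases "y = 1")
    case True
    then show ?thesis using that cyc_last[of n] by (intro image_eqI[of _ _ "2 * n"]) auto
  next
    case False
    then show ?thesis using that cyc_less[of "y - 1" n] by (intro image_eqI[of _ _ "y - 1"]) auto
  qed
  then have "cyc n ` {1..2 * n} = {1..2 * n}" using cyc_in by blast
  then show "bij_betw (cyc n) {1..2 * n} {1..2 * n}"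
    using eq_card_imp_inj_on[of "{1..2 * n}" "cyc n"] by (auto simp: bij_betw_def)
  show "cyc n x = x" if "x \<notin> {1..2 * n}" for x
    using that by (auto simp: cyc_def)
qed

lemma finite_pairings: "finite (pairings n)"
  by (rule finite_subset[OF _ finite_permutations[of "{1..2 * n}"]]) (auto simp: pairings_def)

lemma finite_states: "finite (states n g)"
  by (rule finite_subset[OF _ finite_pairings]) (auto simp: states_def)

lemma states_pairings: "\<alpha> \<in> states n g \<Longrightarrow> \<alpha> \<in> pairings n"
  by (simp add: states_def)

lemma sw_sw: "sw (sw \<alpha> b d) b d = \<alpha>"
  by (simp add: sw_def fun_eq_iff)

context
  fixes n :: nat and \<alpha> :: "nat \<Rightarrow> nat"
  assumes \<alpha>: "\<alpha> \<in> pairings n"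
begin

lemma pairing_permutes: "\<alpha> permutes {1..2 * n}"
  and pairing_involution: "\<alpha> (\<alpha> x) = x"
  and pairing_neq: "x \<in> {1..2 * n} \<Longrightarrow> \<alpha> x \<noteq> x"
  using \<alpha> by (auto simp: pairings_def)

lemma pairing_eq_iff: "\<alpha> x = \<alpha> y \<longleftrightarrow> x = y"
  using pairing_involution by metis

lemma pairing_swap_eq: "\<alpha> x = y \<longleftrightarrow> x = \<alpha> y"
  using pairing_involution by metis

lemma pairing_in: "\<alpha> x \<in> {1..2 * n} \<longleftrightarrow> x \<in> {1..2 * n}"
  by (rule permutes_in_image[OF pairing_permutes])

lemma glue_permutes: "cyc n \<circ> \<alpha> permutes {1..2 * n}"
  by (rule permutes_compose[OF pairing_permutes cyc_permutes])

lemma vertex_refl: "x \<in> vertex n \<alpha> x"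
  unfolding vertex_def by (rule orbit_refl[OF glue_permutes]) simp

lemma vertex_eq_iff: "vertex n \<alpha> x = vertex n \<alpha> y \<longleftrightarrow> x \<in> vertex n \<alpha> y"
  unfolding vertex_def by (rule orbit_eq_iff[OF glue_permutes]) simp

lemma vertex_glue: "vertex n \<alpha> (cyc n (\<alpha> x)) = vertex n \<alpha> x"
  using orbit.base[of "cyc n \<circ> \<alpha>" x] by (simp add: vertex_eq_iff) (simp add: vertex_def)

text \<open>The far end of a side is glued to the near end of its partner; so
  \<open>vertex n \<alpha> (\<alpha> x)\<close> may be read as the head of the arc
  \<open>x\<close>.\<close>

lemma vertex_cyc: "vertex n \<alpha> (cyc n x) = vertex n \<alpha> (\<alpha> x)"
  using vertex_glue[of "\<alpha> x"] by (simp add: pairing_involution)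

lemma vertex_subset: "x \<in> {1..2 * n} \<Longrightarrow> vertex n \<alpha> x \<subseteq> {1..2 * n}"
  unfolding vertex_def by (rule permutes_orbit_subset[OF glue_permutes])

text \<open>The standard way to show that two vertices differ: exhibit a function that the gluing
  preserves.\<close>

lemma vertex_invariant:
  assumes "\<And>z. z \<in> {1..2 * n} \<Longrightarrow> h (cyc n (\<alpha> z)) = h z"
    and "vertex n \<alpha> x = vertex n \<alpha> y" "y \<in> {1..2 * n}"
  shows "h x = h y"
proof -
  have "x \<in> orbit (cyc n \<circ> \<alpha>) y" using assms(2) vertex_eq_iff by (simp add: vertex_def)
  then show ?thesis
  proof induction
    case (step z)
    then have "z \<in> {1..2 * n}" using vertex_subset[OF assms(3)] by (auto simp: vertex_def)
    with step assms(1) show ?case by simp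
  qed (use assms in auto)
qed

lemma vertex_fixed:
  assumes "cyc n (\<alpha> x) = x"
  shows "vertex n \<alpha> y = vertex n \<alpha> x \<longleftrightarrow> y = x"
proof -
  have "vertex n \<alpha> x = {x}" using assms by (simp add: vertex_def orbit_eq_singleton_iff)
  then show ?thesis unfolding vertex_eq_iff by simp
qed

context
  fixes b d
  assumes bd: "b \<in> {1..2 * n}" "d \<in> {1..2 * n}" "b \<noteq> d" "d \<noteq> \<alpha> b"
begin

lemma sw_distinct: "\<alpha> b \<noteq> \<alpha> d" "\<alpha> b \<noteq> b" "\<alpha> d \<noteq> d" "\<alpha> d \<noteq> b" "\<alpha> b \<noteq> d"
  using bd by (auto simp: pairing_eq_iff pairing_neq pairing_involution)

lemma sw_apply:
  "sw \<alpha> b d x = (if x = b then \<alpha> d else if x = d then \<alpha> b else if x = \<alpha> b then d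
     else if x = \<alpha> d then b else \<alpha> x)"
  using sw_distinct bd(3) pairing_swap_eq[of x b] pairing_swap_eq[of x d]
  by (simp add: sw_def transpose_def pairing_involution split: if_splits)

lemma sw_pairings: "sw \<alpha> b d \<in> pairings n"
proof -
  have "sw \<alpha> b d permutes {1..2 * n}"
    unfolding sw_def using bd
    by (intro permutes_compose pairing_permutes) (auto intro: permutes_swap_id)
  moreover have "sw \<alpha> b d (sw \<alpha> b d x) = x" for x
    by (simp add: sw_def pairing_involution)
  moreover have "sw \<alpha> b d x \<noteq> x" if "x \<in> {1..2 * n}" for x
    using that sw_distinct bd pairing_neq by (auto simp: sw_apply)
  ultimately show ?thesis by (auto simp: pairings_def)
qed

text \<open>Since \<open>\<alpha>\<close> carries the transposition of \<open>b\<close> and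
  \<open>d\<close> to that of their partners, conjugating the involution becomes right
  multiplication by two disjoint transpositions. This brings swaps under the lemmas on double
  exchanges.\<close>

lemma glue_sw: "cyc n \<circ> sw \<alpha> b d = cyc n \<circ> \<alpha> \<circ> transpose b d \<circ> transpose (\<alpha> b) (\<alpha> d)"
  using sw_distinct bd(3)
  by (simp add: fun_eq_iff sw_apply transpose_def pairing_involution)

lemma sw_fold_card:
  assumes "vertex n \<alpha> b \<noteq> vertex n \<alpha> d"
    and "vertex n \<alpha> (\<alpha> b) = vertex n \<alpha> (\<alpha> d) \<or>
      vertex n \<alpha> (\<alpha> b) = vertex n \<alpha> b \<and> vertex n \<alpha> (\<alpha> d) = vertex n \<alpha> d \<or>
      vertex n \<alpha> (\<alpha> b) = vertex n \<alpha> d \<and> vertex n \<alpha> (\<alpha> d) = vertex n \<alpha> b"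
  shows "card (cycles (cyc n \<circ> sw \<alpha> b d) {1..2 * n}) = card (cycles (cyc n \<circ> \<alpha>) {1..2 * n})"
proof -
  have "\<alpha> b \<in> {1..2 * n}" "\<alpha> d \<in> {1..2 * n}" using bd(1,2) unfolding pairing_in .
  note * = double_exchange_fold[OF glue_permutes _ this(1) bd(1) this(2) bd(2) sw_distinct(1) bd(3)]
  from assms show ?thesis
    unfolding glue_sw vertex_eq_iff unfolding vertex_def by (intro *) auto
qed

lemma sw_cross_card:
  fixes q assumes "q = cyc n \<circ> \<alpha> \<circ> transpose b d"
    and "\<alpha> b \<in> orbit q b \<and> \<alpha> d \<in> orbit q d \<or> \<alpha> b \<in> orbit q d \<and> \<alpha> d \<in> orbit q b"
  shows "card (cycles (cyc n \<circ> sw \<alpha> b d) {1..2 * n}) = card (cycles (cyc n \<circ> \<alpha>) {1..2 * n})"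
proof -
  have "\<alpha> b \<in> {1..2 * n}" "\<alpha> d \<in> {1..2 * n}" using bd(1,2) unfolding pairing_in .
  from double_exchange_cross[OF glue_permutes _ this(1) bd(1) this(2) bd(2) sw_distinct(1) bd(3) assms]
  show ?thesis unfolding glue_sw by simp
qed

end

end

lemma sw_fold_states:
  assumes "\<alpha> \<in> states n g" "b \<in> {1..2 * n}" "d \<in> {1..2 * n}" "d \<noteq> \<alpha> b"
    and "vertex n \<alpha> b \<noteq> vertex n \<alpha> d"
    and "vertex n \<alpha> (\<alpha> b) = vertex n \<alpha> (\<alpha> d) \<or>
      vertex n \<alpha> (\<alpha> b) = vertex n \<alpha> b \<and> vertex n \<alpha> (\<alpha> d) = vertex n \<alpha> d \<or>
      vertex n \<alpha> (\<alpha> b) = vertex n \<alpha> d \<and> vertex n \<alpha> (\<alpha> d) = vertex n \<alpha> b"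
  shows "sw \<alpha> b d \<in> states n g" and "adj n \<alpha> (sw \<alpha> b d)"
proof -
  have p: "\<alpha> \<in> pairings n" and ne: "b \<noteq> d" using assms by (auto simp: states_def)
  show "sw \<alpha> b d \<in> states n g"
    using sw_pairings[OF p assms(2,3) ne assms(4)] sw_fold_card[OF p assms(2,3) ne assms(4-6)] assms(1)
    by (simp add: states_def)
  show "adj n \<alpha> (sw \<alpha> b d)" unfolding adj_def using assms(2-4) ne by blast
qed

lemma sw_cross_states:
  fixes q assumes "\<alpha> \<in> states n g" "b \<in> {1..2 * n}" "d \<in> {1..2 * n}" "b \<noteq> d" "d \<noteq> \<alpha> b"
    and "q = cyc n \<circ> \<alpha> \<circ> transpose b d"
    and "\<alpha> b \<in> orbit q b \<and> \<alpha> d \<in> orbit q d \<or> \<alpha> b \<in> orbit q d \<and> \<alpha> d \<in> orbit q b"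
  shows "sw \<alpha> b d \<in> states n g" and "adj n \<alpha> (sw \<alpha> b d)"
proof -
  have p: "\<alpha> \<in> pairings n" using assms by (auto simp: states_def)
  show "sw \<alpha> b d \<in> states n g"
    using sw_pairings[OF p assms(2-5)] sw_cross_card[OF p assms(2-7)] assms(1)
    by (simp add: states_def)
  show "adj n \<alpha> (sw \<alpha> b d)" unfolding adj_def using assms(2-5) by blast
qed

section \<open>Routing\<close>

text \<open>The Dirichlet form with weight one on ordered pairs; the transition probability enters
  only when the kernel is treated.\<close>

definition energy :: "nat \<Rightarrow> nat \<Rightarrow> ((nat \<Rightarrow> nat) \<Rightarrow> real) \<Rightarrow> real" where
  "energy n g f = (\<Sum>(\<alpha>, \<beta>)\<in>{(\<alpha>, \<beta>). \<alpha> \<in> states n g \<and> \<beta> \<in> states n g \<and> adj n \<alpha> \<beta>}. (f \<alpha> - f \<beta>)\<^sup>2)"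

text \<open>The left-hand side is the variance under the uniform distribution times twice the
  squared number of states. In this form no mean has to be carried along when passing to a subset of
  states.\<close>

definition poincare :: "nat \<Rightarrow> nat \<Rightarrow> real \<Rightarrow> bool" where
  "poincare n g B \<longleftrightarrow> (\<forall>f. (\<Sum>\<alpha>\<in>states n g. \<Sum>\<beta>\<in>states n g. (f \<alpha> - f \<beta>)\<^sup>2)
     \<le> B * real (card (states n g)) * energy n g f)"

text \<open>Comparison along routes from \<open>A\<close> into \<open>A'\<close>; \<open>B\<close> bounds both the congestion of the routes and the
  number of routes with a common end.\<close>

definition flows :: "nat \<Rightarrow> nat \<Rightarrow> (nat \<Rightarrow> nat) set \<Rightarrow> (nat \<Rightarrow> nat) set \<Rightarrow> real \<Rightarrow> bool" where
  "flows n g A A' B \<longleftrightarrow> A \<subseteq> states n g \<and> A' \<subseteq> states n g \<and> (\<exists>\<phi>. \<phi> ` A \<subseteq> A' \<and>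
     (\<forall>f. (\<Sum>\<alpha>\<in>A. (f \<alpha> - f (\<phi> \<alpha>))\<^sup>2) \<le> B * energy n g f) \<and>
     (\<forall>\<beta>. real (card {\<alpha> \<in> A. \<phi> \<alpha> = \<beta>}) \<le> B))"

lemma finite_adj_pairs: "finite {(\<alpha>, \<beta>). \<alpha> \<in> states n g \<and> \<beta> \<in> states n g \<and> adj n \<alpha> \<beta>}"
  by (rule finite_subset[of _ "states n g \<times> states n g"]) (auto simp: finite_states)

lemma energy_nonneg: "0 \<le> energy n g f"
  unfolding energy_def by (intro sum_nonneg) auto

lemma sum_le_by_fibres:
  fixes h :: "'a \<Rightarrow> real"
  assumes "finite A" "finite C" "\<psi> ` A \<subseteq> C" "\<And>c. c \<in> C \<Longrightarrow> 0 \<le> h c"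
    and "\<And>c. c \<in> C \<Longrightarrow> real (card {a \<in> A. \<psi> a = c}) \<le> K"
  shows "(\<Sum>a\<in>A. h (\<psi> a)) \<le> K * (\<Sum>c\<in>C. h c)"
proof -
  have "(\<Sum>a\<in>A. h (\<psi> a)) = (\<Sum>c\<in>C. \<Sum>a\<in>{a \<in> A. \<psi> a = c}. h (\<psi> a))"
    using sum.group[OF assms(1,2,3), of "\<lambda>a. h (\<psi> a)"] by simp
  also have "\<dots> = (\<Sum>c\<in>C. real (card {a \<in> A. \<psi> a = c}) * h c)"
    by (intro sum.cong) auto
  also have "\<dots> \<le> (\<Sum>c\<in>C. K * h c)"
    using assms by (intro sum_mono mult_right_mono) auto
  finally show ?thesis by (simp add: sum_distrib_left)
qed

lemma sum_squared_le_card: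
  fixes f :: "'a \<Rightarrow> real"
  shows "(\<Sum>i\<in>I. f i)\<^sup>2 \<le> real (card I) * (\<Sum>i\<in>I. (f i)\<^sup>2)"
  using Cauchy_Schwarz_ineq_sum[of "\<lambda>_. 1" f I] by simp

text \<open>The difference along a route is a telescoping sum of \<open>l\<close> terms, for which
  Cauchy-Schwarz costs a factor \<open>l\<close>; at each of the \<open>l\<close> times an edge is
  used by at most \<open>K\<close> starting points. The summand 1 lets the bound cover the number of
  routes with a common end, also for \<open>l = 0\<close>. Steps may stay in place, so routes of
  different lengths share one time scale.\<close>

lemma flows_path:
  fixes st :: "nat \<Rightarrow> (nat \<Rightarrow> nat) \<Rightarrow> nat \<Rightarrow> nat"
  assumes A: "A \<subseteq> states n g" and A': "A' \<subseteq> states n g" "st l ` A \<subseteq> A'"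
    and st0: "\<And>\<alpha>. \<alpha> \<in> A \<Longrightarrow> st 0 \<alpha> = \<alpha>"
    and st: "\<And>\<alpha> i. \<alpha> \<in> A \<Longrightarrow> i < l \<Longrightarrow> st (Suc i) \<alpha> \<in> states n g"
    and step: "\<And>\<alpha> i. \<alpha> \<in> A \<Longrightarrow> i < l \<Longrightarrow> st (Suc i) \<alpha> = st i \<alpha> \<or> adj n (st i \<alpha>) (st (Suc i) \<alpha>)"
    and K: "\<And>i \<beta>. i \<le> l \<Longrightarrow> \<beta> \<in> states n g \<Longrightarrow> real (card {\<alpha> \<in> A. st i \<alpha> = \<beta>}) \<le> K"
    and K0: "0 \<le> K"
  shows "flows n g A A' ((real l ^ 2 + 1) * K)"
proof -
  let ?E = "{(\<alpha>, \<beta>). \<alpha> \<in> states n g \<and> \<beta> \<in> states n g \<and> adj n \<alpha> \<beta>}"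
  have finA: "finite A" using A finite_states by (rule finite_subset)
  have sts: "st i \<alpha> \<in> states n g" if "\<alpha> \<in> A" "i \<le> l" for i \<alpha>
    using that st0 st A by (cases i) auto
  have part: "(\<Sum>\<alpha>\<in>A. (f (st i \<alpha>) - f (st (Suc i) \<alpha>))\<^sup>2) \<le> K * energy n g f" if i: "i < l" for i f
  proof -
    \<comment> \<open>Idle steps contribute nothing and need not be edges, so they are removed
      before counting.\<close>
    let ?A = "{\<alpha> \<in> A. st (Suc i) \<alpha> \<noteq> st i \<alpha>}"
    have "(\<Sum>\<alpha>\<in>A. (f (st i \<alpha>) - f (st (Suc i) \<alpha>))\<^sup>2) = (\<Sum>\<alpha>\<in>?A. (f (st i \<alpha>) - f (st (Suc i) \<alpha>))\<^sup>2)"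
      using finA by (intro sum.mono_neutral_right) auto
    also have "\<dots> = (\<Sum>\<alpha>\<in>?A. (\<lambda>(\<alpha>, \<beta>). (f \<alpha> - f \<beta>)\<^sup>2) (st i \<alpha>, st (Suc i) \<alpha>))"
      by simp
    also have "\<dots> \<le> K * (\<Sum>e\<in>?E. (\<lambda>(\<alpha>, \<beta>). (f \<alpha> - f \<beta>)\<^sup>2) e)"
    proof (rule sum_le_by_fibres)
      show "(\<lambda>\<alpha>. (st i \<alpha>, st (Suc i) \<alpha>)) ` ?A \<subseteq> ?E"
      proof (rule image_subsetI)
        fix \<alpha> assume "\<alpha> \<in> ?A"
        then show "(st i \<alpha>, st (Suc i) \<alpha>) \<in> ?E"
          using step[of \<alpha> i] sts[of \<alpha> i] sts[of \<alpha> "Suc i"] i by auto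
      qed
      fix c assume c: "c \<in> ?E"
      have "card {\<alpha> \<in> ?A. (st i \<alpha>, st (Suc i) \<alpha>) = c} \<le> card {\<alpha> \<in> A. st i \<alpha> = fst c}"
        using finA by (intro card_mono) auto
      also have "real \<dots> \<le> K" using K[of i "fst c"] i c by auto
      finally show "real (card {\<alpha> \<in> ?A. (st i \<alpha>, st (Suc i) \<alpha>) = c}) \<le> K" by simp
    qed (use finA finite_adj_pairs in auto)
    finally show ?thesis by (simp add: energy_def)
  qed
  have "(\<Sum>\<alpha>\<in>A. (f \<alpha> - f (st l \<alpha>))\<^sup>2) \<le> real l ^ 2 * K * energy n g f" for f
  proof -
    have "(\<Sum>\<alpha>\<in>A. (f \<alpha> - f (st l \<alpha>))\<^sup>2) = (\<Sum>\<alpha>\<in>A. (\<Sum>i<l. f (st i \<alpha>) - f (st (Suc i) \<alpha>))\<^sup>2)"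
    proof (intro sum.cong refl)
      fix \<alpha> assume "\<alpha> \<in> A"
      then show "(f \<alpha> - f (st l \<alpha>))\<^sup>2 = (\<Sum>i<l. f (st i \<alpha>) - f (st (Suc i) \<alpha>))\<^sup>2"
        using sum_lessThan_telescope'[of "\<lambda>i. f (st i \<alpha>)" l] st0 by simp
    qed
    also have "\<dots> \<le> (\<Sum>\<alpha>\<in>A. real l * (\<Sum>i<l. (f (st i \<alpha>) - f (st (Suc i) \<alpha>))\<^sup>2))"
      using sum_squared_le_card[of _ "{..<l}"] by (intro sum_mono) auto
    also have "\<dots> = real l * (\<Sum>i<l. \<Sum>\<alpha>\<in>A. (f (st i \<alpha>) - f (st (Suc i) \<alpha>))\<^sup>2)"
      unfolding sum_distrib_left[symmetric] by (subst sum.swap) simp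
    also have "\<dots> \<le> real l * (\<Sum>i<l. K * energy n g f)"
      using part by (intro mult_left_mono sum_mono) auto
    finally show ?thesis by (simp add: power2_eq_square algebra_simps)
  qed
  moreover have "real l ^ 2 * K * energy n g f \<le> (real l ^ 2 + 1) * K * energy n g f" for f
    using K0 energy_nonneg by (intro mult_right_mono) auto
  moreover have "real (card {\<alpha> \<in> A. st l \<alpha> = \<beta>}) \<le> (real l ^ 2 + 1) * K" for \<beta>
  proof (cases "\<beta> \<in> states n g")
    case True
    have "1 * K \<le> (real l ^ 2 + 1) * K" using K0 by (intro mult_right_mono) auto
    with K[of l \<beta>] True show ?thesis by simp
  next
    case False
    then have "{\<alpha> \<in> A. st l \<alpha> = \<beta>} = {}" using sts by auto
    then show ?thesis using K0 by (simp only: card.empty) auto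
  qed
  ultimately show ?thesis
    unfolding flows_def using A A' by (intro conjI exI[of _ "st l"]) (auto intro: order_trans)
qed

text \<open>The second leg is traversed once for each first leg that ends at its start, at most
  \<open>B\<close> times; this is why \<open>flows\<close> also bounds the fibres. The factor 4
  comes from \<open>2 * B + 2 * B * B'\<close>, after squaring a sum of two terms.\<close>

lemma flows_trans:
  assumes "flows n g A A' B" "flows n g A' A'' B'" "1 \<le> B" "1 \<le> B'"
  shows "flows n g A A'' (4 * B * B')"
proof -
  from assms(1) obtain \<phi> where A: "A \<subseteq> states n g" and \<phi>: "\<phi> ` A \<subseteq> A'"
    and 1: "\<And>f. (\<Sum>\<alpha>\<in>A. (f \<alpha> - f (\<phi> \<alpha>))\<^sup>2) \<le> B * energy n g f"
    and 2: "\<And>\<beta>. real (card {\<alpha> \<in> A. \<phi> \<alpha> = \<beta>}) \<le> B"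
    unfolding flows_def by blast
  from assms(2) obtain \<psi> where A': "A' \<subseteq> states n g" "A'' \<subseteq> states n g" and \<psi>: "\<psi> ` A' \<subseteq> A''"
    and 3: "\<And>f. (\<Sum>\<alpha>\<in>A'. (f \<alpha> - f (\<psi> \<alpha>))\<^sup>2) \<le> B' * energy n g f"
    and 4: "\<And>\<beta>. real (card {\<alpha> \<in> A'. \<psi> \<alpha> = \<beta>}) \<le> B'"
    unfolding flows_def by blast
  have fin: "finite A" "finite A'"
    using finite_subset[OF A finite_states] finite_subset[OF A'(1) finite_states] .
  have "(\<Sum>\<alpha>\<in>A. (f \<alpha> - f (\<psi> (\<phi> \<alpha>)))\<^sup>2) \<le> 4 * B * B' * energy n g f" for f
  proof -
    have "(\<Sum>\<alpha>\<in>A. (f \<alpha> - f (\<psi> (\<phi> \<alpha>)))\<^sup>2)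
        \<le> (\<Sum>\<alpha>\<in>A. 2 * (f \<alpha> - f (\<phi> \<alpha>))\<^sup>2 + 2 * (f (\<phi> \<alpha>) - f (\<psi> (\<phi> \<alpha>)))\<^sup>2)"
    proof (rule sum_mono)
      fix \<alpha>
      have "0 \<le> ((f \<alpha> - f (\<phi> \<alpha>)) - (f (\<phi> \<alpha>) - f (\<psi> (\<phi> \<alpha>))))\<^sup>2" by simp
      then show "(f \<alpha> - f (\<psi> (\<phi> \<alpha>)))\<^sup>2 \<le> 2 * (f \<alpha> - f (\<phi> \<alpha>))\<^sup>2 + 2 * (f (\<phi> \<alpha>) - f (\<psi> (\<phi> \<alpha>)))\<^sup>2"
        by (simp add: power2_eq_square algebra_simps)
    qed
    also have "\<dots> = 2 * (\<Sum>\<alpha>\<in>A. (f \<alpha> - f (\<phi> \<alpha>))\<^sup>2) + 2 * (\<Sum>\<alpha>\<in>A. (f (\<phi> \<alpha>) - f (\<psi> (\<phi> \<alpha>)))\<^sup>2)"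
      by (simp add: sum.distrib sum_distrib_left)
    also have "(\<Sum>\<alpha>\<in>A. (f (\<phi> \<alpha>) - f (\<psi> (\<phi> \<alpha>)))\<^sup>2) \<le> B * (\<Sum>\<beta>\<in>A'. (f \<beta> - f (\<psi> \<beta>))\<^sup>2)"
      using fin \<phi> 2 by (intro sum_le_by_fibres[where h = "\<lambda>\<beta>. (f \<beta> - f (\<psi> \<beta>))\<^sup>2"]) auto
    also have "\<dots> \<le> B * (B' * energy n g f)"
      using 3 assms by (intro mult_left_mono) auto
    also have "(\<Sum>\<alpha>\<in>A. (f \<alpha> - f (\<phi> \<alpha>))\<^sup>2) \<le> B * energy n g f" by (rule 1)
    also have "B * energy n g f \<le> B * B' * energy n g f"
      using assms energy_nonneg by (intro mult_right_mono) auto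
    finally show ?thesis by simp
  qed
  moreover have "real (card {\<alpha> \<in> A. \<psi> (\<phi> \<alpha>) = \<gamma>}) \<le> 4 * B * B'" for \<gamma>
  proof -
    let ?C = "{\<beta> \<in> A'. \<psi> \<beta> = \<gamma>}"
    have "real (card {\<alpha> \<in> A. \<psi> (\<phi> \<alpha>) = \<gamma>}) = (\<Sum>\<alpha>\<in>{\<alpha> \<in> A. \<psi> (\<phi> \<alpha>) = \<gamma>}. (\<lambda>_. 1) (\<phi> \<alpha>))" by simp
    also have "\<dots> \<le> B * (\<Sum>\<beta>\<in>?C. 1)"
    proof (rule sum_le_by_fibres)
      fix c
      have "card {a \<in> {\<alpha> \<in> A. \<psi> (\<phi> \<alpha>) = \<gamma>}. \<phi> a = c} \<le> card {\<alpha> \<in> A. \<phi> \<alpha> = c}"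
        using fin by (intro card_mono) auto
      with 2[of c] show "real (card {a \<in> {\<alpha> \<in> A. \<psi> (\<phi> \<alpha>) = \<gamma>}. \<phi> a = c}) \<le> B" by linarith
    qed (use fin \<phi> in auto)
    also have "\<dots> \<le> B * B'" using 4[of \<gamma>] assms by (intro mult_left_mono) auto
    also have "\<dots> \<le> 4 * B * B'" using assms by simp
    finally show ?thesis .
  qed
  ultimately show ?thesis
    unfolding flows_def using A A' \<phi> \<psi> by (intro conjI exI[of _ "\<psi> \<circ> \<phi>"]) (auto simp: image_subset_iff)
qed

lemma flows_mono:
  assumes "flows n g A A' B" "B \<le> B'" "A' \<subseteq> A''" "A'' \<subseteq> states n g" "A0 \<subseteq> A"
  shows "flows n g A0 A'' B'"
proof -
  from assms(1) obtain \<phi> where A: "A \<subseteq> states n g" and \<phi>: "\<phi> ` A \<subseteq> A'"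
    and 1: "\<And>f. (\<Sum>\<alpha>\<in>A. (f \<alpha> - f (\<phi> \<alpha>))\<^sup>2) \<le> B * energy n g f"
    and 2: "\<And>\<beta>. real (card {\<alpha> \<in> A. \<phi> \<alpha> = \<beta>}) \<le> B"
    unfolding flows_def by blast
  have fin: "finite A" using A finite_states by (rule finite_subset)
  have "(\<Sum>\<alpha>\<in>A0. (f \<alpha> - f (\<phi> \<alpha>))\<^sup>2) \<le> B' * energy n g f" for f
  proof -
    have "(\<Sum>\<alpha>\<in>A0. (f \<alpha> - f (\<phi> \<alpha>))\<^sup>2) \<le> (\<Sum>\<alpha>\<in>A. (f \<alpha> - f (\<phi> \<alpha>))\<^sup>2)"
      using fin assms by (intro sum_mono2) auto
    also have "\<dots> \<le> B * energy n g f" by (rule 1)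
    also have "\<dots> \<le> B' * energy n g f" using assms energy_nonneg by (intro mult_right_mono) auto
    finally show ?thesis .
  qed
  moreover have "real (card {\<alpha> \<in> A0. \<phi> \<alpha> = \<beta>}) \<le> B'" for \<beta>
  proof -
    have "card {\<alpha> \<in> A0. \<phi> \<alpha> = \<beta>} \<le> card {\<alpha> \<in> A. \<phi> \<alpha> = \<beta>}"
      using fin assms by (intro card_mono) auto
    with 2[of \<beta>] assms(2) show ?thesis by linarith
  qed
  ultimately show ?thesis
    unfolding flows_def using A \<phi> assms by (intro conjI exI[of _ \<phi>]) (auto simp: image_subset_iff subset_iff)
qed

text \<open>Steps that depend only on a parameter \<open>t\<close> and on the time are undone by the same
  exchanges, so each of the finitely many parameters contributes an injective route.\<close>

lemma flows_drift:
  fixes R :: "'t \<Rightarrow> nat \<Rightarrow> (nat \<Rightarrow> nat) set" and b d :: "'t \<Rightarrow> nat \<Rightarrow> nat"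
  assumes T: "finite T" and len: "\<And>t. t \<in> T \<Longrightarrow> len t \<le> l"
    and R: "\<And>t i. t \<in> T \<Longrightarrow> i \<le> len t \<Longrightarrow> R t i \<subseteq> states n g"
    and step: "\<And>t i \<alpha>. t \<in> T \<Longrightarrow> i < len t \<Longrightarrow> \<alpha> \<in> R t i \<Longrightarrow>
      sw \<alpha> (b t i) (d t i) \<in> R t (Suc i) \<and> adj n \<alpha> (sw \<alpha> (b t i) (d t i))"
    and A: "A \<subseteq> (\<Union>t\<in>T. R t 0)" and A': "(\<Union>t\<in>T. R t (len t)) \<subseteq> A'" "A' \<subseteq> states n g"
  shows "flows n g A A' ((real l ^ 2 + 1) * real (card T))"
proof -
  define run where "run t = rec_nat (\<lambda>\<alpha>. \<alpha>)
    (\<lambda>i r \<alpha>. if i < len t then sw (r \<alpha>) (b t i) (d t i) else r \<alpha>)" for t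
  have run0: "run t 0 \<alpha> = \<alpha>" for t \<alpha> by (simp add: run_def)
  have runS: "run t (Suc i) \<alpha> = (if i < len t then sw (run t i \<alpha>) (b t i) (d t i) else run t i \<alpha>)" for t i \<alpha>
    by (simp add: run_def)
  have run_inj: "\<alpha> = \<alpha>'" if "run t i \<alpha> = run t i \<alpha>'" for t i \<alpha> \<alpha>'
    using that
  proof (induction i)
    case (Suc i)
    have "run t i \<alpha> = run t i \<alpha>'"
    proof (cases "i < len t")
      case True
      with Suc.prems have "sw (sw (run t i \<alpha>) (b t i) (d t i)) (b t i) (d t i)
          = sw (sw (run t i \<alpha>') (b t i) (d t i)) (b t i) (d t i)"
        by (simp add: runS)
      then show ?thesis by (simp only: sw_sw)
    qed (use Suc.prems in \<open>simp add: runS\<close>)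
    with Suc.IH show ?case .
  qed (simp add: run0)
  have run_R: "run t i \<alpha> \<in> R t (min i (len t))" if "\<alpha> \<in> R t 0" "t \<in> T" for t i \<alpha>
    using that
  proof (induction i)
    case (Suc i)
    then show ?case using step[of t i "run t i \<alpha>"]
      by (cases "i < len t") (auto simp: runS min_def split: if_splits)
  qed (simp add: run0)
  have "\<forall>\<alpha>\<in>A. \<exists>t. t \<in> T \<and> \<alpha> \<in> R t 0" using A by auto
  then obtain t where t: "\<And>\<alpha>. \<alpha> \<in> A \<Longrightarrow> t \<alpha> \<in> T \<and> \<alpha> \<in> R (t \<alpha>) 0" by metis
  show ?thesis
  proof (rule flows_path[where st = "\<lambda>i \<alpha>. run (t \<alpha>) i \<alpha>"])
    show "A \<subseteq> states n g" using A R by fastforce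
    show "(\<lambda>\<alpha>. run (t \<alpha>) l \<alpha>) ` A \<subseteq> A'"
      using run_R[of _ _ l] t len A' by (fastforce simp: min_absorb2)
    fix \<alpha> i assume \<alpha>: "\<alpha> \<in> A"
    show "run (t \<alpha>) 0 \<alpha> = \<alpha>" by (rule run0)
    show "run (t \<alpha>) (Suc i) \<alpha> \<in> states n g"
      using run_R[of \<alpha> "t \<alpha>" "Suc i"] t[OF \<alpha>] R[of "t \<alpha>" "min (Suc i) (len (t \<alpha>))"] by auto
    show "run (t \<alpha>) (Suc i) \<alpha> = run (t \<alpha>) i \<alpha> \<or> adj n (run (t \<alpha>) i \<alpha>) (run (t \<alpha>) (Suc i) \<alpha>)"
      using run_R[of \<alpha> "t \<alpha>" i] t[OF \<alpha>] step[of "t \<alpha>" i "run (t \<alpha>) i \<alpha>"]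
      by (auto simp: runS min_def split: if_splits)
  next
    fix i \<beta>
    have "inj_on t {\<alpha> \<in> A. run (t \<alpha>) i \<alpha> = \<beta>}"
      using run_inj by (auto intro!: inj_onI) metis
    then have "card {\<alpha> \<in> A. run (t \<alpha>) i \<alpha> = \<beta>} \<le> card T"
      using t T by (intro card_inj_on_le) auto
    then show "real (card {\<alpha> \<in> A. run (t \<alpha>) i \<alpha> = \<beta>}) \<le> real (card T)" by simp
  qed (use A' in auto)
qed

section \<open>Sets of chords modulo 2\<close>

definition chord_set :: "nat \<Rightarrow> (nat \<Rightarrow> nat) \<Rightarrow> nat set set" where
  "chord_set n \<alpha> = (\<lambda>x. {x, \<alpha> x}) ` {1..2 * n}"

text \<open>The boundary map modulo 2 of the graph of vertices and chords. Both ends of a chord are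
  counted, so a loop contributes nothing.\<close>

definition odd_degree :: "nat \<Rightarrow> (nat \<Rightarrow> nat) \<Rightarrow> nat set set \<Rightarrow> nat set \<Rightarrow> bool" where
  "odd_degree n \<alpha> M v \<longleftrightarrow> odd (\<Sum>c\<in>M. card {z \<in> c. vertex n \<alpha> z = v})"

text \<open>The chords met an odd number of times when walking along the polygon from vertex 1 to
  vertex \<open>x\<close>: a chord with both sides on the way cancels. Its boundary therefore
  consists of the two ends of the walk.\<close>

definition cut :: "nat \<Rightarrow> (nat \<Rightarrow> nat) \<Rightarrow> nat \<Rightarrow> nat set set" where
  "cut n \<alpha> x = {c \<in> chord_set n \<alpha>. odd (card (c \<inter> {1..<x}))}"

lemma finite_chord_set: "finite (chord_set n \<alpha>)"
  by (simp add: chord_set_def)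

lemma odd_sum_sym_diff:
  fixes h :: "'a \<Rightarrow> nat"
  assumes "finite A" "finite B"
  shows "odd (sum h (sym_diff A B)) \<longleftrightarrow> odd (sum h A) \<noteq> odd (sum h B)"
proof -
  have 1: "sum h A = sum h (A - B) + sum h (A \<inter> B)" "sum h B = sum h (B - A) + sum h (A \<inter> B)"
    using assms sum.Int_Diff[of A h B] sum.Int_Diff[of B h A] by (simp_all add: Int_commute add.commute)
  have 2: "sum h (sym_diff A B) = sum h (A - B) + sum h (B - A)"
    using assms by (intro sum.union_disjoint) auto
  show ?thesis unfolding 1 2 by auto
qed

lemma odd_degree_sym_diff:
  assumes "M \<subseteq> chord_set n \<alpha>" "M' \<subseteq> chord_set n \<alpha>"
  shows "odd_degree n \<alpha> (sym_diff M M') v \<longleftrightarrow> odd_degree n \<alpha> M v \<noteq> odd_degree n \<alpha> M' v"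
  unfolding odd_degree_def
  by (rule odd_sum_sym_diff) (use assms finite_chord_set in \<open>auto intro: finite_subset\<close>)

context
  fixes n :: nat and \<alpha> :: "nat \<Rightarrow> nat"
  assumes \<alpha>: "\<alpha> \<in> pairings n"
begin

lemma chord_eq_iff: "{x, \<alpha> x} = {y, \<alpha> y} \<longleftrightarrow> y = x \<or> y = \<alpha> x"
  using pairing_involution[OF \<alpha>] by (metis doubleton_eq_iff)

lemma card_chord_set: "card (chord_set n \<alpha>) = n"
proof -
  have *: "\<alpha> x \<in> {1..2 * n}" if "x \<in> {1..2 * n}" for x using pairing_in[OF \<alpha>] that by blast
  have "2 * card (chord_set n \<alpha>) = card (\<Union> (chord_set n \<alpha>))"
  proof (rule card_partition)
    show "finite (\<Union> (chord_set n \<alpha>))" by (auto simp: chord_set_def)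
    fix c assume "c \<in> chord_set n \<alpha>"
    then show "card c = 2" using pairing_neq[OF \<alpha>] by (force simp: chord_set_def)
    fix c' assume c: "c \<in> chord_set n \<alpha>" "c' \<in> chord_set n \<alpha>" "c \<noteq> c'"
    then obtain x y where xy: "c = {x, \<alpha> x}" "c' = {y, \<alpha> y}" by (auto simp: chord_set_def)
    have "\<not> (y = x \<or> y = \<alpha> x)" using c(3) unfolding xy(1,2) chord_eq_iff .
    then have "y \<noteq> x" "y \<noteq> \<alpha> x" by blast+
    moreover have "x \<noteq> \<alpha> y" "\<alpha> x \<noteq> \<alpha> y"
      using \<open>y \<noteq> \<alpha> x\<close> \<open>y \<noteq> x\<close> pairing_swap_eq[OF \<alpha>, of y x] pairing_eq_iff[OF \<alpha>, of x y] by auto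
    ultimately show "c \<inter> c' = {}" by (simp add: xy)
  qed (simp add: finite_chord_set)
  moreover have "\<Union> (chord_set n \<alpha>) = {1..2 * n}" using * by (auto simp: chord_set_def)
  ultimately show ?thesis by simp
qed

lemma odd_degree_chord:
  assumes "x \<in> {1..2 * n}"
  shows "odd_degree n \<alpha> {{x, \<alpha> x}} v \<longleftrightarrow> (vertex n \<alpha> x = v) \<noteq> (vertex n \<alpha> (\<alpha> x) = v)"
proof -
  have ne: "\<alpha> x \<noteq> x" using pairing_neq[OF \<alpha> assms] .
  have "{z \<in> {x, \<alpha> x}. vertex n \<alpha> z = v} =
      (if vertex n \<alpha> x = v then {x} else {}) \<union> (if vertex n \<alpha> (\<alpha> x) = v then {\<alpha> x} else {})"
    by auto
  then show ?thesis using ne by (auto simp: odd_degree_def)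
qed

lemma cut_subset: "cut n \<alpha> x \<subseteq> chord_set n \<alpha>"
  by (auto simp: cut_def)

lemma cut_Suc:
  assumes "x \<in> {1..2 * n}"
  shows "cut n \<alpha> (Suc x) = sym_diff (cut n \<alpha> x) {{x, \<alpha> x}}"
proof -
  have "odd (card (c \<inter> {1..<Suc x})) \<longleftrightarrow> odd (card (c \<inter> {1..<x})) \<noteq> (c = {x, \<alpha> x})"
    if "c \<in> chord_set n \<alpha>" for c
  proof (cases "c = {x, \<alpha> x}")
    case True
    then have "c \<inter> {1..<Suc x} = insert x (c \<inter> {1..<x})" using assms by auto
    then show ?thesis using True by simp
  next
    case False
    then have "x \<notin> c" using that chord_eq_iff by (auto simp: chord_set_def)
    then have "c \<inter> {1..<Suc x} = c \<inter> {1..<x}" by (auto simp: less_Suc_eq)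
    then show ?thesis using False by simp
  qed
  moreover have "{x, \<alpha> x} \<in> chord_set n \<alpha>" using assms by (auto simp: chord_set_def)
  ultimately show ?thesis by (auto simp: cut_def)
qed

lemma odd_degree_cut:
  assumes "1 \<le> x" "x \<le> 2 * n"
  shows "odd_degree n \<alpha> (cut n \<alpha> x) v \<longleftrightarrow> (vertex n \<alpha> 1 = v) \<noteq> (vertex n \<alpha> x = v)"
  using assms
proof (induction x rule: dec_induct)
  case base
  show ?case by (simp add: cut_def odd_degree_def)
next
  case (step x)
  then have x: "x \<in> {1..2 * n}" "x < 2 * n" by auto
  have "{{x, \<alpha> x}} \<subseteq> chord_set n \<alpha>" using x(1) by (auto simp: chord_set_def)
  moreover have "vertex n \<alpha> (\<alpha> x) = vertex n \<alpha> (Suc x)"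
    using vertex_cyc[OF \<alpha>, of x] x step by (simp add: cyc_less)
  ultimately show ?case
    using step.IH x(2) odd_degree_chord[OF x(1), of v]
      odd_degree_sym_diff[OF cut_subset[of x], of "{{x, \<alpha> x}}" v]
    unfolding cut_Suc[OF x(1)] by simp argo
qed

end

abbreviation vertices_of :: "nat \<Rightarrow> (nat \<Rightarrow> nat) \<Rightarrow> nat set set" where
  "vertices_of n \<alpha> \<equiv> vertex n \<alpha> ` {1..2 * n}"

lemma card_vertices: "\<alpha> \<in> states n g \<Longrightarrow> card (vertices_of n \<alpha>) + 2 * g = n + 1"
  by (simp add: states_def cycles_def vertex_def)

text \<open>Since the polygon is connected, the odd-degree map from sets of chords to sets of
  vertices has all values on the vertices other than that of \<open>1\<close>; so each of its fibres is small.\<close>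

lemma odd_degree_fibre:
  assumes \<alpha>: "\<alpha> \<in> states n g" and n: "1 \<le> n"
  shows "card {M. M \<subseteq> chord_set n \<alpha> \<and> (\<forall>v\<in>vertices_of n \<alpha>. odd_degree n \<alpha> M v \<longleftrightarrow> \<delta> v)} \<le> 2 ^ (2 * g)"
    (is "card ?N \<le> _")
proof -
  note p = states_pairings[OF \<alpha>]
  let ?V = "vertices_of n \<alpha>" and ?v = "vertex n \<alpha> 1"
  let ?W = "?V - {?v}"
  have ex: "\<exists>M. M \<subseteq> chord_set n \<alpha> \<and> (\<forall>v\<in>?W. odd_degree n \<alpha> M v \<longleftrightarrow> v \<in> A)" if "A \<subseteq> ?W" for A
  proof -
    have "finite A" using that by (rule finite_subset) simp
    then show ?thesis using that
    proof (induction A)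
      case empty
      show ?case by (rule exI[of _ "{}"]) (simp add: odd_degree_def)
    next
      case (insert w A)
      then obtain M where M: "M \<subseteq> chord_set n \<alpha>" "\<forall>v\<in>?W. odd_degree n \<alpha> M v \<longleftrightarrow> v \<in> A" by auto
      have "w \<in> ?V" using insert.prems by blast
      then obtain x where "x \<in> {1..2 * n}" and w: "w = vertex n \<alpha> x" by (rule imageE)
      then have x: "1 \<le> x" "x \<le> 2 * n" by simp_all
      \<comment> \<open>Adding the walk from \<open>1\<close> to \<open>x\<close> changes the parity
        only at \<open>w\<close> and at the excluded vertex of \<open>1\<close>.\<close>
      have "odd_degree n \<alpha> (sym_diff M (cut n \<alpha> x)) v \<longleftrightarrow> v \<in> insert w A" if "v \<in> ?W" for v
      proof -
        have "odd_degree n \<alpha> (cut n \<alpha> x) v \<longleftrightarrow> v = w"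
          using that w odd_degree_cut[OF p x, of v] by (metis DiffD2 singletonI)
        moreover have "odd_degree n \<alpha> M v \<longleftrightarrow> v \<in> A" by (rule bspec[OF M(2) that])
        ultimately show ?thesis
          using insert.hyps(2) odd_degree_sym_diff[OF M(1) cut_subset[OF p], of x v]
          by (metis insert_iff)
      qed
      moreover have "sym_diff M (cut n \<alpha> x) \<subseteq> chord_set n \<alpha>" using M(1) cut_subset[OF p, of x] by blast
      ultimately show ?case by blast
    qed
  qed
  then obtain m where m: "\<And>A. A \<subseteq> ?W \<Longrightarrow> m A \<subseteq> chord_set n \<alpha>"
    "\<And>A v. A \<subseteq> ?W \<Longrightarrow> v \<in> ?W \<Longrightarrow> odd_degree n \<alpha> (m A) v \<longleftrightarrow> v \<in> A"
    by metis
  \<comment> \<open>Adding the sets \<open>m A\<close> spreads the fibre \<open>?N\<close> into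
    \<open>2 ^ card ?W\<close> disjoint copies among the sets of chords. As there are
    \<open>n\<close> chords and \<open>n - 2 * g\<close> vertices in \<open>?W\<close>, at most
    \<open>2 ^ (2 * g)\<close> elements fit.\<close>
  have "inj_on (\<lambda>(M, A). sym_diff M (m A)) (?N \<times> Pow ?W)"
  proof (rule inj_onI, clarify)
    fix M A M' A'
    assume M: "M \<subseteq> chord_set n \<alpha>" "\<forall>v\<in>?V. odd_degree n \<alpha> M v \<longleftrightarrow> \<delta> v"
      and M': "M' \<subseteq> chord_set n \<alpha>" "\<forall>v\<in>?V. odd_degree n \<alpha> M' v \<longleftrightarrow> \<delta> v"
      and A: "A \<subseteq> ?W" "A' \<subseteq> ?W" and eq: "sym_diff M (m A) = sym_diff M' (m A')"
    have "v \<in> A \<longleftrightarrow> v \<in> A'" if "v \<in> ?W" for v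
    proof -
      have "odd_degree n \<alpha> (sym_diff M (m A)) v \<longleftrightarrow> odd_degree n \<alpha> (sym_diff M' (m A')) v"
        by (simp only: eq)
      then show ?thesis
        using bspec[OF M(2), of v] bspec[OF M'(2), of v] that m(2)[OF A(1) that] m(2)[OF A(2) that]
        by (simp only: odd_degree_sym_diff[OF M(1) m(1)[OF A(1)]]
          odd_degree_sym_diff[OF M'(1) m(1)[OF A(2)]]) blast
    qed
    then have "A = A'" using A by blast
    moreover have "M = M'"
    proof -
      have cancel: "sym_diff (sym_diff B C) C = B" for B C :: "nat set set" by blast
      have "sym_diff (sym_diff M (m A)) (m A) = sym_diff (sym_diff M' (m A)) (m A)"
        using eq unfolding \<open>A = A'\<close> by (simp only:)
      then show ?thesis unfolding cancel .
    qed
    ultimately show "M = M' \<and> A = A'" by simp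
  qed
  then have "card (?N \<times> Pow ?W) \<le> card (Pow (chord_set n \<alpha>))"
  proof (rule card_inj_on_le)
    have "sym_diff M (m A) \<subseteq> chord_set n \<alpha>" if "M \<in> ?N" "A \<in> Pow ?W" for M A
      using that(1) m(1)[of A] that(2) by (simp only: mem_Collect_eq Pow_iff) blast
    then show "(\<lambda>(M, A). sym_diff M (m A)) ` (?N \<times> Pow ?W) \<subseteq> Pow (chord_set n \<alpha>)"
      by (intro image_subsetI) (simp only: mem_Times_iff split_beta Pow_iff)
  qed (simp add: finite_chord_set)
  then have "card ?N * 2 ^ card ?W \<le> 2 ^ n"
    by (simp add: card_cartesian_product card_Pow finite_chord_set card_chord_set[OF p])
  moreover have "?v \<in> ?V" using n by auto
  then have "n = 2 * g + card ?W"
    using card_vertices[OF \<alpha>] card_Suc_Diff1[of ?V ?v] by simp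
  then have "(2::nat) ^ n = 2 ^ (2 * g) * 2 ^ card ?W" unfolding power_add[symmetric] by (rule arg_cong)
  ultimately have "card ?N * 2 ^ card ?W \<le> 2 ^ (2 * g) * 2 ^ card ?W" by simp
  then show ?thesis by simp
qed

text \<open>Pigeonhole: for positive genus there are fewer vertices than chords, so two sets of
  chords have the same boundary, and their symmetric difference has none.\<close>

lemma even_chords_exist:
  assumes \<alpha>: "\<alpha> \<in> states n g" and g: "0 < g"
  shows "\<exists>M. M \<subseteq> chord_set n \<alpha> \<and> M \<noteq> {} \<and> (\<forall>v\<in>vertices_of n \<alpha>. \<not> odd_degree n \<alpha> M v)"
proof -
  note p = states_pairings[OF \<alpha>]
  let ?V = "vertices_of n \<alpha>"
  let ?h = "\<lambda>M. {v \<in> ?V. odd_degree n \<alpha> M v}"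
  have "card (Pow ?V) < card (Pow (chord_set n \<alpha>))"
    using card_vertices[OF \<alpha>] g card_chord_set[OF p] finite_chord_set by (simp add: card_Pow)
  moreover have "?h ` Pow (chord_set n \<alpha>) \<subseteq> Pow ?V" by auto
  ultimately have "\<not> inj_on ?h (Pow (chord_set n \<alpha>))"
    using card_inj_on_le[of ?h "Pow (chord_set n \<alpha>)" "Pow ?V"] by (simp add: not_less[symmetric]) blast
  then obtain M M' where M: "M \<subseteq> chord_set n \<alpha>" "M' \<subseteq> chord_set n \<alpha>" "M \<noteq> M'" "?h M = ?h M'"
    by (auto simp: inj_on_def)
  then have "\<forall>v\<in>?V. odd_degree n \<alpha> M v = odd_degree n \<alpha> M' v" by blast
  with M show ?thesis
    by (intro exI[of _ "sym_diff M M'"]) (auto simp: odd_degree_sym_diff[OF M(1,2)])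
qed

section \<open>Simple paths and folding of cycles\<close>

context
  fixes n :: nat and \<alpha> :: "nat \<Rightarrow> nat"
begin

text \<open>The side \<open>x\<close> is regarded as an arc from the vertex of \<open>x\<close> to the vertex of \<open>\<alpha> x\<close>, which
  is also the vertex of \<open>cyc n x\<close>.\<close>

fun simple_path :: "nat list \<Rightarrow> bool" where
  "simple_path [] \<longleftrightarrow> True"
| "simple_path (x # xs) \<longleftrightarrow> x \<in> {1..2 * n} \<and> (xs \<noteq> [] \<longrightarrow> vertex n \<alpha> (\<alpha> x) = vertex n \<alpha> (hd xs)) \<and>
     vertex n \<alpha> x \<notin> insert (vertex n \<alpha> (\<alpha> (last (x # xs)))) (vertex n \<alpha> ` set xs) \<and> simple_path xs"

lemma simple_path_set: "simple_path xs \<Longrightarrow> set xs \<subseteq> {1..2 * n}"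
  by (induction xs) auto

lemma simple_path_ends:
  "simple_path xs \<Longrightarrow> z \<in> set xs \<Longrightarrow>
    vertex n \<alpha> (\<alpha> z) \<in> insert (vertex n \<alpha> (\<alpha> (last xs))) (vertex n \<alpha> ` set (tl xs))"
proof (induction xs)
  case (Cons x xs)
  show ?case
  proof (cases "xs = []")
    case False
    show ?thesis
    proof (cases "z = x")
      case True
      then show ?thesis using Cons.prems False by simp
    next
      case nx: False
      have "simple_path xs" using Cons.prems(1) by simp
      moreover have "z \<in> set xs" using Cons.prems(2) nx by simp
      ultimately have "vertex n \<alpha> (\<alpha> z) \<in> insert (vertex n \<alpha> (\<alpha> (last xs))) (vertex n \<alpha> ` set (tl xs))"
        by (rule Cons.IH)
      moreover have "set (tl xs) \<subseteq> set xs" by (cases xs) auto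
      ultimately show ?thesis using False by auto
    qed
  qed (use Cons in simp)
qed simp

end

context
  fixes n :: nat and \<alpha> :: "nat \<Rightarrow> nat"
  assumes \<alpha>: "\<alpha> \<in> pairings n"
begin

abbreviation chords_of :: "nat list \<Rightarrow> nat set set" where
  "chords_of xs \<equiv> (\<lambda>x. {x, \<alpha> x}) ` set xs"

lemma simple_path_chord_notin:
  assumes "simple_path n \<alpha> (x # xs)"
  shows "{x, \<alpha> x} \<notin> chords_of xs"
proof
  assume "{x, \<alpha> x} \<in> chords_of xs"
  then obtain z where z: "z \<in> set xs" "x = z \<or> x = \<alpha> z"
    using chord_eq_iff[OF \<alpha>] by (metis (no_types, lifting) image_iff)
  have "vertex n \<alpha> (\<alpha> z) \<in> insert (vertex n \<alpha> (\<alpha> (last xs))) (vertex n \<alpha> ` set (tl xs))"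
    using assms z simple_path_ends by auto
  then show False using z assms by (cases xs) (auto split: if_splits)
qed

text \<open>Only the first arc of a simple path meets its initial vertex, so the set of chords
  reveals the first arc together with its direction; deleting it leaves a shorter path that starts
  where this arc ends.\<close>

lemma simple_path_unique:
  assumes "simple_path n \<alpha> xs" "simple_path n \<alpha> ys" "chords_of xs = chords_of ys"
    and "xs \<noteq> [] \<Longrightarrow> ys \<noteq> [] \<Longrightarrow> vertex n \<alpha> (hd xs) = vertex n \<alpha> (hd ys)"
  shows "xs = ys"
  using assms
proof (induction xs arbitrary: ys)
  case (Cons x xs ys')
  have "ys' \<noteq> []" using Cons.prems(3) by force
  then obtain y ys where ys: "ys' = y # ys" by (cases ys') simp_all
  have v: "vertex n \<alpha> x = vertex n \<alpha> y" using Cons.prems(4) unfolding ys by simp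
  have "{x, \<alpha> x} \<in> chords_of (x # xs)" by simp
  then have "{x, \<alpha> x} \<in> chords_of (y # ys)" unfolding Cons.prems(3) ys .
  then obtain z where z: "z \<in> set (y # ys)" "x = z \<or> x = \<alpha> z"
    using chord_eq_iff[OF \<alpha>] by (metis (no_types, lifting) image_iff)
  have "x = y"
    using z(2)
  proof
    assume "x = z"
    moreover have "vertex n \<alpha> y \<notin> vertex n \<alpha> ` set ys" using Cons.prems(2) ys by simp
    ultimately show ?thesis using z(1) v by (metis imageI set_ConsD)
  next
    assume "x = \<alpha> z"
    moreover have "vertex n \<alpha> (\<alpha> z) \<in> insert (vertex n \<alpha> (\<alpha> (last (y # ys)))) (vertex n \<alpha> ` set ys)"
      using simple_path_ends[of n \<alpha> "y # ys" z] z Cons.prems(2) ys by simp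
    moreover have "vertex n \<alpha> y \<notin> insert (vertex n \<alpha> (\<alpha> (last (y # ys)))) (vertex n \<alpha> ` set ys)"
      using Cons.prems(2) unfolding ys simple_path.simps by blast
    ultimately show ?thesis using v by metis
  qed
  have prems: "simple_path n \<alpha> (x # xs)" "simple_path n \<alpha> (x # ys)"
    using Cons.prems(1,2) unfolding ys \<open>x = y\<close> .
  have "chords_of (x # xs) = chords_of (x # ys)" using Cons.prems(3) unfolding ys \<open>x = y\<close> .
  then have "insert {x, \<alpha> x} (chords_of xs) = insert {x, \<alpha> x} (chords_of ys)"
    by (simp only: list.set image_insert)
  then have "chords_of xs = chords_of ys"
    by (rule insert_ident[THEN iffD1, rotated 2])
      (fact simple_path_chord_notin[OF prems(1)], fact simple_path_chord_notin[OF prems(2)])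
  moreover have "vertex n \<alpha> (hd xs) = vertex n \<alpha> (hd ys)" if "xs \<noteq> []" "ys \<noteq> []"
    using that prems by simp
  moreover have "simple_path n \<alpha> xs" "simple_path n \<alpha> ys" using prems by simp_all
  ultimately have "xs = ys" using Cons.IH[of ys] by blast
  then show ?case unfolding ys using \<open>x = y\<close> by simp
qed auto

text \<open>Consecutive chords cancel at the vertex they share.\<close>

lemma odd_degree_simple_path:
  assumes "simple_path n \<alpha> xs" "xs \<noteq> []"
  shows "odd_degree n \<alpha> (chords_of xs) v \<longleftrightarrow>
    (vertex n \<alpha> (hd xs) = v) \<noteq> (vertex n \<alpha> (\<alpha> (last xs)) = v)"
  using assms
proof (induction xs)
  case (Cons x xs)
  have x: "x \<in> {1..2 * n}" using Cons.prems by simp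
  show ?case
  proof (cases "xs = []")
    case True
    then show ?thesis using odd_degree_chord[OF \<alpha> x] by simp
  next
    case False
    have "chords_of (x # xs) = insert {x, \<alpha> x} (chords_of xs)" by simp
    also have "\<dots> = sym_diff {{x, \<alpha> x}} (chords_of xs)"
      using simple_path_chord_notin[OF Cons.prems(1)] by blast
    finally have "chords_of (x # xs) = sym_diff {{x, \<alpha> x}} (chords_of xs)" .
    moreover have "chords_of xs \<subseteq> chord_set n \<alpha>" "{{x, \<alpha> x}} \<subseteq> chord_set n \<alpha>"
      using simple_path_set[of n \<alpha> xs] Cons.prems(1) x by (auto simp: chord_set_def)
    ultimately have "odd_degree n \<alpha> (chords_of (x # xs)) v \<longleftrightarrow>
        odd_degree n \<alpha> {{x, \<alpha> x}} v \<noteq> odd_degree n \<alpha> (chords_of xs) v"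
      using odd_degree_sym_diff[of "{{x, \<alpha> x}}" n \<alpha> "chords_of xs" v] by (simp only:)
    also have "\<dots> \<longleftrightarrow> ((vertex n \<alpha> x = v) \<noteq> (vertex n \<alpha> (\<alpha> x) = v)) \<noteq>
        ((vertex n \<alpha> (hd xs) = v) \<noteq> (vertex n \<alpha> (\<alpha> (last xs)) = v))"
      using Cons.IH Cons.prems(1) False odd_degree_chord[OF \<alpha> x, of v] by simp
    also have "vertex n \<alpha> (\<alpha> x) = vertex n \<alpha> (hd xs)" using Cons.prems(1) False by simp
    finally show ?thesis using False by simp argo
  qed
qed simp

end

text \<open>A nonempty path is determined by its first and last arcs, which prescribe the boundary,
  and by one of the at most \<open>2 ^ (2 * g)\<close> sets of chords with that boundary. The
  summand 1 counts the empty path.\<close>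

lemma card_simple_paths:
  assumes \<alpha>: "\<alpha> \<in> states n g" and n: "1 \<le> n"
  shows "finite {xs. simple_path n \<alpha> xs}"
    and "card {xs. simple_path n \<alpha> xs} \<le> 1 + (2 * n)\<^sup>2 * 2 ^ (2 * g)"
proof -
  note p = states_pairings[OF \<alpha>]
  let ?S = "{xs. simple_path n \<alpha> xs \<and> xs \<noteq> []}"
  define N where "N h l = {M. M \<subseteq> chord_set n \<alpha> \<and> (\<forall>v\<in>vertices_of n \<alpha>. odd_degree n \<alpha> M v \<longleftrightarrow>
     (vertex n \<alpha> h = v) \<noteq> (vertex n \<alpha> (\<alpha> l) = v))}" for h l
  let ?T = "SIGMA hl:{1..2 * n} \<times> {1..2 * n}. N (fst hl) (snd hl)"
  have finN: "finite (N h l)" for h l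
    by (rule finite_subset[of _ "Pow (chord_set n \<alpha>)"]) (auto simp: N_def finite_chord_set)
  have finT: "finite ?T" using finN by auto
  have inj: "inj_on (\<lambda>xs. ((hd xs, last xs), chords_of \<alpha> xs)) ?S"
    using simple_path_unique[OF p] by (intro inj_onI) auto
  have sub: "(\<lambda>xs. ((hd xs, last xs), chords_of \<alpha> xs)) ` ?S \<subseteq> ?T"
  proof (rule image_subsetI)
    fix xs assume xs: "xs \<in> ?S"
    then have set: "set xs \<subseteq> {1..2 * n}" using simple_path_set by auto
    have "hd xs \<in> {1..2 * n}" "last xs \<in> {1..2 * n}" using xs by (auto intro!: subsetD[OF set, unfolded One_nat_def] simp del: atLeastAtMost_iff)
    with set show "((hd xs, last xs), chords_of \<alpha> xs) \<in> ?T"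
      using xs odd_degree_simple_path[OF p] by (auto simp: N_def chord_set_def)
  qed
  have finS: "finite ?S" using inj sub finT by (rule inj_on_finite)
  have eq: "{xs. simple_path n \<alpha> xs} = insert [] ?S" by auto
  show "finite {xs. simple_path n \<alpha> xs}" unfolding eq using finS by simp
  have "card ?S \<le> card ?T" by (rule card_inj_on_le[OF inj sub finT])
  also have "card ?T = (\<Sum>hl\<in>{1..2 * n} \<times> {1..2 * n}. card (N (fst hl) (snd hl)))"
    using finN by (intro card_SigmaI) auto
  also have "\<dots> \<le> (\<Sum>hl\<in>{1..2 * n} \<times> {1..2 * n}. 2 ^ (2 * g))"
    using odd_degree_fibre[OF \<alpha> n] by (intro sum_mono) (auto simp: N_def)
  finally have "card ?S \<le> (2 * n)\<^sup>2 * 2 ^ (2 * g)" by (simp add: card_cartesian_product power2_eq_square)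
  then show "card {xs. simple_path n \<alpha> xs} \<le> 1 + (2 * n)\<^sup>2 * 2 ^ (2 * g)"
    unfolding eq using finS card_insert_if[OF finS, of "[]"] by simp
qed

definition cycle :: "nat \<Rightarrow> (nat \<Rightarrow> nat) \<Rightarrow> nat list \<Rightarrow> bool" where
  "cycle n \<alpha> s \<longleftrightarrow> s \<noteq> [] \<and> set s \<subseteq> {1..2 * n} \<and> distinct (map (vertex n \<alpha>) s) \<and>
     (\<forall>i<length s. vertex n \<alpha> (\<alpha> (s ! i)) = vertex n \<alpha> (s ! (Suc i mod length s)) \<and>
        \<alpha> (s ! i) \<noteq> s ! (Suc i mod length s))"

text \<open>The length is \<open>2 * radius s + 1\<close> or \<open>2 * radius s + 2\<close>:
  folding in pairs stops when one arc or two arcs are left.\<close>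

definition radius :: "nat list \<Rightarrow> nat" where
  "radius s = (length s - 1) div 2"

text \<open>The arcs met when leaving the middle of the cycle \<open>s\<close> backwards and forwards.\<close>

definition bwd :: "nat list \<Rightarrow> nat \<Rightarrow> nat" where
  "bwd s j = s ! (radius s - 1 - j)"

definition fwd :: "nat list \<Rightarrow> nat \<Rightarrow> nat" where
  "fwd s j = s ! (radius s + j)"

text \<open>The arcs that have been exchanged after \<open>j\<close> steps form two simple paths of the refolded
  diagram, and \<open>unfold_along\<close> recovers \<open>\<alpha>\<close> from these.\<close>

primrec refold :: "(nat \<Rightarrow> nat) \<Rightarrow> nat list \<Rightarrow> nat \<Rightarrow> nat \<Rightarrow> nat" where
  "refold \<alpha> s 0 = \<alpha>"
| "refold \<alpha> s (Suc j) = sw (refold \<alpha> s j) (bwd s j) (\<alpha> (fwd s j))"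

fun unfold_along :: "(nat \<Rightarrow> nat) \<Rightarrow> nat list \<Rightarrow> nat list \<Rightarrow> nat \<Rightarrow> nat" where
  "unfold_along \<beta> (b # bs) (d # ds) = unfold_along (sw \<beta> b d) bs ds"
| "unfold_along \<beta> _ _ = \<beta>"

primrec bwd_path :: "nat list \<Rightarrow> nat \<Rightarrow> nat list" where
  "bwd_path s 0 = []"
| "bwd_path s (Suc j) = bwd s j # bwd_path s j"

primrec fwd_path :: "(nat \<Rightarrow> nat) \<Rightarrow> nat list \<Rightarrow> nat \<Rightarrow> nat list" where
  "fwd_path \<alpha> s 0 = []"
| "fwd_path \<alpha> s (Suc j) = \<alpha> (fwd s j) # fwd_path \<alpha> s j"

lemma unfold_refold: "unfold_along (refold \<alpha> s j) (bwd_path s j) (fwd_path \<alpha> s j) = \<alpha>"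
  by (induction j) (simp_all add: sw_sw)

section \<open>Invariants of the folding of a cycle\<close>

context
  fixes n g \<alpha> s
  assumes \<alpha>: "\<alpha> \<in> states n g" and s: "cycle n \<alpha> s"
begin

private lemma p: "\<alpha> \<in> pairings n" by (rule states_pairings[OF \<alpha>])

private abbreviation "k \<equiv> length s"
private abbreviation "r \<equiv> radius s"
private abbreviation v where "v i \<equiv> vertex n \<alpha> (s ! i)"
private abbreviation "bb \<equiv> bwd s"
private abbreviation "cc \<equiv> fwd s"
private abbreviation aa where "aa j \<equiv> \<alpha> (bwd s j)"
private abbreviation dd where "dd j \<equiv> \<alpha> (fwd s j)"
private abbreviation "be \<equiv> refold \<alpha> s"

private lemma k_pos: "0 < k"
  using s by (simp add: cycle_def)

private lemma r_k: "2 * r < k" "k \<le> 2 * r + 2"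
  using k_pos unfolding radius_def by presburger+

private lemma s_in: "i < k \<Longrightarrow> s ! i \<in> {1..2 * n}"
  using s nth_mem unfolding cycle_def by blast

private lemma v_eq_iff: "i < k \<Longrightarrow> j < k \<Longrightarrow> v i = v j \<longleftrightarrow> i = j"
  using s nth_eq_iff_index_eq[of "map (vertex n \<alpha>) s" i j] by (simp add: cycle_def)

private lemma s_eq_iff: "i < k \<Longrightarrow> j < k \<Longrightarrow> s ! i = s ! j \<longleftrightarrow> i = j"
  using v_eq_iff by metis

private lemma v_end: "i < k \<Longrightarrow> vertex n \<alpha> (\<alpha> (s ! i)) = v (Suc i mod k)"
  using s by (simp add: cycle_def)

private lemma s_partner: "i < k \<Longrightarrow> j < k \<Longrightarrow> \<alpha> (s ! i) \<noteq> s ! j"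
proof
  assume ij: "i < k" "j < k" "\<alpha> (s ! i) = s ! j"
  then have "v (Suc i mod k) = v j" using v_end by metis
  then have "Suc i mod k = j" using ij k_pos by (subst (asm) v_eq_iff) simp_all
  then show False using s ij by (auto simp: cycle_def)
qed

lemma radius_le: "radius s \<le> n"
proof -
  have "distinct s" using s by (auto simp: cycle_def distinct_map)
  then have "k = card (set s)" by (simp add: distinct_card)
  also have "\<dots> \<le> card {1..2 * n}" using s by (intro card_mono) (auto simp: cycle_def)
  finally show ?thesis using r_k by simp
qed

private lemma vb: "j < r \<Longrightarrow> vertex n \<alpha> (bb j) = v (r - 1 - j)"
  and vc: "j < r \<Longrightarrow> vertex n \<alpha> (cc j) = v (r + j)"
  by (simp_all add: bwd_def fwd_def)

private lemma va: "j < r \<Longrightarrow> vertex n \<alpha> (aa j) = v (r - j)"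
  using v_end[of "r - 1 - j"] r_k by (simp add: bwd_def Suc_diff_Suc)

private lemma vd: "j < r \<Longrightarrow> vertex n \<alpha> (dd j) = v (r + j + 1)"
  using v_end[of "r + j"] r_k by (simp add: fwd_def)

private lemma in_D: "j < r \<Longrightarrow> bb j \<in> {1..2 * n}" "j < r \<Longrightarrow> cc j \<in> {1..2 * n}"
    "j < r \<Longrightarrow> aa j \<in> {1..2 * n}" "j < r \<Longrightarrow> dd j \<in> {1..2 * n}"
  unfolding pairing_in[OF p] using r_k by (auto simp only: bwd_def fwd_def intro!: s_in)

private lemma distinct_arcs:
  assumes "i < r" "j < r"
  shows "bb i \<noteq> cc j" "bb i \<noteq> aa j" "bb i \<noteq> dd j" "cc i \<noteq> aa j" "cc i \<noteq> dd j" "aa i \<noteq> dd j"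
    and "bb i = bb j \<longleftrightarrow> i = j" "cc i = cc j \<longleftrightarrow> i = j" "aa i = aa j \<longleftrightarrow> i = j" "dd i = dd j \<longleftrightarrow> i = j"
proof -
  have *: "r - 1 - i < k" "r - 1 - j < k" "r + i < k" "r + j < k" using r_k assms by auto
  show "bb i \<noteq> cc j" "bb i = bb j \<longleftrightarrow> i = j" "cc i = cc j \<longleftrightarrow> i = j"
    using assms s_eq_iff[OF *(1,4)] s_eq_iff[OF *(1,2)] s_eq_iff[OF *(3,4)] by (auto simp: bwd_def fwd_def)
  then show "aa i = aa j \<longleftrightarrow> i = j" "dd i = dd j \<longleftrightarrow> i = j" "aa i \<noteq> dd j"
    by (simp_all add: pairing_eq_iff[OF p])
  show "bb i \<noteq> aa j" "bb i \<noteq> dd j" "cc i \<noteq> aa j" "cc i \<noteq> dd j"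
    using s_partner[OF *(2) *(1)] s_partner[OF *(4) *(1)] s_partner[OF *(2) *(3)] s_partner[OF *(4) *(3)]
    by (simp_all add: bwd_def fwd_def)
qed

definition affected :: "nat \<Rightarrow> nat set" where
  "affected j = (\<Union>l<j. {bwd s l, fwd s l, \<alpha> (bwd s l), \<alpha> (fwd s l)})"

private definition "good j \<longleftrightarrow> be j \<in> states n g \<and> (\<forall>x. x \<notin> affected j \<longrightarrow> be j x = \<alpha> x) \<and>
  (\<forall>l<j. be j (bb l) = cc l \<and> be j (cc l) = bb l \<and> be j (aa l) = dd l \<and> be j (dd l) = aa l)"

private lemma good_pairings: "good j \<Longrightarrow> be j \<in> pairings n"
  using states_pairings[of "be j" n g] unfolding good_def by blast

private lemma not_affected: "j < r \<Longrightarrow> {bb j, cc j, aa j, dd j} \<inter> affected j = {}"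
  using distinct_arcs[of _ j] distinct_arcs[of j] by (auto simp: affected_def) (metis less_trans)+

text \<open>The reflection of the cycle in its middle vertex, on the part folded so far: the vertex
  \<open>m\<close> places after the middle goes to the one \<open>m\<close> places before it. It is
  constant along the gluing of the refolded diagram. Since folding may also split vertices, it only
  proves vertices distinct; equalities come from \<open>orbit_arc\<close>.\<close>

private definition rep where
  "rep j V = (if \<exists>m\<le>j. V = v (r + m) then v (r - (LEAST m. V = v (r + m))) else V)"

private lemma rep_right: "m \<le> j \<Longrightarrow> m \<le> r \<Longrightarrow> rep j (v (r + m)) = v (r - m)"
proof -
  assume m: "m \<le> j" "m \<le> r"
  have "(LEAST m'. v (r + m) = v (r + m')) = m"
  proof (rule Least_equality)
    fix m' assume *: "v (r + m) = v (r + m')"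
    show "m \<le> m'"
    proof (rule ccontr)
      assume "\<not> m \<le> m'"
      then show False using * m r_k by (subst (asm) v_eq_iff) auto
    qed
  qed simp
  then show ?thesis using m by (auto simp: rep_def)
qed

private lemma rep_left: "j \<le> r \<Longrightarrow> m \<le> r \<Longrightarrow> rep j (v (r - m)) = v (r - m)"
proof (cases "m = 0")
  case True
  then show ?thesis using rep_right[of 0 j] by simp
next
  case False
  assume m: "j \<le> r" "m \<le> r"
  have "v (r - m) \<noteq> v (r + m')" if "m' \<le> j" for m'
    using v_eq_iff[of "r - m" "r + m'"] m that r_k False by simp
  then show ?thesis by (auto simp: rep_def)
qed

private lemma rep_out: "j \<le> r \<Longrightarrow> j < m \<Longrightarrow> r + m < k \<Longrightarrow> rep j (v (r + m)) = v (r + m)"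
proof -
  assume m: "j \<le> r" "j < m" "r + m < k"
  have "v (r + m) \<noteq> v (r + m')" if "m' \<le> j" for m'
    using v_eq_iff[of "r + m" "r + m'"] m that by simp
  then show ?thesis by (auto simp: rep_def)
qed

private lemma separated:
  assumes j: "j \<le> r" and good: "good j" and x: "x \<in> {1..2 * n}"
    and ne: "rep j (vertex n \<alpha> y) \<noteq> rep j (vertex n \<alpha> x)"
  shows "vertex n (be j) y \<noteq> vertex n (be j) x"
proof
  assume eq: "vertex n (be j) y = vertex n (be j) x"
  have pb: "be j \<in> pairings n" by (rule good_pairings[OF good])
  have "rep j (vertex n \<alpha> y) = rep j (vertex n \<alpha> x)"
  proof (rule vertex_invariant[OF pb _ eq x, where h = "\<lambda>x. rep j (vertex n \<alpha> x)"])
    fix z assume "z \<in> {1..2 * n}"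
    show "rep j (vertex n \<alpha> (cyc n (be j z))) = rep j (vertex n \<alpha> z)"
    proof (cases "z \<in> affected j")
      case False
      then have "be j z = \<alpha> z" using good by (simp add: good_def)
      then show ?thesis by (simp add: vertex_glue[OF p])
    next
      case True
      then obtain l where l: "l < j" "z = bb l \<or> z = cc l \<or> z = aa l \<or> z = dd l"
        by (auto simp: affected_def)
      then have lr: "l < r" using j by simp
      have img: "be j (bb l) = cc l" "be j (cc l) = bb l" "be j (aa l) = dd l" "be j (dd l) = aa l"
        using good l(1) by (auto simp: good_def)
      have b: "rep j (vertex n \<alpha> (bb l)) = v (r - (l + 1))"
        using rep_left[of j "l + 1"] j lr by (simp add: vb)
      have c: "rep j (vertex n \<alpha> (cc l)) = v (r - l)"
        using rep_right[of l j] l lr by (simp add: vc)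
      have a: "rep j (vertex n \<alpha> (aa l)) = v (r - l)"
        using rep_left[of j l] j lr by (simp add: va)
      have d: "rep j (vertex n \<alpha> (dd l)) = v (r - (l + 1))"
        using rep_right[of "l + 1" j] l lr by (simp add: vd)
      show ?thesis
        using l(2) by (elim disjE) (simp_all only: img vertex_cyc[OF p] pairing_involution[OF p] a b c d)
    qed
  qed
  with ne show False by contradiction
qed

text \<open>Among the sides whose partner changes, the vertex \<open>m\<close> places before the
  middle contains at most two, one on each adjacent arc of the cycle. The rest of its rotation is
  untouched, as \<open>orbit_arc\<close> demands.\<close>

private lemma only_left:
  assumes j: "j \<le> r" and good: "good j" and m: "1 \<le> m" "m \<le> r"
    and x: "vertex n \<alpha> x = v (r - m)" "x \<noteq> bb (m - 1)" "m < j \<Longrightarrow> x \<noteq> aa m"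
  shows "be j x = \<alpha> x"
proof -
  have "x \<notin> affected j"
  proof
    assume "x \<in> affected j"
    then obtain l where l: "l < j" "x = bb l \<or> x = cc l \<or> x = aa l \<or> x = dd l"
      by (auto simp: affected_def)
    then have lr: "l < r" using j by simp
    from l(2) show False
    proof (elim disjE)
      assume *: "x = bb l"
      then have "v (r - 1 - l) = v (r - m)" using x(1) vb[OF lr] by simp
      then have "r - 1 - l = r - m" using r_k m lr by (subst (asm) v_eq_iff) auto
      then have "l = m - 1" using lr m by simp
      then show False using * x(2) by simp
    next
      assume "x = cc l"
      then have "v (r + l) = v (r - m)" using x(1) vc[OF lr] by simp
      then have "r + l = r - m" using r_k m lr by (subst (asm) v_eq_iff) auto
      then show False using lr m by simp
    next
      assume *: "x = aa l"
      then have "v (r - l) = v (r - m)" using x(1) va[OF lr] by simp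
      then have "r - l = r - m" using r_k m lr by (subst (asm) v_eq_iff) auto
      then have "l = m" using lr m by simp
      then show False using * x(3) l(1) by simp
    next
      assume "x = dd l"
      then have "v (r + l + 1) = v (r - m)" using x(1) vd[OF lr] by simp
      then have "r + l + 1 = r - m" using r_k m lr by (subst (asm) v_eq_iff) auto
      then show False using lr m by simp
    qed
  qed
  then show ?thesis using good by (simp add: good_def)
qed

private lemma only_right:
  assumes j: "j \<le> r" and good: "good j" and m: "1 \<le> m" "r + m < k"
    and x: "vertex n \<alpha> x = v (r + m)" "m \<le> j \<Longrightarrow> x \<noteq> dd (m - 1)" "m < j \<Longrightarrow> x \<noteq> cc m"
  shows "be j x = \<alpha> x"
proof -
  have "x \<notin> affected j"
  proof
    assume "x \<in> affected j"
    then obtain l where l: "l < j" "x = bb l \<or> x = cc l \<or> x = aa l \<or> x = dd l"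
      by (auto simp: affected_def)
    then have lr: "l < r" using j by simp
    from l(2) show False
    proof (elim disjE)
      assume "x = bb l"
      then have "v (r - 1 - l) = v (r + m)" using x(1) vb[OF lr] by simp
      then have "r - 1 - l = r + m" using r_k m lr by (subst (asm) v_eq_iff) auto
      then show False using lr m by simp
    next
      assume *: "x = cc l"
      then have "v (r + l) = v (r + m)" using x(1) vc[OF lr] by simp
      then have "r + l = r + m" using r_k m lr by (subst (asm) v_eq_iff) auto
      then show False using * x(3) l(1) by simp
    next
      assume "x = aa l"
      then have "v (r - l) = v (r + m)" using x(1) va[OF lr] by simp
      then have "r - l = r + m" using r_k m lr by (subst (asm) v_eq_iff) auto
      then show False using lr m by simp
    next
      assume *: "x = dd l"
      then have "v (r + l + 1) = v (r + m)" using x(1) vd[OF lr] by simp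
      then have "r + l + 1 = r + m" using r_k m lr by (subst (asm) v_eq_iff) auto
      then have "l = m - 1" "m \<le> j" using l(1) by simp_all
      then show False using * x(2) by simp
    qed
  qed
  then show ?thesis using good by (simp add: good_def)
qed

private lemma v_orbit: "x \<in> orbit (cyc n \<circ> \<alpha>) y \<longleftrightarrow> vertex n \<alpha> x = vertex n \<alpha> y"
  by (simp add: vertex_eq_iff[OF p]) (simp add: vertex_def)

private lemma be_orbit: "good j \<Longrightarrow> x \<in> orbit (cyc n \<circ> be j) y \<Longrightarrow> vertex n (be j) x = vertex n (be j) y"
  using vertex_eq_iff[OF good_pairings, of j x y] by (simp add: vertex_def)

text \<open>The last step glued \<open>bb l\<close> to \<open>cc l\<close> and \<open>dd l\<close>
  to \<open>aa l\<close>. From \<open>dd l\<close> the gluing continues as it formerly did from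
  \<open>bb l\<close> and runs through the old vertex on the left; from \<open>bb l\<close> it runs
  through the old one on the right. So both lie in one new vertex.\<close>

private lemma merged:
  assumes j: "j \<le> r" and good: "good j"
    and x: "vertex n \<alpha> x = v (r - j)" and y: "vertex n \<alpha> y = v (r + j)"
  shows "vertex n (be j) x = vertex n (be j) y"
proof (cases "j = 0")
  case True
  then show ?thesis using x y by simp
next
  case False
  define l where "l = j - 1"
  have l: "l < r" "l < j" "j = l + 1" using False j by (auto simp: l_def)
  have img: "be j (bb l) = cc l" "be j (dd l) = aa l" using good l by (auto simp: good_def)
  have left: "z \<in> orbit (cyc n \<circ> be j) (dd l)" if z: "vertex n \<alpha> z = v (r - j)" for z
  proof (rule orbit_arc[where p = "cyc n \<circ> \<alpha>" and a = "bb l"])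
    show "z \<in> orbit (cyc n \<circ> \<alpha>) (bb l)" using z vb[OF l(1)] l(3) by (simp add: v_orbit)
    show "(cyc n \<circ> be j) (dd l) = (cyc n \<circ> \<alpha>) (bb l)" using img by simp
    fix w assume w: "w \<in> orbit (cyc n \<circ> \<alpha>) (bb l)" "w \<noteq> bb l"
    have "be j w = \<alpha> w"
      using w vb[OF l(1)] l by (intro only_left[OF j good, of j]) (use j in \<open>auto simp: v_orbit\<close>)
    then show "(cyc n \<circ> be j) w = (cyc n \<circ> \<alpha>) w" by simp
  qed
  have right: "z \<in> orbit (cyc n \<circ> be j) (bb l)" if z: "vertex n \<alpha> z = v (r + j)" for z
  proof (rule orbit_arc[where p = "cyc n \<circ> \<alpha>" and a = "dd l"])
    show "z \<in> orbit (cyc n \<circ> \<alpha>) (dd l)" using z vd[OF l(1)] l(3) by (simp add: v_orbit)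
    show "(cyc n \<circ> be j) (bb l) = (cyc n \<circ> \<alpha>) (dd l)" using img by (simp add: pairing_involution[OF p])
    fix w assume w: "w \<in> orbit (cyc n \<circ> \<alpha>) (dd l)" "w \<noteq> dd l"
    have "be j w = \<alpha> w"
      using w vd[OF l(1)] l by (intro only_right[OF j good, of j]) (use j r_k in \<open>auto simp: v_orbit\<close>)
    then show "(cyc n \<circ> be j) w = (cyc n \<circ> \<alpha>) w" by simp
  qed
  have "vertex n (be j) (bb l) = vertex n (be j) (dd l)"
    using vb[OF l(1)] l(3) by (intro be_orbit[OF good] left) simp
  then show ?thesis using be_orbit[OF good left[OF x]] be_orbit[OF good right[OF y]] by simp
qed

private lemma good_refold: "j \<le> r \<Longrightarrow> good j"
  and adj_refold: "j < r \<Longrightarrow> adj n (be j) (be (Suc j))"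
proof -
  have step: "good (Suc j) \<and> adj n (be j) (be (Suc j))" if j: "j < r" and good: "good j" for j
  proof -
    have st: "be j \<in> states n g" and out: "\<And>x. x \<notin> affected j \<Longrightarrow> be j x = \<alpha> x"
      and inn: "\<And>l. l < j \<Longrightarrow> be j (bb l) = cc l \<and> be j (cc l) = bb l \<and> be j (aa l) = dd l \<and> be j (dd l) = aa l"
      using good unfolding good_def by blast+
    have pb: "be j \<in> pairings n" by (rule states_pairings[OF st])
    have na: "be j (bb j) = aa j" "be j (dd j) = cc j"
      using out not_affected[OF j] pairing_involution[OF p] by auto
    have D: "bb j \<in> {1..2 * n}" "dd j \<in> {1..2 * n}" and ne: "bb j \<noteq> dd j" "dd j \<noteq> be j (bb j)"
      using in_D[OF j] distinct_arcs[OF j j] unfolding na by simp_all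
    \<comment> \<open>The outer ends of the two arcs are still at different vertices, while the
      inner ends were merged by the previous step, or lie at the middle vertex when
      \<open>j = 0\<close>: this is the legal exchange that merges and splits.\<close>
    have "rep j (vertex n \<alpha> (bb j)) \<noteq> rep j (vertex n \<alpha> (dd j))"
      using rep_left[of j "j + 1"] rep_out[of j "j + 1"] v_eq_iff[of "r - (j + 1)" "r + (j + 1)"] j r_k
      by (simp add: vb vd)
    then have "vertex n (be j) (bb j) \<noteq> vertex n (be j) (dd j)"
      using j by (intro separated[OF _ good D(2)]) auto
    moreover have "vertex n (be j) (be j (bb j)) = vertex n (be j) (be j (dd j))"
      unfolding na using j by (intro merged good) (auto simp: va vc)
    ultimately have *: "sw (be j) (bb j) (dd j) \<in> states n g" "adj n (be j) (sw (be j) (bb j) (dd j))"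
      using sw_fold_states[OF st D ne(2)] by blast+
    note ap = sw_apply[OF pb D ne, unfolded na]
    have "be (Suc j) x = \<alpha> x" if "x \<notin> affected (Suc j)" for x
    proof -
      have "x \<notin> affected j" "x \<noteq> bb j" "x \<noteq> cc j" "x \<noteq> aa j" "x \<noteq> dd j"
        using that by (auto simp: affected_def less_Suc_eq)
      then show ?thesis using out by (simp add: ap)
    qed
    moreover have "be (Suc j) (bb l) = cc l \<and> be (Suc j) (cc l) = bb l \<and>
        be (Suc j) (aa l) = dd l \<and> be (Suc j) (dd l) = aa l" if "l < Suc j" for l
    proof (cases "l = j")
      case True
      then show ?thesis
        using distinct_arcs[OF j j] not_sym[OF distinct_arcs(1)[OF j j]] not_sym[OF distinct_arcs(2)[OF j j]]
          not_sym[OF distinct_arcs(3)[OF j j]] not_sym[OF distinct_arcs(4)[OF j j]]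
          not_sym[OF distinct_arcs(5)[OF j j]] not_sym[OF distinct_arcs(6)[OF j j]] by (simp add: ap)
    next
      case False
      then have l: "l < j" "l < r" using that j by auto
      have mem: "bb l \<in> affected j" "cc l \<in> affected j" "aa l \<in> affected j" "dd l \<in> affected j"
        using l(1) by (auto simp: affected_def)
      have "bb l \<notin> {bb j, cc j, aa j, dd j}" "cc l \<notin> {bb j, cc j, aa j, dd j}"
        "aa l \<notin> {bb j, cc j, aa j, dd j}" "dd l \<notin> {bb j, cc j, aa j, dd j}"
        using not_affected[OF j] mem by blast+
      then show ?thesis using inn[OF l(1)] by (simp add: ap)
    qed
    ultimately show ?thesis using * by (simp add: good_def)
  qed
  have good0: "good 0" using \<alpha> by (simp add: good_def)
  show good: "good j" if "j \<le> r" for j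
    using that by (induction j) (use good0 step in auto)
  show "adj n (be j) (be (Suc j))" if "j < r" for j
    using step[OF that] good that by simp
qed

lemma refold_states: "j \<le> radius s \<Longrightarrow> refold \<alpha> s j \<in> states n g"
  using good_refold by (simp add: good_def)

lemma refold_adj: "j < radius s \<Longrightarrow> adj n (refold \<alpha> s j) (refold \<alpha> s (Suc j))"
  by (rule adj_refold)

text \<open>Distinctness of the vertices along the two paths comes from \<open>rep\<close>.
  Consecutive arcs meet because the old rotation from the head of one to the tail of the next
  survives except for its entrance, which \<open>orbit_arc\<close> tolerates.\<close>

lemma refold_simple_paths:
  assumes J: "J \<le> radius s"
  shows "j \<le> J \<Longrightarrow> simple_path n (refold \<alpha> s J) (bwd_path s j)"
    and "j \<le> J \<Longrightarrow> simple_path n (refold \<alpha> s J) (fwd_path \<alpha> s j)"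
proof -
  have good: "good J" by (rule good_refold[OF J])
  have img: "be J (bb l) = cc l" "be J (cc l) = bb l" "be J (aa l) = dd l" "be J (dd l) = aa l" if "l < J" for l
    using good that by (auto simp: good_def)
  have b: "rep J (vertex n \<alpha> (bb l)) = v (r - (l + 1))" if "l < J" for l
    using rep_left[of J "l + 1"] J that by (simp add: vb)
  have d: "rep J (vertex n \<alpha> (dd l)) = v (r - (l + 1))" if "l < J" for l
    using rep_right[of "l + 1" J] J that by (simp add: vd)
  have ne: "v (r - (l + 1)) \<noteq> v (r - (m + 1))" if "l < J" "m < J" "l \<noteq> m" for l m
    using v_eq_iff[of "r - (l + 1)" "r - (m + 1)"] that J r_k by auto
  have ne0: "v (r - (l + 1)) \<noteq> v r" if "l < J" for l
    using v_eq_iff[of "r - (l + 1)" r] that J r_k by auto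
  have in_path: "x \<in> set (bwd_path s j) \<longleftrightarrow> (\<exists>l<j. x = bb l)" for x j
    by (induction j) (auto simp: less_Suc_eq)
  have in_path': "x \<in> set (fwd_path \<alpha> s j) \<longleftrightarrow> (\<exists>l<j. x = dd l)" for x j
    by (induction j) (auto simp: less_Suc_eq)
  have last: "last (bwd_path s (Suc j)) = bb 0" "last (fwd_path \<alpha> s (Suc j)) = dd 0" for j
    by (induction j) simp_all
  show "simple_path n (be J) (bwd_path s j)" if "j \<le> J"
    using that
  proof (induction j)
    case (Suc j)
    then have j: "j < J" "j < r" using J by auto
    have "vertex n (be J) (be J (bb j)) = vertex n (be J) (hd (bwd_path s j))" if ne: "bwd_path s j \<noteq> []"
    proof -
      obtain l where l: "j = Suc l" using ne by (cases j) auto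
      have "bb l \<in> orbit (cyc n \<circ> be J) (cc j)"
      proof (rule orbit_arc[where p = "cyc n \<circ> \<alpha>" and a = "aa j"])
        show "bb l \<in> orbit (cyc n \<circ> \<alpha>) (aa j)" using l j by (simp add: v_orbit va vb)
        show "(cyc n \<circ> be J) (cc j) = (cyc n \<circ> \<alpha>) (aa j)"
          using img(2)[OF j(1)] by (simp add: pairing_involution[OF p])
        fix w assume w: "w \<in> orbit (cyc n \<circ> \<alpha>) (aa j)" "w \<noteq> aa j" "w \<noteq> bb l"
        have "be J w = \<alpha> w"
          using w l j by (intro only_left[OF J good, of j]) (auto simp: v_orbit va)
        then show "(cyc n \<circ> be J) w = (cyc n \<circ> \<alpha>) w" by simp
      qed
      then have "vertex n (be J) (bb l) = vertex n (be J) (cc j)" by (rule be_orbit[OF good])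
      then show ?thesis using l j(1) img(1) by simp
    qed
    note nxt = this
    have sep: "vertex n (be J) (bb j) \<noteq> vertex n (be J) (bb l)" if "l < j" for l
      using that j J b[of j] b[of l] ne[of j l] in_D(1)[of l]
      by (intro separated[OF J good]) auto
    have sep0: "vertex n (be J) (bb j) \<noteq> vertex n (be J) (be J (bb 0))"
      using j J b[of j] ne0[of j] in_D(2)[of 0] img(1)[of 0] rep_right[of 0 J] vc[of 0]
      by (intro separated[OF J good]) auto
    have "vertex n (be J) (bb j) \<notin>
        insert (vertex n (be J) (be J (bb 0))) (vertex n (be J) ` set (bwd_path s j))"
    proof
      assume "vertex n (be J) (bb j) \<in>
        insert (vertex n (be J) (be J (bb 0))) (vertex n (be J) ` set (bwd_path s j))"
      then show False
      proof (elim insertE imageE)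
        assume "vertex n (be J) (bb j) = vertex n (be J) (be J (bb 0))"
        with sep0 show False by contradiction
      next
        fix z assume z: "vertex n (be J) (bb j) = vertex n (be J) z" "z \<in> set (bwd_path s j)"
        then obtain l where "l < j" "z = bb l" using in_path by blast
        with z(1) sep[of l] show False by simp
      qed
    qed
    moreover have "simple_path n (be J) (bwd_path s j)" using Suc by simp
    ultimately show ?case
      unfolding bwd_path.simps simple_path.simps last(1)[of j, unfolded bwd_path.simps]
      by (intro conjI impI nxt in_D(1)[OF j(2)])
  qed simp
  show "simple_path n (be J) (fwd_path \<alpha> s j)" if "j \<le> J"
    using that
  proof (induction j)
    case (Suc j)
    then have j: "j < J" "j < r" using J by auto
    have "vertex n (be J) (be J (dd j)) = vertex n (be J) (hd (fwd_path \<alpha> s j))" if ne: "fwd_path \<alpha> s j \<noteq> []"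
    proof -
      obtain l where l: "j = Suc l" using ne by (cases j) auto
      have "dd l \<in> orbit (cyc n \<circ> be J) (aa j)"
      proof (rule orbit_arc[where p = "cyc n \<circ> \<alpha>" and a = "cc j"])
        show "dd l \<in> orbit (cyc n \<circ> \<alpha>) (cc j)" using l j by (simp add: v_orbit vd vc)
        show "(cyc n \<circ> be J) (aa j) = (cyc n \<circ> \<alpha>) (cc j)"
          using img(3)[OF j(1)] by simp
        fix w assume w: "w \<in> orbit (cyc n \<circ> \<alpha>) (cc j)" "w \<noteq> cc j" "w \<noteq> dd l"
        have "be J w = \<alpha> w"
          using w l j r_k by (intro only_right[OF J good, of j]) (auto simp: v_orbit vc)
        then show "(cyc n \<circ> be J) w = (cyc n \<circ> \<alpha>) w" by simp
      qed
      then have "vertex n (be J) (dd l) = vertex n (be J) (aa j)" by (rule be_orbit[OF good])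
      then show ?thesis using l j(1) img(4) by simp
    qed
    note nxt = this
    have sep: "vertex n (be J) (dd j) \<noteq> vertex n (be J) (dd l)" if "l < j" for l
      using that j J d[of j] d[of l] ne[of j l] in_D(4)[of l]
      by (intro separated[OF J good]) auto
    have sep0: "vertex n (be J) (dd j) \<noteq> vertex n (be J) (be J (dd 0))"
      using j J d[of j] ne0[of j] in_D(3)[of 0] img(4)[of 0] rep_left[of J 0] va[of 0]
      by (intro separated[OF J good]) auto
    have "vertex n (be J) (dd j) \<notin>
        insert (vertex n (be J) (be J (dd 0))) (vertex n (be J) ` set (fwd_path \<alpha> s j))"
    proof
      assume "vertex n (be J) (dd j) \<in>
        insert (vertex n (be J) (be J (dd 0))) (vertex n (be J) ` set (fwd_path \<alpha> s j))"
      then show False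
      proof (elim insertE imageE)
        assume "vertex n (be J) (dd j) = vertex n (be J) (be J (dd 0))"
        with sep0 show False by contradiction
      next
        fix z assume z: "vertex n (be J) (dd j) = vertex n (be J) z" "z \<in> set (fwd_path \<alpha> s j)"
        then obtain l where "l < j" "z = dd l" using in_path' by blast
        with z(1) sep[of l] show False by simp
      qed
    qed
    moreover have "simple_path n (be J) (fwd_path \<alpha> s j)" using Suc by simp
    ultimately show ?case
      unfolding fwd_path.simps simple_path.simps last(2)[of j, unfolded fwd_path.simps]
      by (intro conjI impI nxt in_D(4)[OF j(2)])
  qed simp
qed

lemma affected_subset: "j \<le> radius s \<Longrightarrow> affected j \<subseteq> set s \<union> \<alpha> ` set s"
proof -
  assume "j \<le> r"
  then have "bb l \<in> set s" "cc l \<in> set s" if "l < j" for l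
    using that r_k by (auto simp: bwd_def fwd_def)
  then show ?thesis by (auto simp: affected_def)
qed

lemma refold_unaffected: "j \<le> radius s \<Longrightarrow> x \<notin> set s \<union> \<alpha> ` set s \<Longrightarrow> refold \<alpha> s j x = \<alpha> x"
  using good_refold affected_subset unfolding good_def by blast

text \<open>The tip of a leaf is a vertex with a single side, so a cycle entering it would have to
  leave along the same chord. Hence folding preserves leaves.\<close>

lemma leaf_not_in_cycle:
  assumes l: "\<alpha> x = cyc n x"
  shows "{x, cyc n x} \<inter> (set s \<union> \<alpha> ` set s) = {}"
proof -
  have ax: "\<alpha> (cyc n x) = x" using l pairing_involution[OF p] by metis
  have single: "vertex n \<alpha> y = vertex n \<alpha> (cyc n x) \<longleftrightarrow> y = cyc n x" for y
    by (rule vertex_fixed[OF p]) (simp add: ax)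
  have 1: "x \<notin> set s"
  proof
    assume "x \<in> set s"
    then obtain i where i: "i < k" "s ! i = x" by (auto simp: in_set_conv_nth)
    then have "s ! (Suc i mod k) = cyc n x" using v_end[OF i(1)] l single by metis
    then show False using s i l by (auto simp: cycle_def)
  qed
  have 2: "cyc n x \<notin> set s"
  proof
    assume "cyc n x \<in> set s"
    then obtain i where i: "i < k" "s ! i = cyc n x" by (auto simp: in_set_conv_nth)
    define i' where "i' = (if i = 0 then k - 1 else i - 1)"
    have i': "i' < k" "Suc i' mod k = i" using i k_pos by (auto simp: i'_def)
    then have "\<alpha> (s ! i') = cyc n x" using v_end[OF i'(1)] i single by metis
    then show False using s i i' unfolding cycle_def by metis
  qed
  have "x \<notin> \<alpha> ` set s" "cyc n x \<notin> \<alpha> ` set s"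
    using 1 2 ax l pairing_involution[OF p] by (metis imageE)+
  with 1 2 show ?thesis by blast
qed

text \<open>Of \<open>2 * r + 1\<close> arcs, \<open>2 * r\<close> are folded in pairs. The
  remaining one leads from the last vertex of the cycle to the first, and these two have been
  merged.\<close>

lemma refold_loop:
  assumes "odd (length s)"
  shows "\<exists>x\<in>{1..2 * n}. vertex n (refold \<alpha> s (radius s)) x
    = vertex n (refold \<alpha> s (radius s)) (refold \<alpha> s (radius s) x)"
proof -
  have k: "k = 2 * r + 1" using assms by (auto simp: radius_def elim: oddE)
  let ?x = "s ! (2 * r)"
  have na: "?x \<notin> affected r"
  proof
    assume "?x \<in> affected r"
    then obtain l where l: "l < r" "?x = bb l \<or> ?x = cc l \<or> ?x = aa l \<or> ?x = dd l"
      by (auto simp: affected_def)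
    have idx: "r - 1 - l < k" "r + l < k" "2 * r < k" using l(1) k by auto
    have "?x \<noteq> aa l" "?x \<noteq> dd l"
      using s_partner[OF idx(1,3)] s_partner[OF idx(2,3)] by (simp_all only: bwd_def fwd_def not_False_eq_True neq_commute)
    moreover have "?x \<noteq> bb l" "?x \<noteq> cc l"
      using s_eq_iff[OF idx(3,1)] s_eq_iff[OF idx(3,2)] l(1) by (auto simp: bwd_def fwd_def)
    ultimately show False using l(2) by blast
  qed
  then have "be r ?x = \<alpha> ?x" using good_refold[of r] by (simp add: good_def)
  moreover have "vertex n (be r) (\<alpha> ?x) = vertex n (be r) ?x"
    using v_end[of "2 * r"] k by (intro merged good_refold) (auto simp: mult_2)
  ultimately show ?thesis using s_in[of "2 * r"] k by (intro bexI[of _ ?x]) auto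
qed

text \<open>Two arcs remain, meeting at the vertex opposite to the middle, which folding never
  reaches; their other ends have been merged.\<close>

lemma refold_double_edge:
  assumes "even (length s)"
  shows "\<exists>x y. x \<in> set s \<and> y \<in> set s \<and>
    refold \<alpha> s (radius s) x = \<alpha> x \<and> refold \<alpha> s (radius s) y = \<alpha> y \<and> y \<noteq> \<alpha> x \<and> x \<noteq> y \<and>
    vertex n (refold \<alpha> s (radius s)) x = vertex n (refold \<alpha> s (radius s)) (\<alpha> y) \<and>
    vertex n (refold \<alpha> s (radius s)) y = vertex n (refold \<alpha> s (radius s)) (\<alpha> x) \<and>
    vertex n (refold \<alpha> s (radius s)) x \<noteq> vertex n (refold \<alpha> s (radius s)) y"
proof -
  have k: "k = 2 * r + 2" using assms k_pos unfolding radius_def by presburger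
  let ?x = "s ! (2 * r)" and ?y = "s ! (2 * r + 1)"
  have good: "good r" by (rule good_refold) simp
  have na: "s ! i \<notin> affected r" if "2 * r \<le> i" "i < k" for i
  proof
    assume "s ! i \<in> affected r"
    then obtain l where l: "l < r" "s ! i = bb l \<or> s ! i = cc l \<or> s ! i = aa l \<or> s ! i = dd l"
      by (auto simp: affected_def)
    have idx: "r - 1 - l < k" "r + l < k" using l(1) k by auto
    have "s ! i \<noteq> aa l" "s ! i \<noteq> dd l"
      using s_partner[OF idx(1) that(2)] s_partner[OF idx(2) that(2)]
      by (simp_all only: bwd_def fwd_def not_False_eq_True neq_commute)
    moreover have "s ! i \<noteq> bb l" "s ! i \<noteq> cc l"
      using s_eq_iff[OF that(2) idx(1)] s_eq_iff[OF that(2) idx(2)] l(1) that by (auto simp: bwd_def fwd_def)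
    ultimately show False using l(2) by blast
  qed
  have img: "be r ?x = \<alpha> ?x" "be r ?y = \<alpha> ?y"
    using na[of "2 * r"] na[of "2 * r + 1"] good k by (simp_all add: good_def)
  have 1: "vertex n (be r) (\<alpha> ?y) = vertex n (be r) ?x"
    using v_end[of "2 * r + 1"] k by (intro merged good) (auto simp: mult_2)
  have "?y \<in> orbit (cyc n \<circ> be r) (\<alpha> ?x)"
  proof (rule orbit_arc[where p = "cyc n \<circ> \<alpha>" and a = "\<alpha> ?x"])
    have *: "vertex n \<alpha> (\<alpha> ?x) = v (2 * r + 1)" using v_end[of "2 * r"] k by simp
    then show "?y \<in> orbit (cyc n \<circ> \<alpha>) (\<alpha> ?x)" by (simp add: v_orbit)
    have same: "be r w = \<alpha> w" if "vertex n \<alpha> w = v (2 * r + 1)" for w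
      using that k by (intro only_right[OF _ good, of "r + 1"]) (auto simp: mult_2)
    show "(cyc n \<circ> be r) (\<alpha> ?x) = (cyc n \<circ> \<alpha>) (\<alpha> ?x)" using same * by simp
    fix w assume "w \<in> orbit (cyc n \<circ> \<alpha>) (\<alpha> ?x)"
    then show "(cyc n \<circ> be r) w = (cyc n \<circ> \<alpha>) w" using same * by (simp add: v_orbit)
  qed
  then have 2: "vertex n (be r) ?y = vertex n (be r) (\<alpha> ?x)" by (rule be_orbit[OF good])
  have 3: "vertex n (be r) ?x \<noteq> vertex n (be r) ?y"
  proof (rule separated[OF _ good])
    have "rep r (v (r + r)) = v (r - r)" "rep r (v (r + (r + 1))) = v (r + (r + 1))"
      using k by (intro rep_right rep_out; simp)+
    moreover have "v 0 \<noteq> v (2 * r + 1)" using v_eq_iff[of 0 "2 * r + 1"] k by simp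
    ultimately show "rep r (vertex n \<alpha> ?x) \<noteq> rep r (vertex n \<alpha> ?y)" by (simp add: mult_2)
  qed (use s_in[of "2 * r + 1"] k in auto)
  have "?y \<noteq> \<alpha> ?x" "?x \<noteq> ?y" using s_partner[of "2 * r" "2 * r + 1"] 3 k by auto
  moreover have "?x \<in> set s" "?y \<in> set s" using k by auto
  ultimately show ?thesis using img 1 2 3 by (intro exI[of _ ?x] exI[of _ ?y]) auto
qed

end

text \<open>By \<open>unfold_along\<close> the starting diagram is recovered from the current one
  and two of its simple paths, so the congestion at any time is at most the square of the number of
  simple paths. Time is capped at the radius to give all routes the common length
  \<open>n\<close>.\<close>

lemma flows_refold:
  assumes n: "1 \<le> n" and A: "A \<subseteq> states n g" and cyc: "\<And>\<alpha>. \<alpha> \<in> A \<Longrightarrow> cycle n \<alpha> (s \<alpha>)"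
    and A': "(\<lambda>\<alpha>. refold \<alpha> (s \<alpha>) (radius (s \<alpha>))) ` A \<subseteq> A'" "A' \<subseteq> states n g"
  shows "flows n g A A' ((real n ^ 2 + 1) * (1 + (2 * real n)\<^sup>2 * 2 ^ (2 * g))\<^sup>2)"
proof (rule flows_path[where st = "\<lambda>i \<alpha>. refold \<alpha> (s \<alpha>) (min i (radius (s \<alpha>)))"])
  have rad: "radius (s \<alpha>) \<le> n" if "\<alpha> \<in> A" for \<alpha>
    using radius_le[of \<alpha> n g] that A cyc by auto
  show "(\<lambda>\<alpha>. refold \<alpha> (s \<alpha>) (min n (radius (s \<alpha>)))) ` A \<subseteq> A'"
    using A' rad by (auto simp: min_absorb2)
  fix \<alpha> i assume \<alpha>: "\<alpha> \<in> A"
  then have st: "\<alpha> \<in> states n g" using A by auto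
  show "refold \<alpha> (s \<alpha>) (min (Suc i) (radius (s \<alpha>))) \<in> states n g"
    by (rule refold_states[OF st cyc[OF \<alpha>]]) simp
  show "refold \<alpha> (s \<alpha>) (min (Suc i) (radius (s \<alpha>))) = refold \<alpha> (s \<alpha>) (min i (radius (s \<alpha>))) \<or>
    adj n (refold \<alpha> (s \<alpha>) (min i (radius (s \<alpha>)))) (refold \<alpha> (s \<alpha>) (min (Suc i) (radius (s \<alpha>))))"
    using refold_adj[OF st cyc[OF \<alpha>], of i] by (cases "i < radius (s \<alpha>)") (auto simp: min_def)
next
  fix i \<beta> assume \<beta>: "\<beta> \<in> states n g"
  let ?P = "{xs. simple_path n \<beta> xs}"
  let ?C = "{\<alpha> \<in> A. refold \<alpha> (s \<alpha>) (min i (radius (s \<alpha>))) = \<beta>}"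
  let ?h = "\<lambda>\<alpha>. (bwd_path (s \<alpha>) (min i (radius (s \<alpha>))), fwd_path \<alpha> (s \<alpha>) (min i (radius (s \<alpha>))))"
  note P = card_simple_paths[OF \<beta> n]
  have "card ?C \<le> card (?P \<times> ?P)"
  proof (rule card_inj_on_le)
    show "inj_on ?h ?C"
    proof (rule inj_onI)
      fix \<alpha> \<alpha>' assume 1: "\<alpha> \<in> ?C" "\<alpha>' \<in> ?C" and 2: "?h \<alpha> = ?h \<alpha>'"
      have "\<alpha> = unfold_along \<beta> (fst (?h \<alpha>)) (snd (?h \<alpha>))"
        using 1 unfold_refold[of \<alpha> "s \<alpha>" "min i (radius (s \<alpha>))"] by simp
      moreover have "\<alpha>' = unfold_along \<beta> (fst (?h \<alpha>')) (snd (?h \<alpha>'))"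
        using 1 unfold_refold[of \<alpha>' "s \<alpha>'" "min i (radius (s \<alpha>'))"] by simp
      ultimately show "\<alpha> = \<alpha>'" using 2 by metis
    qed
    show "?h ` ?C \<subseteq> ?P \<times> ?P"
    proof (rule image_subsetI)
      fix \<alpha> assume \<alpha>: "\<alpha> \<in> ?C"
      then have "\<alpha> \<in> states n g" "cycle n \<alpha> (s \<alpha>)" using A cyc by auto
      from refold_simple_paths[OF this, of "min i (radius (s \<alpha>))"] \<alpha>
      show "?h \<alpha> \<in> ?P \<times> ?P" by simp
    qed
  qed (use P in simp)
  also have "\<dots> \<le> (1 + (2 * n)\<^sup>2 * 2 ^ (2 * g))\<^sup>2"
    using mult_le_mono[OF P(2) P(2)] by (simp add: card_cartesian_product power2_eq_square)
  finally have "real (card ?C) \<le> real ((1 + (2 * n)\<^sup>2 * 2 ^ (2 * g))\<^sup>2)"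
    by (rule of_nat_mono)
  then show "real (card ?C) \<le> (1 + (2 * real n)\<^sup>2 * 2 ^ (2 * g))\<^sup>2" by simp
qed (use A A' in auto)

lemma flows_id: "A \<subseteq> A' \<Longrightarrow> A' \<subseteq> states n g \<Longrightarrow> flows n g A A' 1"
proof -
  assume A: "A \<subseteq> A'" "A' \<subseteq> states n g"
  have "real (card {\<alpha> \<in> A. \<alpha> = \<beta>}) \<le> 1" for \<beta>
  proof -
    have "{\<alpha> \<in> A. \<alpha> = \<beta>} \<subseteq> {\<beta>}" by auto
    then have "card {\<alpha> \<in> A. \<alpha> = \<beta>} \<le> card {\<beta>}" by (intro card_mono) auto
    then show ?thesis by simp
  qed
  then show ?thesis
    unfolding flows_def using A energy_nonneg by (intro conjI exI[of _ "\<lambda>\<alpha>. \<alpha>"]) auto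
qed

lemma flows_Un:
  assumes "flows n g A A' B" "flows n g A2 A' B"
  shows "flows n g (A \<union> A2) A' (2 * B)"
proof -
  from assms(1) obtain \<phi> where A: "A \<subseteq> states n g" "A' \<subseteq> states n g" and \<phi>: "\<phi> ` A \<subseteq> A'"
    and 1: "\<And>f. (\<Sum>\<alpha>\<in>A. (f \<alpha> - f (\<phi> \<alpha>))\<^sup>2) \<le> B * energy n g f"
    and 2: "\<And>\<beta>. real (card {\<alpha> \<in> A. \<phi> \<alpha> = \<beta>}) \<le> B"
    unfolding flows_def by blast
  from assms(2) obtain \<psi> where A2: "A2 \<subseteq> states n g" and \<psi>: "\<psi> ` A2 \<subseteq> A'"
    and 3: "\<And>f. (\<Sum>\<alpha>\<in>A2. (f \<alpha> - f (\<psi> \<alpha>))\<^sup>2) \<le> B * energy n g f"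
    and 4: "\<And>\<beta>. real (card {\<alpha> \<in> A2. \<psi> \<alpha> = \<beta>}) \<le> B"
    unfolding flows_def by blast
  have fin: "finite A" "finite A2"
    using finite_subset[OF A(1) finite_states] finite_subset[OF A2 finite_states] .
  let ?h = "\<lambda>\<alpha>. if \<alpha> \<in> A then \<phi> \<alpha> else \<psi> \<alpha>"
  have "(\<Sum>\<alpha>\<in>A \<union> A2. (f \<alpha> - f (?h \<alpha>))\<^sup>2) \<le> 2 * B * energy n g f" for f
  proof -
    have "(\<Sum>\<alpha>\<in>A \<union> A2. (f \<alpha> - f (?h \<alpha>))\<^sup>2)
        = (\<Sum>\<alpha>\<in>A. (f \<alpha> - f (?h \<alpha>))\<^sup>2) + (\<Sum>\<alpha>\<in>A2 - A. (f \<alpha> - f (?h \<alpha>))\<^sup>2)"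
      using sum.union_disjoint[of A "A2 - A" "\<lambda>\<alpha>. (f \<alpha> - f (?h \<alpha>))\<^sup>2"] fin by simp
    also have "(\<Sum>\<alpha>\<in>A2 - A. (f \<alpha> - f (?h \<alpha>))\<^sup>2) \<le> (\<Sum>\<alpha>\<in>A2. (f \<alpha> - f (\<psi> \<alpha>))\<^sup>2)"
    proof -
      have "(\<Sum>\<alpha>\<in>A2 - A. (f \<alpha> - f (?h \<alpha>))\<^sup>2) = (\<Sum>\<alpha>\<in>A2 - A. (f \<alpha> - f (\<psi> \<alpha>))\<^sup>2)"
        by (intro sum.cong) auto
      also have "\<dots> \<le> (\<Sum>\<alpha>\<in>A2. (f \<alpha> - f (\<psi> \<alpha>))\<^sup>2)" using fin by (intro sum_mono2) auto
      finally show ?thesis .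
    qed
    also have "(\<Sum>\<alpha>\<in>A. (f \<alpha> - f (?h \<alpha>))\<^sup>2) = (\<Sum>\<alpha>\<in>A. (f \<alpha> - f (\<phi> \<alpha>))\<^sup>2)"
      by (intro sum.cong) auto
    finally show ?thesis using 1[of f] 3[of f] by simp
  qed
  moreover have "real (card {\<alpha> \<in> A \<union> A2. ?h \<alpha> = \<beta>}) \<le> 2 * B" for \<beta>
  proof -
    have "card {\<alpha> \<in> A \<union> A2. ?h \<alpha> = \<beta>} \<le> card ({\<alpha> \<in> A. \<phi> \<alpha> = \<beta>} \<union> {\<alpha> \<in> A2. \<psi> \<alpha> = \<beta>})"
      using fin by (intro card_mono) auto
    also have "\<dots> \<le> card {\<alpha> \<in> A. \<phi> \<alpha> = \<beta>} + card {\<alpha> \<in> A2. \<psi> \<alpha> = \<beta>}" by (rule card_Un_le)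
    finally show ?thesis using 2[of \<beta>] 4[of \<beta>] by linarith
  qed
  ultimately show ?thesis
    unfolding flows_def using A A2 \<phi> \<psi> by (intro conjI exI[of _ ?h]) (auto simp: image_subset_iff)
qed

text \<open>In a diagram that is not mixed, parity is constant on vertices and makes the graph formed by the
  vertices and chords bipartite. A mixed diagram has an odd cycle, found along the boundary of the
  polygon between \<open>x\<close> and \<open>\<alpha> x\<close>.\<close>

definition mixed :: "nat \<Rightarrow> (nat \<Rightarrow> nat) \<Rightarrow> bool" where
  "mixed n \<alpha> \<longleftrightarrow> (\<exists>x\<in>{1..2 * n}. even (x + \<alpha> x))"

lemma even_cyc: "x \<in> {1..2 * n} \<Longrightarrow> even (cyc n x) \<longleftrightarrow> odd x"
  by (cases "x = 2 * n") (auto simp: cyc_less cyc_last)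

lemma not_mixed_vertex:
  assumes \<alpha>: "\<alpha> \<in> pairings n" and "\<not> mixed n \<alpha>" and "vertex n \<alpha> x = vertex n \<alpha> y" "y \<in> {1..2 * n}"
  shows "even x \<longleftrightarrow> even y"
proof (rule vertex_invariant[OF \<alpha> _ assms(3,4), where h = even])
  fix z assume z: "z \<in> {1..2 * n}"
  then have "\<alpha> z \<in> {1..2 * n}" using pairing_in[OF \<alpha>] by blast
  then show "even (cyc n (\<alpha> z)) \<longleftrightarrow> even z" using assms(2) z by (auto simp: even_cyc mixed_def)
qed

section \<open>Existence of cycles\<close>

fun walk :: "nat \<Rightarrow> (nat \<Rightarrow> nat) \<Rightarrow> nat set \<Rightarrow> nat list \<Rightarrow> nat set \<Rightarrow> bool" where
  "walk n \<alpha> u [] w \<longleftrightarrow> u = w"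
| "walk n \<alpha> u (x # xs) w \<longleftrightarrow> u = vertex n \<alpha> x \<and> walk n \<alpha> (vertex n \<alpha> (\<alpha> x)) xs w"

lemma walk_append: "walk n \<alpha> u (xs @ ys) w \<longleftrightarrow> (\<exists>m. walk n \<alpha> u xs m \<and> walk n \<alpha> m ys w)"
  by (induction xs arbitrary: u) auto

lemma walk_hd: "walk n \<alpha> u xs w \<Longrightarrow> xs \<noteq> [] \<Longrightarrow> u = vertex n \<alpha> (xs ! 0)"
  by (cases xs) auto

lemma walk_nth: "walk n \<alpha> u xs w \<Longrightarrow> i < length xs \<Longrightarrow>
    vertex n \<alpha> (\<alpha> (xs ! i)) = (if Suc i < length xs then vertex n \<alpha> (xs ! Suc i) else w)"
proof (induction xs arbitrary: u i)
  case (Cons x xs)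
  then show ?case
  proof (cases i)
    case 0
    then show ?thesis using Cons.prems walk_hd[of n \<alpha> "vertex n \<alpha> (\<alpha> x)" xs w] by (cases xs) auto
  next
    case (Suc j)
    then show ?thesis using Cons.IH[of "vertex n \<alpha> (\<alpha> x)" j] Cons.prems by simp
  qed
qed simp

lemma walk_sides:
  assumes \<alpha>: "\<alpha> \<in> pairings n" and "1 \<le> a"
  shows "a \<le> b \<Longrightarrow> b \<le> 2 * n \<Longrightarrow> walk n \<alpha> (vertex n \<alpha> a) [a..<b] (vertex n \<alpha> b)"
proof (induction b rule: dec_induct)
  case (step b)
  have "vertex n \<alpha> (\<alpha> b) = vertex n \<alpha> (Suc b)"
    using vertex_cyc[OF \<alpha>, of b] step assms(2) by (simp add: cyc_less)
  then show ?case using step by (simp add: walk_append)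
qed simp

text \<open>Take a shortest closed walk of odd length. At a repeated vertex it would fall into two
  closed walks, one of them odd and shorter.\<close>

lemma odd_cycle_exists:
  assumes \<alpha>: "\<alpha> \<in> pairings n" and "mixed n \<alpha>"
  shows "\<exists>s. cycle n \<alpha> s \<and> odd (length s)"
proof -
  define P where "P s \<longleftrightarrow> (\<exists>u. walk n \<alpha> u s u) \<and> odd (length s) \<and> set s \<subseteq> {1..2 * n}" for s
  obtain x where x: "x \<in> {1..2 * n}" "even (x + \<alpha> x)" using assms(2) by (auto simp: mixed_def)
  define a b where "a = min x (\<alpha> x)" and "b = max x (\<alpha> x)"
  have ab: "a \<in> {1..2 * n}" "b \<in> {1..2 * n}" "\<alpha> a = b" "even (a + b)" "a < b"
    using x pairing_in[OF \<alpha>, of x] pairing_involution[OF \<alpha>, of x] pairing_neq[OF \<alpha> x(1)]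
    by (auto simp: a_def b_def min_def max_def add.commute)
  \<comment> \<open>The sides strictly between \<open>a\<close> and \<open>b\<close> form a closed
    walk, because the chord glues the end of \<open>a\<close> to the beginning of \<open>b\<close>;
    their number \<open>b - a - 1\<close> is odd.\<close>
  have "vertex n \<alpha> (Suc a) = vertex n \<alpha> b"
    using vertex_cyc[OF \<alpha>, of a] ab by (simp add: cyc_less)
  then have "P [Suc a..<b]"
    using walk_sides[OF \<alpha>, of "Suc a" b] ab unfolding P_def by (intro conjI exI[of _ "vertex n \<alpha> b"]) auto
  then obtain s where s: "P s" and least: "\<And>s'. P s' \<Longrightarrow> length s \<le> length s'"
    using ex_has_least_nat[of P _ length] by blast
  from s obtain u where u: "walk n \<alpha> u s u" and odd: "odd (length s)" and sub: "set s \<subseteq> {1..2 * n}"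
    by (auto simp: P_def)
  have ne: "s \<noteq> []" using odd by auto
  have dist: "distinct (map (vertex n \<alpha>) s)"
  proof (rule ccontr)
    assume "\<not> distinct (map (vertex n \<alpha>) s)"
    then obtain as bs cs v where "map (vertex n \<alpha>) s = as @ [v] @ bs @ [v] @ cs"
      using not_distinct_decomp by blast
    then obtain as' x bs' y cs' where split: "s = as' @ x # bs' @ y # cs'"
      and v: "vertex n \<alpha> x = vertex n \<alpha> y"
      by (auto simp: map_eq_append_conv map_eq_Cons_conv append_eq_map_conv Cons_eq_map_conv)
    have split': "s = as' @ ((x # bs') @ (y # cs'))" unfolding split by simp
    obtain m m' where m: "walk n \<alpha> u as' m" and m': "walk n \<alpha> m (x # bs') m'" "walk n \<alpha> m' (y # cs') u"
      using u unfolding split' walk_append by blast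
    have mm: "m = vertex n \<alpha> x" "m' = m" using m'(1,2) v by simp_all
    have "walk n \<alpha> m (x # bs') m" using m'(1) mm by simp
    then have 1: "P (x # bs')" if "odd (length (x # bs'))"
      using that sub unfolding P_def split by (intro conjI exI[of _ m]) auto
    have "walk n \<alpha> u (as' @ y # cs') u" unfolding walk_append using m m'(2) mm by blast
    then have 2: "P (as' @ y # cs')" if "odd (length (as' @ y # cs'))"
      using that sub unfolding P_def split by (intro conjI exI[of _ u]) auto
    have "odd (length (x # bs')) \<or> odd (length (as' @ y # cs'))" using odd unfolding split by auto
    then show False
    proof
      assume "odd (length (x # bs'))"
      then show False using least[OF 1] unfolding split by simp
    next
      assume "odd (length (as' @ y # cs'))"
      then show False using least[OF 2] unfolding split by simp
    qed
  qed
  let ?k = "length s"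
  have k: "0 < ?k" using ne by simp
  have vend: "vertex n \<alpha> (\<alpha> (s ! i)) = vertex n \<alpha> (s ! (Suc i mod ?k))" if "i < ?k" for i
  proof (cases "Suc i < ?k")
    case False
    then have "Suc i = ?k" using that by simp
    then show ?thesis using walk_nth[OF u that] walk_hd[OF u ne] by simp
  qed (use walk_nth[OF u that] in simp)
  \<comment> \<open>Turning back along the same chord forces length 1 or 2; the first is excluded
    since no side is its own partner, the second by parity.\<close>
  have "\<alpha> (s ! i) \<noteq> s ! (Suc i mod ?k)" if i: "i < ?k" for i
  proof
    let ?j = "Suc i mod ?k"
    assume eq: "\<alpha> (s ! i) = s ! ?j"
    have j: "?j < ?k" using k by simp
    have si: "s ! i \<in> {1..2 * n}" using nth_mem[OF i] sub by blast
    have "\<alpha> (s ! ?j) = s ! i" using eq pairing_involution[OF \<alpha>] by metis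
    then have "vertex n \<alpha> (s ! i) = vertex n \<alpha> (s ! (Suc ?j mod ?k))" using vend[OF j] by simp
    then have "i = Suc ?j mod ?k"
      using nth_eq_iff_index_eq[OF dist, of i "Suc ?j mod ?k"] i k by simp
    moreover have "?k \<noteq> 1"
    proof
      assume "?k = 1"
      then have "\<alpha> (s ! i) = s ! i" using eq i by simp
      then show False using pairing_neq[OF \<alpha> si] by simp
    qed
    ultimately have "?k = 2" using i by (simp add: mod_Suc split: if_splits)
    then show False using odd by simp
  qed
  then have "cycle n \<alpha> s" using ne sub dist vend by (simp add: cycle_def)
  with odd show ?thesis by blast
qed

text \<open>Inside a nonempty set of chords with even degrees every arc can be continued at its head
  without turning back. A walk that never gets stuck repeats a vertex, and the stretch up to the
  first repetition closes to a cycle.\<close>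

lemma cycle_exists:
  assumes \<alpha>: "\<alpha> \<in> states n g" and g: "0 < g"
  shows "\<exists>s. cycle n \<alpha> s"
proof -
  note p = states_pairings[OF \<alpha>]
  obtain M where M: "M \<subseteq> chord_set n \<alpha>" "M \<noteq> {}" "\<forall>v\<in>vertices_of n \<alpha>. \<not> odd_degree n \<alpha> M v"
    using even_chords_exist[OF \<alpha> g] by blast
  define D where "D = {x \<in> {1..2 * n}. {x, \<alpha> x} \<in> M}"
  have finM: "finite M" using M(1) finite_chord_set by (rule finite_subset)
  have cont: "\<exists>y\<in>D. vertex n \<alpha> y = vertex n \<alpha> (\<alpha> x) \<and> y \<noteq> \<alpha> x" if x: "x \<in> D" for x
  proof (rule ccontr)
    assume none: "\<not> ?thesis"
    let ?v = "vertex n \<alpha> (\<alpha> x)"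
    have xD: "x \<in> {1..2 * n}" "{x, \<alpha> x} \<in> M" using x by (auto simp: D_def)
    \<comment> \<open>Without a continuation, \<open>\<alpha> x\<close> is the only end of a chord
      of \<open>M\<close> at its vertex, and the degree there is 1.\<close>
    have ends: "z = \<alpha> x" if "c \<in> M" "z \<in> c" "vertex n \<alpha> z = ?v" for c z
    proof -
      have "c \<in> chord_set n \<alpha>" using M(1) that(1) by blast
      then obtain w where w: "w \<in> {1..2 * n}" "c = {w, \<alpha> w}" by (auto simp: chord_set_def)
      then have "z \<in> {1..2 * n}" "{z, \<alpha> z} = c"
        using that(2) pairing_in[OF p, of w] pairing_involution[OF p, of w] by auto
      then have "z \<in> D" using that(1) by (simp add: D_def)
      then show ?thesis using none that(3) by blast
    qed
    have "(\<Sum>c\<in>M. card {z \<in> c. vertex n \<alpha> z = ?v}) = card {z \<in> {x, \<alpha> x}. vertex n \<alpha> z = ?v}"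
    proof (subst sum.remove[OF finM xD(2)])
      have "card {z \<in> c. vertex n \<alpha> z = ?v} = 0" if c: "c \<in> M - {{x, \<alpha> x}}" for c
      proof -
        have "c \<in> chord_set n \<alpha>" using M(1) c by blast
        then obtain w where w: "c = {w, \<alpha> w}" by (auto simp: chord_set_def)
        have "\<alpha> x \<notin> c"
        proof
          assume "\<alpha> x \<in> c"
          then have "w = \<alpha> x \<or> w = x" unfolding w using pairing_eq_iff[OF p] by auto
          then have "c = {x, \<alpha> x}" unfolding w using pairing_involution[OF p, of x] by auto
          then show False using c by simp
        qed
        then have "{z \<in> c. vertex n \<alpha> z = ?v} = {}" using ends c by blast
        then show ?thesis by (simp only: card.empty)
      qed
      then show "card {z \<in> {x, \<alpha> x}. vertex n \<alpha> z = ?v} +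
          (\<Sum>c\<in>M - {{x, \<alpha> x}}. card {z \<in> c. vertex n \<alpha> z = ?v}) = card {z \<in> {x, \<alpha> x}. vertex n \<alpha> z = ?v}"
        by simp
    qed
    also have "{z \<in> {x, \<alpha> x}. vertex n \<alpha> z = ?v} = {\<alpha> x}" using ends[OF xD(2)] by blast
    finally have "odd_degree n \<alpha> M ?v" by (simp add: odd_degree_def)
    moreover have "?v \<in> vertices_of n \<alpha>" using xD(1) pairing_in[OF p] by blast
    ultimately show False using M(3) by blast
  qed
  then obtain nx where nx: "\<And>x. x \<in> D \<Longrightarrow> nx x \<in> D"
    "\<And>x. x \<in> D \<Longrightarrow> vertex n \<alpha> (nx x) = vertex n \<alpha> (\<alpha> x)" "\<And>x. x \<in> D \<Longrightarrow> nx x \<noteq> \<alpha> x"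
    by metis
  obtain c where c: "c \<in> M" using M(2) by blast
  then have "c \<in> chord_set n \<alpha>" using M(1) by blast
  then obtain x0 where "x0 \<in> {1..2 * n}" "c = {x0, \<alpha> x0}" by (auto simp: chord_set_def)
  with c have x0: "x0 \<in> D" by (simp add: D_def)
  define z where "z i = (nx ^^ i) x0" for i
  have zD: "z i \<in> D" for i by (induction i) (auto simp: z_def x0 nx)
  have zs: "z (Suc i) = nx (z i)" for i by (simp add: z_def)
  have zv: "vertex n \<alpha> (\<alpha> (z i)) = vertex n \<alpha> (z (Suc i))" and zn: "z (Suc i) \<noteq> \<alpha> (z i)" for i
    using nx[OF zD[of i]] by (simp_all add: zs)
  define rep where "rep j \<longleftrightarrow> (\<exists>i<j. vertex n \<alpha> (z i) = vertex n \<alpha> (z j))" for j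
  have "\<not> inj_on (\<lambda>i. vertex n \<alpha> (z i)) UNIV"
  proof
    assume "inj_on (\<lambda>i. vertex n \<alpha> (z i)) UNIV"
    moreover have "(\<lambda>i. vertex n \<alpha> (z i)) ` UNIV \<subseteq> vertices_of n \<alpha>" using zD by (auto simp: D_def)
    ultimately have "finite (UNIV :: nat set)" by (rule inj_on_finite) simp
    then show False by simp
  qed
  then obtain i1 i2 where "i1 \<noteq> i2" "vertex n \<alpha> (z i1) = vertex n \<alpha> (z i2)" by (auto simp: inj_on_def)
  then have "rep (max i1 i2)" unfolding rep_def by (intro exI[of _ "min i1 i2"]) (auto simp: min_def max_def)
  then obtain j where j: "rep j" "\<And>j'. j' < j \<Longrightarrow> \<not> rep j'"
    using LeastI[of rep] not_less_Least[of _ rep] by blast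
  then obtain i where i: "i < j" "vertex n \<alpha> (z i) = vertex n \<alpha> (z j)" by (auto simp: rep_def)
  define s where "s = map z [i..<j]"
  have len: "length s = j - i" by (simp add: s_def)
  have nth: "s ! l = z (i + l)" if "l < j - i" for l using that by (simp add: s_def)
  have inj: "l = l'" if "vertex n \<alpha> (z l) = vertex n \<alpha> (z l')" "l < j" "l' < j" for l l'
  proof (rule ccontr)
    assume "l \<noteq> l'"
    with that have "rep (max l l')"
      unfolding rep_def by (intro exI[of _ "min l l'"]) (auto simp: min_def max_def)
    moreover have "max l l' < j" using that by simp
    ultimately show False using j(2) by blast
  qed
  have dist: "distinct (map (vertex n \<alpha>) s)"
    unfolding s_def map_map using inj by (auto simp: distinct_map inj_on_def)
  have last: "vertex n \<alpha> (\<alpha> (z (j - 1))) = vertex n \<alpha> (z i)" using zv[of "j - 1"] i by simp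
  have lastn: "\<alpha> (z (j - 1)) \<noteq> z i"
  proof
    assume eq: "\<alpha> (z (j - 1)) = z i"
    then have eq': "\<alpha> (z i) = z (j - 1)" using pairing_involution[OF p] by metis
    show False
    proof (cases "j = Suc i")
      case True
      then show False using eq pairing_neq[OF p] zD[of i] by (auto simp: D_def)
    next
      case False
      have "vertex n \<alpha> (z (j - 1)) = vertex n \<alpha> (z (Suc i))" using zv[of i] eq' by simp
      then have "j - 1 = Suc i" using i False by (intro inj) auto
      then show False using eq' zn[of i] by simp
    qed
  qed
  have "vertex n \<alpha> (\<alpha> (s ! l)) = vertex n \<alpha> (s ! (Suc l mod length s)) \<and>
      \<alpha> (s ! l) \<noteq> s ! (Suc l mod length s)" if l: "l < length s" for l
  proof (cases "Suc l < j - i")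
    case True
    then show ?thesis using zv[of "i + l"] zn[of "i + l"] by (simp add: len nth)
  next
    case False
    then have "Suc l = j - i" "i + l = j - 1" using l len by simp_all
    then show ?thesis using last lastn i by (simp add: len nth)
  qed
  moreover have "set s \<subseteq> {1..2 * n}" using zD by (auto simp: s_def D_def)
  moreover have "s \<noteq> []" using i by (simp add: s_def)
  ultimately have "cycle n \<alpha> s" using dist by (simp add: cycle_def)
  then show ?thesis by blast
qed

section \<open>Creating loops and leaves\<close>

text \<open>A single base for all congestion bounds: \<open>n\<close> times a constant depending on
  the genus, large enough to absorb the number of simple paths and the numerical factors, so that
  combining routes is addition of exponents.\<close>

definition scale :: "nat \<Rightarrow> nat \<Rightarrow> real" where
  "scale n g = real n * 4 ^ (g + 1)"

lemma scale_bounds: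
  assumes "1 \<le> n"
  shows "4 * real n \<le> scale n g" "4 \<le> scale n g" "(2 * real n)\<^sup>2 * 2 ^ (2 * g) + 1 \<le> scale n g ^ 2"
    "(real n)\<^sup>2 + 1 \<le> scale n g ^ 2"
proof -
  have p: "(1::real) \<le> 4 ^ g" by simp
  have n: "1 \<le> real n" using assms by simp
  show 1: "4 * real n \<le> scale n g"
    using mult_left_mono[OF p, of "4 * real n"] n by (simp add: scale_def)
  then show "4 \<le> scale n g" using n by linarith
  have n2: "1 \<le> (real n)\<^sup>2" using n by simp
  have "(4 * real n)\<^sup>2 \<le> scale n g ^ 2" using 1 n by (intro power_mono) auto
  then show "(real n)\<^sup>2 + 1 \<le> scale n g ^ 2" using n2 by (simp add: power2_eq_square)
  have "(2 * real n)\<^sup>2 * 2 ^ (2 * g) + 1 \<le> (2 * real n)\<^sup>2 * 4 ^ g + (real n)\<^sup>2 * 4 ^ g"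
    using mult_mono[OF n2 p] by (simp add: power_mult)
  also have "\<dots> = 5 * (real n)\<^sup>2 * 4 ^ g" by (simp add: power2_eq_square)
  also have "\<dots> \<le> 16 * (real n)\<^sup>2 * (4 ^ g * 4 ^ g)"
    using mult_left_mono[OF p, of "4 ^ g"] n2 by (intro mult_mono) auto
  also have "\<dots> = scale n g ^ 2" by (simp add: scale_def power2_eq_square)
  finally show "(2 * real n)\<^sup>2 * 2 ^ (2 * g) + 1 \<le> scale n g ^ 2" .
qed

lemma flows_refold_scale:
  assumes n: "1 \<le> n" and A: "A \<subseteq> states n g" and cyc: "\<And>\<alpha>. \<alpha> \<in> A \<Longrightarrow> cycle n \<alpha> (s \<alpha>)"
    and A': "(\<lambda>\<alpha>. refold \<alpha> (s \<alpha>) (radius (s \<alpha>))) ` A \<subseteq> A'" "A' \<subseteq> states n g"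
  shows "flows n g A A' (scale n g ^ 6)"
proof (rule flows_mono[OF flows_refold[OF assms]])
  note b = scale_bounds[OF n, of g]
  \<comment> \<open>The length of the routes accounts for exponent 2, and each of the two simple
    paths for another 2.\<close>
  have "(real n ^ 2 + 1) * (1 + (2 * real n)\<^sup>2 * 2 ^ (2 * g))\<^sup>2 \<le> scale n g ^ 2 * (scale n g ^ 2)\<^sup>2"
    using b by (intro mult_mono power_mono) (auto simp: add.commute)
  also have "\<dots> = scale n g ^ 6" by (simp add: power_mult[symmetric] power_add[symmetric])
  finally show "(real n ^ 2 + 1) * (1 + (2 * real n)\<^sup>2 * 2 ^ (2 * g))\<^sup>2 \<le> scale n g ^ 6" .
qed (use A' in auto)

text \<open>The additional factor \<open>scale n g\<close> absorbs the 4 of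
  \<open>flows_trans\<close>.\<close>

lemma flows_scale_trans:
  assumes "flows n g A A' (scale n g ^ i)" "flows n g A' A'' (scale n g ^ j)" "1 \<le> n"
  shows "flows n g A A'' (scale n g ^ (i + j + 1))"
proof (rule flows_mono[OF flows_trans[OF assms(1,2)]])
  note b = scale_bounds(2)[OF assms(3), of g]
  show "1 \<le> scale n g ^ i" "1 \<le> scale n g ^ j" using b by simp_all
  have "4 * (scale n g ^ i * scale n g ^ j) \<le> scale n g * (scale n g ^ i * scale n g ^ j)"
    using b by (intro mult_right_mono) auto
  then show "4 * scale n g ^ i * scale n g ^ j \<le> scale n g ^ (i + j + 1)"
    by (simp add: power_add algebra_simps)
qed (use assms in \<open>auto simp: flows_def\<close>)

lemma flows_scale_mono:
  assumes "flows n g A A' (scale n g ^ i)" "i \<le> j" "1 \<le> n"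
  shows "flows n g A A' (scale n g ^ j)"
  using scale_bounds(2)[OF assms(3), of g] assms
  by (intro flows_mono[OF assms(1)]) (auto simp: flows_def intro: power_increasing)

lemma flows_scale_Un:
  assumes "flows n g A A' (scale n g ^ i)" "flows n g A2 A' (scale n g ^ i)" "1 \<le> n"
  shows "flows n g (A \<union> A2) A' (scale n g ^ (i + 1))"
proof (rule flows_mono[OF flows_Un[OF assms(1,2)]])
  show "2 * scale n g ^ i \<le> scale n g ^ (i + 1)"
    using scale_bounds(2)[OF assms(3), of g] by (simp add: mult_right_mono)
qed (use assms in \<open>auto simp: flows_def\<close>)

text \<open>The shape of the explicit routes: each is steered by at most two side numbers and takes
  at most \<open>8 * n\<close> steps; the longest ones spend four steps on each of fewer than
  \<open>2 * n\<close> places that a handle moves.\<close>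

lemma flows_drift_scale:
  fixes R :: "'t \<Rightarrow> nat \<Rightarrow> (nat \<Rightarrow> nat) set" and b d :: "'t \<Rightarrow> nat \<Rightarrow> nat"
  assumes n: "1 \<le> n" and T: "finite T" "card T \<le> (2 * n)\<^sup>2" and len: "\<And>t. t \<in> T \<Longrightarrow> len t \<le> 8 * n"
    and R: "\<And>t i. t \<in> T \<Longrightarrow> i \<le> len t \<Longrightarrow> R t i \<subseteq> states n g"
    and step: "\<And>t i \<alpha>. t \<in> T \<Longrightarrow> i < len t \<Longrightarrow> \<alpha> \<in> R t i \<Longrightarrow>
      sw \<alpha> (b t i) (d t i) \<in> R t (Suc i) \<and> adj n \<alpha> (sw \<alpha> (b t i) (d t i))"
    and A: "A \<subseteq> (\<Union>t\<in>T. R t 0)" and A': "(\<Union>t\<in>T. R t (len t)) \<subseteq> A'" "A' \<subseteq> states n g"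
  shows "flows n g A A' (scale n g ^ 6)"
proof (rule flows_mono[OF flows_drift[where l = "8 * n" and b = b and d = d, OF T(1) len R step A A']])
  note s = scale_bounds[OF n, of g]
  have "1 \<le> (real n)\<^sup>2" using n by simp
  then have "real (8 * n) ^ 2 + 1 \<le> 65 * (real n)\<^sup>2" by (simp add: power_mult_distrib)
  also have "\<dots> \<le> 16 * (2 * (2 * real n))\<^sup>2" by (simp add: power2_eq_square)
  also have "\<dots> \<le> scale n g ^ 2 * scale n g ^ 2"
    using s(1,2) power_mono[of "4" "scale n g" 2] power_mono[of "4 * real n" "scale n g" 2]
    by (intro mult_mono) auto
  finally have 1: "real (8 * n) ^ 2 + 1 \<le> scale n g ^ 4" by (simp add: power_add[symmetric])
  have "real (card T) \<le> real ((2 * n)\<^sup>2)" using T(2) by (rule of_nat_mono)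
  also have "\<dots> \<le> (4 * real n)\<^sup>2" by (simp add: power_mult_distrib)
  also have "\<dots> \<le> scale n g ^ 2" using s(1) by (intro power_mono) auto
  finally have "(real (8 * n) ^ 2 + 1) * real (card T) \<le> scale n g ^ 4 * scale n g ^ 2"
    using 1 s(2) by (intro mult_mono) auto
  then show "(real (8 * n) ^ 2 + 1) * real (card T) \<le> scale n g ^ 6" by (simp add: power_add[symmetric])
qed (use A' in auto)

lemma loop_mixed:
  assumes \<alpha>: "\<alpha> \<in> pairings n" and "x \<in> {1..2 * n}" "vertex n \<alpha> x = vertex n \<alpha> (\<alpha> x)"
  shows "mixed n \<alpha>"
proof (rule ccontr)
  assume not: "\<not> mixed n \<alpha>"
  have "\<alpha> x \<in> {1..2 * n}" using assms(2) pairing_in[OF \<alpha>] by blast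
  then have "even x \<longleftrightarrow> even (\<alpha> x)" by (rule not_mixed_vertex[OF \<alpha> not assms(3)])
  then show False using not assms(2) by (auto simp: mixed_def)
qed

definition leaves :: "nat \<Rightarrow> nat set \<Rightarrow> (nat \<Rightarrow> nat) \<Rightarrow> bool" where
  "leaves n L \<alpha> \<longleftrightarrow> (\<forall>x\<in>L. \<alpha> x = cyc n x)"

text \<open>Fold any cycle of an unmixed diagram. If the result is still unmixed, the cycle was even
  and leaves two chords joining the same two vertices; exchanging them produces a chord whose sides
  came from one vertex and so have equal parity. The set \<open>L\<close> is carried along because a
  second use of the lemma must not destroy the leaf made in between.\<close>

lemma flows_mixed:
  assumes g: "0 < g" and n: "1 \<le> n"
  shows "flows n g {\<alpha> \<in> states n g. leaves n L \<alpha>} {\<alpha> \<in> states n g. leaves n L \<alpha> \<and> mixed n \<alpha>} (scale n g ^ 15)"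
proof -
  \<comment> \<open>The double edge left by \<open>refold_double_edge\<close>: \<open>x\<close> and
    \<open>y\<close> lead in opposite directions between two vertices and involve no leaf.\<close>
  define K where "K \<beta> x y \<longleftrightarrow> x \<in> {1..2 * n} \<and> y \<in> {1..2 * n} \<and> y \<noteq> \<beta> x \<and> x \<noteq> y \<and>
    vertex n \<beta> x = vertex n \<beta> (\<beta> y) \<and> vertex n \<beta> y = vertex n \<beta> (\<beta> x) \<and> vertex n \<beta> x \<noteq> vertex n \<beta> y \<and>
    (\<forall>l\<in>L. l \<notin> {x, y, \<beta> x, \<beta> y})" for \<beta> x y
  let ?M = "{\<alpha> \<in> states n g. leaves n L \<alpha> \<and> mixed n \<alpha>}"
  let ?N = "{\<alpha> \<in> states n g. leaves n L \<alpha> \<and> \<not> mixed n \<alpha>}"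
  let ?D = "{\<beta> \<in> states n g. leaves n L \<beta> \<and> \<not> mixed n \<beta> \<and> (\<exists>x y. K \<beta> x y)}"
  have "\<forall>\<alpha>\<in>?N. \<exists>s. cycle n \<alpha> s" using cycle_exists[OF _ g] by blast
  then obtain s where s: "\<And>\<alpha>. \<alpha> \<in> ?N \<Longrightarrow> cycle n \<alpha> (s \<alpha>)" by metis
  have 1: "flows n g ?N (?M \<union> ?D) (scale n g ^ 6)"
  proof (rule flows_refold_scale[OF n _ s])
    show "(\<lambda>\<alpha>. refold \<alpha> (s \<alpha>) (radius (s \<alpha>))) ` ?N \<subseteq> ?M \<union> ?D"
    proof (rule image_subsetI)
      fix \<alpha> assume \<alpha>: "\<alpha> \<in> ?N"
      then have st: "\<alpha> \<in> states n g" and lv: "\<And>l. l \<in> L \<Longrightarrow> \<alpha> l = cyc n l" by (auto simp: leaves_def)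
      note p = states_pairings[OF st]
      let ?\<beta> = "refold \<alpha> (s \<alpha>) (radius (s \<alpha>))"
      have \<beta>: "?\<beta> \<in> states n g" by (rule refold_states[OF st s[OF \<alpha>]]) simp
      have avoid: "l \<notin> set (s \<alpha>) \<union> \<alpha> ` set (s \<alpha>)" if "l \<in> L" for l
        using leaf_not_in_cycle[OF st s[OF \<alpha>] lv[OF that]] by blast
      have lb: "leaves n L ?\<beta>"
        unfolding leaves_def using refold_unaffected[OF st s[OF \<alpha>] order_refl avoid] lv by simp
      show "?\<beta> \<in> ?M \<union> ?D"
      proof (cases "mixed n ?\<beta>")
        case False
        have "even (length (s \<alpha>))"
        proof (rule ccontr)
          assume "odd (length (s \<alpha>))"
          then show False
            using refold_loop[OF st s[OF \<alpha>]] loop_mixed[OF states_pairings[OF \<beta>]] False by blast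
        qed
        then obtain x y where xy: "x \<in> set (s \<alpha>)" "y \<in> set (s \<alpha>)" "?\<beta> x = \<alpha> x" "?\<beta> y = \<alpha> y"
          "y \<noteq> \<alpha> x" "x \<noteq> y" "vertex n ?\<beta> x = vertex n ?\<beta> (\<alpha> y)" "vertex n ?\<beta> y = vertex n ?\<beta> (\<alpha> x)"
          "vertex n ?\<beta> x \<noteq> vertex n ?\<beta> y"
          using refold_double_edge[OF st s[OF \<alpha>]] by metis
        have "x \<in> {1..2 * n}" "y \<in> {1..2 * n}" using s[OF \<alpha>] xy(1,2) unfolding cycle_def by blast+
        moreover have "l \<notin> {x, y, ?\<beta> x, ?\<beta> y}" if "l \<in> L" for l
          using avoid[OF that] xy(1-4) by auto
        ultimately have "K ?\<beta> x y" unfolding K_def xy(3,4) using xy(5-9) by blast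
        then show ?thesis using \<beta> lb False by blast
      qed (use \<beta> lb in blast)
    qed
  qed auto
  have 2: "flows n g ?D ?M (scale n g ^ 6)"
  proof (rule flows_drift_scale[OF n, where T = "{1..2 * n} \<times> {1..2 * n}" and len = "\<lambda>_. 1"
      and R = "\<lambda>t i. if i = 0 then {\<beta> \<in> states n g. leaves n L \<beta> \<and> \<not> mixed n \<beta> \<and> K \<beta> (\<beta> (fst t)) (\<beta> (snd t))} else ?M"
      and b = "\<lambda>t _. fst t" and d = "\<lambda>t _. snd t"])
    show "?D \<subseteq> (\<Union>t\<in>{1..2 * n} \<times> {1..2 * n}. if 0 = 0 then {\<beta> \<in> states n g. leaves n L \<beta> \<and> \<not> mixed n \<beta> \<and> K \<beta> (\<beta> (fst t)) (\<beta> (snd t))} else ?M)"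
    proof
      fix \<beta> assume "\<beta> \<in> ?D"
      then obtain x y where \<beta>: "\<beta> \<in> states n g" "leaves n L \<beta>" "\<not> mixed n \<beta>" and K: "K \<beta> x y" by blast
      note pb = states_pairings[OF \<beta>(1)]
      have "(\<beta> x, \<beta> y) \<in> {1..2 * n} \<times> {1..2 * n}" using K pairing_in[OF pb] unfolding K_def mem_Times_iff by simp
      then show "\<beta> \<in> (\<Union>t\<in>{1..2 * n} \<times> {1..2 * n}. if 0 = 0 then {\<beta> \<in> states n g. leaves n L \<beta> \<and> \<not> mixed n \<beta> \<and> K \<beta> (\<beta> (fst t)) (\<beta> (snd t))} else ?M)"
        using \<beta> K by (intro UN_I[of "(\<beta> x, \<beta> y)"]) (simp_all add: pairing_involution[OF pb])
    qed
    fix t i \<beta>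
    assume t: "t \<in> {1..2 * n} \<times> {1..2 * n}" and i: "i < (1::nat)"
      and "\<beta> \<in> (if i = 0 then {\<beta> \<in> states n g. leaves n L \<beta> \<and> \<not> mixed n \<beta> \<and> K \<beta> (\<beta> (fst t)) (\<beta> (snd t))} else ?M)"
    then have \<beta>: "\<beta> \<in> states n g" "leaves n L \<beta>" "\<not> mixed n \<beta>" "K \<beta> (\<beta> (fst t)) (\<beta> (snd t))" by simp_all
    note pb = states_pairings[OF \<beta>(1)]
    define b d where "b = fst t" and "d = snd t"
    have D: "b \<in> {1..2 * n}" "d \<in> {1..2 * n}" using t by (auto simp: b_def d_def)
    note K = \<beta>(4)[unfolded K_def pairing_involution[OF pb], folded b_def d_def]
    have ne: "b \<noteq> d" "d \<noteq> \<beta> b" using K pairing_involution[OF pb] by metis+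
    have vne: "vertex n \<beta> b \<noteq> vertex n \<beta> d" using K by metis
    have *: "sw \<beta> b d \<in> states n g" "adj n \<beta> (sw \<beta> b d)"
      using sw_fold_states[OF \<beta>(1) D ne(2) vne] K by simp_all
    \<comment> \<open>The new partner of \<open>b\<close> is a side at the vertex of
      \<open>b\<close>, and parity is constant on the vertices of an unmixed diagram.\<close>
    have ap: "sw \<beta> b d b = \<beta> d" using sw_apply[OF pb D ne, of b] by simp
    have "\<beta> d \<in> {1..2 * n}" "vertex n \<beta> b = vertex n \<beta> (\<beta> d)" using K by simp_all
    then have "even b \<longleftrightarrow> even (\<beta> d)" using not_mixed_vertex[OF pb \<beta>(3)] by blast
    then have "even (b + sw \<beta> b d b)" unfolding ap by simp
    then have "mixed n (sw \<beta> b d)" using D(1) unfolding mixed_def by blast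
    moreover have "leaves n L (sw \<beta> b d)"
      unfolding leaves_def
    proof
      fix l assume l: "l \<in> L"
      then have "l \<notin> {\<beta> b, \<beta> d, b, d}" using K by blast
      then show "sw \<beta> b d l = cyc n l" using \<beta>(2) l by (simp add: sw_apply[OF pb D ne] leaves_def)
    qed
    ultimately have "sw \<beta> b d \<in> ?M" using *(1) by blast
    with *(2) show "sw \<beta> (fst t) (snd t) \<in> (if Suc i = 0 then {\<beta> \<in> states n g. leaves n L \<beta> \<and> \<not> mixed n \<beta> \<and> K \<beta> (\<beta> (fst t)) (\<beta> (snd t))} else ?M)
       \<and> adj n \<beta> (sw \<beta> (fst t) (snd t))"
      by (simp add: b_def d_def)
  qed (use n in \<open>auto simp: card_cartesian_product power2_eq_square\<close>)
  have idM: "flows n g ?M ?M (scale n g ^ 0)" using flows_id[of ?M ?M n g] by auto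
  have "flows n g (?M \<union> ?D) ?M (scale n g ^ (6 + 1))"
    using flows_scale_mono[OF idM _ n, of 6] 2 by (intro flows_scale_Un n) auto
  \<comment> \<open>6 for folding, 7 for the exchange of the double edge joined with the idle
    routes, 1 for the composition; adding the diagrams that are mixed from the start costs the last
    unit.\<close>
  then have "flows n g ?N ?M (scale n g ^ (6 + (6 + 1) + 1))"
    using 1 by (intro flows_scale_trans[OF _ _ n])
  then have "flows n g (?M \<union> ?N) ?M (scale n g ^ (14 + 1))"
    using flows_scale_mono[OF idM _ n, of 14] by (intro flows_scale_Un n) simp_all
  moreover have "?M \<union> ?N = {\<alpha> \<in> states n g. leaves n L \<alpha>}" by blast
  ultimately show ?thesis by simp
qed

section \<open>Exchanges next to a leaf\<close>

context
  fixes n \<alpha> b d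
  assumes \<alpha>: "\<alpha> \<in> pairings n" and bd: "b \<in> {1..2 * n}" "d \<in> {1..2 * n}" "b \<noteq> d" "d \<noteq> \<alpha> b"
begin

text \<open>An exchange may be named by either end of each chord. The genus is checked at the ends
  whose vertices are known, while the parameters of \<open>flows_drift\<close> must not depend on
  the diagram.\<close>

lemma sw_partners: "sw \<alpha> (\<alpha> b) (\<alpha> d) = sw \<alpha> b d"
proof
  fix x
  have D: "\<alpha> b \<in> {1..2 * n}" "\<alpha> d \<in> {1..2 * n}" using bd(1,2) unfolding pairing_in[OF \<alpha>] .
  note ne = sw_distinct[OF \<alpha> bd]
  show "sw \<alpha> (\<alpha> b) (\<alpha> d) x = sw \<alpha> b d x"
    using ne bd(3) sw_apply[OF \<alpha> bd, of x] sw_apply[OF \<alpha> D ne(1), of x]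
    by (auto simp: pairing_involution[OF \<alpha>])
qed

text \<open>The merge only enlarges vertices, and the split that follows cuts off
  \<open>\<alpha> d\<close> alone; so other sides that were together remain together. This preserves
  the loop while the leaf moves towards it.\<close>

lemma sw_vertex_same:
  assumes merge: "vertex n \<alpha> b \<noteq> vertex n \<alpha> d"
    and split: "vertex n \<alpha> (\<alpha> b) = vertex n \<alpha> (\<alpha> d)" and single: "cyc n (sw \<alpha> b d (\<alpha> d)) = \<alpha> d"
    and xy: "x \<noteq> \<alpha> d" "y \<noteq> \<alpha> d" "vertex n \<alpha> x = vertex n \<alpha> y"
  shows "vertex n (sw \<alpha> b d) x = vertex n (sw \<alpha> b d) y"
proof -
  define p where "p = cyc n \<circ> \<alpha>"
  define q where "q = p \<circ> transpose b d"
  let ?r = "q \<circ> transpose (\<alpha> b) (\<alpha> d)"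
  note pp = glue_permutes[OF \<alpha>, folded p_def]
  have qp: "q permutes {1..2 * n}" unfolding q_def by (rule exchange_permutes[OF pp _ bd(1,2)]) simp
  have D: "\<alpha> b \<in> {1..2 * n}" "\<alpha> d \<in> {1..2 * n}" using bd(1,2) unfolding pairing_in[OF \<alpha>] .
  note ne = sw_distinct[OF \<alpha> bd]
  have vo: "vertex n \<alpha> x = vertex n \<alpha> y \<longleftrightarrow> x \<in> orbit p y" for x y
    by (simp add: vertex_eq_iff[OF \<alpha>] p_def) (simp add: vertex_def)
  have bd': "b \<notin> orbit p d" using merge by (simp add: vo)
  have pq: "x \<in> orbit q y" if "x \<in> orbit p y" for x y
    using exchange_merge(1)[OF pp _ bd(1,2) bd', of x y] that by (simp add: q_def)
  have ac: "\<alpha> b \<in> orbit q (\<alpha> d)" using split by (intro pq) (simp add: vo)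
  have r: "cyc n \<circ> sw \<alpha> b d = ?r" unfolding glue_sw[OF \<alpha> bd] p_def q_def ..
  have "orbit ?r (\<alpha> d) = {\<alpha> d}"
    unfolding r[symmetric] orbit_eq_singleton_iff using single by simp
  moreover have "x \<in> orbit q y" using xy(3) by (intro pq) (simp add: vo)
  ultimately have "x \<in> orbit ?r y \<or> x \<in> orbit ?r (\<alpha> b) \<and> y \<in> orbit ?r (\<alpha> b)"
    using exchange_split_orbit[OF qp _ D ac ne(1), of x y] xy(1,2) by auto
  moreover have rp: "?r permutes {1..2 * n}" by (rule exchange_permutes[OF qp _ D]) simp
  ultimately have "orbit ?r x = orbit ?r y" using orbit_eq_iff[OF rp, of x y] orbit_eq_iff[OF rp, of x "\<alpha> b"]
      orbit_eq_iff[OF rp, of y "\<alpha> b"] by auto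
  then show ?thesis unfolding vertex_def r .
qed

end

lemma leaf_vertex:
  assumes \<alpha>: "\<alpha> \<in> pairings n" and "\<alpha> x = cyc n x"
  shows "vertex n \<alpha> y = vertex n \<alpha> (cyc n x) \<longleftrightarrow> y = cyc n x"
    and "vertex n \<alpha> (cyc n (cyc n x)) = vertex n \<alpha> x"
proof -
  have *: "\<alpha> (cyc n x) = x" using assms(2) pairing_involution[OF \<alpha>] by metis
  show "vertex n \<alpha> y = vertex n \<alpha> (cyc n x) \<longleftrightarrow> y = cyc n x"
    by (rule vertex_fixed[OF \<alpha>]) (simp add: *)
  show "vertex n \<alpha> (cyc n (cyc n x)) = vertex n \<alpha> x" by (simp add: vertex_cyc[OF \<alpha>] *)
qed

text \<open>If \<open>b\<close> and the side two places further lie at different vertices,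
  exchanging \<open>b\<close> with the partner of \<open>cyc n b\<close> makes \<open>b\<close> and
  \<open>cyc n b\<close> a leaf. If all sides two places apart shared a vertex, there would be at
  most two vertices, one for each parity; a mixed diagram identifies these, whereas
  \<open>n + 1 - 2 * g\<close> is at least 2.\<close>

lemma flows_leaf:
  assumes n: "2 * g < n"
  shows "flows n g {\<alpha> \<in> states n g. mixed n \<alpha>} {\<alpha> \<in> states n g. \<exists>x\<in>{1..2 * n}. \<alpha> x = cyc n x} (scale n g ^ 6)"
    (is "flows n g ?A ?B _")
proof -
  have n1: "1 \<le> n" using n by simp
  let ?R = "\<lambda>t i. if i = (0::nat) then {\<alpha> \<in> states n g. snd t = \<alpha> (cyc n (fst t)) \<and> vertex n \<alpha> (fst t) \<noteq> vertex n \<alpha> (snd t)} else ?B"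
  show ?thesis
  proof (rule flows_drift_scale[OF n1, where T = "{1..2 * n} \<times> {1..2 * n}" and len = "\<lambda>_. 1"
      and R = ?R and b = "\<lambda>t _. fst t" and d = "\<lambda>t _. snd t"])
    show "?A \<subseteq> (\<Union>t\<in>{1..2 * n} \<times> {1..2 * n}. ?R t 0)"
    proof
      fix \<alpha> assume "\<alpha> \<in> ?A"
      then have st: "\<alpha> \<in> states n g" and mx: "mixed n \<alpha>" by auto
      note p = states_pairings[OF st]
      have "\<exists>b\<in>{1..2 * n}. vertex n \<alpha> b \<noteq> vertex n \<alpha> (cyc n (cyc n b))"
      proof (rule ccontr)
        assume not: "\<not> ?thesis"
        have all: "vertex n \<alpha> x = vertex n \<alpha> (if odd x then 1 else 2)" if "1 \<le> x" "x \<le> 2 * n" for x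
          using that
        proof (induction x rule: less_induct)
          case (less x)
          show ?case
          proof (cases "x \<le> 2")
            case True
            then have "x = 1 \<or> x = 2" using less.prems by linarith
            then show ?thesis by auto
          next
            case False
            then obtain y where y: "x = Suc (Suc y)" "1 \<le> y" by (metis One_nat_def Suc_1 Suc_le_eq le_Suc_eq not_less_eq_eq not0_implies_Suc zero_less_Suc le0)
            then have "cyc n (cyc n y) = x" using less.prems by (simp add: cyc_less)
            moreover have "y \<in> {1..2 * n}" using y less.prems by auto
            ultimately have "vertex n \<alpha> y = vertex n \<alpha> x" using not by blast
            then show ?thesis using less.IH[of y] y less.prems by simp
          qed
        qed
        obtain z where z: "z \<in> {1..2 * n}" "even (z + \<alpha> z)" using mx by (auto simp: mixed_def)
        have az: "\<alpha> z \<in> {1..2 * n}" using z(1) pairing_in[OF p] by blast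
        have cz: "cyc n z \<in> {1..2 * n}" by (rule cyc_in[OF z(1)])
        have "vertex n \<alpha> (cyc n z) = vertex n \<alpha> (\<alpha> z)" by (rule vertex_cyc[OF p])
        then have 12: "vertex n \<alpha> 1 = vertex n \<alpha> 2"
          using all[of "cyc n z"] all[of "\<alpha> z"] az cz even_cyc[OF z(1)] z(2)
          by (cases "even z") simp_all
        have "vertex n \<alpha> x = vertex n \<alpha> 1" if "x \<in> {1..2 * n}" for x
          using all[of x] 12 that by (cases "odd x") simp_all
        then have "vertices_of n \<alpha> \<subseteq> {vertex n \<alpha> 1}" by (intro image_subsetI) (simp only: singleton_iff)
        then have "card (vertices_of n \<alpha>) \<le> card {vertex n \<alpha> 1}" by (intro card_mono) auto
        then show False using card_vertices[OF st] n by simp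
      qed
      then obtain b where b: "b \<in> {1..2 * n}" "vertex n \<alpha> b \<noteq> vertex n \<alpha> (cyc n (cyc n b))" by blast
      have "\<alpha> (cyc n b) \<in> {1..2 * n}" unfolding pairing_in[OF p] by (rule cyc_in[OF b(1)])
      then show "\<alpha> \<in> (\<Union>t\<in>{1..2 * n} \<times> {1..2 * n}. ?R t 0)"
        using st b by (intro UN_I[of "(b, \<alpha> (cyc n b))"]) (simp_all add: vertex_cyc[OF p])
    qed
    fix t i \<alpha>
    assume t: "t \<in> {1..2 * n} \<times> {1..2 * n}" and i: "i < (1::nat)" and "\<alpha> \<in> ?R t i"
    define b d where "b = fst t" and "d = snd t"
    have "i = 0" using i by simp
    with \<open>\<alpha> \<in> ?R t i\<close> have "\<alpha> \<in> {\<alpha> \<in> states n g. d = \<alpha> (cyc n b) \<and> vertex n \<alpha> b \<noteq> vertex n \<alpha> d}"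
      unfolding b_def d_def by (simp only: refl if_True)
    then have \<alpha>: "\<alpha> \<in> states n g" and d: "d = \<alpha> (cyc n b)" and vne: "vertex n \<alpha> b \<noteq> vertex n \<alpha> d"
      by blast+
    note p = states_pairings[OF \<alpha>]
    have D: "b \<in> {1..2 * n}" "d \<in> {1..2 * n}" using t by (auto simp: b_def d_def)
    have ad: "\<alpha> d = cyc n b" by (simp add: d pairing_involution[OF p])
    have "cyc n b \<noteq> b" using even_cyc[OF D(1)] by auto
    then have ne: "b \<noteq> d" "d \<noteq> \<alpha> b" using vne by (auto simp: d pairing_eq_iff[OF p])
    have *: "sw \<alpha> b d \<in> states n g" "adj n \<alpha> (sw \<alpha> b d)"
      using sw_fold_states[OF \<alpha> D ne(2) vne] by (simp_all add: ad vertex_cyc[OF p])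
    have "sw \<alpha> b d b = cyc n b" using sw_apply[OF p D ne, of b] ad by simp
    then have "sw \<alpha> b d \<in> ?B" using *(1) D(1) by blast
    with *(2) show "sw \<alpha> (fst t) (snd t) \<in> ?R t (Suc i) \<and> adj n \<alpha> (sw \<alpha> (fst t) (snd t))"
      by (simp add: b_def d_def)
  qed (auto simp: card_cartesian_product power2_eq_square)
qed

text \<open>The tip of a leaf is a vertex of its own, so exchanging it with the side before the leaf
  always merges two vertices. The partners of the exchanged sides share a vertex, which is split,
  and the leaf has moved one place to the left.\<close>

lemma flows_slide:
  assumes n: "2 \<le> n"
  shows "flows n g {\<alpha> \<in> states n g. \<exists>x\<in>{1..2 * n}. \<alpha> x = cyc n x} {\<alpha> \<in> states n g. leaves n {1} \<alpha>} (scale n g ^ 6)"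
proof (rule flows_drift_scale[where T = "{1..2 * n}" and len = "\<lambda>x. x - 1"
      and R = "\<lambda>x i. {\<alpha> \<in> states n g. \<alpha> (x - i) = cyc n (x - i)}"
      and b = "\<lambda>x i. cyc n (x - i)" and d = "\<lambda>x i. x - i - 1"])
  show "card {1..2 * n} \<le> (2 * n)\<^sup>2" by (simp add: power2_eq_square)
  fix x i \<alpha> assume x: "x \<in> {1..2 * n}" and i: "i < x - 1" and "\<alpha> \<in> {\<alpha> \<in> states n g. \<alpha> (x - i) = cyc n (x - i)}"
  then have \<alpha>: "\<alpha> \<in> states n g" and leaf: "\<alpha> (x - i) = cyc n (x - i)" by auto
  note p = states_pairings[OF \<alpha>]
  define y where "y = x - i - 1"
  have y: "1 \<le> y" "Suc y \<le> 2 * n" "x - i = Suc y" using x i by (auto simp: y_def)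
  note leaf = leaf[unfolded y(3)]
  let ?b = "cyc n (Suc y)"
  have D: "?b \<in> {1..2 * n}" "y \<in> {1..2 * n}" "Suc y \<in> {1..2 * n}"
    using y cyc_in[of "Suc y" n] by auto
  have ab: "\<alpha> ?b = Suc y" using leaf pairing_involution[OF p] by metis
  have bny: "?b \<noteq> y" using y n by (cases "Suc y = 2 * n") (auto simp: cyc_less cyc_last)
  have vne: "vertex n \<alpha> ?b \<noteq> vertex n \<alpha> y"
    using leaf_vertex(1)[OF p leaf, of y] bny by metis
  have "vertex n \<alpha> (\<alpha> y) = vertex n \<alpha> (Suc y)"
    using vertex_cyc[OF p, of y] y by (simp add: cyc_less)
  then have *: "sw \<alpha> ?b y \<in> states n g" "adj n \<alpha> (sw \<alpha> ?b y)"
    using sw_fold_states[OF \<alpha> D(1,2) _ vne] ab by simp_all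
  have "sw \<alpha> ?b y y = Suc y" using sw_apply[OF p D(1,2) bny, of y] bny ab by simp
  then have "sw \<alpha> ?b y y = cyc n y" using y(1,2) by (simp add: cyc_less)
  moreover have "x - i - 1 = y" "x - Suc i = y" by (simp_all add: y_def)
  ultimately show "sw \<alpha> (cyc n (x - i)) (x - i - 1) \<in> {\<alpha> \<in> states n g. \<alpha> (x - Suc i) = cyc n (x - Suc i)} \<and>
      adj n \<alpha> (sw \<alpha> (cyc n (x - i)) (x - i - 1))"
    using * y(3) by simp
qed (use n in \<open>auto simp: leaves_def\<close>)

definition has_loop :: "nat \<Rightarrow> (nat \<Rightarrow> nat) \<Rightarrow> bool" where
  "has_loop n \<alpha> \<longleftrightarrow> (\<exists>x\<in>{1..2 * n}. vertex n \<alpha> x = vertex n \<alpha> (\<alpha> x))"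

lemma flows_loop:
  assumes n: "1 \<le> n"
  shows "flows n g {\<alpha> \<in> states n g. leaves n L \<alpha> \<and> mixed n \<alpha>}
    {\<alpha> \<in> states n g. leaves n L \<alpha> \<and> has_loop n \<alpha>} (scale n g ^ 6)" (is "flows n g ?A ?B _")
proof -
  have "\<forall>\<alpha>\<in>?A. \<exists>s. cycle n \<alpha> s \<and> odd (length s)" using odd_cycle_exists[OF states_pairings] by blast
  from bchoice[OF this] obtain s where "\<forall>\<alpha>\<in>?A. cycle n \<alpha> (s \<alpha>) \<and> odd (length (s \<alpha>))" by blast
  then have s: "\<And>\<alpha>. \<alpha> \<in> ?A \<Longrightarrow> cycle n \<alpha> (s \<alpha>)" "\<And>\<alpha>. \<alpha> \<in> ?A \<Longrightarrow> odd (length (s \<alpha>))" by blast+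
  show ?thesis
  proof (rule flows_refold_scale[OF n _ s(1)])
    show "(\<lambda>\<alpha>. refold \<alpha> (s \<alpha>) (radius (s \<alpha>))) ` ?A \<subseteq> ?B"
    proof (rule image_subsetI)
      fix \<alpha> assume \<alpha>: "\<alpha> \<in> ?A"
      then have st: "\<alpha> \<in> states n g" and lv: "\<And>l. l \<in> L \<Longrightarrow> \<alpha> l = cyc n l" by (auto simp: leaves_def)
      let ?\<beta> = "refold \<alpha> (s \<alpha>) (radius (s \<alpha>))"
      have avoid: "l \<notin> set (s \<alpha>) \<union> \<alpha> ` set (s \<alpha>)" if "l \<in> L" for l
        using leaf_not_in_cycle[OF st s(1)[OF \<alpha>] lv[OF that]] by blast
      have "leaves n L ?\<beta>"
        unfolding leaves_def using refold_unaffected[OF st s(1)[OF \<alpha>] order_refl avoid] lv by simp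
      moreover have "?\<beta> \<in> states n g" by (rule refold_states[OF st s(1)[OF \<alpha>]]) simp
      moreover have "has_loop n ?\<beta>" unfolding has_loop_def by (rule refold_loop[OF st s[OF \<alpha>]])
      ultimately show "?\<beta> \<in> ?B" by blast
    qed
  qed auto
qed

section \<open>Building and moving a handle\<close>

text \<open>The leaf travels right until it stands just before the side \<open>p\<close> of the
  loop. There the exchange of its tip with \<open>p\<close> is legal because both ends of the loop
  lie at one vertex, and it turns leaf and loop into two crossing chords.\<close>

lemma flows_hook:
  assumes n: "2 \<le> n"
  shows "flows n g {\<alpha> \<in> states n g. leaves n {1} \<alpha> \<and> has_loop n \<alpha>}
    {\<alpha> \<in> states n g. \<exists>x q. 1 \<le> x \<and> x + 3 \<le> q \<and> q \<le> 2 * n \<and> \<alpha> x = x + 2 \<and> \<alpha> (x + 1) = q} (scale n g ^ 6)"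
    (is "flows n g ?A ?B _")
proof -
  \<comment> \<open>\<open>p\<close> is the lower side of the loop. In stage \<open>i\<close> the
    leaf starts at \<open>1 + i\<close>; after \<open>p - 3\<close> moves it occupies
    \<open>p - 2\<close> and \<open>p - 1\<close>, and the hooking step follows.\<close>
  define R where "R p i = (if i \<le> p - 3 then {\<gamma> \<in> states n g. \<gamma> (1 + i) = 2 + i \<and> p < \<gamma> p \<and>
    vertex n \<gamma> p = vertex n \<gamma> (\<gamma> p)} else ?B)" for p i
  show ?thesis
  proof (rule flows_drift_scale[where T = "{3..2 * n}" and len = "\<lambda>p. p - 2" and R = R
        and b = "\<lambda>p i. if i < p - 3 then i + 1 else p - 1" and d = "\<lambda>p i. if i < p - 3 then i + 3 else p"])
    show "?A \<subseteq> (\<Union>p\<in>{3..2 * n}. R p 0)"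
    proof
      fix \<alpha> assume "\<alpha> \<in> ?A"
      then obtain x where st: "\<alpha> \<in> states n g" and lf: "\<alpha> 1 = cyc n 1"
        and x: "x \<in> {1..2 * n}" "vertex n \<alpha> x = vertex n \<alpha> (\<alpha> x)"
        by (auto simp: leaves_def has_loop_def)
      note p = states_pairings[OF st]
      have c1: "cyc n 1 = 2" using n by (simp add: cyc_less)
      have ne12: "vertex n \<alpha> 1 \<noteq> vertex n \<alpha> 2" using leaf_vertex(1)[OF p lf, of 1] c1 by simp
      have a2: "\<alpha> 2 = 1" using lf c1 pairing_involution[OF p] by metis
      define m where "m = min x (\<alpha> x)"
      have ax: "\<alpha> x \<in> {1..2 * n}" "\<alpha> x \<noteq> x" using x(1) pairing_in[OF p] pairing_neq[OF p] by blast+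
      have am: "\<alpha> m = max x (\<alpha> x)" using pairing_involution[OF p] by (auto simp: m_def min_def max_def)
      have loop: "vertex n \<alpha> m = vertex n \<alpha> (\<alpha> m)" 
        using x(2) am by (cases "x \<le> \<alpha> x") (simp_all add: m_def min_def max_def)
      \<comment> \<open>The chord of the leaf is not the loop, since its two sides lie at different
        vertices.\<close>
      have "m \<noteq> 1" using loop ne12 lf c1 by metis
      moreover have "m \<noteq> 2" using loop ne12 a2 by metis
      ultimately have "m \<in> {3..2 * n}" "m < \<alpha> m" using x(1) ax am by (auto simp: m_def)
      then show "\<alpha> \<in> (\<Union>p\<in>{3..2 * n}. R p 0)"
        using st lf c1 loop by (intro UN_I[of m]) (auto simp: R_def)
    qed
    have "card {3..2 * n} \<le> 2 * n * 1" by simp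
    also have "\<dots> \<le> 2 * n * (2 * n)" using n by (intro mult_left_mono) auto
    finally show "card {3..2 * n} \<le> (2 * n)\<^sup>2" by (simp add: power2_eq_square)
    fix p i assume p: "p \<in> {3..2 * n}"
    show "R p i \<subseteq> states n g" by (auto simp: R_def)
    fix \<gamma> assume i: "i < p - 2" and \<gamma>: "\<gamma> \<in> R p i"
    have "i \<le> p - 3" using i by simp
    then have st: "\<gamma> \<in> states n g" and lf: "\<gamma> (1 + i) = 2 + i" and pp: "p < \<gamma> p"
      and loop: "vertex n \<gamma> p = vertex n \<gamma> (\<gamma> p)" using \<gamma> by (simp_all add: R_def)
    note pr = states_pairings[OF st]
    have ge: "\<gamma> p \<in> {1..2 * n}" unfolding pairing_in[OF pr] using p by auto
    let ?x = "1 + i"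
    have xs: "cyc n ?x = ?x + 1" "cyc n (?x + 1) = ?x + 2" using p i pp ge by (simp_all add: cyc_less)
    note leaf = leaf_vertex[OF pr, of ?x, unfolded xs, simplified, OF lf[simplified]]
    have ax: "\<gamma> (?x + 1) = ?x" using lf pairing_involution[OF pr, of ?x] by simp
    show "sw \<gamma> (if i < p - 3 then i + 1 else p - 1) (if i < p - 3 then i + 3 else p) \<in> R p (Suc i) \<and>
      adj n \<gamma> (sw \<gamma> (if i < p - 3 then i + 1 else p - 1) (if i < p - 3 then i + 3 else p))"
    proof (cases "i < p - 3")
      case True
      let ?b = "?x + 1" and ?d = "\<gamma> (?x + 2)"
      have D: "?b \<in> {1..2 * n}" "?x + 2 \<in> {1..2 * n}" "?x \<in> {1..2 * n}" using True p by auto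
      have D': "?d \<in> {1..2 * n}" unfolding pairing_in[OF pr] by (rule D(2))
      have ad: "\<gamma> ?d = ?x + 2" by (rule pairing_involution[OF pr])
      have ne: "?b \<noteq> ?d" "?d \<noteq> \<gamma> ?b"
        using pairing_involution[OF pr, of "?x + 2"] lf ax by (metis add_left_cancel add.commute n_not_Suc_n one_add_one plus_1_eq_Suc nat_1_add_1 add_cancel_right_right zero_neq_numeral)+
      have vne: "vertex n \<gamma> ?b \<noteq> vertex n \<gamma> ?d" using leaf(1)[of ?d] ne(1) by (auto simp: eq_commute)
      have same: "vertex n \<gamma> (\<gamma> ?b) = vertex n \<gamma> (\<gamma> ?d)" unfolding ax ad using leaf(2) by simp
      \<comment> \<open>The genus is checked at \<open>?b\<close> and \<open>?d\<close>, but the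
        step is named by their partners, whose positions depend on \<open>i\<close> alone.\<close>
      have eq: "sw \<gamma> ?b ?d = sw \<gamma> (i + 1) (i + 3)"
        using sw_partners[OF pr D(1) D' ne] ax ad by (simp add: add.commute numeral_3_eq_3)
      note ap = sw_apply[OF pr D(1) D' ne, unfolded ax ad]
      have st': "sw \<gamma> ?b ?d \<in> states n g" "adj n \<gamma> (sw \<gamma> ?b ?d)"
        using sw_fold_states[OF st D(1) D' ne(2) vne] same by blast+
      have lf': "sw \<gamma> ?b ?d (?x + 1) = ?x + 2" using ne(1) by (simp only: ap if_False if_True refl)
      have np: "p \<noteq> ?x" "p \<noteq> ?x + 1" "p \<noteq> ?x + 2" using True by auto
      have nd: "p \<noteq> ?d" using pp True pairing_involution[OF pr, of "?x + 2"] by auto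
      have p': "sw \<gamma> ?b ?d p = \<gamma> p" using np nd by (simp only: ap if_False)
      have "sw \<gamma> ?b ?d (?x + 2) = ?x + 1" unfolding ap using ne(1) pairing_neq[OF pr D(2)] by auto
      then have "cyc n (sw \<gamma> ?b ?d (\<gamma> ?d)) = \<gamma> ?d" unfolding ad using xs by simp
      moreover have "p \<noteq> \<gamma> ?d" "\<gamma> p \<noteq> \<gamma> ?d" unfolding ad using pp True np by simp_all
      ultimately have "vertex n (sw \<gamma> ?b ?d) p = vertex n (sw \<gamma> ?b ?d) (\<gamma> p)"
        by (rule sw_vertex_same[OF pr D(1) D' ne vne same _ _ _ loop])
      then have "sw \<gamma> ?b ?d \<in> R p (Suc i)" using st'(1) lf' p' pp True by (auto simp: R_def)
      then show ?thesis using st'(2) True unfolding eq by simp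
    next
      case False
      then have i3: "p = i + 3" using i p by auto
      let ?b = "?x + 1" and ?d = "?x + 2"
      have pd: "p = ?d" using i3 by simp
      have D: "?b \<in> {1..2 * n}" "?d \<in> {1..2 * n}" using p pd by auto
      have ne: "?b \<noteq> ?d" "?d \<noteq> \<gamma> ?b" using ax by auto
      have vne: "vertex n \<gamma> ?b \<noteq> vertex n \<gamma> ?d" using leaf(1)[of ?d] by auto
      have same: "vertex n \<gamma> (\<gamma> ?b) = vertex n \<gamma> (\<gamma> ?d)" unfolding ax using leaf(2) loop pd by simp
      have st': "sw \<gamma> ?b ?d \<in> states n g" "adj n \<gamma> (sw \<gamma> ?b ?d)"
        using sw_fold_states[OF st D ne(2) vne] same by blast+
      have nx: "?x \<noteq> \<gamma> ?d" using pp pd by simp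
      note ap = sw_apply[OF pr D ne, unfolded ax]
      have "sw \<gamma> ?b ?d ?x = ?x + 2" "sw \<gamma> ?b ?d (?x + 1) = \<gamma> ?d"
        unfolding ap by simp_all
      note ap' = this[folded pd]
      then have "sw \<gamma> ?b ?d \<in> ?B"
        using st'(1) pp pd ge ap' by (intro CollectI conjI exI[of _ ?x] exI[of _ "\<gamma> p"]) auto
      then have "sw \<gamma> ?b ?d \<in> R p (Suc i)" using i3 by (simp add: R_def)
      then show ?thesis using st'(2) False i3 by (simp add: numeral_3_eq_3)
    qed
  qed (use n in \<open>auto simp: R_def power2_eq_square\<close>)
qed

text \<open>\<open>q\<close> is the intermediate permutation spelled out, so that short arcs are
  found by evaluating it. Orbits being symmetric, each incidence may be given in either direction,
  whichever arc is shorter.\<close>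

lemma hop_states:
  assumes st: "\<gamma> \<in> states n g" and D: "b \<in> {1..2 * n}" "d \<in> {1..2 * n}" "b \<noteq> d" "d \<noteq> \<gamma> b"
    and q: "\<And>x. q x = (if x = b then cyc n (\<gamma> d) else if x = d then cyc n (\<gamma> b) else cyc n (\<gamma> x))"
    and hit: "(\<gamma> b \<in> orbit q d \<or> d \<in> orbit q (\<gamma> b)) \<and> (\<gamma> d \<in> orbit q b \<or> b \<in> orbit q (\<gamma> d)) \<or>
      (\<gamma> b \<in> orbit q b \<or> b \<in> orbit q (\<gamma> b)) \<and> (\<gamma> d \<in> orbit q d \<or> d \<in> orbit q (\<gamma> d))"
  shows "sw \<gamma> b d \<in> states n g" "adj n \<gamma> (sw \<gamma> b d)"
proof -
  note pr = states_pairings[OF st]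
  have eq: "q = cyc n \<circ> \<gamma> \<circ> transpose b d" by (auto simp: q transpose_def fun_eq_iff)
  have qp: "q permutes {1..2 * n}" unfolding eq by (rule exchange_permutes[OF glue_permutes[OF pr] _ D(1,2)]) simp
  have sym: "x \<in> orbit q y \<longleftrightarrow> y \<in> orbit q x" for x y
    using orbit_sym[OF qp, of x y] orbit_sym[OF qp, of y x] by auto
  show "sw \<gamma> b d \<in> states n g" "adj n \<gamma> (sw \<gamma> b d)"
    using hit sw_cross_states[OF st D eq] sym by blast+
qed

lemma orbit_hit: "q x = y \<Longrightarrow> y \<in> orbit q x" "q x = u \<Longrightarrow> q u = y \<Longrightarrow> y \<in> orbit q x"
  by (auto intro: orbit.intros)

text \<open>Thanks to the chord from \<open>x\<close> to \<open>x + 2\<close>, the far end of the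
  crossing chord can pass any neighbouring side: in the intermediate permutation \<open>d\<close>
  reaches \<open>x + 1\<close> in two steps, and the partner of \<open>d\<close> reaches
  \<open>Suc d\<close> in one, whatever the rest of the diagram is.\<close>

lemma flows_tighten:
  assumes n: "2 \<le> n"
  shows "flows n g {\<alpha> \<in> states n g. \<exists>x q. 1 \<le> x \<and> x + 3 \<le> q \<and> q \<le> 2 * n \<and> \<alpha> x = x + 2 \<and> \<alpha> (x + 1) = q}
    {\<alpha> \<in> states n g. \<exists>x. 1 \<le> x \<and> x + 3 \<le> 2 * n \<and> \<alpha> x = x + 2 \<and> \<alpha> (x + 1) = x + 3} (scale n g ^ 6)"
    (is "flows n g ?A ?B _")
proof (rule flows_drift_scale[where T = "{(x, q) \<in> {1..2 * n} \<times> {1..2 * n}. x + 3 \<le> q}"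
      and len = "\<lambda>t. snd t - (fst t + 3)"
      and R = "\<lambda>t i. {\<gamma> \<in> states n g. \<gamma> (fst t) = fst t + 2 \<and> \<gamma> (fst t + 1) = snd t - i}"
      and b = "\<lambda>t i. snd t - i" and d = "\<lambda>t i. snd t - i - 1"])
  let ?T = "{(x, q) \<in> {1..2 * n} \<times> {1..2 * n}. x + 3 \<le> q}"
  have sub: "?T \<subseteq> {1..2 * n} \<times> {1..2 * n}" by auto
  then show "finite ?T" by (rule finite_subset) simp
  show "card ?T \<le> (2 * n)\<^sup>2"
    using card_mono[OF _ sub] by (simp add: card_cartesian_product power2_eq_square)
  show "?A \<subseteq> (\<Union>t\<in>?T. {\<gamma> \<in> states n g. \<gamma> (fst t) = fst t + 2 \<and> \<gamma> (fst t + 1) = snd t - 0})"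
  proof
    fix \<alpha> assume "\<alpha> \<in> ?A"
    then obtain x q where "\<alpha> \<in> states n g" "1 \<le> x" "x + 3 \<le> q" "q \<le> 2 * n" "\<alpha> x = x + 2" "\<alpha> (x + 1) = q" by blast
    then show "\<alpha> \<in> (\<Union>t\<in>?T. {\<gamma> \<in> states n g. \<gamma> (fst t) = fst t + 2 \<and> \<gamma> (fst t + 1) = snd t - 0})"
      by (intro UN_I[of "(x, q)"]) auto
  qed
  fix t i \<gamma>
  assume t: "t \<in> ?T" and i: "i < snd t - (fst t + 3)"
    and \<gamma>: "\<gamma> \<in> {\<gamma> \<in> states n g. \<gamma> (fst t) = fst t + 2 \<and> \<gamma> (fst t + 1) = snd t - i}"
  define x d where "x = fst t" and "d = snd t - i - 1"
  have b: "snd t - i = Suc d" and x: "1 \<le> x" "x + 3 \<le> d" "Suc d \<le> 2 * n"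
    using t i by (auto simp: x_def d_def)
  have st: "\<gamma> \<in> states n g" and gx: "\<gamma> x = x + 2" "\<gamma> (x + 1) = Suc d" using \<gamma> b by (auto simp: x_def)
  note pr = states_pairings[OF st]
  have gx': "\<gamma> (x + 2) = x" "\<gamma> (Suc d) = x + 1"
    using gx pairing_involution[OF pr, of x] pairing_involution[OF pr, of "x + 1"] by simp_all
  have D: "Suc d \<in> {1..2 * n}" "d \<in> {1..2 * n}" "Suc d \<noteq> d" "d \<noteq> \<gamma> (Suc d)" using x gx' by auto
  have c: "\<gamma> d \<notin> {d, Suc d, x, x + 1, x + 2}"
    using pairing_involution[OF pr, of d] pairing_neq[OF pr D(2)] gx gx' x by auto
  define q where "q z = (if z = Suc d then cyc n (\<gamma> d) else if z = d then cyc n (\<gamma> (Suc d)) else cyc n (\<gamma> z))" for z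
  have "q d = x + 2" "q (x + 2) = x + 1" "q (\<gamma> d) = Suc d"
    using x gx gx' c pairing_involution[OF pr, of d] by (simp_all add: q_def cyc_less)
  then have "\<gamma> (Suc d) \<in> orbit q d" "Suc d \<in> orbit q (\<gamma> d)"
    unfolding gx' using orbit_hit by metis+
  then have *: "sw \<gamma> (Suc d) d \<in> states n g" "adj n \<gamma> (sw \<gamma> (Suc d) d)"
    using hop_states[OF st D q_def] by blast+
  have "sw \<gamma> (Suc d) d x = x + 2" "sw \<gamma> (Suc d) d (x + 1) = d"
    using x gx c by (auto simp: sw_apply[OF pr D] gx')
  moreover have ends: "snd t - i - 1 = d" "snd t - Suc i = d" by (simp_all add: d_def)
  ultimately show "sw \<gamma> (snd t - i) (snd t - i - 1) \<in> {\<gamma> \<in> states n g. \<gamma> (fst t) = fst t + 2 \<and> \<gamma> (fst t + 1) = snd t - Suc i} \<and>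
      adj n \<gamma> (sw \<gamma> (snd t - i) (snd t - i - 1))"
    using * b ends by (simp add: x_def)
next
  let ?T = "{(x, q) \<in> {1..2 * n} \<times> {1..2 * n}. x + 3 \<le> q}"
  show "(\<Union>t\<in>?T. {\<gamma> \<in> states n g. \<gamma> (fst t) = fst t + 2 \<and> \<gamma> (fst t + 1) = snd t - (snd t - (fst t + 3))}) \<subseteq> ?B"
    by auto
qed (use n in auto)

text \<open>A handle is moved one place to the left through the stages \<open>m = 0, \<dots>, 4\<close>.\<close>

definition handle_form :: "nat \<Rightarrow> nat \<Rightarrow> (nat \<Rightarrow> nat) \<Rightarrow> bool" where
  "handle_form m z \<gamma> \<longleftrightarrow>
    (if m = 0 then \<gamma> (z + 1) = z + 3 \<and> \<gamma> (z + 2) = z + 4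
     else if m = 1 then \<gamma> z = z + 3 \<and> \<gamma> (z + 2) = z + 4
     else if m = 2 then \<gamma> z = z + 3 \<and> \<gamma> (z + 1) = z + 4
     else if m = 3 then \<gamma> z = z + 2 \<and> \<gamma> (z + 1) = z + 4
     else \<gamma> z = z + 2 \<and> \<gamma> (z + 1) = z + 3)"

text \<open>The five sides from \<open>z\<close> on are the four sides of the handle and one free
  side, which moves from \<open>z\<close> to \<open>z + 4\<close>, one place per stage. In each case
  \<open>w\<close> is the partner of the free side, and two arcs through these sides and
  \<open>w\<close> show that the exchange keeps the genus.\<close>

lemma handle_step:
  assumes st: "\<gamma> \<in> states n g" and z: "1 \<le> z" "z + 4 \<le> 2 * n" and m: "m < 4" and f: "handle_form m z \<gamma>"
  shows "sw \<gamma> (z + m) (z + m + 1) \<in> states n g \<and> adj n \<gamma> (sw \<gamma> (z + m) (z + m + 1)) \<and>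
    handle_form (Suc m) z (sw \<gamma> (z + m) (z + m + 1))"
proof -
  note pr = states_pairings[OF st]
  define b d where "b = z + m" and "d = z + m + 1"
  have bd: "b \<in> {1..2 * n}" "d \<in> {1..2 * n}" "b \<noteq> d" using z m by (auto simp: b_def d_def)
  define q where "q w = (if w = b then cyc n (\<gamma> d) else if w = d then cyc n (\<gamma> b) else cyc n (\<gamma> w))" for w
  have c: "cyc n z = z + 1" "cyc n (z + 1) = z + 2" "cyc n (z + 2) = z + 3" "cyc n (z + 3) = z + 4"
    using z by (simp_all add: cyc_less)
  consider "m = 0" | "m = 1" | "m = 2" | "m = 3" using m by linarith
  then show ?thesis
  proof cases
    case 1
    have g: "\<gamma> (z + 1) = z + 3" "\<gamma> (z + 2) = z + 4" "\<gamma> (z + 3) = z + 1" "\<gamma> (z + 4) = z + 2"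
      using f 1 pairing_involution[OF pr, of "z + 1"] pairing_involution[OF pr, of "z + 2"]
      by (auto simp: handle_form_def)
    define w where "w = \<gamma> z"
    have gw: "\<gamma> w = z" by (simp add: w_def pairing_involution[OF pr])
    have w: "w \<notin> {z, z + 1, z + 2, z + 3, z + 4}"
      using gw g pairing_neq[OF pr, of z] z by (auto simp: w_def)
    have b: "b = z" "d = z + 1" using 1 by (simp_all add: b_def d_def)
    have ne: "d \<noteq> \<gamma> b" using w by (auto simp: b w_def)
    have "q z = z + 4" "q (z + 4) = z + 3" "q w = z + 1"
      using w c g gw by (auto simp: q_def b)
    then have "\<gamma> d \<in> orbit q b" "d \<in> orbit q (\<gamma> b)"
      unfolding b g(1) w_def[symmetric] using orbit_hit by metis+
    then have *: "sw \<gamma> b d \<in> states n g" "adj n \<gamma> (sw \<gamma> b d)"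
      using hop_states[OF st bd ne q_def] by blast+
    note ap = sw_apply[OF pr bd ne, unfolded b]
    have "sw \<gamma> b d z = z + 3" "sw \<gamma> b d (z + 2) = z + 4"
      unfolding b ap using w g by (auto simp: w_def[symmetric] w_def[symmetric, simplified])
    then show ?thesis using * 1 by (simp add: handle_form_def b eval_nat_numeral)
  next
    case 2
    have g: "\<gamma> z = z + 3" "\<gamma> (z + 2) = z + 4" "\<gamma> (z + 3) = z" "\<gamma> (z + 4) = z + 2"
      using f 2 pairing_involution[OF pr, of z] pairing_involution[OF pr, of "z + 2"]
      by (auto simp: handle_form_def)
    define w where "w = \<gamma> (z + 1)"
    have gw: "\<gamma> w = z + 1" by (simp add: w_def pairing_involution[OF pr])
    have w: "w \<notin> {z, z + 1, z + 2, z + 3, z + 4}"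
      using gw g pairing_neq[OF pr, of "z + 1"] z by (auto simp: w_def)
    have b: "b = z + 1" "d = z + 2" using 2 by (simp_all add: b_def d_def)
    have ne: "d \<noteq> \<gamma> b" using w by (auto simp: b w_def)
    have "q (z + 4) = z + 3" "q (z + 3) = z + 1" "q w = z + 2"
      using w c g gw by (auto simp: q_def b)
    then have "b \<in> orbit q (\<gamma> d)" "d \<in> orbit q (\<gamma> b)"
      unfolding b g(2) w_def[symmetric] using orbit_hit by metis+
    then have *: "sw \<gamma> b d \<in> states n g" "adj n \<gamma> (sw \<gamma> b d)"
      using hop_states[OF st bd ne q_def] by blast+
    note ap = sw_apply[OF pr bd ne, unfolded b]
    have "sw \<gamma> b d z = z + 3" "sw \<gamma> b d (z + 1) = z + 4"
      unfolding b ap using w g by (auto simp: w_def[symmetric] w_def[symmetric, simplified])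
    then show ?thesis using * 2 by (simp add: handle_form_def b eval_nat_numeral)
  next
    case 3
    have g: "\<gamma> z = z + 3" "\<gamma> (z + 1) = z + 4" "\<gamma> (z + 3) = z" "\<gamma> (z + 4) = z + 1"
      using f 3 pairing_involution[OF pr, of z] pairing_involution[OF pr, of "z + 1"]
      by (auto simp: handle_form_def)
    define w where "w = \<gamma> (z + 2)"
    have gw: "\<gamma> w = z + 2" by (simp add: w_def pairing_involution[OF pr])
    have w: "w \<notin> {z, z + 1, z + 2, z + 3, z + 4}"
      using gw g pairing_neq[OF pr, of "z + 2"] z by (auto simp: w_def)
    have b: "b = z + 2" "d = z + 3" using 3 by (simp_all add: b_def d_def)
    have ne: "d \<noteq> \<gamma> b" using w by (auto simp: b w_def)
    have "q z = z + 4" "q (z + 4) = z + 2" "q w = z + 3"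
      using w c g gw by (auto simp: q_def b)
    then have "b \<in> orbit q (\<gamma> d)" "d \<in> orbit q (\<gamma> b)"
      unfolding b g(3) w_def[symmetric] using orbit_hit by metis+
    then have *: "sw \<gamma> b d \<in> states n g" "adj n \<gamma> (sw \<gamma> b d)"
      using hop_states[OF st bd ne q_def] by blast+
    note ap = sw_apply[OF pr bd ne, unfolded b]
    have "sw \<gamma> b d z = z + 2" "sw \<gamma> b d (z + 1) = z + 4"
      unfolding b ap using w g by (auto simp: w_def[symmetric] w_def[symmetric, simplified])
    then show ?thesis using * 3 by (simp add: handle_form_def b eval_nat_numeral)
  next
    case 4
    have g: "\<gamma> z = z + 2" "\<gamma> (z + 1) = z + 4" "\<gamma> (z + 2) = z" "\<gamma> (z + 4) = z + 1"
      using f 4 pairing_involution[OF pr, of z] pairing_involution[OF pr, of "z + 1"]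
      by (auto simp: handle_form_def)
    define w where "w = \<gamma> (z + 3)"
    have gw: "\<gamma> w = z + 3" by (simp add: w_def pairing_involution[OF pr])
    have w: "w \<notin> {z, z + 1, z + 2, z + 3, z + 4}"
      using gw g pairing_neq[OF pr, of "z + 3"] z by (auto simp: w_def)
    have b: "b = z + 3" "d = z + 4" using 4 by (simp_all add: b_def d_def)
    have ne: "d \<noteq> \<gamma> b" using w by (auto simp: b w_def)
    have "q (z + 3) = z + 2" "q (z + 2) = z + 1" "q w = z + 4"
      using w c g gw by (auto simp: q_def b)
    then have "\<gamma> d \<in> orbit q b" "d \<in> orbit q (\<gamma> b)"
      unfolding b g(4) w_def[symmetric] using orbit_hit by metis+
    then have *: "sw \<gamma> b d \<in> states n g" "adj n \<gamma> (sw \<gamma> b d)"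
      using hop_states[OF st bd ne q_def] by blast+
    note ap = sw_apply[OF pr bd ne, unfolded b]
    have "sw \<gamma> b d z = z + 2" "sw \<gamma> b d (z + 1) = z + 3"
      unfolding b ap using w g by (auto simp: w_def[symmetric] w_def[symmetric, simplified])
    then show ?thesis using * 4 by (simp add: handle_form_def b eval_nat_numeral)
  qed
qed

text \<open>Time \<open>j\<close> is stage \<open>j mod 4\<close> of move number
  \<open>j div 4\<close>; the last form of one move is the first form of the next, one place further
  left.\<close>

lemma flows_handle_front:
  assumes n: "2 \<le> n"
  shows "flows n g {\<alpha> \<in> states n g. \<exists>x. 1 \<le> x \<and> x + 3 \<le> 2 * n \<and> \<alpha> x = x + 2 \<and> \<alpha> (x + 1) = x + 3}
    {\<alpha> \<in> states n g. \<alpha> 1 = 3 \<and> \<alpha> 2 = 4} (scale n g ^ 6)"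
    (is "flows n g ?A ?B _")
proof (rule flows_drift_scale[where T = "{1..2 * n - 3}" and len = "\<lambda>x. 4 * (x - 1)"
      and R = "\<lambda>x j. {\<gamma> \<in> states n g. handle_form (j mod 4) (x - 1 - j div 4) \<gamma>}"
      and b = "\<lambda>x j. (x - 1 - j div 4) + j mod 4" and d = "\<lambda>x j. (x - 1 - j div 4) + j mod 4 + 1"])
  show "?A \<subseteq> (\<Union>x\<in>{1..2 * n - 3}. {\<gamma> \<in> states n g. handle_form (0 mod 4) (x - 1 - 0 div 4) \<gamma>})"
  proof
    fix \<alpha> assume "\<alpha> \<in> ?A"
    then obtain x where x: "\<alpha> \<in> states n g" "1 \<le> x" "x + 3 \<le> 2 * n" "\<alpha> x = x + 2" "\<alpha> (x + 1) = x + 3" by blast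
    then obtain y where "x = Suc y" by (cases x) auto
    then show "\<alpha> \<in> (\<Union>x\<in>{1..2 * n - 3}. {\<gamma> \<in> states n g. handle_form (0 mod 4) (x - 1 - 0 div 4) \<gamma>})"
      using x by (intro UN_I[of x]) (auto simp: handle_form_def)
  qed
  have "card {1..2 * n - 3} \<le> 2 * n * 1" by simp
  also have "\<dots> \<le> 2 * n * (2 * n)" using n by (intro mult_left_mono) auto
  finally show "card {1..2 * n - 3} \<le> (2 * n)\<^sup>2" by (simp add: power2_eq_square)
  show "(\<Union>x\<in>{1..2 * n - 3}. {\<gamma> \<in> states n g. handle_form (4 * (x - 1) mod 4) (x - 1 - 4 * (x - 1) div 4) \<gamma>}) \<subseteq> ?B"
    by (auto simp: handle_form_def numeral_2_eq_2)
  fix x j \<gamma> assume x: "x \<in> {1..2 * n - 3}" and j: "j < 4 * (x - 1)"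
    and \<gamma>: "\<gamma> \<in> {\<gamma> \<in> states n g. handle_form (j mod 4) (x - 1 - j div 4) \<gamma>}"
  define z m where "z = x - 1 - j div 4" and "m = j mod 4"
  have zj: "j div 4 < x - 1" using j by (simp add: less_mult_imp_div_less mult.commute)
  have z: "1 \<le> z" "z + 4 \<le> 2 * n" and m: "m < 4" using x zj by (auto simp: z_def m_def)
  have *: "sw \<gamma> (z + m) (z + m + 1) \<in> states n g \<and> adj n \<gamma> (sw \<gamma> (z + m) (z + m + 1)) \<and>
    handle_form (Suc m) z (sw \<gamma> (z + m) (z + m + 1))"
    using \<gamma> by (intro handle_step z m) (auto simp: z_def m_def)
  have "handle_form (Suc j mod 4) (x - 1 - Suc j div 4) (sw \<gamma> (z + m) (z + m + 1))"
  proof (cases "m = 3")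
    case True
    then have "Suc j mod 4 = 0" "Suc j div 4 = Suc (j div 4)" unfolding m_def by presburger+
    moreover obtain y where y: "z = Suc y" using z(1) by (cases z) auto
    then have "x - 1 - Suc (j div 4) = y" by (simp add: z_def)
    ultimately show ?thesis using * True y by (simp add: handle_form_def)
  next
    case False
    then have "Suc j mod 4 = Suc m" "Suc j div 4 = j div 4" using m unfolding m_def by presburger+
    then show ?thesis using * by (simp add: z_def)
  qed
  then show "sw \<gamma> (x - 1 - j div 4 + j mod 4) (x - 1 - j div 4 + j mod 4 + 1)
      \<in> {\<gamma> \<in> states n g. handle_form (Suc j mod 4) (x - 1 - Suc j div 4) \<gamma>} \<and>
      adj n \<gamma> (sw \<gamma> (x - 1 - j div 4 + j mod 4) (x - 1 - j div 4 + j mod 4 + 1))"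
    using * by (simp add: z_def m_def)
qed (use n in auto)

text \<open>\<open>flows_leaf\<close> and \<open>flows_slide\<close> do not record whether the
  result is mixed, so this is restored before the loop is made. The exponents 15, 6, 6, 15, 6, 6, 6,
  6 and one for each of the seven compositions add up to 73.\<close>

lemma flows_to_handle:
  assumes g: "0 < g" and n: "2 * g < n"
  shows "flows n g (states n g) {\<alpha> \<in> states n g. \<alpha> 1 = 3 \<and> \<alpha> 2 = 4} (scale n g ^ 74)"
proof -
  have n': "1 \<le> n" "2 \<le> n" using g n by auto
  note t = flows_scale_trans[OF _ _ n'(1)]
  have 1: "flows n g (states n g) {\<alpha> \<in> states n g. mixed n \<alpha>} (scale n g ^ 15)"
    using flows_mixed[OF g n'(1), of "{}"] by (simp add: leaves_def)
  note 2 = t[OF 1 flows_leaf[OF n]]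
  note 3 = t[OF 2 flows_slide[OF n'(2)]]
  note 4 = t[OF 3 flows_mixed[OF g n'(1)]]
  note 5 = t[OF 4 flows_loop[OF n'(1)]]
  note 6 = t[OF 5 flows_hook[OF n'(2)]]
  note 7 = t[OF 6 flows_tighten[OF n'(2)]]
  note 8 = t[OF 7 flows_handle_front[OF n'(2)]]
  show ?thesis by (rule flows_scale_mono[OF 8 _ n'(1)]) simp
qed

section \<open>Removing a handle\<close>

text \<open>Puts a handle in front and shifts the old sides by 4. The number 0 is not a side and
  must stay fixed, since pairings are permutations of all numbers.\<close>

definition attach :: "(nat \<Rightarrow> nat) \<Rightarrow> nat \<Rightarrow> nat" where
  "attach \<omega> x = (if x = 0 then 0 else if x = 1 then 3 else if x = 2 then 4 else if x = 3 then 1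
     else if x = 4 then 2 else \<omega> (x - 4) + 4)"

lemma attach_simps [simp]:
  "attach \<omega> 0 = 0" "attach \<omega> 1 = 3" "attach \<omega> (Suc 0) = 3" "attach \<omega> 2 = 4" "attach \<omega> 3 = 1" "attach \<omega> 4 = 2"
  by (simp_all add: attach_def)

lemma attach_shift [simp]: "0 < x \<Longrightarrow> attach \<omega> (x + 4) = \<omega> x + 4"
  by (simp add: attach_def)

lemma attach_cases:
  obtains "x = 0" | "x = 1" | "x = 2" | "x = 3" | "x = 4" | y where "x = y + 4" "0 < (y::nat)"
proof -
  have "x = 0 \<or> x = 1 \<or> x = 2 \<or> x = 3 \<or> x = 4 \<or> (x = (x - 4) + 4 \<and> 0 < x - 4)" by arith
  then show ?thesis using that by blast
qed

lemma involution_permutes: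
  assumes "\<And>x. f (f x) = x" "\<And>x. x \<notin> S \<Longrightarrow> f x = x"
  shows "f permutes S"
  unfolding permutes_def using assms by metis

lemma card_image_kernel:
  assumes "\<And>x y. x \<in> A \<Longrightarrow> y \<in> A \<Longrightarrow> f x = f y \<longleftrightarrow> g x = g y"
  shows "card (f ` A) = card (g ` A)"
proof (rule bij_betw_same_card)
  have inv: "inv_into A f v \<in> A" "f (inv_into A f v) = v" if "v \<in> f ` A" for v
    using that by (auto intro: inv_into_into f_inv_into_f)
  show "bij_betw (\<lambda>v. g (inv_into A f v)) (f ` A) (g ` A)"
  proof (rule bij_betwI')
    fix v w assume "v \<in> f ` A" "w \<in> f ` A"
    then show "g (inv_into A f v) = g (inv_into A f w) \<longleftrightarrow> v = w"
      using inv assms by metis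
  next
    fix v assume "v \<in> f ` A"
    then show "g (inv_into A f v) \<in> g ` A" using inv by blast
  next
    fix y assume "y \<in> g ` A"
    then obtain x where x: "x \<in> A" "y = g x" by blast
    then have "f x \<in> f ` A" by blast
    then show "\<exists>v\<in>f ` A. y = g (inv_into A f v)" using inv[of "f x"] assms x by metis
  qed
qed

context
  fixes m \<omega>
  assumes \<omega>: "\<omega> \<in> pairings m" and m: "1 \<le> m"
begin

lemma omega_zero: "\<omega> 0 = 0"
  using permutes_not_in[OF pairing_permutes[OF \<omega>], of 0] by simp

lemma omega_pos: "0 < x \<Longrightarrow> 0 < \<omega> x"
  using omega_zero pairing_eq_iff[OF \<omega>, of x 0] by auto

lemma attach_pairings: "attach \<omega> \<in> pairings (m + 2)"
proof -
  have inv: "attach \<omega> (attach \<omega> x) = x" for x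
    by (cases x rule: attach_cases) (simp_all add: omega_pos pairing_involution[OF \<omega>])
  moreover have "attach \<omega> permutes {1..2 * (m + 2)}"
  proof (rule involution_permutes[OF inv])
    fix x assume x: "x \<notin> {1..2 * (m + 2)}"
    show "attach \<omega> x = x"
    proof (cases x rule: attach_cases)
      case (6 y)
      then have "y \<notin> {1..2 * m}" using x by auto
      then show ?thesis using 6 permutes_not_in[OF pairing_permutes[OF \<omega>]] by simp
    qed (use x in auto)
  qed
  moreover have "attach \<omega> x \<noteq> x" if x: "x \<in> {1..2 * (m + 2)}" for x
  proof (cases x rule: attach_cases)
    case (6 y)
    then have "y \<in> {1..2 * m}" using x by auto
    then show ?thesis using 6 pairing_neq[OF \<omega>] by simp
  qed (use x in auto)
  ultimately show ?thesis by (auto simp: pairings_def)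
qed

text \<open>The gluing runs through 1, 4, 3, 2, 5, so the sides of the handle all join the vertex of
  the old first side. Two chords and no vertex are added, hence the genus rises by one.\<close>

lemma vertex_attach:
  assumes "x \<in> {1..2 * (m + 2)}" "y \<in> {1..2 * (m + 2)}"
  shows "vertex (m + 2) (attach \<omega>) x = vertex (m + 2) (attach \<omega>) y \<longleftrightarrow>
    vertex m \<omega> (if x \<le> 4 then 1 else x - 4) = vertex m \<omega> (if y \<le> 4 then 1 else y - 4)"
proof -
  define n where n: "n = m + 2"
  have pa: "attach \<omega> \<in> pairings n" unfolding n by (rule attach_pairings)
  note assms = assms[folded n]
  define r :: "nat \<Rightarrow> nat" where "r x = (if x \<le> 4 then 1 else x - 4)" for x
  have c: "cyc n 1 = 2" "cyc n 2 = 3" "cyc n 3 = 4" "cyc n 4 = 5"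
    using m by (simp_all add: n cyc_less)
  \<comment> \<open>The old rotation wraps around to the old side 1, now side 5; the new one returns
    to side 1 and passes through the handle first.\<close>
  have cs: "cyc n (w + 4) = (if w = 2 * m then 1 else cyc m w + 4)" if "w \<in> {1..2 * m}" for w
  proof -
    have last: "cyc n (2 * m + 4) = 1" 
    proof -
      have "2 * (m + 2) = 2 * m + 4" by simp
      then show ?thesis using cyc_last[of n] unfolding n by (metis le_add2 le_trans one_le_numeral)
    qed
    show ?thesis
    proof (cases "w = 2 * m")
      case True
      with last show ?thesis by (simp only: if_True refl)
    next
      case False
      then have "w < 2 * m" using that by simp
      then show ?thesis using that by (simp add: n cyc_less)
    qed
  qed
  have front: "vertex n (attach \<omega>) x = vertex n (attach \<omega>) 5" if "x \<in> {1, 2, 3, 4}" for x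
    using that vertex_glue[OF pa, of 1] vertex_glue[OF pa, of 2] vertex_glue[OF pa, of 3] vertex_glue[OF pa, of 4]
    by (auto simp: c simp del: One_nat_def)
  have to: "vertex m \<omega> (r x) = vertex m \<omega> (r y)"
    if "vertex n (attach \<omega>) x = vertex n (attach \<omega>) y" "y \<in> {1..2 * n}" for x y
  proof (rule vertex_invariant[OF pa _ that, where h = "\<lambda>z. vertex m \<omega> (r z)"])
    fix z assume z: "z \<in> {1..2 * n}"
    show "vertex m \<omega> (r (cyc n (attach \<omega> z))) = vertex m \<omega> (r z)"
    proof (cases z rule: attach_cases)
      case (6 w)
      then have w: "w \<in> {1..2 * m}" using z n by auto
      have ow: "\<omega> w \<in> {1..2 * m}" unfolding pairing_in[OF \<omega>] by (rule w)
      have "r (cyc n (\<omega> w + 4)) = cyc m (\<omega> w)"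
        unfolding cs[OF ow] using cyc_last[OF m] cyc_in[OF ow] by (auto simp: r_def)
      then show ?thesis using 6 vertex_glue[OF \<omega>, of w] by (simp add: r_def)
    qed (use z c in \<open>simp_all add: r_def\<close>)
  qed
  have from_: "vertex n (attach \<omega>) (v + 4) = vertex n (attach \<omega>) (w + 4)"
    if "vertex m \<omega> v = vertex m \<omega> w" "w \<in> {1..2 * m}" for v w
  proof (rule vertex_invariant[OF \<omega> _ that, where h = "\<lambda>z. vertex n (attach \<omega>) (z + 4)"])
    fix z assume z: "z \<in> {1..2 * m}"
    have oz: "\<omega> z \<in> {1..2 * m}" unfolding pairing_in[OF \<omega>] by (rule z)
    have glue: "vertex n (attach \<omega>) (cyc n (\<omega> z + 4)) = vertex n (attach \<omega>) (z + 4)"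
      using vertex_glue[OF pa, of "z + 4"] z by simp
    show "vertex n (attach \<omega>) (cyc m (\<omega> z) + 4) = vertex n (attach \<omega>) (z + 4)"
    proof (cases "\<omega> z = 2 * m")
      case True
      then have "cyc m (\<omega> z) = 1" using cyc_last[OF m] by simp
      then show ?thesis using glue front[of 1] True cs[OF oz] by simp
    next
      case False
      then show ?thesis using glue cs[OF oz] by simp
    qed
  qed
  have norm: "vertex n (attach \<omega>) x = vertex n (attach \<omega>) (r x + 4)" "r x \<in> {1..2 * m}"
    if "x \<in> {1..2 * n}" for x
  proof -
    show "vertex n (attach \<omega>) x = vertex n (attach \<omega>) (r x + 4)"
    proof (cases "x \<le> 4")
      case True
      then have "x \<in> {1, 2, 3, 4}" using that by auto
      then show ?thesis using front[of x] True by (simp add: r_def)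
    qed (simp add: r_def)
    show "r x \<in> {1..2 * m}" using that m n by (auto simp: r_def)
  qed
  have "vertex n (attach \<omega>) x = vertex n (attach \<omega>) y \<longleftrightarrow> vertex m \<omega> (r x) = vertex m \<omega> (r y)"
    using to[OF _ assms(2)] from_[OF _ norm(2)[OF assms(2)]] norm(1)[OF assms(1)] norm(1)[OF assms(2)] by metis
  then show ?thesis by (simp only: r_def n)
qed

lemma card_vertices_attach: "card (vertices_of (m + 2) (attach \<omega>)) = card (vertices_of m \<omega>)"
proof -
  let ?r = "\<lambda>x::nat. if x \<le> 4 then 1 else x - 4"
  have "card (vertices_of (m + 2) (attach \<omega>)) = card ((\<lambda>x. vertex m \<omega> (?r x)) ` {1..2 * (m + 2)})"
    by (rule card_image_kernel[OF vertex_attach])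
  also have "(\<lambda>x. vertex m \<omega> (?r x)) ` {1..2 * (m + 2)} = vertices_of m \<omega>"
  proof -
    have "?r ` {1..2 * (m + 2)} = {1..2 * m}"
    proof (intro equalityI subsetI)
      fix y assume "y \<in> {1..2 * m}"
      then show "y \<in> ?r ` {1..2 * (m + 2)}" by (intro image_eqI[of _ _ "y + 4"]) auto
    qed (use m in auto)
    then show ?thesis by (simp only: image_image[symmetric, of "vertex m \<omega>" ?r])
  qed
  finally show ?thesis .
qed

end

lemma attach_states:
  assumes "\<omega> \<in> states m g" "1 \<le> m"
  shows "attach \<omega> \<in> states (m + 2) (Suc g)"
  using attach_pairings[OF states_pairings[OF assms(1)] assms(2)]
    card_vertices_attach[OF states_pairings[OF assms(1)] assms(2)] assms(1)
  by (simp add: states_def cycles_def vertex_def)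

lemma attach_inj:
  assumes "\<omega> \<in> pairings m" "\<omega>' \<in> pairings m" "attach \<omega> = attach \<omega>'"
  shows "\<omega> = \<omega>'"
proof
  fix x
  show "\<omega> x = \<omega>' x"
  proof (cases "x = 0")
    case True
    then show ?thesis using permutes_not_in[OF pairing_permutes[OF assms(1)], of 0]
        permutes_not_in[OF pairing_permutes[OF assms(2)], of 0] by simp
  next
    case False
    then show ?thesis using fun_cong[OF assms(3), of "x + 4"] by simp
  qed
qed

lemma attach_surj:
  assumes \<alpha>: "\<alpha> \<in> states (m + 2) (Suc g)" and m: "1 \<le> m" and front: "\<alpha> 1 = 3" "\<alpha> 2 = 4"
  shows "\<exists>\<omega>\<in>states m g. \<alpha> = attach \<omega>"
proof -
  note p = states_pairings[OF \<alpha>]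
  define \<omega> where "\<omega> x = (if x = 0 then 0 else \<alpha> (x + 4) - 4)" for x
  have front': "\<alpha> 3 = 1" "\<alpha> 4 = 2" using front pairing_involution[OF p] by metis+
  have a0: "\<alpha> 0 = 0" using permutes_not_in[OF pairing_permutes[OF p], of 0] by simp
  \<comment> \<open>The first four sides are paired among themselves, so no later side has its
    partner there.\<close>
  have ge: "4 < \<alpha> (x + 4)" if "0 < x" for x
  proof -
    have "\<alpha> (x + 4) \<noteq> y" if "y \<in> {0, 1, 2, 3, 4}" for y
    proof
      assume "\<alpha> (x + 4) = y"
      then have "x + 4 = \<alpha> y" using pairing_swap_eq[OF p] by blast
      moreover have "\<alpha> y \<le> 4" using that front front' a0 by auto
      ultimately show False using \<open>0 < x\<close> by simp
    qed
    then have "\<alpha> (x + 4) \<notin> {0, 1, 2, 3, 4}" by blast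
    then show ?thesis by auto
  qed
  have shift: "\<alpha> (x + 4) = \<omega> x + 4" "0 < \<omega> x" if "0 < x" for x
    using ge[OF that] that by (simp_all add: \<omega>_def)
  have eq: "\<alpha> = attach \<omega>"
  proof
    fix x show "\<alpha> x = attach \<omega> x"
      by (cases x rule: attach_cases) (use front front' a0 shift in simp_all)
  qed
  have inv: "\<omega> (\<omega> x) = x" for x
  proof (cases "x = 0")
    case False
    then have "\<omega> (\<omega> x) + 4 = \<alpha> (\<alpha> (x + 4))" using shift by simp
    then show ?thesis using pairing_involution[OF p] by simp
  qed (simp add: \<omega>_def)
  have "\<omega> permutes {1..2 * m}"
  proof (rule involution_permutes[OF inv])
    fix x assume x: "x \<notin> {1..2 * m}"
    show "\<omega> x = x"
    proof (cases "x = 0")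
      case False
      then have "x + 4 \<notin> {1..2 * (m + 2)}" using x by auto
      then have "\<alpha> (x + 4) = x + 4" by (rule permutes_not_in[OF pairing_permutes[OF p]])
      then show ?thesis using False by (simp add: \<omega>_def)
    qed (simp add: \<omega>_def)
  qed
  moreover have "\<omega> x \<noteq> x" if "x \<in> {1..2 * m}" for x
  proof -
    have "x + 4 \<in> {1..2 * (m + 2)}" "0 < x" using that by auto
    then show ?thesis using pairing_neq[OF p, of "x + 4"] shift[of x] by simp
  qed
  ultimately have "\<omega> \<in> pairings m" using inv by (auto simp: pairings_def)
  then have "\<omega> \<in> states m g"
    using card_vertices_attach[of \<omega> m] m card_vertices[OF \<alpha>] unfolding eq
    by (simp add: states_def cycles_def vertex_def)
  with eq show ?thesis by blast
qed

lemma attach_adj: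
  assumes \<omega>: "\<omega> \<in> pairings m" and adj: "adj m \<omega> \<omega>'"
  shows "adj (m + 2) (attach \<omega>) (attach \<omega>')"
proof -
  obtain b d where bd: "b \<in> {1..2 * m}" "d \<in> {1..2 * m}" "b \<noteq> d" "d \<noteq> \<omega> b" and \<omega>': "\<omega>' = sw \<omega> b d"
    using adj by (auto simp: adj_def)
  have "attach \<omega>' = sw (attach \<omega>) (b + 4) (d + 4)"
  proof
    fix x show "attach \<omega>' x = sw (attach \<omega>) (b + 4) (d + 4) x"
    proof (cases x rule: attach_cases)
      case (6 y)
      have t: "transpose (b + 4) (d + 4) (z + 4) = transpose b d z + 4" for z
        by (auto simp: transpose_def)
      have "0 < transpose b d y" using 6 bd by (auto simp: transpose_def)
      then show ?thesis using 6 by (simp add: \<omega>' sw_def t)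
    qed (use bd in \<open>auto simp: sw_def transpose_def\<close>)
  qed
  moreover have "b + 4 \<in> {1..2 * (m + 2)}" "d + 4 \<in> {1..2 * (m + 2)}" "b + 4 \<noteq> d + 4"
    "d + 4 \<noteq> attach \<omega> (b + 4)" using bd by auto
  ultimately show ?thesis unfolding adj_def by blast
qed

section \<open>Induction on the genus\<close>

lemma poincare_attach:
  assumes P: "poincare m g C" and m: "1 \<le> m" and C: "0 \<le> C"
  shows "(\<Sum>\<alpha>\<in>{\<alpha> \<in> states (m + 2) (Suc g). \<alpha> 1 = 3 \<and> \<alpha> 2 = 4}.
      \<Sum>\<beta>\<in>{\<alpha> \<in> states (m + 2) (Suc g). \<alpha> 1 = 3 \<and> \<alpha> 2 = 4}. (f \<alpha> - f \<beta>)\<^sup>2)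
    \<le> C * real (card (states (m + 2) (Suc g))) * energy (m + 2) (Suc g) f"
proof -
  let ?G = "{\<alpha> \<in> states (m + 2) (Suc g). \<alpha> 1 = 3 \<and> \<alpha> 2 = 4}" and ?S = "states m g"
  have bij: "bij_betw attach ?S ?G"
  proof (rule bij_betwI')
    fix \<omega> \<omega>' assume "\<omega> \<in> ?S" "\<omega>' \<in> ?S"
    then show "attach \<omega> = attach \<omega>' \<longleftrightarrow> \<omega> = \<omega>'" using attach_inj states_pairings by blast
  next
    fix \<omega> assume "\<omega> \<in> ?S"
    then show "attach \<omega> \<in> ?G" using attach_states[OF _ m] by simp
  next
    fix \<alpha> assume "\<alpha> \<in> ?G"
    then show "\<exists>\<omega>\<in>?S. \<alpha> = attach \<omega>" using attach_surj[OF _ m] by blast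
  qed
  have "(\<Sum>\<alpha>\<in>?G. \<Sum>\<beta>\<in>?G. (f \<alpha> - f \<beta>)\<^sup>2) = (\<Sum>\<omega>\<in>?S. \<Sum>\<omega>'\<in>?S. (f (attach \<omega>) - f (attach \<omega>'))\<^sup>2)"
    by (simp only: sum.reindex_bij_betw[OF bij, symmetric])
  also have "\<dots> \<le> C * real (card ?S) * energy m g (\<lambda>\<omega>. f (attach \<omega>))"
    using P by (simp add: poincare_def)
  also have "\<dots> \<le> C * real (card (states (m + 2) (Suc g))) * energy (m + 2) (Suc g) f"
  proof (intro mult_mono mult_left_mono)
    have "card ?S = card ?G" by (rule bij_betw_same_card[OF bij])
    also have "\<dots> \<le> card (states (m + 2) (Suc g))" using finite_states by (intro card_mono) auto
    finally show "real (card ?S) \<le> real (card (states (m + 2) (Suc g)))" by simp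
    let ?E = "{(\<alpha>, \<beta>). \<alpha> \<in> ?S \<and> \<beta> \<in> ?S \<and> adj m \<alpha> \<beta>}"
    let ?E' = "{(\<alpha>, \<beta>). \<alpha> \<in> states (m + 2) (Suc g) \<and> \<beta> \<in> states (m + 2) (Suc g) \<and> adj (m + 2) \<alpha> \<beta>}"
    have "energy m g (\<lambda>\<omega>. f (attach \<omega>)) = (\<Sum>e\<in>map_prod attach attach ` ?E. (f (fst e) - f (snd e))\<^sup>2)"
    proof (subst sum.reindex)
      have inj: "inj_on attach ?S" using bij by (simp add: bij_betw_def)
      show "inj_on (map_prod attach attach) ?E"
        using inj_onD[OF inj] by (auto intro!: inj_onI)
    qed (simp add: energy_def case_prod_beta)
    also have "\<dots> \<le> (\<Sum>e\<in>?E'. (f (fst e) - f (snd e))\<^sup>2)"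
    proof (rule sum_mono2[OF finite_adj_pairs])
      show "map_prod attach attach ` ?E \<subseteq> ?E'"
        using attach_states[OF _ m] attach_adj states_pairings by fastforce
    qed simp
    finally show "energy m g (\<lambda>\<omega>. f (attach \<omega>)) \<le> energy (m + 2) (Suc g) f"
      by (simp add: energy_def case_prod_beta)
  qed (use C energy_nonneg in auto)
  finally show ?thesis .
qed

text \<open>Move both states of a pair along their routes and compare the ends. Squaring a sum of
  three terms costs 3; the two routes give \<open>6 * B\<close>, and each of the two ends is hit at
  most \<open>B\<close> times, which gives \<open>3 * B\<^sup>2 * C\<close>.\<close>

lemma poincare_flows:
  assumes fl: "flows n g (states n g) A' B" and B: "0 \<le> B" and C: "0 \<le> C"
    and A': "\<And>f. (\<Sum>\<alpha>\<in>A'. \<Sum>\<beta>\<in>A'. (f \<alpha> - f \<beta>)\<^sup>2) \<le> C * real (card (states n g)) * energy n g f"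
  shows "poincare n g (6 * B + 3 * B\<^sup>2 * C)"
  unfolding poincare_def
proof
  fix f
  let ?S = "states n g" and ?E = "energy n g f"
  obtain \<phi> where sub: "A' \<subseteq> ?S" and \<phi>: "\<phi> ` ?S \<subseteq> A'"
    and 1: "\<And>f. (\<Sum>\<alpha>\<in>?S. (f \<alpha> - f (\<phi> \<alpha>))\<^sup>2) \<le> B * energy n g f"
    and 2: "\<And>\<beta>. real (card {\<alpha> \<in> ?S. \<phi> \<alpha> = \<beta>}) \<le> B"
    using fl unfolding flows_def by blast
  have fin: "finite A'" by (rule finite_subset[OF sub finite_states])
  have "(f \<alpha> - f \<beta>)\<^sup>2 \<le> 3 * (f \<alpha> - f (\<phi> \<alpha>))\<^sup>2 + 3 * (f \<beta> - f (\<phi> \<beta>))\<^sup>2 + 3 * (f (\<phi> \<alpha>) - f (\<phi> \<beta>))\<^sup>2" for \<alpha> \<beta>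
  proof -
    define x y z where "x = f \<alpha> - f (\<phi> \<alpha>)" and "y = f (\<phi> \<beta>) - f \<beta>" and "z = f (\<phi> \<alpha>) - f (\<phi> \<beta>)"
    have "0 \<le> (x - y)\<^sup>2 + (y - z)\<^sup>2 + (x - z)\<^sup>2" by simp
    then have "(x + y + z)\<^sup>2 \<le> 3 * x\<^sup>2 + 3 * y\<^sup>2 + 3 * z\<^sup>2" by (simp add: power2_eq_square algebra_simps)
    moreover have "y\<^sup>2 = (f \<beta> - f (\<phi> \<beta>))\<^sup>2" by (simp add: y_def power2_commute)
    ultimately show ?thesis by (simp add: x_def y_def z_def)
  qed
  then have "(\<Sum>\<alpha>\<in>?S. \<Sum>\<beta>\<in>?S. (f \<alpha> - f \<beta>)\<^sup>2)
      \<le> (\<Sum>\<alpha>\<in>?S. \<Sum>\<beta>\<in>?S. 3 * (f \<alpha> - f (\<phi> \<alpha>))\<^sup>2 + 3 * (f \<beta> - f (\<phi> \<beta>))\<^sup>2 + 3 * (f (\<phi> \<alpha>) - f (\<phi> \<beta>))\<^sup>2)"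
    by (intro sum_mono)
  also have "\<dots> = 6 * real (card ?S) * (\<Sum>\<alpha>\<in>?S. (f \<alpha> - f (\<phi> \<alpha>))\<^sup>2)
      + 3 * (\<Sum>\<alpha>\<in>?S. \<Sum>\<beta>\<in>?S. (f (\<phi> \<alpha>) - f (\<phi> \<beta>))\<^sup>2)"
    by (simp add: sum.distrib sum_distrib_left algebra_simps)
  also have "(\<Sum>\<alpha>\<in>?S. \<Sum>\<beta>\<in>?S. (f (\<phi> \<alpha>) - f (\<phi> \<beta>))\<^sup>2) \<le> B * (\<Sum>\<gamma>\<in>A'. \<Sum>\<beta>\<in>?S. (f \<gamma> - f (\<phi> \<beta>))\<^sup>2)"
    using fin finite_states \<phi> 2
    by (intro sum_le_by_fibres[where h = "\<lambda>\<gamma>. \<Sum>\<beta>\<in>?S. (f \<gamma> - f (\<phi> \<beta>))\<^sup>2"]) (auto intro: sum_nonneg)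
  also have "(\<Sum>\<gamma>\<in>A'. \<Sum>\<beta>\<in>?S. (f \<gamma> - f (\<phi> \<beta>))\<^sup>2) \<le> (\<Sum>\<gamma>\<in>A'. B * (\<Sum>\<delta>\<in>A'. (f \<gamma> - f \<delta>)\<^sup>2))"
  proof (rule sum_mono)
    fix \<gamma> show "(\<Sum>\<beta>\<in>?S. (f \<gamma> - f (\<phi> \<beta>))\<^sup>2) \<le> B * (\<Sum>\<delta>\<in>A'. (f \<gamma> - f \<delta>)\<^sup>2)"
      using fin finite_states \<phi> 2
      by (intro sum_le_by_fibres[where h = "\<lambda>\<delta>. (f \<gamma> - f \<delta>)\<^sup>2"]) auto
  qed
  also have "(\<Sum>\<gamma>\<in>A'. B * (\<Sum>\<delta>\<in>A'. (f \<gamma> - f \<delta>)\<^sup>2)) = B * (\<Sum>\<gamma>\<in>A'. \<Sum>\<delta>\<in>A'. (f \<gamma> - f \<delta>)\<^sup>2)"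
    by (simp add: sum_distrib_left)
  also have "\<dots> \<le> B * (C * real (card ?S) * ?E)" using A' B by (intro mult_left_mono)
  also have "(\<Sum>\<alpha>\<in>?S. (f \<alpha> - f (\<phi> \<alpha>))\<^sup>2) \<le> B * ?E" by (rule 1)
  finally have "(\<Sum>\<alpha>\<in>?S. \<Sum>\<beta>\<in>?S. (f \<alpha> - f \<beta>)\<^sup>2)
      \<le> 6 * real (card ?S) * (B * ?E) + 3 * (B * (B * (C * real (card ?S) * ?E)))"
    using B by (simp add: mult_left_mono)
  also have "\<dots> = (6 * B + 3 * B\<^sup>2 * C) * real (card ?S) * ?E"
    by (simp add: power2_eq_square algebra_simps)
  finally show "(\<Sum>\<alpha>\<in>?S. \<Sum>\<beta>\<in>?S. (f \<alpha> - f \<beta>)\<^sup>2) \<le> (6 * B + 3 * B\<^sup>2 * C) * real (card ?S) * ?E" .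
qed

lemma poincare_mono: "poincare n g B \<Longrightarrow> B \<le> B' \<Longrightarrow> poincare n g B'"
  unfolding poincare_def
  by (meson energy_nonneg mult_right_mono of_nat_0_le_iff order_trans)

text \<open>The bound for the routes is of order \<open>real n ^ 74\<close> and enters squared,
  which makes 148 for each unit of genus; 4 is the exponent in genus zero. Removing a handle lowers
  \<open>n\<close> by 2 and the genus by 1, so the condition \<open>2 * g < n\<close> is
  inherited.\<close>

lemma poincare_all:
  assumes base: "\<And>n. 1 \<le> n \<Longrightarrow> poincare n 0 (C0 * real n ^ 4)" and C0: "1 \<le> C0"
  shows "\<exists>C\<ge>1. \<forall>n>2 * g. poincare n g (C * real n ^ (148 * g + 4))"
proof (induction g)
  case 0
  show ?case using base C0 by (intro exI[of _ C0]) auto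
next
  case (Suc g)
  then obtain C where C: "1 \<le> C" and IH: "\<And>n. 2 * g < n \<Longrightarrow> poincare n g (C * real n ^ (148 * g + 4))"
    by blast
  define c :: real where "c = (4 ^ (Suc g + 1)) ^ 74"
  have c: "1 \<le> c" unfolding c_def by (intro one_le_power) simp
  show ?case
  proof (intro exI[of _ "9 * c\<^sup>2 * C"] conjI allI impI)
    show "1 \<le> 9 * c\<^sup>2 * C"
      using mult_mono[of 1 "9 * c\<^sup>2" 1 C] c C one_le_power[OF c, of 2] by simp
    fix n assume n: "2 * Suc g < n"
    define m where "m = n - 2"
    have nm: "n = m + 2" "1 \<le> m" "2 * g < m" using n by (auto simp: m_def)
    define B where "B = scale n (Suc g) ^ 74"
    have rn: "1 \<le> real n" using n by simp
    have B: "B = c * real n ^ 74" by (simp add: B_def scale_def c_def power_mult_distrib)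
    have B1: "1 \<le> B" unfolding B using mult_mono[of 1 c 1 "real n ^ 74"] c one_le_power[OF rn, of 74] by simp
    define K where "K = C * real n ^ (148 * g + 4)"
    have K1: "1 \<le> K" unfolding K_def using mult_mono[of 1 C 1 "real n ^ (148 * g + 4)"] C one_le_power[OF rn] by simp
    have "C * real m ^ (148 * g + 4) \<le> K"
      unfolding K_def using C nm by (intro mult_left_mono power_mono) auto
    then have "poincare m g K" using IH[OF nm(3)] poincare_mono by blast
    note pa = poincare_attach[OF this nm(2), unfolded nm(1)[symmetric]]
    have "flows n (Suc g) (states n (Suc g)) {\<alpha> \<in> states n (Suc g). \<alpha> 1 = 3 \<and> \<alpha> 2 = 4} B"
      unfolding B_def using n by (intro flows_to_handle) auto
    then have "poincare n (Suc g) (6 * B + 3 * B\<^sup>2 * K)"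
      using pa B1 K1 by (intro poincare_flows) auto
    moreover have "6 * B + 3 * B\<^sup>2 * K \<le> 9 * c\<^sup>2 * C * real n ^ (148 * Suc g + 4)"
    proof -
      have "B * 1 \<le> B * (B * K)" using B1 K1 mult_mono[of 1 B 1 K] by (intro mult_left_mono) auto
      then have "6 * B + 3 * B\<^sup>2 * K \<le> 9 * (B\<^sup>2 * K)" by (simp add: power2_eq_square algebra_simps)
      also have "B\<^sup>2 * K = c\<^sup>2 * C * (real n ^ 148 * real n ^ (148 * g + 4))"
        by (simp add: B K_def power_mult_distrib power_mult[symmetric])
      also have "real n ^ 148 * real n ^ (148 * g + 4) = real n ^ (148 * Suc g + 4)"
        by (simp add: power_add[symmetric])
      finally show ?thesis by (simp add: mult.assoc)
    qed
    ultimately show "poincare n (Suc g) (9 * c\<^sup>2 * C * real n ^ (148 * Suc g + 4))"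
      by (rule poincare_mono)
  qed
qed

text \<open>For a symmetric operator the squared norms of the iterates are logarithmically convex.
  If the first step shrank them by less than the factor \<open>\<rho>\<^sup>2\<close>, so would all
  later steps, against the assumed decay. Only the rate enters the conclusion, so \<open>C\<close>
  may depend on \<open>F\<close>.\<close>

lemma operator_contraction:
  fixes P :: "('a \<Rightarrow> real) \<Rightarrow> 'a \<Rightarrow> real" and \<rho> C :: real
  assumes S: "finite S" and sym: "\<And>F G. (\<Sum>u\<in>S. P F u * G u) = (\<Sum>u\<in>S. F u * P G u)"
    and \<rho>: "0 < \<rho>" and C: "\<And>t. (\<Sum>u\<in>S. ((P ^^ t) F u)\<^sup>2) \<le> C * (\<rho>\<^sup>2) ^ t"
  shows "(\<Sum>u\<in>S. F u * P F u) \<le> \<rho> * (\<Sum>u\<in>S. (F u)\<^sup>2)"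
proof -
  define a where "a t = (\<Sum>u\<in>S. ((P ^^ t) F u)\<^sup>2)" for t
  have a0: "0 \<le> a t" for t by (simp add: a_def sum_nonneg)
  have lc: "(a (Suc t))\<^sup>2 \<le> a t * a (Suc (Suc t))" for t
  proof -
    have "a (Suc t) = (\<Sum>u\<in>S. (P ^^ t) F u * (P ^^ Suc (Suc t)) F u)"
      using sym[of "(P ^^ t) F" "P ((P ^^ t) F)"] by (simp add: a_def power2_eq_square)
    then show ?thesis
      using Cauchy_Schwarz_ineq_sum[of "(P ^^ t) F" "(P ^^ Suc (Suc t)) F" S] by (simp add: a_def)
  qed
  have "a 1 \<le> \<rho>\<^sup>2 * a 0"
  proof (rule ccontr)
    assume "\<not> a 1 \<le> \<rho>\<^sup>2 * a 0"
    then have gt: "\<rho>\<^sup>2 * a 0 < a 1" by simp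
    have a0pos: "0 < a 0"
    proof (rule ccontr)
      assume "\<not> 0 < a 0"
      then have "a 0 = 0" using a0[of 0] by simp
      then have "(a 1)\<^sup>2 \<le> 0" using lc[of 0] by simp
      then show False using gt \<open>a 0 = 0\<close> by simp
    qed
    define r where "r = a 1 / a 0"
    have r: "\<rho>\<^sup>2 < r" using gt a0pos by (simp add: r_def field_simps)
    have rp: "0 < r" using r \<rho> by (meson less_trans zero_less_power)
    have step: "0 < a t \<and> r * a t \<le> a (Suc t)" for t
    proof (induction t)
      case 0
      show ?case using a0pos by (simp add: r_def)
    next
      case (Suc t)
      have pos: "0 < a (Suc t)" using Suc rp by (meson mult_pos_pos less_le_trans)
      have "r * a t * a (Suc t) \<le> a (Suc t) * a (Suc t)"
        using Suc pos by (intro mult_right_mono) auto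
      also have "\<dots> \<le> a t * a (Suc (Suc t))" using lc[of t] by (simp add: power2_eq_square)
      finally have "a t * (r * a (Suc t)) \<le> a t * a (Suc (Suc t))" by (simp add: ac_simps)
      then show ?case using pos Suc by simp
    qed
    have geo: "r ^ t * a 0 \<le> a t" for t
    proof (induction t)
      case (Suc t)
      have "r ^ Suc t * a 0 \<le> r * a t" using Suc rp by (simp add: mult.assoc)
      also have "\<dots> \<le> a (Suc t)" using step by blast
      finally show ?case .
    qed simp
    have "(r / \<rho>\<^sup>2) ^ t \<le> C / a 0" for t
    proof -
      have "r ^ t * a 0 \<le> C * (\<rho>\<^sup>2) ^ t" using geo[of t] C[of t] by (simp add: a_def)
      moreover have "0 < (\<rho>\<^sup>2) ^ t" using \<rho> by simp
      ultimately show ?thesis using a0pos by (simp only: power_divide pos_divide_le_eq times_divide_eq_left pos_le_divide_eq)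
    qed
    moreover have "1 < r / \<rho>\<^sup>2" using r \<rho> by simp
    then obtain t where "C / a 0 < (r / \<rho>\<^sup>2) ^ t" using real_arch_pow by blast
    ultimately show False by (meson not_less)
  qed
  have "(\<Sum>u\<in>S. F u * P F u)\<^sup>2 \<le> a 0 * a 1"
    using Cauchy_Schwarz_ineq_sum[of F "P F" S] by (simp add: a_def)
  also have "\<dots> \<le> a 0 * (\<rho>\<^sup>2 * a 0)" using \<open>a 1 \<le> \<rho>\<^sup>2 * a 0\<close> a0 by (intro mult_left_mono) auto
  also have "\<dots> = (\<rho> * a 0)\<^sup>2" by (simp add: power2_eq_square)
  finally have "(\<Sum>u\<in>S. F u * P F u) \<le> \<rho> * a 0"
    by (rule power2_le_imp_le) (use \<rho> a0[of 0] in simp)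
  then show ?thesis by (simp add: a_def)
qed

section \<open>Ballot sets\<close>

text \<open>A set of positions is read as a lattice path: its members are up steps, the other
  positions down steps.\<close>

definition flip :: "nat \<Rightarrow> nat set \<Rightarrow> nat set" where
  "flip b u = transpose b (Suc b) ` u"

definition rises :: "nat \<Rightarrow> nat set \<Rightarrow> bool" where
  "rises b u \<longleftrightarrow> b \<notin> u \<and> Suc b \<in> u"

text \<open>The height after \<open>b\<close> steps is
  \<open>2 * card (u \<inter> {1..b}) - b\<close>. The last clause asks for a peak of height at
  least 2, so that turning it into a valley keeps the path nonnegative.\<close>

definition falls :: "nat \<Rightarrow> nat set \<Rightarrow> bool" where
  "falls b u \<longleftrightarrow> b \<in> u \<and> Suc b \<notin> u \<and> b + 2 \<le> 2 * card (u \<inter> {1..b})"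

definition move :: "nat \<Rightarrow> nat set \<Rightarrow> nat set" where
  "move b u = (if rises b u \<or> falls b u then flip b u else u)"

lemma flip_flip [simp]: "flip b (flip b u) = u"
  by (simp add: flip_def image_image)

lemma mem_flip: "x \<in> flip b u \<longleftrightarrow> transpose b (Suc b) x \<in> u"
proof
  assume "x \<in> flip b u"
  then obtain y where "y \<in> u" "x = transpose b (Suc b) y" by (auto simp: flip_def)
  then show "transpose b (Suc b) x \<in> u" by simp
next
  assume "transpose b (Suc b) x \<in> u"
  then have "transpose b (Suc b) (transpose b (Suc b) x) \<in> flip b u" unfolding flip_def by (rule imageI)
  then show "x \<in> flip b u" by simp
qed

lemma mem_flip_simps [simp]: "b \<in> flip b u \<longleftrightarrow> Suc b \<in> u" "Suc b \<in> flip b u \<longleftrightarrow> b \<in> u"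
  "x \<noteq> b \<Longrightarrow> x \<noteq> Suc b \<Longrightarrow> x \<in> flip b u \<longleftrightarrow> x \<in> u"
  by (simp_all add: mem_flip)

lemma flip_commute: "c \<noteq> Suc b \<Longrightarrow> b \<noteq> Suc c \<Longrightarrow> flip b (flip c u) = flip c (flip b u)"
  by (rule set_eqI) (auto simp: mem_flip transpose_def)

lemma card_flip_prefix:
  assumes "c \<noteq> b" "1 \<le> b"
  shows "card (flip b u \<inter> {1..c}) = card (u \<inter> {1..c})"
proof -
  have t: "transpose b (Suc b) x \<in> {1..c} \<longleftrightarrow> x \<in> {1..c}" for x
    using assms by (auto simp: transpose_def)
  have "flip b u \<inter> {1..c} = transpose b (Suc b) ` (u \<inter> {1..c})"
  proof (intro equalityI subsetI)
    fix x assume "x \<in> flip b u \<inter> {1..c}"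
    then show "x \<in> transpose b (Suc b) ` (u \<inter> {1..c})"
      using t by (intro image_eqI[of _ _ "transpose b (Suc b) x"]) (simp_all only: mem_flip Int_iff transpose_involutory)
  next
    fix x assume "x \<in> transpose b (Suc b) ` (u \<inter> {1..c})"
    then obtain y where "x = transpose b (Suc b) y" "y \<in> u" "y \<in> {1..c}" by blast
    then show "x \<in> flip b u \<inter> {1..c}" using t by (simp only: mem_flip Int_iff transpose_involutory)
  qed
  then show ?thesis by (simp add: card_image)
qed

lemma flip_prefix_rise:
  assumes "rises b u" "1 \<le> b"
  shows "card (flip b u \<inter> {1..b}) = Suc (card (u \<inter> {1..b}))"
proof -
  have "flip b u \<inter> {1..b} = insert b (u \<inter> {1..b})"
  proof (rule set_eqI)
    fix x show "x \<in> flip b u \<inter> {1..b} \<longleftrightarrow> x \<in> insert b (u \<inter> {1..b})"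
      using assms by (cases "x = b") (auto simp: rises_def)
  qed
  then show ?thesis using assms by (simp add: rises_def)
qed

lemma falls_flip_rises: "falls b u \<Longrightarrow> rises b (flip b u)"
  by (simp add: rises_def falls_def)

lemma move_far:
  assumes "1 \<le> b" "c \<noteq> b" "c \<noteq> Suc b" "b \<noteq> Suc c"
  shows "rises c (flip b u) \<longleftrightarrow> rises c u" "falls c (flip b u) \<longleftrightarrow> falls c u"
    "move c (flip b u) = flip b (move c u)"
proof -
  have m: "c \<in> flip b u \<longleftrightarrow> c \<in> u" "Suc c \<in> flip b u \<longleftrightarrow> Suc c \<in> u"
    using assms by (auto simp: mem_flip transpose_def)
  show 1: "rises c (flip b u) \<longleftrightarrow> rises c u" "falls c (flip b u) \<longleftrightarrow> falls c u"
    unfolding rises_def falls_def m card_flip_prefix[OF assms(2,1)] by simp_all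
  show "move c (flip b u) = flip b (move c u)"
    unfolding move_def 1 using flip_commute[OF assms(3,4)] by simp
qed

context
  fixes N :: nat and \<U> :: "nat set set"
  assumes N: "2 \<le> N" and fin: "finite \<U>"
    and sub: "\<And>u. u \<in> \<U> \<Longrightarrow> u \<subseteq> {1..N}"
    and ballot: "\<And>u i. u \<in> \<U> \<Longrightarrow> i \<le> N \<Longrightarrow> i \<le> 2 * card (u \<inter> {1..i})"
    and balanced: "\<And>u. u \<in> \<U> \<Longrightarrow> 2 * card u = N"
    and closed: "\<And>u b. u \<in> \<U> \<Longrightarrow> b \<in> {1..<N} \<Longrightarrow> rises b u \<or> falls b u \<Longrightarrow> flip b u \<in> \<U>"
begin

text \<open>A valley has height at least 0, so the peak that replaces it has height at least 2; this
  makes the moves reversible.\<close>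

lemma rises_flip_falls:
  assumes "u \<in> \<U>" "b \<in> {1..<N}" "rises b u"
  shows "falls b (flip b u)"
  using assms ballot[of u b] flip_prefix_rise[of b u] by (auto simp: falls_def rises_def)

lemma move_in: "u \<in> \<U> \<Longrightarrow> b \<in> {1..<N} \<Longrightarrow> move b u \<in> \<U>"
  using closed by (simp add: move_def)

lemma move_move:
  assumes "u \<in> \<U>" "b \<in> {1..<N}"
  shows "move b (move b u) = u"
  using rises_flip_falls[OF assms] falls_flip_rises[of b u] by (auto simp: move_def)

text \<open>The length assigned to an exchange at \<open>b\<close>. It vanishes at both ends, and
  its second difference is -2, which is the source of the contraction.\<close>

definition weight :: "nat \<Rightarrow> real" where
  "weight b = real b * real (N - b)"

text \<open>The Lipschitz condition for the path metric in which an exchange at \<open>b\<close> has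
  length \<open>weight b\<close>. Path coupling takes the dual form that averaging lowers Lipschitz
  constants.\<close>

definition lip :: "real \<Rightarrow> (nat set \<Rightarrow> real) \<Rightarrow> bool" where
  "lip L F \<longleftrightarrow> (\<forall>u\<in>\<U>. \<forall>b\<in>{1..<N}. rises b u \<longrightarrow> \<bar>F (flip b u) - F u\<bar> \<le> L * weight b)"

definition heat :: "(nat set \<Rightarrow> real) \<Rightarrow> nat set \<Rightarrow> real" where
  "heat F u = (\<Sum>b\<in>{1..<N}. (F u + F (move b u)) / 2) / real (N - 1)"

lemma weight_bounds: "b \<in> {1..<N} \<Longrightarrow> 1 \<le> weight b" "b \<in> {1..<N} \<Longrightarrow> weight b \<le> (real N)\<^sup>2"
proof -
  assume b: "b \<in> {1..<N}"
  have "1 * 1 \<le> b * (N - b)" using b by (intro mult_le_mono) auto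
  then have "1 \<le> real (b * (N - b))" by linarith
  then show "1 \<le> weight b" by (simp only: weight_def of_nat_mult)
  have "weight b \<le> real N * real N" unfolding weight_def using b by (intro mult_mono) auto
  then show "weight b \<le> (real N)\<^sup>2" by (simp add: power2_eq_square)
qed

lemma weight_concave: "b \<in> {1..<N} \<Longrightarrow> weight (b - 1) + weight (Suc b) = 2 * weight b - 2"
proof -
  assume "b \<in> {1..<N}"
  then obtain c d where b: "b = Suc c" "N = Suc c + Suc d" by (auto simp: less_iff_Suc_add dest!: Suc_le_D)
  then have "weight (b - 1) = real c * (real d + 2)" "weight (Suc b) = (real c + 2) * real d"
    "weight b = (real c + 1) * (real d + 1)"
    unfolding weight_def using b by (simp_all add: add.commute)
  then show ?thesis by (simp add: algebra_simps)
qed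

lemma lip_move:
  assumes L: "lip L F" and u: "u \<in> \<U>" and b: "b \<in> {1..<N}" and L0: "0 \<le> L"
  shows "\<bar>F (move b u) - F u\<bar> \<le> L * weight b"
proof (cases "rises b u")
  case True
  then show ?thesis using L u b by (auto simp: lip_def move_def)
next
  case False
  show ?thesis
  proof (cases "falls b u")
    case True
    then have "flip b u \<in> \<U>" using closed[OF u b] by blast
    then have "\<bar>F (flip b (flip b u)) - F (flip b u)\<bar> \<le> L * weight b"
      using L b falls_flip_rises[OF True] unfolding lip_def by blast
    then show ?thesis using True by (simp add: move_def abs_minus_commute)
  next
    case nf: False
    then show ?thesis using False L0 weight_bounds(1)[OF b] by (simp add: move_def)
  qed
qed

text \<open>Path coupling: averaging over the moves contracts the weighted distance because the
  weight is strictly concave.\<close>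

lemma heat_lip:
  assumes L: "lip L F" and L0: "0 \<le> L"
  shows "lip ((1 - 1 / real N ^ 3) * L) (heat F)"
  unfolding lip_def
proof (intro ballI impI)
  fix x b assume x: "x \<in> \<U>" and b: "b \<in> {1..<N}" and r: "rises b x"
  define y where "y = flip b x"
  have y: "y \<in> \<U>" using closed[OF x b] r by (simp add: y_def)
  have xy: "\<bar>F y - F x\<bar> \<le> L * weight b" using L x b r by (auto simp: lip_def y_def)
  define D where "D c = (F y + F (move c y)) / 2 - (F x + F (move c x)) / 2" for c
  have absD: "\<bar>D c\<bar> \<le> (\<bar>F y - F x\<bar> + \<bar>F (move c y) - F (move c x)\<bar>) / 2" for c
  proof -
    have "D c = ((F y - F x) + (F (move c y) - F (move c x))) / 2" by (simp add: D_def field_simps)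
    then show ?thesis using abs_triangle_ineq[of "F y - F x" "F (move c y) - F (move c x)"] by simp
  qed
  \<comment> \<open>The expected new distance by the place \<open>c\<close> of the move: for
    \<open>c = b\<close> both paths have the same average; next to \<open>b\<close> at most one of
    the two paths can move, and it does so with probability one half; elsewhere the move commutes
    with the exchange at \<open>b\<close>.\<close>
  define B where "B c = (if c = b then 0 else if c = Suc b \<or> b = Suc c then weight b + weight c / 2 else weight b)" for c
  have D: "\<bar>D c\<bar> \<le> L * B c" if c: "c \<in> {1..<N}" for c
  proof -
    consider "c = b" | "c \<noteq> b" "c = Suc b \<or> b = Suc c" | "c \<noteq> b" "c \<noteq> Suc b" "b \<noteq> Suc c" by blast
    then show ?thesis
    proof cases
      case 1
      have "move b x = y" using r by (simp add: move_def y_def)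
      moreover have "move b y = x" using move_move[OF x b] \<open>move b x = y\<close> by simp
      ultimately show ?thesis by (simp add: D_def B_def 1)
    next
      case 2
      have "move c x = x \<or> move c y = y"
        using 2(2) r by (auto simp: move_def rises_def falls_def y_def)
      moreover have "\<bar>F (move c x) - F x\<bar> \<le> L * weight c" "\<bar>F (move c y) - F y\<bar> \<le> L * weight c"
        using lip_move[OF L x c L0] lip_move[OF L y c L0] by auto
      ultimately have "\<bar>F (move c y) - F (move c x)\<bar> \<le> L * weight b + L * weight c"
        using xy by auto
      then have "(\<bar>F y - F x\<bar> + \<bar>F (move c y) - F (move c x)\<bar>) / 2 \<le> (L * weight b + (L * weight b + L * weight c)) / 2"
        using xy by (intro divide_right_mono add_mono) auto
      then have "\<bar>D c\<bar> \<le> (L * weight b + (L * weight b + L * weight c)) / 2"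
        using absD[of c] by (rule order_trans[rotated])
      then show ?thesis using 2 by (simp add: B_def field_simps)
    next
      case 3
      have 1: "1 \<le> b" using b by simp
      have "move c y = flip b (move c x)" unfolding y_def by (rule move_far(3)[OF 1 3])
      moreover have "rises b (move c x)"
        using r 3 by (auto simp: move_def rises_def)
      moreover have "move c x \<in> \<U>" by (rule move_in[OF x c])
      ultimately have "\<bar>F (move c y) - F (move c x)\<bar> \<le> L * weight b" using L b by (auto simp: lip_def)
      then have "(\<bar>F y - F x\<bar> + \<bar>F (move c y) - F (move c x)\<bar>) / 2 \<le> (L * weight b + L * weight b) / 2"
        using xy by (intro divide_right_mono add_mono) auto
      then have "\<bar>D c\<bar> \<le> L * weight b" using absD[of c] by simp
      then show ?thesis using 3 by (simp add: B_def)
    qed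
  qed
  \<comment> \<open>The weight is zero at 0 and \<open>N\<close>, so both neighbours may be counted
    even at the boundary; concavity then leaves a gain of exactly 1.\<close>
  have sumB: "(\<Sum>c\<in>{1..<N}. B c) \<le> real (N - 1) * weight b - 1"
  proof -
    have "B c = weight b + (if c = b then - weight b else 0) + (if c = Suc b then weight (Suc b) / 2 else 0)
        + (if c = b - 1 then weight (b - 1) / 2 else 0)" if "c \<in> {1..<N}" for c
      using that b by (auto simp: B_def)
    then have "(\<Sum>c\<in>{1..<N}. B c) = (\<Sum>c\<in>{1..<N}. weight b + (if c = b then - weight b else 0)
        + (if c = Suc b then weight (Suc b) / 2 else 0) + (if c = b - 1 then weight (b - 1) / 2 else 0))"
      by (intro sum.cong) auto
    also have "\<dots> = real (N - 1) * weight b - weight b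
        + (if Suc b \<in> {1..<N} then weight (Suc b) / 2 else 0) + (if b - 1 \<in> {1..<N} then weight (b - 1) / 2 else 0)"
      using b by (simp add: sum.distrib)
    also have "\<dots> \<le> real (N - 1) * weight b - weight b + weight (Suc b) / 2 + weight (b - 1) / 2"
      by (simp add: weight_def)
    also have "\<dots> = real (N - 1) * weight b - 1" using weight_concave[OF b] by (simp add: field_simps)
    finally show ?thesis .
  qed
  have N1: "0 < real (N - 1)" using N by simp
  have "heat F y - heat F x = (\<Sum>c\<in>{1..<N}. D c) / real (N - 1)"
    by (simp add: heat_def D_def sum_subtractf diff_divide_distrib)
  then have "\<bar>heat F y - heat F x\<bar> = \<bar>\<Sum>c\<in>{1..<N}. D c\<bar> / real (N - 1)" by simp
  also have "\<dots> \<le> (L * (real (N - 1) * weight b - 1)) / real (N - 1)"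
  proof (intro divide_right_mono)
    have "\<bar>\<Sum>c\<in>{1..<N}. D c\<bar> \<le> (\<Sum>c\<in>{1..<N}. L * B c)"
      using D by (intro order_trans[OF sum_abs] sum_mono)
    also have "\<dots> \<le> L * (real (N - 1) * weight b - 1)"
      unfolding sum_distrib_left[symmetric] using sumB L0 by (intro mult_left_mono)
    finally show "\<bar>\<Sum>c\<in>{1..<N}. D c\<bar> \<le> L * (real (N - 1) * weight b - 1)" .
  qed simp
  also have "\<dots> = L * weight b * (1 - 1 / (real (N - 1) * weight b))"
    using N1 weight_bounds(1)[OF b] by (simp add: field_simps)
  also have "\<dots> \<le> L * weight b * (1 - 1 / real N ^ 3)"
  proof (intro mult_left_mono)
    have "real (N - 1) * weight b \<le> real N * (real N)\<^sup>2"
      using weight_bounds[OF b] by (intro mult_mono) auto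
    also have "\<dots> = real N ^ 3" by (simp add: power2_eq_square power3_eq_cube)
    finally have "real (N - 1) * weight b \<le> real N ^ 3" .
    then have "1 / real N ^ 3 \<le> 1 / (real (N - 1) * weight b)"
      using N1 weight_bounds(1)[OF b] by (intro divide_left_mono) (auto intro: mult_pos_pos)
    then show "1 - 1 / (real (N - 1) * weight b) \<le> 1 - 1 / real N ^ 3" by simp
    show "0 \<le> L * weight b" using L0 weight_bounds(1)[OF b] by simp
  qed
  finally show "\<bar>heat F (flip b x) - heat F x\<bar> \<le> (1 - 1 / real N ^ 3) * L * weight b"
    by (simp add: y_def mult_ac)
qed

text \<open>If the path exceeds height 1, the last up step arriving at height at least 2 before it
  comes down to 1 again is followed by a down step, which is a peak that can be lowered. Otherwise
  the heights alternate between 0 and 1.\<close>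

lemma zigzag_or_falls:
  assumes u: "u \<in> \<U>"
  shows "u = {x \<in> {1..N}. odd x} \<or> (\<exists>b\<in>{1..<N}. falls b u)"
proof (rule disjCI)
  assume nf: "\<not> (\<exists>b\<in>{1..<N}. falls b u)"
  define C where "C i = card (u \<inter> {1..i})" for i
  have C0: "C 0 = 0" by (simp add: C_def)
  have CS: "C (Suc i) = (if Suc i \<in> u then Suc (C i) else C i)" for i
  proof -
    have "u \<inter> {1..Suc i} = (if Suc i \<in> u then insert (Suc i) (u \<inter> {1..i}) else u \<inter> {1..i})"
      by (auto simp: le_Suc_eq)
    then show ?thesis by (simp add: C_def)
  qed
  have CN: "2 * C N = N" using sub[OF u] balanced[OF u] by (simp add: C_def Int_absorb2)
  have low: "2 * C i \<le> i + 1" if "i \<le> N" for i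
  proof (rule ccontr)
    assume high: "\<not> 2 * C i \<le> i + 1"
    \<comment> \<open>The first time from \<open>i\<close> on at which the height is at most 1; it
      exists because the path ends at height 0.\<close>
    define j where "j = (LEAST j. i \<le> j \<and> 2 * C j \<le> j + 1)"
    have ex: "i \<le> N \<and> 2 * C N \<le> N + 1" using that CN by simp
    have j: "i \<le> j" "2 * C j \<le> j + 1" and jN: "j \<le> N"
      using LeastI[of "\<lambda>j. i \<le> j \<and> 2 * C j \<le> j + 1", OF ex] Least_le[of "\<lambda>j. i \<le> j \<and> 2 * C j \<le> j + 1", OF ex]
      by (auto simp: j_def)
    have before: "k + 2 \<le> 2 * C k" if "i \<le> k" "k < j" for k
      using not_less_Least[of k "\<lambda>j. i \<le> j \<and> 2 * C j \<le> j + 1"] that by (auto simp: j_def)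
    define P where "P k \<longleftrightarrow> k < j \<and> k \<in> u \<and> k + 2 \<le> 2 * C k" for k
    have "\<exists>k. 1 \<le> k \<and> P k"
    proof -
      \<comment> \<open>The path first reaches height 2 with an up step.\<close>
      define k where "k = (LEAST k. k + 2 \<le> 2 * C k)"
      have hi: "i + 2 \<le> 2 * C i" using high by simp
      have k: "k + 2 \<le> 2 * C k" "k \<le> i"
        using LeastI[of "\<lambda>k. k + 2 \<le> 2 * C k", OF hi] Least_le[of "\<lambda>k. k + 2 \<le> 2 * C k", OF hi] by (auto simp: k_def)
      have k0: "k \<noteq> 0" using k(1) C0 by (intro notI) simp
      then obtain l where l: "k = Suc l" by (cases k) auto
      have "\<not> l + 2 \<le> 2 * C l" using not_less_Least[of l "\<lambda>k. k + 2 \<le> 2 * C k"] l by (simp add: k_def)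
      then have "k \<in> u" using k(1) CS[of l] l by (auto split: if_splits)
      moreover have "i < j" using j high by (cases "i = j") auto
      ultimately show ?thesis using k k0 by (intro exI[of _ k]) (auto simp: P_def)
    qed
    then obtain k0 where k0: "1 \<le> k0" "P k0" by blast
    define k where "k = Max {k. P k}"
    have finP: "finite {k. P k}" by (rule finite_subset[of _ "{..<j}"]) (auto simp: P_def)
    have k: "P k" using Max_in[OF finP] k0 by (auto simp: k_def)
    have kge: "k0 \<le> k" using Max_ge[OF finP] k0 by (simp add: k_def)
    have "Suc k \<notin> u"
    proof
      assume Suck: "Suc k \<in> u"
      have "Suc k + 2 \<le> 2 * C (Suc k)" using k CS[of k] Suck by (simp add: P_def)
      moreover have "Suc k < j"
      proof (rule ccontr)
        assume "\<not> Suc k < j"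
        then have "Suc k = j" using k by (simp add: P_def)
        then show False using \<open>Suc k + 2 \<le> 2 * C (Suc k)\<close> j by simp
      qed
      ultimately have "P (Suc k)" using Suck by (simp add: P_def)
      then have "Suc k \<le> k" using Max_ge[OF finP, of "Suc k"] by (simp add: k_def)
      then show False by simp
    qed
    then have "falls k u" using k by (simp add: falls_def P_def C_def)
    moreover have "k \<in> {1..<N}" using k k0 kge jN by (auto simp: P_def)
    ultimately show False using nf by blast
  qed
  have "2 * C i = i + (if odd i then 1 else 0)" if "i \<le> N" for i
  proof -
    have "i \<le> 2 * C i" using ballot[OF u that] by (simp add: C_def)
    then show ?thesis using low[OF that] by presburger
  qed
  note Ci = this
  have "x \<in> u \<longleftrightarrow> odd x" if x: "x \<in> {1..N}" for x
  proof -
    obtain i where i: "x = Suc i" using x by (cases x) auto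
    then show ?thesis using Ci[of i] Ci[of x] CS[of i] x by (auto split: if_splits)
  qed
  then show "u = {x \<in> {1..N}. odd x}" using sub[OF u] by blast
qed

text \<open>Lower peaks until the zigzag is reached. Each lowering raises the sum of the positions
  of the up steps by 1, so there are at most \<open>\<Sum>{1..N}\<close> of them, each of cost at
  most \<open>(real N)\<^sup>2 * L\<close>; two paths meet at the zigzag, hence the factor
  2.\<close>

lemma lip_oscillation:
  assumes L: "lip L F" and L0: "0 \<le> L" and u: "u \<in> \<U>" and v: "v \<in> \<U>"
  shows "\<bar>F u - F v\<bar> \<le> 2 * ((real N)\<^sup>2 * real (\<Sum>{1..N})) * L"
proof -
  let ?z = "{x \<in> {1..N}. odd x}"
  have *: "\<bar>F u - F ?z\<bar> \<le> (real N)\<^sup>2 * real k * L" if "u \<in> \<U>" "\<Sum>{1..N} \<le> \<Sum>u + k" for u k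
    using that
  proof (induction k arbitrary: u)
    case 0
    have fu: "finite u" using sub[OF 0(1)] by (rule finite_subset) simp
    have False if b: "b \<in> {1..<N}" "falls b u" for b
    proof -
      have "Suc b \<in> {1..N} - u" using b by (auto simp: falls_def)
      moreover have "\<Sum>{1..N} = \<Sum>u + \<Sum>({1..N} - u)"
        using sub[OF 0(1)] by (simp add: sum.subset_diff add.commute)
      moreover have "Suc b \<le> \<Sum>({1..N} - u)" if "Suc b \<in> {1..N} - u"
        using that member_le_sum[of "Suc b" "{1..N} - u" "\<lambda>x. x"] by simp
      ultimately show False using 0(2) by linarith
    qed
    then have "u = ?z" using zigzag_or_falls[OF 0(1)] by blast
    then show ?case using L0 by simp
  next
    case (Suc k)
    show ?case
    proof (cases "u = ?z")
      case True
      then show ?thesis using L0 by simp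
    next
      case False
      then obtain b where b: "b \<in> {1..<N}" "falls b u" using zigzag_or_falls[OF Suc.prems(1)] by blast
      have fu: "finite u" using sub[OF Suc.prems(1)] by (rule finite_subset) simp
      have fl: "flip b u \<in> \<U>" using closed[OF Suc.prems(1) b(1)] b(2) by blast
      have eq: "flip b u = insert (Suc b) (u - {b})"
      proof (rule set_eqI)
        fix x show "x \<in> flip b u \<longleftrightarrow> x \<in> insert (Suc b) (u - {b})"
          using b(2) by (cases "x = b"; cases "x = Suc b") (auto simp: falls_def)
      qed
      have "\<Sum>(flip b u) = Suc (\<Sum>u)"
      proof -
        have "\<Sum>u = b + \<Sum>(u - {b})" using b(2) fu sum.remove[of u b "\<lambda>x. x"] by (simp add: falls_def)
        moreover have "\<Sum>(flip b u) = Suc b + \<Sum>(u - {b})"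
          unfolding eq using b(2) fu by (subst sum.insert) (auto simp: falls_def)
        ultimately show ?thesis by simp
      qed
      then have "\<bar>F (flip b u) - F ?z\<bar> \<le> (real N)\<^sup>2 * real k * L" using Suc.prems(2) by (intro Suc.IH fl) simp
      moreover have "\<bar>F (flip b u) - F u\<bar> \<le> L * weight b"
        using lip_move[OF L Suc.prems(1) b(1) L0] b(2) by (simp add: move_def)
      moreover have "L * weight b \<le> L * (real N)\<^sup>2" using weight_bounds(2)[OF b(1)] L0 by (intro mult_left_mono)
      ultimately show ?thesis by (simp add: algebra_simps)
    qed
  qed
  have "\<bar>F u - F ?z\<bar> \<le> (real N)\<^sup>2 * real (\<Sum>{1..N}) * L" "\<bar>F v - F ?z\<bar> \<le> (real N)\<^sup>2 * real (\<Sum>{1..N}) * L"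
    using u v by (intro *; simp)+
  then show ?thesis by simp
qed

section \<open>Symmetry, decay and gap of the averaging operator\<close>

lemma sum_move: "b \<in> {1..<N} \<Longrightarrow> (\<Sum>u\<in>\<U>. h (move b u)) = (\<Sum>u\<in>\<U>. h u)"
proof -
  assume b: "b \<in> {1..<N}"
  have "bij_betw (move b) \<U> \<U>"
    by (rule bij_betw_byWitness[where f' = "move b"]) (use move_move[OF _ b] move_in[OF _ b] in auto)
  then show ?thesis by (rule sum.reindex_bij_betw)
qed

lemma heat_symmetric: "(\<Sum>u\<in>\<U>. heat F u * G u) = (\<Sum>u\<in>\<U>. F u * heat G u)"
proof -
  have *: "(\<Sum>u\<in>\<U>. (F u + F (move b u)) / 2 * G u) = (\<Sum>u\<in>\<U>. F u * ((G u + G (move b u)) / 2))"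
    if b: "b \<in> {1..<N}" for b
  proof -
    have "(\<Sum>u\<in>\<U>. F (move b u) * G u) = (\<Sum>u\<in>\<U>. F (move b (move b u)) * G (move b u))"
      by (rule sum_move[OF b, of "\<lambda>u. F (move b u) * G u", symmetric])
    also have "\<dots> = (\<Sum>u\<in>\<U>. F u * G (move b u))" using move_move[OF _ b] by (intro sum.cong) auto
    finally show ?thesis by (simp add: field_simps sum.distrib flip: sum_divide_distrib)
  qed
  have "(\<Sum>u\<in>\<U>. heat F u * G u) = (\<Sum>u\<in>\<U>. \<Sum>b\<in>{1..<N}. (F u + F (move b u)) / 2 * G u) / real (N - 1)"
    by (simp add: heat_def sum_distrib_right sum_divide_distrib)
  also have "\<dots> = (\<Sum>b\<in>{1..<N}. \<Sum>u\<in>\<U>. F u * ((G u + G (move b u)) / 2)) / real (N - 1)"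
    by (subst sum.swap, rule arg_cong[of _ _ "\<lambda>x. x / real (N - 1)"], rule sum.cong[OF refl], rule *)
  also have "\<dots> = (\<Sum>u\<in>\<U>. F u * heat G u)"
    by (subst sum.swap) (simp add: heat_def sum_distrib_left sum_divide_distrib)
  finally show ?thesis .
qed

lemma heat_sum: "(\<Sum>u\<in>\<U>. heat F u) = (\<Sum>u\<in>\<U>. F u)"
proof -
  have "heat (\<lambda>_. 1) u = 1" for u using N by (simp add: heat_def)
  then show ?thesis using heat_symmetric[of F "\<lambda>_. 1"] by simp
qed

text \<open>Lipschitz constants shrink by a fixed factor and bound the oscillation; for functions of
  mean zero the oscillation bounds the absolute value.\<close>

lemma heat_decay:
  assumes mean: "(\<Sum>u\<in>\<U>. F u) = 0"
  shows "\<exists>C. \<forall>t. (\<Sum>u\<in>\<U>. ((heat ^^ t) F u)\<^sup>2) \<le> C * ((1 - 1 / real N ^ 3)\<^sup>2) ^ t"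
proof -
  let ?\<rho> = "1 - 1 / real N ^ 3"
  have "1 \<le> real N ^ 3" using N by simp
  then have \<rho>: "0 \<le> ?\<rho>" by (auto simp: divide_le_eq_1)
  define L where "L = 2 * (\<Sum>u\<in>\<U>. \<bar>F u\<bar>)"
  define K where "K = 2 * ((real N)\<^sup>2 * real (\<Sum>{1..N}))"
  have L0: "0 \<le> L" by (simp add: L_def sum_nonneg)
  have bound: "\<bar>F u\<bar> \<le> (\<Sum>u\<in>\<U>. \<bar>F u\<bar>)" if "u \<in> \<U>" for u
    using member_le_sum[OF that, of "\<lambda>u. \<bar>F u\<bar>"] fin by simp
  have "lip L F"
    unfolding lip_def
  proof (intro ballI impI)
    fix u b assume "u \<in> \<U>" "b \<in> {1..<N}" "rises b u"
    then have "\<bar>F (flip b u) - F u\<bar> \<le> L * 1" using bound[of u] bound[of "flip b u"] closed[of u b] by (auto simp: L_def)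
    also have "\<dots> \<le> L * weight b" using L0 weight_bounds(1)[OF \<open>b \<in> {1..<N}\<close>] by (intro mult_left_mono)
    finally show "\<bar>F (flip b u) - F u\<bar> \<le> L * weight b" .
  qed
  have lip: "lip (?\<rho> ^ t * L) ((heat ^^ t) F)" for t
  proof (induction t)
    case (Suc t)
    have "lip (?\<rho> * (?\<rho> ^ t * L)) (heat ((heat ^^ t) F))"
      using heat_lip[OF Suc] \<rho> L0 by simp
    then show ?case by (simp add: mult.assoc)
  qed (simp add: \<open>lip L F\<close>)
  have mean_t: "(\<Sum>u\<in>\<U>. (heat ^^ t) F u) = 0" for t by (induction t) (simp_all add: mean heat_sum)
  have sup: "\<bar>(heat ^^ t) F u\<bar> \<le> K * (?\<rho> ^ t * L)" if u: "u \<in> \<U>" for t u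
  proof -
    let ?G = "(heat ^^ t) F"
    have card: "0 < real (card \<U>)" using fin u by (auto simp: card_gt_0_iff)
    have "real (card \<U>) * ?G u = (\<Sum>v\<in>\<U>. ?G u - ?G v)"
      using mean_t[of t] by (simp add: sum_subtractf)
    then have "\<bar>real (card \<U>) * ?G u\<bar> = \<bar>\<Sum>v\<in>\<U>. ?G u - ?G v\<bar>" by (simp only:)
    then have "real (card \<U>) * \<bar>?G u\<bar> = \<bar>\<Sum>v\<in>\<U>. ?G u - ?G v\<bar>" by (simp only: abs_mult abs_of_nat)
    also have "\<dots> \<le> (\<Sum>v\<in>\<U>. K * (?\<rho> ^ t * L))"
      using lip_oscillation[OF lip _ u] \<rho> L0 by (intro order_trans[OF sum_abs] sum_mono) (simp add: K_def)
    also have "\<dots> = real (card \<U>) * (K * (?\<rho> ^ t * L))" by simp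
    finally show ?thesis using card by simp
  qed
  have "(\<Sum>u\<in>\<U>. ((heat ^^ t) F u)\<^sup>2) \<le> (real (card \<U>) * (K * L)\<^sup>2) * (?\<rho>\<^sup>2) ^ t" for t
  proof -
    have "(\<Sum>u\<in>\<U>. ((heat ^^ t) F u)\<^sup>2) \<le> (\<Sum>u\<in>\<U>. (K * (?\<rho> ^ t * L))\<^sup>2)"
      using sup by (intro sum_mono) (metis abs_ge_zero power2_abs power_mono)
    also have "\<dots> = (real (card \<U>) * (K * L)\<^sup>2) * (?\<rho>\<^sup>2) ^ t"
      by (simp add: power_mult_distrib power_mult[symmetric] mult.commute[of 2])
    finally show ?thesis .
  qed
  then show ?thesis by blast
qed

text \<open>The gap of \<open>heat\<close> is at least \<open>1 / real N ^ 3\<close>. The quadratic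
  form of the identity minus \<open>heat\<close> is the sum of squared differences along moves
  divided by \<open>4 * (N - 1)\<close>, a divisor that is simply dropped. Passing from squares
  around the mean to pairs gives the factor \<open>2 * real (card \<U>)\<close>.\<close>

lemma ballot_poincare:
  "(\<Sum>u\<in>\<U>. \<Sum>v\<in>\<U>. (F u - F v)\<^sup>2)
    \<le> 2 * real N ^ 3 * real (card \<U>) * (\<Sum>b\<in>{1..<N}. \<Sum>u\<in>\<U>. (F u - F (move b u))\<^sup>2)"
proof (cases "\<U> = {}")
  case False
  let ?\<rho> = "1 - 1 / real N ^ 3"
  define c where "c = (\<Sum>u\<in>\<U>. F u) / real (card \<U>)"
  define G where "G u = F u - c" for u
  have card: "0 < real (card \<U>)" using fin False by (auto simp: card_gt_0_iff)
  have mean: "(\<Sum>u\<in>\<U>. G u) = 0" using card by (simp add: G_def sum_subtractf c_def)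
  have "1 < real N" using N by simp
  then have "1 < real N ^ 3" by simp
  then have \<rho>: "0 < ?\<rho>" by (auto simp: divide_less_eq_1)
  obtain C where C: "\<And>t. (\<Sum>u\<in>\<U>. ((heat ^^ t) G u)\<^sup>2) \<le> C * (?\<rho>\<^sup>2) ^ t" using heat_decay[OF mean] by blast
  have "(\<Sum>u\<in>\<U>. G u * heat G u) \<le> ?\<rho> * (\<Sum>u\<in>\<U>. (G u)\<^sup>2)"
    by (rule operator_contraction[OF fin heat_symmetric \<rho> C])
  then have gap: "(\<Sum>u\<in>\<U>. (G u)\<^sup>2) \<le> real N ^ 3 * ((\<Sum>u\<in>\<U>. (G u)\<^sup>2) - (\<Sum>u\<in>\<U>. G u * heat G u))"
    using N by (simp add: field_simps)
  have N1: "1 \<le> real (N - 1)" using N by simp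
  let ?E = "\<Sum>b\<in>{1..<N}. \<Sum>u\<in>\<U>. (G u - G (move b u))\<^sup>2"
  have part: "(\<Sum>u\<in>\<U>. (G u)\<^sup>2 - G u * ((G u + G (move b u)) / 2)) = (\<Sum>u\<in>\<U>. (G u - G (move b u))\<^sup>2) / 4"
    if b: "b \<in> {1..<N}" for b
  proof -
    have "(\<Sum>u\<in>\<U>. (G u - G (move b u))\<^sup>2) = (\<Sum>u\<in>\<U>. (G u)\<^sup>2) + (\<Sum>u\<in>\<U>. (G (move b u))\<^sup>2) - 2 * (\<Sum>u\<in>\<U>. G u * G (move b u))"
      by (simp add: power2_diff sum.distrib sum_subtractf sum_distrib_left mult.assoc)
    also have "(\<Sum>u\<in>\<U>. (G (move b u))\<^sup>2) = (\<Sum>u\<in>\<U>. (G u)\<^sup>2)" by (rule sum_move[OF b])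
    finally have "(\<Sum>u\<in>\<U>. (G u - G (move b u))\<^sup>2) = 2 * (\<Sum>u\<in>\<U>. (G u)\<^sup>2) - 2 * (\<Sum>u\<in>\<U>. G u * G (move b u))" by simp
    moreover have "(\<Sum>u\<in>\<U>. (G u)\<^sup>2 - G u * ((G u + G (move b u)) / 2))
        = (\<Sum>u\<in>\<U>. (G u)\<^sup>2) / 2 - (\<Sum>u\<in>\<U>. G u * G (move b u)) / 2"
    proof -
      have "(G u)\<^sup>2 - G u * ((G u + G (move b u)) / 2) = (G u)\<^sup>2 / 2 - G u * G (move b u) / 2" for u
        by (simp add: power2_eq_square field_simps)
      then show ?thesis by (simp add: sum_subtractf sum_divide_distrib)
    qed
    ultimately show ?thesis by simp
  qed
  have "(\<Sum>u\<in>\<U>. (G u)\<^sup>2) - (\<Sum>u\<in>\<U>. G u * heat G u)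
      = (\<Sum>b\<in>{1..<N}. \<Sum>u\<in>\<U>. (G u)\<^sup>2 - G u * ((G u + G (move b u)) / 2)) / real (N - 1)"
  proof -
    have "(\<Sum>b\<in>{1..<N}. \<Sum>u\<in>\<U>. G u * ((G u + G (move b u)) / 2)) = real (N - 1) * (\<Sum>u\<in>\<U>. G u * heat G u)"
    proof (subst sum.swap)
      have "(\<Sum>b\<in>{1..<N}. (G u + G (move b u)) / 2) = real (N - 1) * heat G u" for u
        unfolding heat_def using N1 by simp
      then have "(\<Sum>u\<in>\<U>. \<Sum>b\<in>{1..<N}. G u * ((G u + G (move b u)) / 2))
          = (\<Sum>u\<in>\<U>. G u * (real (N - 1) * heat G u))"
        by (simp only: sum_distrib_left[symmetric])
      then show "(\<Sum>u\<in>\<U>. \<Sum>b\<in>{1..<N}. G u * ((G u + G (move b u)) / 2))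
          = real (N - 1) * (\<Sum>u\<in>\<U>. G u * heat G u)"
        by (simp only: sum_distrib_left mult.left_commute)
    qed
    moreover have "(\<Sum>b\<in>{1..<N}. \<Sum>u\<in>\<U>. (G u)\<^sup>2 - G u * ((G u + G (move b u)) / 2))
        = real (N - 1) * (\<Sum>u\<in>\<U>. (G u)\<^sup>2) - (\<Sum>b\<in>{1..<N}. \<Sum>u\<in>\<U>. G u * ((G u + G (move b u)) / 2))"
      by (simp only: sum_subtractf sum_constant card_atLeastLessThan)
    moreover have "real (N - 1) \<noteq> 0" using N1 by linarith
    ultimately show ?thesis by (simp only: right_diff_distrib[symmetric] nonzero_mult_div_cancel_left simp_thms)
  qed
  also have "\<dots> = (\<Sum>b\<in>{1..<N}. (\<Sum>u\<in>\<U>. (G u - G (move b u))\<^sup>2) / 4) / real (N - 1)"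
    by (rule arg_cong[of _ _ "\<lambda>x. x / real (N - 1)"], rule sum.cong[OF refl], rule part)
  also have "\<dots> = ?E / 4 / real (N - 1)" by (simp only: sum_divide_distrib)
  also have "\<dots> \<le> ?E"
  proof -
    have E: "0 \<le> ?E" by (intro sum_nonneg) auto
    have "?E / 4 / real (N - 1) \<le> ?E / 4 / 1" using N1 E by (intro divide_left_mono) auto
    then show ?thesis using E by simp
  qed
  finally have "real N ^ 3 * ((\<Sum>u\<in>\<U>. (G u)\<^sup>2) - (\<Sum>u\<in>\<U>. G u * heat G u)) \<le> real N ^ 3 * ?E"
    by (intro mult_left_mono) auto
  with gap have main: "(\<Sum>u\<in>\<U>. (G u)\<^sup>2) \<le> real N ^ 3 * ?E" by simp
  have "(\<Sum>u\<in>\<U>. \<Sum>v\<in>\<U>. (F u - F v)\<^sup>2) = (\<Sum>u\<in>\<U>. \<Sum>v\<in>\<U>. (G u - G v)\<^sup>2)" by (simp add: G_def)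
  also have "\<dots> = 2 * real (card \<U>) * (\<Sum>u\<in>\<U>. (G u)\<^sup>2)"
  proof -
    have "(\<Sum>v\<in>\<U>. (G u - G v)\<^sup>2) = real (card \<U>) * (G u)\<^sup>2 + (\<Sum>v\<in>\<U>. (G v)\<^sup>2)" for u
    proof -
      have "(\<Sum>v\<in>\<U>. (G u - G v)\<^sup>2) = real (card \<U>) * (G u)\<^sup>2 + (\<Sum>v\<in>\<U>. (G v)\<^sup>2) - 2 * G u * (\<Sum>v\<in>\<U>. G v)"
        by (simp add: power2_diff sum.distrib sum_subtractf sum_distrib_left)
      then show ?thesis by (simp add: mean)
    qed
    then show ?thesis by (simp add: sum.distrib sum_distrib_left mult.assoc)
  qed
  also have "\<dots> \<le> 2 * real (card \<U>) * (real N ^ 3 * ?E)" using main by (intro mult_left_mono) auto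
  finally show ?thesis by (simp add: G_def mult_ac)
qed simp

end

section \<open>Noncrossing diagrams\<close>

definition openers :: "nat \<Rightarrow> (nat \<Rightarrow> nat) \<Rightarrow> nat set" where
  "openers n \<alpha> = {x \<in> {1..2 * n}. x < \<alpha> x}"

text \<open>In genus zero the bound \<open>2 ^ (2 * g)\<close> is 1: a set of chords is determined
  by its boundary. The planarity arguments rest on this.\<close>

lemma even_chords_empty:
  assumes \<alpha>: "\<alpha> \<in> states n 0" and n: "1 \<le> n"
    and M: "M \<subseteq> chord_set n \<alpha>" "M' \<subseteq> chord_set n \<alpha>"
    and eq: "\<And>v. odd_degree n \<alpha> M v = odd_degree n \<alpha> M' v"
  shows "M = M'"
proof -
  let ?N = "{X. X \<subseteq> chord_set n \<alpha> \<and> (\<forall>v\<in>vertices_of n \<alpha>. odd_degree n \<alpha> X v \<longleftrightarrow> odd_degree n \<alpha> M v)}"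
  have "card ?N \<le> 1" using odd_degree_fibre[OF \<alpha> n, of "odd_degree n \<alpha> M"] by simp
  moreover have "finite ?N" by (rule finite_subset[of _ "Pow (chord_set n \<alpha>)"]) (auto simp: finite_chord_set)
  moreover have "M \<in> ?N" "M' \<in> ?N" using M eq by simp_all
  ultimately show ?thesis by (metis (no_types, lifting) card_le_Suc0_iff_eq One_nat_def)
qed

context
  fixes n \<alpha>
  assumes \<alpha>: "\<alpha> \<in> states n 0" and n: "1 \<le> n"
begin

lemma pl_pairings: "\<alpha> \<in> pairings n" by (rule states_pairings[OF \<alpha>])

lemma pl_in: "x \<in> {1..2 * n} \<Longrightarrow> \<alpha> x \<in> {1..2 * n}"
  using pairing_in[OF pl_pairings] by blast

text \<open>The chord glues the end of \<open>a\<close> to the beginning of its partner, so the cuts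
  at \<open>Suc a\<close> and \<open>\<alpha> a\<close> have the same boundary and coincide; a chord
  with one side strictly between \<open>a\<close> and its partner and the other outside would belong
  to just one of the two cuts.\<close>

lemma noncrossing:
  assumes a: "a \<in> {1..2 * n}" "a < \<alpha> a" and y: "a < y" "y < \<alpha> a"
  shows "a < \<alpha> y" "\<alpha> y < \<alpha> a"
proof -
  note p = pl_pairings
  let ?b = "\<alpha> a"
  have b: "?b \<in> {1..2 * n}" by (rule pl_in[OF a(1)])
  have yD: "y \<in> {1..2 * n}" using a y b by auto
  have "vertex n \<alpha> (Suc a) = vertex n \<alpha> ?b"
    using vertex_cyc[OF p, of a] a b by (simp add: cyc_less)
  then have "odd_degree n \<alpha> (cut n \<alpha> (Suc a)) v = odd_degree n \<alpha> (cut n \<alpha> ?b) v" for v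
    using odd_degree_cut[OF p, of "Suc a" v] odd_degree_cut[OF p, of ?b v] a b by auto
  then have cut: "cut n \<alpha> (Suc a) = cut n \<alpha> ?b"
    by (rule even_chords_empty[OF \<alpha> n cut_subset[OF p] cut_subset[OF p]])
  have "{y, \<alpha> y} \<in> chord_set n \<alpha>" using yD by (auto simp: chord_set_def)
  then have par: "odd (card ({y, \<alpha> y} \<inter> {1..<Suc a})) \<longleftrightarrow> odd (card ({y, \<alpha> y} \<inter> {1..<?b}))"
    using cut by (auto simp: cut_def set_eq_iff)
  have ay: "\<alpha> y \<in> {1..2 * n}" "\<alpha> y \<noteq> y" using pl_in[OF yD] pairing_neq[OF p yD] by auto
  have ne: "\<alpha> y \<noteq> a" "\<alpha> y \<noteq> ?b"
    using y pairing_involution[OF p, of y] pairing_involution[OF p, of a] by auto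
  have 1: "{y, \<alpha> y} \<inter> {1..<Suc a} = (if \<alpha> y < a then {\<alpha> y} else {})" using y ay ne by auto
  have 2: "{y, \<alpha> y} \<inter> {1..<?b} = (if \<alpha> y < ?b then {y, \<alpha> y} else {y})" using y yD ay ne by auto
  show "a < \<alpha> y" "\<alpha> y < ?b" using par unfolding 1 2 using ay ne y by (auto split: if_splits)
qed

text \<open>In a stretch of sides paired among themselves, jump from \<open>i\<close> over its chord
  to the side after its partner; the starting points of these outermost chords all lie at one
  vertex.\<close>

lemma nested_vertex:
  assumes "i \<le> b" "1 \<le> i" "b \<le> 2 * n" and "\<And>x. i \<le> x \<Longrightarrow> x < b \<Longrightarrow> i \<le> \<alpha> x \<and> \<alpha> x < b"
  shows "vertex n \<alpha> i = vertex n \<alpha> b"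
  using assms
proof (induction "b - i" arbitrary: i rule: less_induct)
  case less
  note p = pl_pairings
  show ?case
  proof (cases "i = b")
    case False
    then have ib: "i < b" using less.prems(1) by simp
    let ?j = "\<alpha> i"
    have iD: "i \<in> {1..2 * n}" using ib less.prems by auto
    have j: "i < ?j" "?j < b" using less.prems(4)[of i] ib pairing_neq[OF p iD] by auto
    have "vertex n \<alpha> (Suc ?j) = vertex n \<alpha> i"
      using vertex_glue[OF p, of i] j less.prems(2,3) by (simp add: cyc_less)
    moreover have "vertex n \<alpha> (Suc ?j) = vertex n \<alpha> b"
    proof (rule less.hyps)
      fix x assume x: "Suc ?j \<le> x" "x < b"
      have ax: "i \<le> \<alpha> x" "\<alpha> x < b" using less.prems(4)[of x] x j by auto
      have "Suc ?j \<le> \<alpha> x"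
      proof (rule ccontr)
        assume "\<not> Suc ?j \<le> \<alpha> x"
        moreover have "\<alpha> x \<noteq> i" "\<alpha> x \<noteq> ?j"
          using x j pairing_involution[OF p, of x] pairing_eq_iff[OF p, of x i] by auto
        ultimately have "i < \<alpha> x" "\<alpha> x < ?j" using ax by auto
        then have "\<alpha> (\<alpha> x) < ?j" using noncrossing(2)[OF iD j(1)] by blast
        then show False using x pairing_involution[OF p, of x] by simp
      qed
      with ax show "Suc ?j \<le> \<alpha> x \<and> \<alpha> x < b" by simp
    qed (use j less.prems(2,3) ib in auto)
    ultimately show ?thesis by simp
  qed simp
qed

lemma closer_partner: "y \<in> {1..2 * n} \<Longrightarrow> y \<notin> openers n \<alpha> \<Longrightarrow> \<alpha> y < y \<and> \<alpha> y \<in> openers n \<alpha>"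
  using pairing_neq[OF pl_pairings, of y] pl_in[of y] pairing_involution[OF pl_pairings, of y]
  by (auto simp: openers_def)

lemma opener_partner: "y \<in> openers n \<alpha> \<Longrightarrow> y < \<alpha> y \<and> \<alpha> y \<in> {1..2 * n} \<and> \<alpha> y \<notin> openers n \<alpha>"
  using pl_in[of y] pairing_involution[OF pl_pairings, of y] by (auto simp: openers_def)

lemma openers_ballot:
  assumes "i \<le> 2 * n"
  shows "i \<le> 2 * card (openers n \<alpha> \<inter> {1..i})"
proof -
  let ?U = "openers n \<alpha>"
  have "card ({1..i} - ?U) \<le> card (?U \<inter> {1..i})"
  proof (rule card_inj_on_le)
    show "inj_on \<alpha> ({1..i} - ?U)" using pairing_eq_iff[OF pl_pairings] by (auto intro: inj_onI)
    show "\<alpha> ` ({1..i} - ?U) \<subseteq> ?U \<inter> {1..i}"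
    proof (rule image_subsetI)
      fix y assume y: "y \<in> {1..i} - ?U"
      then have "\<alpha> y < y \<and> \<alpha> y \<in> ?U" using assms by (intro closer_partner) auto
      then show "\<alpha> y \<in> ?U \<inter> {1..i}" using y by (auto simp: openers_def)
    qed
  qed simp
  moreover have "card {1..i} = card (?U \<inter> {1..i}) + card ({1..i} - ?U)"
    using card_Int_Diff[of "{1..i}" ?U] by (simp add: Int_commute)
  ultimately show ?thesis by simp
qed

lemma openers_balanced: "2 * card (openers n \<alpha>) = 2 * n"
proof -
  let ?U = "openers n \<alpha>"
  have "bij_betw \<alpha> ?U ({1..2 * n} - ?U)"
  proof (rule bij_betw_byWitness[where f' = \<alpha>])
    show "\<alpha> ` ?U \<subseteq> {1..2 * n} - ?U" using opener_partner by blast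
    show "\<alpha> ` ({1..2 * n} - ?U) \<subseteq> ?U" using closer_partner by blast
  qed (simp_all add: pairing_involution[OF pl_pairings])
  then have "card ?U = card ({1..2 * n} - ?U)" by (rule bij_betw_same_card)
  moreover have "?U \<subseteq> {1..2 * n}" by (auto simp: openers_def)
  then have "card ({1..2 * n} - ?U) + card ?U = 2 * n" using card_mono[of "{1..2 * n}" ?U]
    by (simp add: card_Diff_subset finite_subset)
  ultimately show ?thesis by simp
qed

text \<open>The exchange makes \<open>b\<close> and \<open>Suc b\<close> partners, and likewise
  their former partners. If it did not merge two vertices, the two old chords would have the same
  boundary, which genus zero forbids.\<close>

lemma flip_rise_state:
  assumes b: "b \<in> {1..<2 * n}" and r: "rises b (openers n \<alpha>)"
  shows "\<exists>\<beta>\<in>states n 0. adj n \<alpha> \<beta> \<and> openers n \<beta> = flip b (openers n \<alpha>)"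
proof -
  note p = pl_pairings
  let ?U = "openers n \<alpha>"
  let ?a = "\<alpha> b" and ?c = "Suc b" and ?d = "\<alpha> (Suc b)"
  have D: "b \<in> {1..2 * n}" "?c \<in> {1..2 * n}" using b by auto
  have D': "?d \<in> {1..2 * n}" "?a \<in> {1..2 * n}" using pl_in D by auto
  have a: "?a < b" using closer_partner[OF D(1)] r by (simp add: rises_def)
  have d: "?c < ?d" using opener_partner[of ?c] r by (simp add: rises_def)
  have ne: "b \<noteq> ?d" "?d \<noteq> ?a" using a d by auto
  have ad: "\<alpha> ?d = ?c" by (rule pairing_involution[OF p])
  have v1: "vertex n \<alpha> ?a = vertex n \<alpha> ?c" using vertex_cyc[OF p, of b] b by (simp add: cyc_less)
  have vne: "vertex n \<alpha> b \<noteq> vertex n \<alpha> ?d"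
  proof
    assume v2: "vertex n \<alpha> b = vertex n \<alpha> ?d"
    have "{b, ?a} \<noteq> {?c, ?d}" using a d by (auto simp: doubleton_eq_iff)
    then have "sym_diff {{b, ?a}} {{?c, ?d}} = {{b, ?a}, {?c, ?d}}" by auto
    moreover have sub: "{{b, ?a}} \<subseteq> chord_set n \<alpha>" "{{?c, ?d}} \<subseteq> chord_set n \<alpha>"
      using D by (auto simp: chord_set_def)
    have "odd_degree n \<alpha> {{b, ?a}} v = odd_degree n \<alpha> {{?c, ?d}} v" for v
      unfolding odd_degree_chord[OF p D(1)] odd_degree_chord[OF p D(2)] using v1 v2 by metis
    then have "{{b, ?a}} = {{?c, ?d}}" by (rule even_chords_empty[OF \<alpha> n sub])
    then show False using \<open>{b, ?a} \<noteq> {?c, ?d}\<close> by simp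
  qed
  let ?\<beta> = "sw \<alpha> b ?d"
  have st: "?\<beta> \<in> states n 0" "adj n \<alpha> ?\<beta>"
    using sw_fold_states[OF \<alpha> D(1) D'(1) ne(2) vne] v1 ad by simp_all
  note ap = sw_apply[OF p D(1) D'(1) ne, unfolded ad]
  have "openers n ?\<beta> = flip b ?U"
  proof (rule set_eqI)
    fix x
    consider "x = b" | "x = ?c" | "x = ?a" | "x = ?d" | "x \<notin> {b, ?c, ?a, ?d}" by blast
    then show "x \<in> openers n ?\<beta> \<longleftrightarrow> x \<in> flip b ?U"
    proof cases
      case 1
      then show ?thesis using r D by (simp add: openers_def ap rises_def)
    next
      case 2
      have "?c \<noteq> ?a" "?c \<noteq> b" "?c \<noteq> ?d" using a d by auto
      then show ?thesis using 2 r by (simp add: openers_def ap rises_def)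
    next
      case 3
      have "?a \<in> ?U" using closer_partner[OF D(1)] r by (simp add: rises_def)
      moreover have "?a \<noteq> b" "?a \<noteq> ?c" "?a \<noteq> ?d" using a d by auto
      ultimately show ?thesis using 3 a d D' by (simp add: openers_def ap)
    next
      case 4
      have "?d \<notin> ?U" using opener_partner[of ?c] r by (simp add: rises_def)
      moreover have "?d \<noteq> b" "?d \<noteq> ?c" using a d by auto
      ultimately show ?thesis using 4 a d by (simp add: openers_def ap)
    next
      case 5
      then show ?thesis by (simp add: openers_def ap)
    qed
  qed
  with st show ?thesis by blast
qed

text \<open>At a peak the sides \<open>b\<close> and \<open>Suc b\<close> are partners. Height at
  least 2 means that some chord encloses them; the exchange with the innermost such chord makes
  \<open>b\<close> a closing and \<open>Suc b\<close> an opening side.\<close>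

lemma flip_fall_state:
  assumes b: "b \<in> {1..<2 * n}" and f: "falls b (openers n \<alpha>)"
  shows "\<exists>\<beta>\<in>states n 0. adj n \<alpha> \<beta> \<and> openers n \<beta> = flip b (openers n \<alpha>)"
proof -
  note p = pl_pairings
  let ?U = "openers n \<alpha>"
  have D: "b \<in> {1..2 * n}" "Suc b \<in> {1..2 * n}" using b by auto
  have U: "b \<in> ?U" "Suc b \<notin> ?U" using f by (auto simp: falls_def)
  have ab: "\<alpha> b = Suc b"
  proof (rule ccontr)
    assume "\<alpha> b \<noteq> Suc b"
    then have "Suc b < \<alpha> b" "b < \<alpha> b" using opener_partner[OF U(1)] by auto
    then have "b < \<alpha> (Suc b)" using noncrossing(1)[OF D(1), of "Suc b"] by simp
    then show False using closer_partner[OF D(2) U(2)] by simp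
  qed
  have ac: "\<alpha> (Suc b) = b" using ab pairing_involution[OF p] by metis
  have "\<exists>e. e < b \<and> e \<in> ?U \<and> Suc b < \<alpha> e"
  proof (rule ccontr)
    assume none: "\<not> ?thesis"
    have small: "\<alpha> e < b" if "e \<in> ?U" "e < b" for e
    proof -
      have "\<alpha> e \<noteq> b" "\<alpha> e \<noteq> Suc b" using that ab ac pairing_involution[OF p, of e] by auto
      then show ?thesis using none that by (metis linorder_neqE_nat less_antisym)
    qed
    \<comment> \<open>If every side opened before \<open>b\<close> were also closed before
      \<open>b\<close>, the height at \<open>b\<close> would be at most 1.\<close>
    have "card (?U \<inter> {1..<b}) \<le> card ({1..<b} - ?U)"
    proof (rule card_inj_on_le)
      show "inj_on \<alpha> (?U \<inter> {1..<b})" using pairing_eq_iff[OF p] by (auto intro: inj_onI)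
      show "\<alpha> ` (?U \<inter> {1..<b}) \<subseteq> {1..<b} - ?U"
        using small opener_partner by fastforce
    qed simp
    moreover have "card {1..<b} = card (?U \<inter> {1..<b}) + card ({1..<b} - ?U)"
      using card_Int_Diff[of "{1..<b}" ?U] by (simp add: Int_commute)
    ultimately have "2 * card (?U \<inter> {1..<b}) \<le> b - 1" by simp
    moreover have "?U \<inter> {1..b} = insert b (?U \<inter> {1..<b})" using U b by auto
    then have "card (?U \<inter> {1..b}) = Suc (card (?U \<inter> {1..<b}))" by simp
    moreover have "b + 2 \<le> 2 * card (?U \<inter> {1..b})" using f by (simp add: falls_def)
    ultimately show False using b by auto
  qed
  then obtain e0 where e0: "e0 < b" "e0 \<in> ?U" "Suc b < \<alpha> e0" by blast
  define Q where "Q = {e. e < b \<and> e \<in> ?U \<and> Suc b < \<alpha> e}"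
  have finQ: "finite Q" by (rule finite_subset[of _ "{..<b}"]) (auto simp: Q_def)
  have Qne: "Q \<noteq> {}" using e0 by (auto simp: Q_def)
  define e where "e = Max Q"
  have e: "e < b" "e \<in> ?U" "Suc b < \<alpha> e" using Max_in[OF finQ Qne] by (auto simp: e_def Q_def)
  have emax: "e' \<le> e" if "e' < b" "e' \<in> ?U" "Suc b < \<alpha> e'" for e'
    using Max_ge[OF finQ, of e'] that by (simp add: e_def Q_def)
  have De: "e \<in> {1..2 * n}" using e(2) by (simp add: openers_def)
  let ?f = "\<alpha> e"
  have Df: "?f \<in> {1..2 * n}" using pl_in[OF De] .
  \<comment> \<open>Since \<open>e\<close> is the innermost choice, the sides strictly between
    \<open>e\<close> and \<open>b\<close> are paired among themselves; so \<open>\<alpha> e\<close>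
    and \<open>b\<close> share a vertex.\<close>
  have inner: "Suc e \<le> \<alpha> x \<and> \<alpha> x < b" if x: "Suc e \<le> x" "x < b" for x
  proof -
    have xD: "x \<in> {1..2 * n}" using x De D by auto
    have "e < \<alpha> x" using noncrossing(1)[OF De, of x] e x by simp
    moreover have "\<alpha> x \<noteq> b" "\<alpha> x \<noteq> Suc b" using x ab ac pairing_involution[OF p, of x] by auto
    moreover have "\<not> Suc b < \<alpha> x"
    proof
      assume "Suc b < \<alpha> x"
      then have "x \<in> ?U" using x xD by (simp add: openers_def)
      then have "x \<le> e" using emax x \<open>Suc b < \<alpha> x\<close> by simp
      then show False using x by simp
    qed
    ultimately show ?thesis by auto
  qed
  have "vertex n \<alpha> (Suc e) = vertex n \<alpha> b"
    using e D inner by (intro nested_vertex) auto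
  then have v1: "vertex n \<alpha> ?f = vertex n \<alpha> b"
    using vertex_cyc[OF p, of e] e De D by (simp add: cyc_less)
  have leaf: "\<alpha> b = cyc n b" using ab b by (simp add: cyc_less)
  have cb: "cyc n b = Suc b" using b by (simp add: cyc_less)
  have vne: "vertex n \<alpha> (Suc b) \<noteq> vertex n \<alpha> e"
    using leaf_vertex(1)[OF p leaf, of e] e unfolding cb by (metis less_SucI less_irrefl)
  have ne: "Suc b \<noteq> e" "e \<noteq> \<alpha> (Suc b)" using e ac by auto
  let ?\<beta> = "sw \<alpha> (Suc b) e"
  have st: "?\<beta> \<in> states n 0" "adj n \<alpha> ?\<beta>"
    using sw_fold_states[OF \<alpha> D(2) De ne(2) vne] v1 ac by simp_all
  note ap = sw_apply[OF p D(2) De ne, unfolded ac]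
  have "openers n ?\<beta> = flip b ?U"
  proof (rule set_eqI)
    fix x
    consider "x = b" | "x = Suc b" | "x = e" | "x = ?f" | "x \<notin> {b, Suc b, e, ?f}" by blast
    then show "x \<in> openers n ?\<beta> \<longleftrightarrow> x \<in> flip b ?U"
    proof cases
      case 1
      then show ?thesis using U e by (simp add: openers_def ap)
    next
      case 2
      then show ?thesis using U e D by (simp add: openers_def ap)
    next
      case 3
      then show ?thesis using e De by (simp add: openers_def ap)
    next
      case 4
      have "?f \<notin> ?U" using opener_partner[OF e(2)] by simp
      then show ?thesis using 4 e by (simp add: openers_def ap)
    next
      case 5
      then show ?thesis by (simp add: openers_def ap)
    qed
  qed
  with st show ?thesis by blast
qed

end

text \<open>Compare the partners of the first closing side \<open>y\<close> at which the diagrams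
  differ. The partner further right lies inside the chord of \<open>y\<close> in the other diagram,
  so it is closed there before \<open>y\<close>, where both diagrams agree: a contradiction.\<close>

lemma openers_inj:
  assumes \<alpha>: "\<alpha> \<in> states n 0" and \<beta>: "\<beta> \<in> states n 0" and n: "1 \<le> n" and eq: "openers n \<alpha> = openers n \<beta>"
  shows "\<alpha> = \<beta>"
proof -
  note pa = states_pairings[OF \<alpha>] and pb = states_pairings[OF \<beta>]
  have aux: False
    if st: "\<gamma> \<in> states n 0" "\<delta> \<in> states n 0" and eq: "openers n \<gamma> = openers n \<delta>"
      and y: "y \<in> {1..2 * n}" "y \<notin> openers n \<gamma>" and lt: "\<gamma> y < \<delta> y"
      and IH: "\<And>z. z < y \<Longrightarrow> z \<in> {1..2 * n} \<Longrightarrow> z \<notin> openers n \<gamma> \<Longrightarrow> \<gamma> z = \<delta> z" for \<gamma> \<delta> y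
  proof -
    note pg = states_pairings[OF st(1)] and pd = states_pairings[OF st(2)]
    have g: "\<gamma> y < y" "\<gamma> y \<in> openers n \<gamma>" using closer_partner[OF st(1) n y] by auto
    have d: "\<delta> y < y" "\<delta> y \<in> openers n \<gamma>" using closer_partner[OF st(2) n y(1)] y(2) eq by auto
    have D: "\<gamma> y \<in> {1..2 * n}" using g(2) by (simp add: openers_def)
    have gg: "\<gamma> (\<gamma> y) = y" by (rule pairing_involution[OF pg])
    let ?z = "\<gamma> (\<delta> y)"
    have "?z < y" using noncrossing(2)[OF st(1) n D, of "\<delta> y"] g d lt gg by simp
    moreover have z: "?z \<in> {1..2 * n}" "?z \<notin> openers n \<gamma>" using opener_partner[OF st(1) n d(2)] by auto
    ultimately have "\<gamma> ?z = \<delta> ?z" by (rule IH)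
    then have "\<delta> y = \<delta> ?z" using pairing_involution[OF pg] by simp
    then have "y = ?z" using pairing_eq_iff[OF pd] by simp
    with \<open>?z < y\<close> show False by simp
  qed
  have closer: "\<alpha> y = \<beta> y" if "y \<in> {1..2 * n}" "y \<notin> openers n \<alpha>" for y
    using that
  proof (induction y rule: less_induct)
    case (less y)
    show ?case
    proof (rule ccontr)
      assume "\<alpha> y \<noteq> \<beta> y"
      then consider "\<alpha> y < \<beta> y" | "\<beta> y < \<alpha> y" by linarith
      then show False
      proof cases
        case 1
        show False by (rule aux[OF \<alpha> \<beta> eq less.prems 1]) (use less.IH in auto)
      next
        case 2
        have "y \<notin> openers n \<beta>" using less.prems eq by simp
        then show False
          by (rule aux[OF \<beta> \<alpha> eq[symmetric] less.prems(1) _ 2]) (use less.IH eq in auto)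
      qed
    qed
  qed
  show ?thesis
  proof
    fix x
    consider "x \<notin> {1..2 * n}" | "x \<in> {1..2 * n}" "x \<notin> openers n \<alpha>" | "x \<in> openers n \<alpha>" by blast
    then show "\<alpha> x = \<beta> x"
    proof cases
      case 1
      then show ?thesis using permutes_not_in[OF pairing_permutes[OF pa]] permutes_not_in[OF pairing_permutes[OF pb]] by simp
    next
      case 2
      then show ?thesis by (rule closer)
    next
      case 3
      then have "\<alpha> x \<in> {1..2 * n}" "\<alpha> x \<notin> openers n \<alpha>" using opener_partner[OF \<alpha> n] by blast+
      then have "\<beta> (\<alpha> x) = x" using closer[of "\<alpha> x"] pairing_involution[OF pa, of x] by simp
      then show ?thesis using pairing_involution[OF pb, of "\<alpha> x"] by simp
    qed
  qed
qed

text \<open>For a fixed position \<open>b\<close> different diagrams that move give different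
  adjacent pairs, so each position costs at most the energy. The constant is
  \<open>2 * real (2 * n) ^ 3\<close> from the ballot paths times \<open>2 * n\<close> for the
  number of positions.\<close>

lemma poincare_planar:
  assumes n: "1 \<le> n"
  shows "poincare n 0 (32 * real n ^ 4)"
  unfolding poincare_def
proof
  fix f
  let ?S = "states n 0"
  let ?U = "openers n ` ?S"
  have inj: "inj_on (openers n) ?S" using openers_inj[OF _ _ n] by (intro inj_onI)
  define h where "h = inv_into ?S (openers n)"
  have h: "h (openers n \<alpha>) = \<alpha>" if "\<alpha> \<in> ?S" for \<alpha> using inj that by (simp add: h_def inv_into_f_f)
  have flip: "\<exists>\<beta>\<in>?S. adj n \<alpha> \<beta> \<and> openers n \<beta> = flip b (openers n \<alpha>)"
    if "\<alpha> \<in> ?S" "b \<in> {1..<2 * n}" "rises b (openers n \<alpha>) \<or> falls b (openers n \<alpha>)" for \<alpha> b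
    using that flip_rise_state[OF _ n] flip_fall_state[OF _ n] by blast
  have "(\<Sum>u\<in>?U. \<Sum>v\<in>?U. (f (h u) - f (h v))\<^sup>2)
    \<le> 2 * real (2 * n) ^ 3 * real (card ?U) * (\<Sum>b\<in>{1..<2 * n}. \<Sum>u\<in>?U. (f (h u) - f (h (move b u)))\<^sup>2)"
  proof (rule ballot_poincare[where F = "\<lambda>u. f (h u)"])
    show "2 \<le> 2 * n" "finite ?U" using n finite_states by auto
    show "u \<subseteq> {1..2 * n}" if "u \<in> ?U" for u using that by (auto simp: openers_def)
    show "i \<le> 2 * card (u \<inter> {1..i})" if "u \<in> ?U" "i \<le> 2 * n" for u i
      using that openers_ballot[OF _ n] by auto
    show "2 * card u = 2 * n" if "u \<in> ?U" for u using that openers_balanced[OF _ n] by auto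
    show "flip b u \<in> ?U" if u: "u \<in> ?U" and b: "b \<in> {1..<2 * n}" and m: "rises b u \<or> falls b u" for u b
    proof -
      obtain \<alpha> where "\<alpha> \<in> ?S" "u = openers n \<alpha>" using u by blast
      then show ?thesis using flip[of \<alpha> b] b m by (metis imageI)
    qed
  qed
  also have "(\<Sum>u\<in>?U. \<Sum>v\<in>?U. (f (h u) - f (h v))\<^sup>2) = (\<Sum>\<alpha>\<in>?S. \<Sum>\<beta>\<in>?S. (f \<alpha> - f \<beta>)\<^sup>2)"
    by (simp add: sum.reindex[OF inj] h)
  also have "(\<Sum>b\<in>{1..<2 * n}. \<Sum>u\<in>?U. (f (h u) - f (h (move b u)))\<^sup>2) \<le> (\<Sum>b\<in>{1..<2 * n}. energy n 0 f)"
  proof (rule sum_mono)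
    fix b assume b: "b \<in> {1..<2 * n}"
    let ?E = "{(\<alpha>, \<beta>). \<alpha> \<in> ?S \<and> \<beta> \<in> ?S \<and> adj n \<alpha> \<beta>}"
    let ?A = "{\<alpha> \<in> ?S. rises b (openers n \<alpha>) \<or> falls b (openers n \<alpha>)}"
    let ?\<psi> = "\<lambda>\<alpha>. (\<alpha>, h (move b (openers n \<alpha>)))"
    have mv: "h (move b (openers n \<alpha>)) \<in> ?S \<and> adj n \<alpha> (h (move b (openers n \<alpha>)))" if "\<alpha> \<in> ?A" for \<alpha>
    proof -
      have \<alpha>: "\<alpha> \<in> ?S" and m: "rises b (openers n \<alpha>) \<or> falls b (openers n \<alpha>)" using that by auto
      obtain \<beta> where \<beta>: "\<beta> \<in> ?S" "adj n \<alpha> \<beta>" "openers n \<beta> = flip b (openers n \<alpha>)"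
        using flip[OF \<alpha> b m] by blast
      have "h (move b (openers n \<alpha>)) = \<beta>" using h[OF \<beta>(1)] \<beta>(3) m by (simp add: move_def)
      then show ?thesis using \<beta> by simp
    qed
    have "(\<Sum>u\<in>?U. (f (h u) - f (h (move b u)))\<^sup>2) = (\<Sum>\<alpha>\<in>?S. (f \<alpha> - f (h (move b (openers n \<alpha>))))\<^sup>2)"
      by (simp add: sum.reindex[OF inj] h)
    also have "\<dots> = (\<Sum>\<alpha>\<in>?A. (f \<alpha> - f (h (move b (openers n \<alpha>))))\<^sup>2)"
      by (rule sum.mono_neutral_right) (auto simp: finite_states move_def h)
    also have "\<dots> = (\<Sum>e\<in>?\<psi> ` ?A. (f (fst e) - f (snd e))\<^sup>2)"
      by (subst sum.reindex) (auto intro: inj_onI)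
    also have "\<dots> \<le> (\<Sum>e\<in>?E. (f (fst e) - f (snd e))\<^sup>2)"
      by (rule sum_mono2[OF finite_adj_pairs]) (use mv in auto)
    finally show "(\<Sum>u\<in>?U. (f (h u) - f (h (move b u)))\<^sup>2) \<le> energy n 0 f"
      by (simp add: energy_def case_prod_beta)
  qed
  also have "card ?U = card ?S" by (rule card_image[OF inj])
  also have "2 * real (2 * n) ^ 3 * real (card ?S) * (\<Sum>b\<in>{1..<2 * n}. energy n 0 f)
      \<le> 2 * real (2 * n) ^ 3 * real (card ?S) * (2 * real n * energy n 0 f)"
    using energy_nonneg by (intro mult_left_mono) (auto intro: mult_right_mono)
  also have "\<dots> = 32 * real n ^ 4 * real (card ?S) * energy n 0 f"
    by (simp add: power_mult_distrib eval_nat_numeral)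
  finally show "(\<Sum>\<alpha>\<in>?S. \<Sum>\<beta>\<in>?S. (f \<alpha> - f \<beta>)\<^sup>2) \<le> 32 * real n ^ 4 * real (card ?S) * energy n 0 f"
    by (simp add: mult_left_mono)
qed

section \<open>Chord diagrams and the swap kernel\<close>

context
  fixes n :: nat and \<alpha> :: "nat \<Rightarrow> nat"
  assumes \<alpha>: "\<alpha> \<in> pairings n"
begin

lemma chord_mem_iff: "{a, b} \<in> chord_set n \<alpha> \<longleftrightarrow> a \<in> {1..2 * n} \<and> b = \<alpha> a"
proof
  assume "{a, b} \<in> chord_set n \<alpha>"
  then obtain x where x: "x \<in> {1..2 * n}" "{a, b} = {x, \<alpha> x}" unfolding chord_set_def by (rule imageE)
  then have "a = x \<and> b = \<alpha> x \<or> a = \<alpha> x \<and> b = x" by (simp only: doubleton_eq_iff)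
  then show "a \<in> {1..2 * n} \<and> b = \<alpha> a"
    using x(1) pairing_in[OF \<alpha>, of x] pairing_involution[OF \<alpha>, of x] by metis
qed (auto simp: chord_set_def)

lemma chord_set_diagram: "chord_set n \<alpha> \<in> chord_diagrams n"
proof -
  have "c \<in> chords n" if c: "c \<in> chord_set n \<alpha>" for c
  proof -
    obtain x where x: "x \<in> {1..2 * n}" "c = {x, \<alpha> x}" using c unfolding chord_set_def by (rule imageE)
    have "\<alpha> x \<in> {1..2 * n}" using pairing_in[OF \<alpha>] x(1) by simp
    then show ?thesis using x(1) pairing_neq[OF \<alpha> x(1)] unfolding x(2) chords_def sides_def by simp
  qed
  moreover have "\<exists>!c. c \<in> chord_set n \<alpha> \<and> s \<in> c" if s: "s \<in> sides n" for s
  proof (rule ex1I)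
    show "{s, \<alpha> s} \<in> chord_set n \<alpha> \<and> s \<in> {s, \<alpha> s}" using s by (simp add: chord_mem_iff sides_def)
    fix c assume c: "c \<in> chord_set n \<alpha> \<and> s \<in> c"
    then obtain x where x: "c = {x, \<alpha> x}" unfolding chord_set_def by (elim conjE imageE)
    then have "s = x \<or> s = \<alpha> x" using c by simp
    then show "c = {s, \<alpha> s}" unfolding x chord_eq_iff[OF \<alpha>] .
  qed
  ultimately show ?thesis using card_chord_set[OF \<alpha>] by (auto simp: chord_diagrams_def)
qed

lemma identified_chord_set: "identified n (chord_set n \<alpha>) = (\<lambda>x. (x, cyc n (\<alpha> x))) ` {1..2 * n}"
proof -
  have "(\<exists>y. e = (x, next_vertex n y) \<and> {x, y} \<in> chord_set n \<alpha> \<and> x \<noteq> y)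
      \<longleftrightarrow> x \<in> {1..2 * n} \<and> e = (x, cyc n (\<alpha> x))" for e x
    using pairing_neq[OF \<alpha>, of x] pairing_in[OF \<alpha>, of x] unfolding chord_mem_iff cyc_def by metis
  then show ?thesis unfolding identified_def by blast
qed

text \<open>The classes are generated by gluing steps in both directions; a cycle of a permutation
  of a finite set already contains the backward steps.\<close>

lemma vertex_classes_chord_set: "vertex_classes n (chord_set n \<alpha>) = vertices_of n \<alpha>"
proof -
  let ?R = "identified n (chord_set n \<alpha>)"
  have "(?R \<union> ?R\<inverse>)\<^sup>* `` {x} = vertex n \<alpha> x" if x: "x \<in> {1..2 * n}" for x
  proof (intro equalityI subsetI)
    fix y assume "y \<in> (?R \<union> ?R\<inverse>)\<^sup>* `` {x}"
    then have "(x, y) \<in> (?R \<union> ?R\<inverse>)\<^sup>*" by simp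
    then have "vertex n \<alpha> y = vertex n \<alpha> x"
    proof induction
      case (step y z)
      have "vertex n \<alpha> z = vertex n \<alpha> y"
        using step.hyps(2) vertex_glue[OF \<alpha>] unfolding identified_chord_set by auto
      with step.IH show ?case by simp
    qed simp
    then show "y \<in> vertex n \<alpha> x" by (simp only: vertex_eq_iff[OF \<alpha>])
  next
    fix y assume "y \<in> vertex n \<alpha> x"
    then have "y \<in> orbit (cyc n \<circ> \<alpha>) x" by (simp add: vertex_def)
    then have "(x, y) \<in> (?R \<union> ?R\<inverse>)\<^sup>* \<and> y \<in> {1..2 * n}"
    proof induction
      case base
      show ?case using x cyc_in pairing_in[OF \<alpha>] by (auto simp: identified_chord_set)
    next
      case (step y)
      then have "(y, (cyc n \<circ> \<alpha>) y) \<in> ?R \<union> ?R\<inverse>" by (auto simp: identified_chord_set)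
      moreover have "(cyc n \<circ> \<alpha>) y \<in> {1..2 * n}" using step cyc_in pairing_in[OF \<alpha>] by auto
      ultimately show ?case using step.IH by (meson rtrancl.rtrancl_into_rtrancl)
    qed
    then show "y \<in> (?R \<union> ?R\<inverse>)\<^sup>* `` {x}" by simp
  qed
  then show ?thesis unfolding vertex_classes_def quotient_def vertices_def by auto
qed

lemma chord_set_genus: "chord_set n \<alpha> \<in> genus_diagrams n g \<longleftrightarrow> \<alpha> \<in> states n g"
proof -
  have "genus n (chord_set n \<alpha>) = real g \<longleftrightarrow> real n + 1 = real (card (vertices_of n \<alpha>)) + 2 * real g"
    by (auto simp: genus_def vertex_classes_chord_set)
  also have "\<dots> \<longleftrightarrow> card (vertices_of n \<alpha>) + 2 * g = n + 1" by linarith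
  finally show ?thesis
    using chord_set_diagram \<alpha> by (simp add: genus_diagrams_def states_def cycles_def vertex_def)
qed

end

section \<open>Chord swaps and exchanges of an involution\<close>

lemma adj_chord_swap:
  assumes \<alpha>: "\<alpha> \<in> pairings n" and adj: "adj n \<alpha> \<beta>"
  shows "chord_swap (chord_set n \<alpha>) (chord_set n \<beta>)"
proof -
  obtain b d where bd: "b \<in> {1..2 * n}" "d \<in> {1..2 * n}" "b \<noteq> d" "d \<noteq> \<alpha> b" and \<beta>: "\<beta> = sw \<alpha> b d"
    using adj unfolding adj_def by metis
  note app = sw_apply[OF \<alpha> bd]
  have in': "\<alpha> b \<in> {1..2 * n}" "\<alpha> d \<in> {1..2 * n}" using bd(1,2) pairing_in[OF \<alpha>] by blast+
  have new: "{\<alpha> b, d} \<in> chord_set n \<beta>" "{b, \<alpha> d} \<in> chord_set n \<beta>"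
    using bd in' sw_distinct[OF \<alpha> bd] unfolding \<beta> chord_mem_iff[OF sw_pairings[OF \<alpha> bd]] app by simp_all
  have "chord_set n \<beta> = (chord_set n \<alpha> - {{b, \<alpha> b}, {d, \<alpha> d}}) \<union> {{b, \<alpha> d}, {\<alpha> b, d}}"
  proof (intro equalityI subsetI)
    fix c assume "c \<in> chord_set n \<beta>"
    then obtain x where x: "x \<in> {1..2 * n}" "c = {x, \<beta> x}" unfolding chord_set_def by (rule imageE)
    consider "x = b \<or> x = d \<or> x = \<alpha> b \<or> x = \<alpha> d" | "x \<noteq> b" "x \<noteq> d" "x \<noteq> \<alpha> b" "x \<noteq> \<alpha> d" by blast
    then show "c \<in> (chord_set n \<alpha> - {{b, \<alpha> b}, {d, \<alpha> d}}) \<union> {{b, \<alpha> d}, {\<alpha> b, d}}"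
    proof cases
      case 1
      then have "c = {b, \<alpha> d} \<or> c = {\<alpha> b, d}"
        using bd(3) sw_distinct[OF \<alpha> bd] unfolding x(2) \<beta> app by (auto simp: insert_commute)
      then show ?thesis by blast
    next
      case 2
      then have "c = {x, \<alpha> x}" unfolding x(2) \<beta> app by simp
      moreover have "x \<notin> {b, \<alpha> b}" "x \<notin> {d, \<alpha> d}" using 2 by auto
      ultimately show ?thesis using x(1) unfolding chord_set_def by blast
    qed
  next
    fix c assume c: "c \<in> (chord_set n \<alpha> - {{b, \<alpha> b}, {d, \<alpha> d}}) \<union> {{b, \<alpha> d}, {\<alpha> b, d}}"
    show "c \<in> chord_set n \<beta>"
    proof (cases "c = {b, \<alpha> d} \<or> c = {\<alpha> b, d}")
      case True
      then show ?thesis using new by metis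
    next
      case False
      with c have c: "c \<in> chord_set n \<alpha>" "c \<noteq> {b, \<alpha> b}" "c \<noteq> {d, \<alpha> d}" by blast+
      then obtain x where x: "x \<in> {1..2 * n}" "c = {x, \<alpha> x}" unfolding chord_set_def by (elim imageE)
      then have "\<not> (x = b \<or> x = \<alpha> b)" "\<not> (x = d \<or> x = \<alpha> d)"
        using c(2,3) chord_eq_iff[OF \<alpha>, of b x] chord_eq_iff[OF \<alpha>, of d x] by metis+
      then have eq: "\<beta> x = \<alpha> x" unfolding \<beta> app by simp
      have "{x, \<beta> x} \<in> chord_set n \<beta>" using x(1) unfolding chord_set_def by (rule imageI)
      then show ?thesis unfolding x(2) eq .
    qed
  qed
  moreover have "{b, \<alpha> b} \<noteq> {d, \<alpha> d}" using bd chord_eq_iff[OF \<alpha>, of b d] by metis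
  moreover have "{b, \<alpha> b} \<in> chord_set n \<alpha>" "{d, \<alpha> d} \<in> chord_set n \<alpha>" using bd by (simp_all add: chord_mem_iff[OF \<alpha>])
  ultimately show ?thesis
    unfolding chord_swap_def
    by (intro exI[of _ b] exI[of _ "\<alpha> b"] exI[of _ d] exI[of _ "\<alpha> d"]) (simp only: simp_thms)
qed

lemma chord_diagram_pairing:
  assumes X: "X \<in> chord_diagrams n"
  shows "\<exists>\<alpha>\<in>pairings n. X = chord_set n \<alpha>"
proof -
  have two: "\<exists>a b. c = {a, b} \<and> a \<noteq> b \<and> a \<in> {1..2 * n} \<and> b \<in> {1..2 * n}" if "c \<in> X" for c
  proof -
    have "c \<subseteq> {1..2 * n}" "card c = 2" using X that by (auto simp: chord_diagrams_def chords_def sides_def)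
    then show ?thesis by (metis card_2_iff insert_subset)
  qed
  have unique: "c = c'" if "c \<in> X" "c' \<in> X" "s \<in> c" "s \<in> c'" for c c' s
  proof -
    have "s \<in> sides n" using X that by (auto simp: chord_diagrams_def chords_def)
    then show ?thesis using X that unfolding chord_diagrams_def by blast
  qed
  have "\<exists>y. {s, y} \<in> X \<and> y \<noteq> s \<and> y \<in> {1..2 * n}" if "s \<in> {1..2 * n}" for s
  proof -
    obtain c where c: "c \<in> X" "s \<in> c" using X \<open>s \<in> _\<close> unfolding chord_diagrams_def sides_def by blast
    obtain a b where "c = {a, b}" "a \<noteq> b" "a \<in> {1..2 * n}" "b \<in> {1..2 * n}" using two[OF c(1)] by blast
    then show ?thesis using c by (metis insert_commute insert_iff singletonD)
  qed
  then obtain p where p: "\<And>s. s \<in> {1..2 * n} \<Longrightarrow> {s, p s} \<in> X \<and> p s \<noteq> s \<and> p s \<in> {1..2 * n}" by metis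
  define \<alpha> where "\<alpha> s = (if s \<in> {1..2 * n} then p s else s)" for s
  have invol: "\<alpha> (\<alpha> s) = s" for s
  proof (cases "s \<in> {1..2 * n}")
    case True
    have "{s, p s} = {p s, p (p s)}" using p[OF True] p[of "p s"] by (intro unique[of _ _ "p s"]) auto
    then have "p (p s) = s" using p[of "p s"] p[OF True] by (metis doubleton_eq_iff)
    then show ?thesis using True p[OF True] by (simp add: \<alpha>_def)
  qed (auto simp: \<alpha>_def)
  have "\<exists>!x. \<alpha> x = y" for y by (rule ex1I[of _ "\<alpha> y"]) (rule invol, use invol in metis)
  then have "\<alpha> permutes {1..2 * n}" by (simp add: permutes_def \<alpha>_def)
  then have \<alpha>: "\<alpha> \<in> pairings n" using invol p by (auto simp: pairings_def \<alpha>_def)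
  have "X = chord_set n \<alpha>"
  proof (intro equalityI subsetI)
    fix c assume c: "c \<in> X"
    then obtain a b where ab: "c = {a, b}" "a \<in> {1..2 * n}" using two by blast
    then have "c = {a, p a}" using p[of a] c by (intro unique[of _ _ a]) auto
    then show "c \<in> chord_set n \<alpha>" using ab(2) by (simp add: chord_mem_iff[OF \<alpha>] \<alpha>_def)
  qed (auto simp: chord_set_def \<alpha>_def p)
  with \<alpha> show ?thesis by blast
qed

lemma chord_set_bij: "bij_betw (chord_set n) (states n g) (genus_diagrams n g)"
  unfolding bij_betw_def
proof
  have "\<alpha> = \<beta>" if \<alpha>: "\<alpha> \<in> pairings n" and \<beta>: "\<beta> \<in> pairings n" and eq: "chord_set n \<alpha> = chord_set n \<beta>" for \<alpha> \<beta>
  proof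
    fix x
    show "\<alpha> x = \<beta> x"
    proof (cases "x \<in> {1..2 * n}")
      case True
      then have "{x, \<alpha> x} \<in> chord_set n \<beta>" unfolding eq[symmetric] chord_mem_iff[OF \<alpha>] by simp
      then show ?thesis by (simp only: chord_mem_iff[OF \<beta>])
    next
      case False
      then show ?thesis using pairing_permutes[OF \<alpha>] pairing_permutes[OF \<beta>] by (metis permutes_not_in)
    qed
  qed
  then show "inj_on (chord_set n) (states n g)" by (intro inj_onI) (blast dest: states_pairings)
  show "chord_set n ` states n g = genus_diagrams n g"
  proof (intro equalityI subsetI)
    fix X assume "X \<in> chord_set n ` states n g"
    then show "X \<in> genus_diagrams n g" using chord_set_genus states_pairings by blast
  next
    fix X assume X: "X \<in> genus_diagrams n g"
    then have "X \<in> chord_diagrams n" by (simp add: genus_diagrams_def)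
    then obtain \<alpha> where "\<alpha> \<in> pairings n" "X = chord_set n \<alpha>" using chord_diagram_pairing by metis
    then show "X \<in> chord_set n ` states n g" using X chord_set_genus by (metis imageI)
  qed
qed

text \<open>The two rematchings differ only by the naming of the second chord, so one form
  suffices.\<close>

lemma chord_swapE:
  assumes "chord_swap X Y"
  obtains A B C D where "{A, B} \<in> X" "{C, D} \<in> X" "{A, B} \<noteq> {C, D}"
    "Y = (X - {{A, B}, {C, D}}) \<union> {{A, C}, {B, D}}"
proof -
  obtain A B C D where 1: "{A, B} \<in> X" "{C, D} \<in> X" "{A, B} \<noteq> {C, D}"
    and 2: "Y = (X - {{A, B}, {C, D}}) \<union> {{A, C}, {B, D}} \<or> Y = (X - {{A, B}, {C, D}}) \<union> {{A, D}, {B, C}}"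
    using assms unfolding chord_swap_def by metis
  from 2 show ?thesis
  proof
    assume "Y = (X - {{A, B}, {C, D}}) \<union> {{A, D}, {B, C}}"
    then show ?thesis by (rule that[of A B D C, unfolded insert_commute[of D C "{}"], OF 1])
  qed (rule that[OF 1])
qed

text \<open>Undoing a swap recovers \<open>X\<close> only if the new chords were absent from
  \<open>X\<close>; this holds since each side lies on one chord.\<close>

lemma chord_swap_sym:
  assumes X: "X \<in> chord_diagrams n" and swap: "chord_swap X Y"
  shows "chord_swap Y X"
proof -
  obtain A B C D where m: "{A, B} \<in> X" "{C, D} \<in> X" and ne: "{A, B} \<noteq> {C, D}"
    and Y: "Y = (X - {{A, B}, {C, D}}) \<union> {{A, C}, {B, D}}" by (rule chord_swapE[OF swap])
  have unique: "c = c'" if "c \<in> X" "c' \<in> X" "s \<in> c" "s \<in> c'" for c c' s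
  proof -
    have "s \<in> sides n" using X that by (auto simp: chord_diagrams_def chords_def)
    then show ?thesis using X that unfolding chord_diagrams_def by blast
  qed
  have two: "card {A, B} = 2" using X m by (auto simp: chord_diagrams_def chords_def)
  then have "A \<noteq> B" by auto
  have disj: "{A, B} \<inter> {C, D} = {}" using unique[OF m] ne by blast
  have "{A, C} \<notin> X" using unique[OF m(1), of "{A, C}" A] disj by blast
  moreover have "{B, D} \<notin> X" using unique[OF m(1), of "{B, D}" B] disj by blast
  ultimately have "X = (Y - {{A, C}, {B, D}}) \<union> {{A, B}, {C, D}}" unfolding Y using m by blast
  moreover have "{A, C} \<noteq> {B, D}" using \<open>A \<noteq> B\<close> disj by (simp add: doubleton_eq_iff)
  moreover have "{A, C} \<in> Y" "{B, D} \<in> Y" unfolding Y by simp_all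
  ultimately show ?thesis unfolding chord_swap_def by blast
qed

text \<open>Two chords have two other matchings of their four sides, which gives at most
  \<open>2 * (n choose 2)\<close> swaps. With the probability of each this yields a holding
  probability of at least one half.\<close>

lemma card_chord_swaps:
  assumes X: "X \<in> chord_diagrams n"
  shows "finite {Z. chord_swap X Z}" "card {Z. chord_swap X Z} \<le> 2 * (n choose 2)"
proof -
  define rematch where "rematch e = {Z. \<exists>A B C D. e = {{A, B}, {C, D}} \<and> Z = (X - e) \<union> {{A, C}, {B, D}}}"
    for e :: "nat set set"
  let ?E = "{e. e \<subseteq> X \<and> card e = 2}"
  have "finite (chords n)" by (rule finite_subset[of _ "Pow (sides n)"]) (auto simp: chords_def sides_def)
  then have fin: "finite X" using X by (auto simp: chord_diagrams_def intro: finite_subset)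
  have re: "finite (rematch e) \<and> card (rematch e) \<le> 2" for e
  proof (cases "rematch e = {}")
    case False
    then obtain A B C D where e: "e = {{A, B}, {C, D}}" unfolding rematch_def by blast
    have "rematch e \<subseteq> {(X - e) \<union> {{A, C}, {B, D}}, (X - e) \<union> {{A, D}, {B, C}}}"
    proof
      fix Z assume "Z \<in> rematch e"
      then obtain A' B' C' D' where e': "{{A, B}, {C, D}} = {{A', B'}, {C', D'}}"
        and Z: "Z = (X - e) \<union> {{A', C'}, {B', D'}}" unfolding rematch_def e by blast
      \<comment> \<open>Renaming the sides within a chord or interchanging the two chords leads to
        no third result.\<close>
      have "{{A', C'}, {B', D'}} = {{A, C}, {B, D}} \<or> {{A', C'}, {B', D'}} = {{A, D}, {B, C}}"
        using e' unfolding doubleton_eq_iff[of "{A, B}"] doubleton_eq_iff[of A B] doubleton_eq_iff[of C D]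
        by (elim disjE conjE; hypsubst) (simp_all only: insert_commute simp_thms)
      then show "Z \<in> {(X - e) \<union> {{A, C}, {B, D}}, (X - e) \<union> {{A, D}, {B, C}}}"
        unfolding Z by (elim disjE) (simp_all only: insert_iff simp_thms)
    qed
    then show ?thesis by (auto intro: finite_subset dest: card_mono[rotated] simp: card_insert_if split: if_splits)
  qed simp
  have sub: "{Z. chord_swap X Z} \<subseteq> (\<Union>e\<in>?E. rematch e)"
  proof
    fix Z assume "Z \<in> {Z. chord_swap X Z}"
    then have "chord_swap X Z" by simp
    then obtain A B C D where Z: "{A, B} \<in> X" "{C, D} \<in> X" "{A, B} \<noteq> {C, D}"
      "Z = (X - {{A, B}, {C, D}}) \<union> {{A, C}, {B, D}}" by (rule chord_swapE)
    then have "{{A, B}, {C, D}} \<in> ?E" "Z \<in> rematch {{A, B}, {C, D}}" unfolding rematch_def by (simp, blast)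
    then show "Z \<in> (\<Union>e\<in>?E. rematch e)" by blast
  qed
  have finE: "finite ?E" by (rule finite_subset[of _ "Pow X"]) (use fin in auto)
  have finU: "finite (\<Union>e\<in>?E. rematch e)" using finE re by blast
  show "finite {Z. chord_swap X Z}" by (rule finite_subset[OF sub finU])
  have "card {Z. chord_swap X Z} \<le> card (\<Union>e\<in>?E. rematch e)" by (rule card_mono[OF finU sub])
  also have "\<dots> \<le> (\<Sum>e\<in>?E. card (rematch e))" by (rule card_UN_le[OF finE])
  also have "\<dots> \<le> (\<Sum>e\<in>?E. 2)" by (rule sum_mono) (use re in blast)
  also have "\<dots> = 2 * (card X choose 2)" by (simp add: n_subsets[OF fin])
  finally show "card {Z. chord_swap X Z} \<le> 2 * (n choose 2)" using X by (simp add: chord_diagrams_def)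
qed

section \<open>The swap kernel as a symmetric lazy chain\<close>

context
  fixes n g :: nat
  assumes n: "2 \<le> n"
begin

lemma choose_pos: "0 < real (n choose 2)" using n by simp

lemma finite_genus_diagrams: "finite (genus_diagrams n g)"
  using bij_betw_finite[OF chord_set_bij] finite_states by blast

lemma swap_kernel_sym:
  assumes "X \<in> genus_diagrams n g" "Y \<in> genus_diagrams n g"
  shows "swap_kernel n g X Y = swap_kernel n g Y X"
proof -
  have "X \<in> chord_diagrams n" "Y \<in> chord_diagrams n" using assms by (simp_all add: genus_diagrams_def)
  then have "chord_swap X Y \<longleftrightarrow> chord_swap Y X" using chord_swap_sym by blast
  then show ?thesis by (auto simp: swap_kernel_def swap_prob_def)
qed

lemma swap_kernel_lazy:
  assumes "X \<in> genus_diagrams n g"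
  shows "1 / 2 \<le> swap_kernel n g X X"
proof -
  have X: "X \<in> chord_diagrams n" using assms by (simp add: genus_diagrams_def)
  let ?c = "1 / (4 * real (n choose 2))"
  have "(\<Sum>Z\<in>genus_diagrams n g - {X}. swap_prob n X Z) = (\<Sum>Z\<in>(genus_diagrams n g - {X}) \<inter> {Z. chord_swap X Z}. ?c)"
    using finite_genus_diagrams by (simp add: swap_prob_def sum.If_cases)
  also have "\<dots> \<le> (\<Sum>Z\<in>{Z. chord_swap X Z}. ?c)"
    by (rule sum_mono2) (use card_chord_swaps(1)[OF X] in auto)
  also have "\<dots> = real (card {Z. chord_swap X Z}) * ?c" by simp
  also have "\<dots> \<le> real (2 * (n choose 2)) * ?c"
    using card_chord_swaps(2)[OF X] by (intro mult_right_mono) (simp_all only: of_nat_le_iff, simp)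
  also have "\<dots> = 1 / 2" using choose_pos by simp
  finally show ?thesis by (simp add: swap_kernel_def)
qed

lemma swap_kernel_nonneg:
  "X \<in> genus_diagrams n g \<Longrightarrow> 0 \<le> swap_kernel n g X Y"
  using swap_kernel_lazy[of X] by (cases "X = Y") (auto simp: swap_kernel_def swap_prob_def)

lemma swap_kernel_rows:
  assumes "X \<in> genus_diagrams n g"
  shows "(\<Sum>Y\<in>genus_diagrams n g. swap_kernel n g X Y) = 1"
proof -
  have "(\<Sum>Y\<in>genus_diagrams n g. swap_kernel n g X Y)
      = swap_kernel n g X X + (\<Sum>Y\<in>genus_diagrams n g - {X}. swap_kernel n g X Y)"
    by (rule sum.remove[OF finite_genus_diagrams assms])
  also have "(\<Sum>Y\<in>genus_diagrams n g - {X}. swap_kernel n g X Y) = (\<Sum>Y\<in>genus_diagrams n g - {X}. swap_prob n X Y)"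
    by (rule sum.cong) (auto simp: swap_kernel_def)
  finally show ?thesis by (simp add: swap_kernel_def)
qed

text \<open>Every adjacent pair of different diagrams is a transition of probability
  \<open>1 / (4 * real (n choose 2))\<close>; its reciprocal is the price for passing from the
  energy to the quadratic form of the kernel.\<close>

lemma swap_kernel_gap:
  assumes "poincare n g B" "0 \<le> B"
  shows "(\<Sum>X\<in>genus_diagrams n g. \<Sum>Y\<in>genus_diagrams n g. (f X - f Y)\<^sup>2)
    \<le> 4 * real (n choose 2) * B * real (card (genus_diagrams n g))
      * (\<Sum>X\<in>genus_diagrams n g. \<Sum>Y\<in>genus_diagrams n g. swap_kernel n g X Y * (f X - f Y)\<^sup>2)"
proof -
  let ?G = "genus_diagrams n g" and ?S = "states n g" and ?c = "chord_set n"
  let ?E = "{(\<alpha>, \<beta>). \<alpha> \<in> ?S \<and> \<beta> \<in> ?S \<and> adj n \<alpha> \<beta>}"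
  let ?K = "\<lambda>X Y. 4 * real (n choose 2) * (swap_kernel n g X Y * (f X - f Y)\<^sup>2)"
  have re: "(\<Sum>X\<in>?G. \<Sum>Y\<in>?G. h X Y) = (\<Sum>\<alpha>\<in>?S. \<Sum>\<beta>\<in>?S. h (?c \<alpha>) (?c \<beta>))" for h :: "_ \<Rightarrow> _ \<Rightarrow> real"
    by (simp only: sum.reindex_bij_betw[OF chord_set_bij, symmetric])
  have K0: "0 \<le> ?K (?c \<alpha>) (?c \<beta>)" if "\<alpha> \<in> ?S" for \<alpha> \<beta>
  proof -
    have "?c \<alpha> \<in> ?G" using chord_set_genus[OF states_pairings[OF that]] that by simp
    then show ?thesis using swap_kernel_nonneg by simp
  qed
  have "energy n g (f \<circ> ?c) = (\<Sum>(\<alpha>, \<beta>)\<in>?E. (f (?c \<alpha>) - f (?c \<beta>))\<^sup>2)" by (simp add: energy_def)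
  also have "\<dots> \<le> (\<Sum>(\<alpha>, \<beta>)\<in>?E. ?K (?c \<alpha>) (?c \<beta>))"
  proof (rule sum_mono, clarify)
    fix \<alpha> \<beta> assume a: "\<alpha> \<in> ?S" "adj n \<alpha> \<beta>"
    have "chord_swap (?c \<alpha>) (?c \<beta>)" by (rule adj_chord_swap[OF states_pairings[OF a(1)] a(2)])
    then show "(f (?c \<alpha>) - f (?c \<beta>))\<^sup>2 \<le> ?K (?c \<alpha>) (?c \<beta>)"
      using choose_pos by (cases "?c \<alpha> = ?c \<beta>") (simp_all add: swap_kernel_def swap_prob_def)
  qed
  also have "\<dots> \<le> (\<Sum>(\<alpha>, \<beta>)\<in>?S \<times> ?S. ?K (?c \<alpha>) (?c \<beta>))"
    by (rule sum_mono2) (use K0 finite_states in \<open>auto simp del: mult_nonneg_nonneg\<close>)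
  also have "\<dots> = (\<Sum>X\<in>?G. \<Sum>Y\<in>?G. ?K X Y)" by (simp only: re sum.cartesian_product[symmetric])
  also have "\<dots> = 4 * real (n choose 2) * (\<Sum>X\<in>?G. \<Sum>Y\<in>?G. swap_kernel n g X Y * (f X - f Y)\<^sup>2)"
    by (simp only: sum_distrib_left)
  finally have en: "energy n g (f \<circ> ?c) \<le> \<dots>" .
  have "(\<Sum>X\<in>?G. \<Sum>Y\<in>?G. (f X - f Y)\<^sup>2) \<le> B * real (card ?S) * energy n g (f \<circ> ?c)"
    using assms(1)[unfolded poincare_def, rule_format, of "f \<circ> ?c"] unfolding re by (simp only: comp_apply)
  also have "\<dots> \<le> B * real (card ?S) * (4 * real (n choose 2) * (\<Sum>X\<in>?G. \<Sum>Y\<in>?G. swap_kernel n g X Y * (f X - f Y)\<^sup>2))"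
    using en assms(2) by (intro mult_left_mono) auto
  also have "card ?S = card ?G" by (rule bij_betw_same_card[OF chord_set_bij])
  finally show ?thesis by (simp only: mult_ac)
qed

end

section \<open>Mixing from a spectral gap\<close>

text \<open>Every event is bounded by the full L1 norm, without the usual factor one half, and
  Cauchy-Schwarz passes to L2.\<close>

lemma uniform_tv_le:
  assumes "finite S" "\<And>y. y \<in> S \<Longrightarrow> \<nu> y = 1 / real (card S)"
  shows "tv_dist S \<mu> \<nu> \<le> sqrt (real (card S) * (\<Sum>y\<in>S. (\<mu> y - 1 / real (card S))\<^sup>2))"
proof -
  let ?k = "\<lambda>y. \<mu> y - 1 / real (card S)"
  have "\<bar>sum \<mu> A - sum \<nu> A\<bar> \<le> sqrt (real (card S) * (\<Sum>y\<in>S. (?k y)\<^sup>2))" if A: "A \<subseteq> S" for A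
  proof -
    have "sum \<mu> A - sum \<nu> A = (\<Sum>y\<in>A. ?k y)"
      using assms(2) A by (auto simp: sum_subtractf[symmetric] intro!: sum.cong)
    also have "\<bar>\<dots>\<bar> \<le> (\<Sum>y\<in>A. \<bar>?k y\<bar>)" by (rule sum_abs)
    also have "\<dots> \<le> (\<Sum>y\<in>S. \<bar>?k y\<bar>)" by (rule sum_mono2[OF assms(1) A]) auto
    also have "\<dots> \<le> sqrt (real (card S) * (\<Sum>y\<in>S. (?k y)\<^sup>2))"
      using sum_squared_le_card[of "\<lambda>y. \<bar>?k y\<bar>" S] by (intro real_le_rsqrt) simp
    finally show ?thesis .
  qed
  moreover have "finite ((\<lambda>A. \<bar>sum \<mu> A - sum \<nu> A\<bar>) ` Pow S)" using assms(1) by simp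
  ultimately show ?thesis unfolding tv_dist_def by (subst Max_le_iff) auto
qed

context
  fixes S :: "'a set" and P :: "'a \<Rightarrow> 'a \<Rightarrow> real"
  assumes fin: "finite S" and ne: "S \<noteq> {}"
    and sym: "\<And>x y. x \<in> S \<Longrightarrow> y \<in> S \<Longrightarrow> P x y = P y x"
    and nonneg: "\<And>x y. x \<in> S \<Longrightarrow> y \<in> S \<Longrightarrow> 0 \<le> P x y"
    and rows: "\<And>x. x \<in> S \<Longrightarrow> (\<Sum>y\<in>S. P x y) = 1"
    and lazy: "\<And>x. x \<in> S \<Longrightarrow> 1 / 2 \<le> P x x"
begin

lemma columns: "y \<in> S \<Longrightarrow> (\<Sum>x\<in>S. P x y) = 1"
  using rows[of y] sym by (metis (mono_tags, lifting) sum.cong)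

text \<open>By laziness \<open>P = (I + Q) / 2\<close> with \<open>Q\<close> doubly stochastic, hence \<open>P\<^sup>2 \<le> P\<close> as quadratic forms.\<close>

lemma lazy_contraction:
  "(\<Sum>y\<in>S. (\<Sum>z\<in>S. k z * P z y)\<^sup>2) \<le> (\<Sum>y\<in>S. k y * (\<Sum>z\<in>S. k z * P z y))"
proof -
  define q where "q z y = 2 * P z y - (if z = y then 1 else 0)" for z y
  define m where "m y = (\<Sum>z\<in>S. k z * q z y)" for y
  have q0: "0 \<le> q z y" if "z \<in> S" "y \<in> S" for z y
    using nonneg[OF that] lazy[OF that(1)] by (auto simp: q_def)
  have col: "(\<Sum>z\<in>S. q z y) = 1" if "y \<in> S" for y
    using columns[OF that] that fin by (simp add: q_def sum_subtractf flip: sum_distrib_left)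
  have row: "(\<Sum>y\<in>S. q z y) = 1" if "z \<in> S" for z
    using rows[OF that] that fin by (simp add: q_def sum_subtractf flip: sum_distrib_left)
  have P: "(\<Sum>z\<in>S. k z * P z y) = (k y + m y) / 2" if "y \<in> S" for y
  proof -
    have "(\<Sum>z\<in>S. k z * P z y) = (\<Sum>z\<in>S. ((if z = y then k z else 0) + k z * q z y) / 2)"
      by (rule sum.cong) (auto simp: q_def algebra_simps)
    also have "\<dots> = ((\<Sum>z\<in>S. if z = y then k z else 0) + m y) / 2"
      by (simp only: sum_divide_distrib[symmetric] sum.distrib m_def)
    finally show ?thesis using that fin by simp
  qed
  have jensen: "(m y)\<^sup>2 \<le> (\<Sum>z\<in>S. q z y * (k z)\<^sup>2)" if "y \<in> S" for y
  proof -
    have "0 \<le> (\<Sum>z\<in>S. q z y * (k z - m y)\<^sup>2)" using q0 that by (intro sum_nonneg) auto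
    also have "\<dots> = (\<Sum>z\<in>S. q z y * (k z)\<^sup>2 + (m y)\<^sup>2 * q z y - 2 * m y * (k z * q z y))"
      by (rule sum.cong) (auto simp: power2_diff algebra_simps)
    also have "\<dots> = (\<Sum>z\<in>S. q z y * (k z)\<^sup>2) + (m y)\<^sup>2 * (\<Sum>z\<in>S. q z y) - 2 * m y * m y"
      by (simp only: sum.distrib sum_subtractf sum_distrib_left[symmetric] m_def[symmetric])
    finally show ?thesis by (simp add: col[OF that] power2_eq_square)
  qed
  have "(\<Sum>y\<in>S. (m y)\<^sup>2) \<le> (\<Sum>y\<in>S. \<Sum>z\<in>S. q z y * (k z)\<^sup>2)" by (rule sum_mono) (rule jensen)
  also have "\<dots> = (\<Sum>z\<in>S. (\<Sum>y\<in>S. q z y) * (k z)\<^sup>2)" by (subst sum.swap) (simp add: sum_distrib_right)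
  also have "\<dots> = (\<Sum>z\<in>S. (k z)\<^sup>2)" by (simp add: row)
  finally have m: "(\<Sum>y\<in>S. (m y)\<^sup>2) \<le> (\<Sum>y\<in>S. (k y)\<^sup>2)" .
  have "(\<Sum>y\<in>S. k y * ((k y + m y) / 2)) - (\<Sum>y\<in>S. ((k y + m y) / 2)\<^sup>2) = (\<Sum>y\<in>S. ((k y)\<^sup>2 - (m y)\<^sup>2) / 4)"
    unfolding sum_subtractf[symmetric]
    by (rule sum.cong) (auto simp: power2_eq_square field_simps)
  also have "\<dots> \<ge> 0" using m by (simp add: sum_subtractf flip: sum_divide_distrib)
  finally show ?thesis by (simp add: P)
qed

lemma dirichlet_form:
  "(\<Sum>x\<in>S. \<Sum>y\<in>S. P x y * (k x - k y)\<^sup>2) = 2 * ((\<Sum>y\<in>S. (k y)\<^sup>2) - (\<Sum>y\<in>S. k y * (\<Sum>z\<in>S. k z * P z y)))"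
proof -
  have "(\<Sum>x\<in>S. \<Sum>y\<in>S. P x y * (k x - k y)\<^sup>2)
      = (\<Sum>x\<in>S. \<Sum>y\<in>S. P x y * (k x)\<^sup>2 + P x y * (k y)\<^sup>2 - 2 * (k y * (k x * P x y)))"
    by (intro sum.cong refl) (simp add: power2_diff algebra_simps)
  also have "\<dots> = (\<Sum>x\<in>S. \<Sum>y\<in>S. P x y * (k x)\<^sup>2) + (\<Sum>x\<in>S. \<Sum>y\<in>S. P x y * (k y)\<^sup>2)
      - 2 * (\<Sum>x\<in>S. \<Sum>y\<in>S. k y * (k x * P x y))"
    by (simp only: sum.distrib sum_subtractf sum_distrib_left[symmetric])
  also have "(\<Sum>x\<in>S. \<Sum>y\<in>S. P x y * (k x)\<^sup>2) = (\<Sum>y\<in>S. (k y)\<^sup>2)"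
    by (simp only: sum_distrib_right[symmetric]) (simp add: rows)
  also have "(\<Sum>x\<in>S. \<Sum>y\<in>S. P x y * (k y)\<^sup>2) = (\<Sum>y\<in>S. (k y)\<^sup>2)"
    by (subst sum.swap, simp only: sum_distrib_right[symmetric]) (simp add: columns)
  also have "(\<Sum>x\<in>S. \<Sum>y\<in>S. k y * (k x * P x y)) = (\<Sum>y\<in>S. k y * (\<Sum>z\<in>S. k z * P z y))"
    by (subst sum.swap) (simp only: sum_distrib_left)
  finally show ?thesis by simp
qed

context
  fixes T :: real
  assumes T: "1 \<le> T"
    and gap: "\<And>f. (\<Sum>x\<in>S. \<Sum>y\<in>S. (f x - f y)\<^sup>2)
      \<le> T * real (card S) * (\<Sum>x\<in>S. \<Sum>y\<in>S. P x y * (f x - f y)\<^sup>2)"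
begin

text \<open>Laziness excludes negative eigenvalues, so the Poincare inequality controls the whole
  operator on functions of mean zero.\<close>

lemma contraction:
  assumes "(\<Sum>y\<in>S. k y) = 0"
  shows "(\<Sum>y\<in>S. (\<Sum>z\<in>S. k z * P z y)\<^sup>2) \<le> (1 - 1 / T) * (\<Sum>y\<in>S. (k y)\<^sup>2)"
proof -
  let ?N = "\<Sum>y\<in>S. (k y)\<^sup>2" and ?I = "\<Sum>y\<in>S. k y * (\<Sum>z\<in>S. k z * P z y)"
  have card: "0 < real (card S)" using fin ne by (simp add: card_gt_0_iff)
  have "(\<Sum>y\<in>S. (k x - k y)\<^sup>2) = real (card S) * (k x)\<^sup>2 + ?N - 2 * k x * (\<Sum>y\<in>S. k y)" for x
    by (simp add: power2_diff sum.distrib sum_subtractf sum_distrib_left)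
  then have "(\<Sum>x\<in>S. \<Sum>y\<in>S. (k x - k y)\<^sup>2) = 2 * real (card S) * ?N"
    by (simp add: assms sum.distrib sum_distrib_left mult.assoc)
  then have "(2 * real (card S)) * ?N \<le> (2 * real (card S)) * (T * (?N - ?I))"
    using gap[of k] unfolding dirichlet_form by (simp only: mult_ac)
  then have "?N \<le> T * (?N - ?I)" using card by (simp add: mult_le_cancel_left)
  then have "?N / T \<le> ?N - ?I" using T by (simp add: field_simps)
  then have "?I \<le> (1 - 1 / T) * ?N" by (simp add: algebra_simps)
  with lazy_contraction[of k] show ?thesis by linarith
qed

lemma kernel_power_decay:
  assumes x: "x \<in> S"
  shows "(\<Sum>y\<in>S. (kernel_power S P t x y - 1 / real (card S))\<^sup>2) \<le> (1 - 1 / T) ^ t"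
    (is "(\<Sum>y\<in>S. (?k t y)\<^sup>2) \<le> _")
proof -
  have card: "0 < real (card S)" using fin ne by (simp add: card_gt_0_iff)
  have total: "(\<Sum>y\<in>S. kernel_power S P t x y) = 1" for t
  proof (induction t)
    case 0
    show ?case using x fin by simp
  next
    case (Suc t)
    have "(\<Sum>y\<in>S. kernel_power S P (Suc t) x y) = (\<Sum>z\<in>S. \<Sum>y\<in>S. kernel_power S P t x z * P z y)"
      by (simp, rule sum.swap)
    also have "\<dots> = (\<Sum>z\<in>S. kernel_power S P t x z * (\<Sum>y\<in>S. P z y))" by (simp only: sum_distrib_left)
    also have "\<dots> = 1" using rows Suc.IH by simp
    finally show ?case .
  qed
  have mean: "(\<Sum>y\<in>S. ?k t y) = 0" for t using total card by (simp add: sum_subtractf)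
  show ?thesis
  proof (induction t)
    case 0
    have "(\<Sum>y\<in>S. (?k 0 y)\<^sup>2) = (\<Sum>y\<in>S. (if x = y then 1 else 0) * (1 - 2 / real (card S)) + (1 / real (card S))\<^sup>2)"
      by (rule sum.cong) (auto simp: power2_eq_square algebra_simps)
    also have "\<dots> = 1 - 1 / real (card S)"
      using x fin card unfolding sum.distrib sum_distrib_right[symmetric]
      by (simp add: power2_eq_square field_simps)
    also have "\<dots> \<le> 1" using card by simp
    finally show ?case by simp
  next
    case (Suc t)
    have "?k (Suc t) y = (\<Sum>z\<in>S. ?k t z * P z y)" if "y \<in> S" for y
      using columns[OF that] by (simp add: left_diff_distrib sum_subtractf flip: sum_divide_distrib)
    then have "(\<Sum>y\<in>S. (?k (Suc t) y)\<^sup>2) = (\<Sum>y\<in>S. (\<Sum>z\<in>S. ?k t z * P z y)\<^sup>2)" by (simp only: cong: sum.cong)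
    also have "\<dots> \<le> (1 - 1 / T) * (\<Sum>y\<in>S. (?k t y)\<^sup>2)" by (rule contraction[OF mean])
    also have "\<dots> \<le> (1 - 1 / T) * (1 - 1 / T) ^ t" using Suc.IH T by (intro mult_left_mono) auto
    finally show ?case by simp
  qed
qed

text \<open>The 2 before \<open>ln (1 / \<epsilon>)\<close> appears because the distance is
  estimated through its square, which must fall below \<open>\<epsilon>\<^sup>2\<close>; the
  logarithm of the cardinality pays for the passage from L2 to total variation.\<close>

lemma mixing_time_le:
  assumes \<epsilon>: "0 < \<epsilon>" and t: "T * (ln (real (card S)) + 2 * ln (1 / \<epsilon>)) \<le> real t"
  shows "mixing_time S P (uniform S) \<epsilon> \<le> enat t"
proof -
  have card: "0 < real (card S)" using fin ne by (simp add: card_gt_0_iff)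
  have "tv_dist S (kernel_power S P t x) (uniform S) \<le> \<epsilon>" if x: "x \<in> S" for x
  proof -
    have "ln (real (card S)) + 2 * ln (1 / \<epsilon>) \<le> real t / T" using t T by (simp add: field_simps)
    then have *: "ln (real (card S)) - real t / T \<le> 2 * ln \<epsilon>" using \<epsilon> by (simp add: ln_div)
    have "(1 - 1 / T) ^ t \<le> exp (- 1 / T) ^ t"
      using T exp_ge_add_one_self[of "- 1 / T"] by (intro power_mono) auto
    also have "\<dots> = exp (- (real t / T))" by (simp flip: exp_of_nat_mult)
    finally have "real (card S) * (1 - 1 / T) ^ t \<le> exp (ln (real (card S))) * exp (- (real t / T))"
      using card T by (intro mult_mono) auto
    also have "\<dots> = exp (ln (real (card S)) - real t / T)" by (simp only: exp_add[symmetric] add_uminus_conv_diff)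
    also have "\<dots> \<le> exp (2 * ln \<epsilon>)" using * by simp
    also have "\<dots> = \<epsilon>\<^sup>2" using \<epsilon> by (simp add: exp_double)
    finally have bound: "real (card S) * (1 - 1 / T) ^ t \<le> \<epsilon>\<^sup>2" .
    have "tv_dist S (kernel_power S P t x) (uniform S)
        \<le> sqrt (real (card S) * (\<Sum>y\<in>S. (kernel_power S P t x y - 1 / real (card S))\<^sup>2))"
      by (rule uniform_tv_le[OF fin]) (simp add: uniform_def)
    also have "\<dots> \<le> sqrt (\<epsilon>\<^sup>2)"
      using kernel_power_decay[OF x] card
      by (intro real_sqrt_le_mono order_trans[OF mult_left_mono bound]) auto
    finally show ?thesis using \<epsilon> by simp
  qed
  then have "Max ((\<lambda>x. tv_dist S (kernel_power S P t x) (uniform S)) ` S) \<le> \<epsilon>"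
    using fin ne by (subst Max_le_iff) auto
  then show ?thesis unfolding mixing_time_def by (intro INF_lower) simp
qed

end

end

section \<open>Size of the state space and conclusion\<close>

text \<open>Pair the neighbouring sides \<open>2 * k - 1\<close> and \<open>2 * k\<close>: each even
  side is a vertex by itself and all odd sides form one vertex, in total
  \<open>n + 1\<close>.\<close>

lemma planar_state_exists:
  assumes n: "1 \<le> n"
  shows "states n 0 \<noteq> {}"
proof -
  define \<alpha> where "\<alpha> x = (if x \<in> {1..2 * n} then if odd x then x + 1 else x - 1 else x)" for x
  have odd: "\<alpha> x = x + 1 \<and> x + 1 \<in> {1..2 * n}" if "x \<in> {1..2 * n}" "odd x" for x
  proof -
    have "x \<noteq> 2 * n" using that(2) by auto
    then show ?thesis using that by (simp add: \<alpha>_def)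
  qed
  have even: "\<alpha> x = x - 1 \<and> x - 1 \<in> {1..2 * n} \<and> odd (x - 1) \<and> 0 < x" if "x \<in> {1..2 * n}" "even x" for x
  proof -
    have "x \<noteq> 1" using that(2) by auto
    then show ?thesis using that by (auto simp: \<alpha>_def)
  qed
  have invol: "\<alpha> (\<alpha> x) = x" for x
  proof (cases "x \<in> {1..2 * n}")
    case True
    then show ?thesis using odd[of x] even[of x] odd[of "x - 1"] even[of "x + 1"] by (cases "odd x") auto
  next
    case False
    then have "\<alpha> x = x" unfolding \<alpha>_def by (rule if_not_P)
    then show ?thesis by simp
  qed
  have "\<exists>!x. \<alpha> x = y" for y by (rule ex1I[of _ "\<alpha> y"]) (rule invol, use invol in metis)
  then have "\<alpha> permutes {1..2 * n}" by (simp add: permutes_def \<alpha>_def)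
  moreover have "\<alpha> x \<noteq> x" if "x \<in> {1..2 * n}" for x using odd[OF that] even[OF that] by (cases "odd x") auto
  ultimately have \<alpha>: "\<alpha> \<in> pairings n" using invol by (simp add: pairings_def)
  have single: "vertex n \<alpha> (2 * k) = {2 * k}" if "k \<in> {1..n}" for k
  proof -
    have "cyc n (\<alpha> (2 * k)) = 2 * k" using that even[of "2 * k"] by (auto simp: cyc_less)
    then show ?thesis by (simp add: vertex_def orbit_eq_singleton_iff)
  qed
  have common: "vertex n \<alpha> (2 * k + 1) = vertex n \<alpha> 1" if "k < n" for k
    using that
  proof (induction k)
    case (Suc k)
    have "cyc n (\<alpha> (2 * k + 1)) = 2 * Suc k + 1" using Suc.prems odd[of "2 * k + 1"] by (auto simp: cyc_less)
    then have "vertex n \<alpha> (2 * Suc k + 1) = vertex n \<alpha> (2 * k + 1)" using vertex_glue[OF \<alpha>, of "2 * k + 1"] by metis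
    with Suc show ?case by simp
  qed simp
  have "vertices_of n \<alpha> = insert (vertex n \<alpha> 1) ((\<lambda>k. {2 * k}) ` {1..n})"
  proof (intro equalityI subsetI)
    fix v assume "v \<in> vertices_of n \<alpha>"
    then obtain x where x: "x \<in> {1..2 * n}" "v = vertex n \<alpha> x" by blast
    show "v \<in> insert (vertex n \<alpha> 1) ((\<lambda>k. {2 * k}) ` {1..n})"
    proof (cases "even x")
      case True
      then obtain k where k: "x = 2 * k" by blast
      then have "k \<in> {1..n}" using x(1) by auto
      then show ?thesis unfolding x(2) k using single by blast
    next
      case False
      then obtain k where k: "x = 2 * k + 1" by (rule oddE)
      then have "k < n" using x(1) by auto
      then show ?thesis unfolding x(2) k using common by simp
    qed
  next
    fix v assume "v \<in> insert (vertex n \<alpha> 1) ((\<lambda>k. {2 * k}) ` {1..n})"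
    then consider "v = vertex n \<alpha> 1" | k where "k \<in> {1..n}" "v = {2 * k}" by blast
    then show "v \<in> vertices_of n \<alpha>"
    proof cases
      case 1
      then show ?thesis using n by simp
    next
      case 2
      then have "v = vertex n \<alpha> (2 * k)" "2 * k \<in> {1..2 * n}" using single by auto
      then show ?thesis by blast
    qed
  qed
  moreover have "vertex n \<alpha> 1 \<notin> (\<lambda>k. {2 * k}) ` {1..n}"
  proof
    assume "vertex n \<alpha> 1 \<in> (\<lambda>k. {2 * k}) ` {1..n}"
    then obtain k where "vertex n \<alpha> 1 = {2 * k}" by blast
    then have "1 = 2 * k" using vertex_refl[OF \<alpha>, of 1] by simp
    then show False by presburger
  qed
  moreover have "card ((\<lambda>k. {2 * k}) ` {1..n}) = n" by (subst card_image) (auto intro: inj_onI)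
  ultimately have "card (vertices_of n \<alpha>) = n + 1" by simp
  with \<alpha> have "\<alpha> \<in> states n 0" by (simp add: states_def cycles_def vertex_def)
  then show ?thesis by blast
qed

lemma states_nonempty: "2 * g < n \<Longrightarrow> states n g \<noteq> {}"
proof (induction g arbitrary: n)
  case 0
  then show ?case by (intro planar_state_exists) simp
next
  case (Suc g)
  define m where "m = n - 2"
  have m: "n = m + 2" "2 * g < m" using Suc.prems by (auto simp: m_def)
  then obtain \<omega> where "\<omega> \<in> states m g" using Suc.IH by blast
  then have "attach \<omega> \<in> states (m + 2) (Suc g)" using m by (intro attach_states) auto
  then show ?case unfolding m by blast
qed

text \<open>Counting all permutations of the sides suffices: \<open>fact (2 * n)\<close> is at most
  \<open>(2 * n) ^ (2 * n)\<close>, and \<open>2 * n\<close> is at most the square of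
  \<open>n\<close>.\<close>

lemma ln_card_states:
  assumes "2 \<le> n" "states n g \<noteq> {}"
  shows "ln (real (card (states n g))) \<le> 4 * real n * ln (real n)"
proof -
  have "card (states n g) \<le> card {p. p permutes {1..2 * n}}"
    by (rule card_mono) (auto simp: finite_permutations states_def pairings_def)
  also have "\<dots> = fact (2 * n)" by (simp add: card_permutations)
  also have "\<dots> \<le> (2 * n) ^ (2 * n)" using fact_le_power[of "2 * n", where 'a = nat] by simp
  finally have "real (card (states n g)) \<le> real ((2 * n) ^ (2 * n))" by (simp only: of_nat_le_iff)
  also have "\<dots> \<le> (real n ^ 2) ^ (2 * n)"
  proof -
    have "2 * real n \<le> real n * real n" using assms(1) by (intro mult_right_mono) auto
    then have "(2 * real n) ^ (2 * n) \<le> (real n * real n) ^ (2 * n)" by (rule power_mono) simp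
    then show ?thesis by (simp add: power2_eq_square)
  qed
  finally have "real (card (states n g)) \<le> real n ^ (4 * n)" by (simp add: power_mult[symmetric])
  moreover have "0 < real (card (states n g))" using assms(2) finite_states by (simp add: card_gt_0_iff)
  ultimately have "ln (real (card (states n g))) \<le> ln (real n ^ (4 * n))"
    using assms(1) by (subst ln_le_cancel_iff) auto
  also have "\<dots> = 4 * real n * ln (real n)" using assms(1) by (simp add: ln_realpow)
  finally show ?thesis .
qed

lemma swap_mixing_time_le:
  assumes g: "0 < g" "2 * g < n" and \<epsilon>: "0 < \<epsilon>" "\<epsilon> < 1"
    and B: "poincare n g (C * real n ^ k)" and C: "1 \<le> C"
  shows "\<exists>t. swap_mixing_time n g \<epsilon> \<le> enat t \<and> real t \<le> 9 * C * real n ^ (k + 3) * (ln (real n) + ln (1 / \<epsilon>))"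
proof -
  let ?G = "genus_diagrams n g" and ?L = "ln (real n) + ln (1 / \<epsilon>)"
  \<comment> \<open>The constant \<open>C * real n ^ k\<close> times
    \<open>4 * real (n choose 2)\<close>, of which the latter is at most twice the square of
    \<open>n\<close>.\<close>
  define T where "T = 2 * C * real n ^ (k + 2)"
  have n: "2 \<le> n" "3 \<le> n" using g by auto
  have pow: "1 \<le> real n ^ j" for j using n by simp
  \<comment> \<open>Positive genus forces \<open>n\<close> to be at least 3, which exceeds Euler's
    number.\<close>
  have ln: "1 \<le> ln (real n)" using exp_le n by (subst ln_ge_iff) (auto intro: order_trans)
  have \<epsilon>0: "0 < ln (1 / \<epsilon>)" using \<epsilon> by (subst ln_gt_zero_iff) auto
  have ne: "states n g \<noteq> {}" by (rule states_nonempty[OF g(2)])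
  then have neG: "?G \<noteq> {}" using bij_betw_imp_surj_on[OF chord_set_bij, of n g] by blast
  have T1: "1 \<le> T"
  proof -
    have "1 * 1 \<le> (2 * C) * real n ^ (k + 2)" using C pow[of "k + 2"] by (intro mult_mono) auto
    then show ?thesis by (simp only: T_def mult_1_left)
  qed
  have "4 * real (n choose 2) * (C * real n ^ k) \<le> T"
  proof -
    have "2 * (n choose 2) \<le> n * (n - 1)" by (simp add: choose_two)
    also have "\<dots> \<le> n * n" by (rule mult_left_mono) auto
    finally have "real (2 * (n choose 2)) \<le> real (n * n)" by (simp only: of_nat_le_iff)
    then have "2 * (2 * real (n choose 2)) * (C * real n ^ k) \<le> 2 * real (n * n) * (C * real n ^ k)"
      using C by (intro mult_right_mono mult_left_mono) auto
    then have "4 * real (n choose 2) * (C * real n ^ k) \<le> 2 * real (n * n) * (C * real n ^ k)" by simp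
    then show ?thesis by (simp add: T_def power_add power2_eq_square mult_ac)
  qed
  then have gap: "(\<Sum>X\<in>?G. \<Sum>Y\<in>?G. (f X - f Y)\<^sup>2) \<le> T * real (card ?G)
      * (\<Sum>X\<in>?G. \<Sum>Y\<in>?G. swap_kernel n g X Y * (f X - f Y)\<^sup>2)" for f
  proof -
    assume "4 * real (n choose 2) * (C * real n ^ k) \<le> T"
    then have "4 * real (n choose 2) * (C * real n ^ k) * real (card ?G)
        * (\<Sum>X\<in>?G. \<Sum>Y\<in>?G. swap_kernel n g X Y * (f X - f Y)\<^sup>2)
      \<le> T * real (card ?G) * (\<Sum>X\<in>?G. \<Sum>Y\<in>?G. swap_kernel n g X Y * (f X - f Y)\<^sup>2)"
      using swap_kernel_nonneg[OF n(1)] by (intro mult_right_mono sum_nonneg mult_nonneg_nonneg) auto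
    with swap_kernel_gap[OF n(1) B, of f] C show ?thesis by simp
  qed
  \<comment> \<open>The factors 2 in \<open>T\<close> and \<open>4 * real n\<close> make eight
    copies of the final quantity. Rounding up costs at most 1, which a ninth copy covers, as that
    quantity is at least 1.\<close>
  define t where "t = nat \<lceil>T * (4 * real n * ln (real n) + 2 * ln (1 / \<epsilon>))\<rceil>"
  have "card ?G = card (states n g)" using bij_betw_same_card[OF chord_set_bij] by metis
  then have "ln (real (card ?G)) \<le> 4 * real n * ln (real n)" using ln_card_states[OF n(1) ne] by simp
  then have "T * (ln (real (card ?G)) + 2 * ln (1 / \<epsilon>)) \<le> T * (4 * real n * ln (real n) + 2 * ln (1 / \<epsilon>))"
    using T1 by (intro mult_left_mono) auto
  also have "\<dots> \<le> real t" unfolding t_def by linarith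
  finally have "mixing_time ?G (swap_kernel n g) (uniform ?G) \<epsilon> \<le> enat t"
    by (intro mixing_time_le[where T = T] finite_genus_diagrams[OF n(1)] neG swap_kernel_sym[OF n(1)]
        swap_kernel_nonneg[OF n(1)] swap_kernel_rows[OF n(1)] swap_kernel_lazy[OF n(1)] T1 gap \<epsilon>(1))
  moreover have "real t \<le> 9 * C * real n ^ (k + 3) * ?L"
  proof -
    have "2 * ln (1 / \<epsilon>) \<le> 4 * real n * ln (1 / \<epsilon>)" using n \<epsilon>0 by (intro mult_right_mono) auto
    then have "4 * real n * ln (real n) + 2 * ln (1 / \<epsilon>) \<le> 4 * real n * ?L" by (simp add: distrib_left)
    then have le: "T * (4 * real n * ln (real n) + 2 * ln (1 / \<epsilon>)) \<le> T * (4 * real n * ?L)"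
      using T1 by (intro mult_left_mono) auto
    have "0 \<le> T * (4 * real n * ln (real n) + 2 * ln (1 / \<epsilon>))"
      using T1 ln \<epsilon>0 by (intro mult_nonneg_nonneg add_nonneg_nonneg) auto
    then have up: "real t \<le> T * (4 * real n * ln (real n) + 2 * ln (1 / \<epsilon>)) + 1"
      unfolding t_def by linarith
    have T: "T * (4 * real n * ?L) = 8 * (C * real n ^ (k + 3) * ?L)"
      by (simp add: T_def power_add power3_eq_cube power2_eq_square mult_ac)
    have "1 \<le> C * real n ^ (k + 3) * ?L"
    proof -
      have "1 * 1 * 1 \<le> C * real n ^ (k + 3) * ?L" using C pow[of "k + 3"] ln \<epsilon>0 by (intro mult_mono) auto
      then show ?thesis by simp
    qed
    with up le show ?thesis unfolding T by linarith
  qed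
  ultimately show ?thesis unfolding swap_mixing_time_def by blast
qed

theorem corollary1p3:
  shows "\<forall>g::nat. g > 0 \<longrightarrow>
    (\<exists>C::real. C > 0 \<and>
      (\<forall>(n::nat) (\<epsilon>::real). n > 2 * g \<longrightarrow> 0 < \<epsilon> \<longrightarrow> \<epsilon> < 1 \<longrightarrow>
        ereal_of_enat (swap_mixing_time n g \<epsilon>)
          \<le> ereal (C * real n ^ (1488 * g - 615) * (ln (real n) + ln (1 / \<epsilon>)))))"
proof (intro allI impI)
  fix g :: nat
  assume g: "0 < g"
  obtain C where C: "1 \<le> C" and B: "\<And>n. 2 * g < n \<Longrightarrow> poincare n g (C * real n ^ (148 * g + 4))"
    using poincare_all[of 32 g, OF poincare_planar] by auto
  show "\<exists>C::real. C > 0 \<and>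
      (\<forall>(n::nat) (\<epsilon>::real). n > 2 * g \<longrightarrow> 0 < \<epsilon> \<longrightarrow> \<epsilon> < 1 \<longrightarrow>
        ereal_of_enat (swap_mixing_time n g \<epsilon>)
          \<le> ereal (C * real n ^ (1488 * g - 615) * (ln (real n) + ln (1 / \<epsilon>))))"
  proof (intro exI[of _ "9 * C"] conjI allI impI)
    show "0 < 9 * C" using C by simp
    fix n :: nat and \<epsilon> :: real
    assume n: "2 * g < n" and \<epsilon>: "0 < \<epsilon>" "\<epsilon> < 1"
    let ?L = "ln (real n) + ln (1 / \<epsilon>)"
    obtain t where t: "swap_mixing_time n g \<epsilon> \<le> enat t" "real t \<le> 9 * C * real n ^ (148 * g + 4 + 3) * ?L"
      using swap_mixing_time_le[OF g n \<epsilon> B[OF n] C] by blast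
    have n1: "1 \<le> real n" using n by simp
    have "0 \<le> ?L" using n1 \<epsilon> by (intro add_nonneg_nonneg ln_ge_zero) auto
    \<comment> \<open>The exponent reached is \<open>148 * g + 7\<close>, below the required one for
      every positive \<open>g\<close>: already for \<open>g = 1\<close> it is 155 against
      873.\<close>
    moreover have "real n ^ (148 * g + 4 + 3) \<le> real n ^ (1488 * g - 615)"
      using n1 g by (intro power_increasing) auto
    ultimately have le: "9 * C * real n ^ (148 * g + 4 + 3) * ?L \<le> 9 * C * real n ^ (1488 * g - 615) * ?L"
      using C by (intro mult_right_mono mult_left_mono) auto
    have "ereal_of_enat (swap_mixing_time n g \<epsilon>) \<le> ereal_of_enat (enat t)"
      using t(1) by (simp only: ereal_of_enat_le_iff)
    also have "\<dots> \<le> ereal (9 * C * real n ^ (1488 * g - 615) * ?L)" using t(2) le by simp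
    finally show "ereal_of_enat (swap_mixing_time n g \<epsilon>) \<le> ereal (9 * C * real n ^ (1488 * g - 615) * ?L)" .
  qed
qed

end
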